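(* Let $o\in\mathsf Q_{p,q}$ and fix a $\mathfrak b^+$-compatible Weyl chamber $\mathfrak a^+$. Let $\xi_s$ be a $\mathfrak b^+$-compatible flag and fix compact sets $C_s\subset\mathsf F(V)^o_{\xi_s}$ and $C\subset\mathsf F(V)^o$. Then there exists a positive $L$ with the following property: for every $g\in G$ for which $$\min_{\alpha\in\Sigma^+(\mathfrak g,\mathfrak b)}\alpha(a^\tau(g))>L$$ holds, and such that $S^\tau(g)\in C_s$ and $U^\tau(g)\in C$, one has $g\in\mathscr B_{o,G}$ and $$b^o(g)=\tfrac12\,w_{\iota_{\mathfrak b^+}(\xi_s)\xi_{\mathfrak a^+}}\cdot\lambda(\sigma^o(g^{-1})g).$$ In particular, if $\iota_{\mathfrak b^+}(\xi_s)=\xi_{\mathfrak a^+}$ then $b^o(g)=\frac12\lambda(\sigma^o(g^{-1})g)$.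
   Context: Let $\mathbb K=\mathbb R$ or $\mathbb C$, let $p,q\geq 1$ be integers with $d=p+q\geq 3$, $V$ a $\mathbb K$-vector space of dimension $d$, $G=\mathrm{PSL}(V)$ with Lie algebra $\mathfrak g$. A form of signature $(p,q)$ on $V$ is a quadratic ($\mathbb K=\mathbb R$) or Hermitian ($\mathbb K=\mathbb C$) form of that signature; $\mathsf Q_{p,q}$ is the set of such forms up to positive real multiples. For $o\in\mathsf Q_{p,q}$ with representative $\langle\cdot,\cdot\rangle_o$: $H^o\subset G$ is the group of projectivized linear isometries of $o$; ${}^{\star_o}T$ is the adjoint, $\langle Tu,v\rangle_o=\langle u,{}^{\star_o}Tv\rangle_o$; $\sigma^o(g)=({}^{\star_o}g)^{-1}$ is an involutive automorphism of $G$ with derivative $d\sigma^o$; $\mathfrak q^o=\{d\sigma^o=-1\}$. $K^\tau$ is the stabilizer in $G$ of a Cartan involution $\tau$ of $\mathfrak g$, and $\mathfrak p^\tau=\{\tau=-1\}$. Fix a Cartan involution $\tau$ commuting with $d\sigma^o$ and a maximal subalgebra $\mathfrak b\subset\mathfrak p^\tau\cap\mathfrak q^o$; there is a set $\mathcal C$ of $d$ lines spanning $V$, pairwise orthogonal for $o$ and for $\tau$ (viewed as an inner product class), such that $\mathfrak b$ is the set of elements of $\mathfrak g$ diagonal in $\mathcal C$ with real eigenvalues. For $\ell\in\mathcal C$ let $\varepsilon_\ell(X)$ be the eigenvalue of $X\in\mathfrak b$ on $\ell$. Let $\hat W=N_{K^\tau}(\mathfrak b)$, $W=\hat W/Z_{K^\tau}(\mathfrak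 b)$. Fix a closed Weyl chamber $\mathfrak b^+$ of $\Sigma(\mathfrak g^{\tau o},\mathfrak b)$, where $\mathfrak g^{\tau o}$ is the fixed subalgebra of $\tau d\sigma^o$ (the roots are $\varepsilon_\ell-\varepsilon_{\ell'}$ with $\ell\neq\ell'$ of the same $o$-sign). Writing $\mathcal C=\mathcal C^+\sqcup\mathcal C^-$ for the $o$-positive and $o$-negative lines, $\mathfrak b^+$ induces total orders on $\mathcal C^\pm$ (elements of $\mathfrak b^+$ have decreasing eigenvalues). Let $w_{\mathfrak b^+}\in W$ be the element preserving $\mathcal C^+$ and $\mathcal C^-$ and reversing both orders, and $\iota_{\mathfrak b^+}(X)=-w_{\mathfrak b^+}\cdot X$, which preserves $\mathfrak b^+$. A closed Weyl chamber $\mathfrak a^+$ of $\Sigma(\mathfrak g,\mathfrak b)$ is $\mathfrak b^+$-compatible if $\mathfrak a^+\subset\mathfrak b^+$; $\Sigma^+(\mathfrak g,\mathfrak b)$ denotes the roots of $\Sigma(\mathfrak g,\mathfrak b)$ non-negative on $\mathfrak a^+$. Chambers $\mathfrak a^+$ of $\Sigma(\mathfrak g,\mathfrak b)$ correspond bijectively to orders $\ell_1,\dots,\ell_d$ of $\mathcal C$ (decreasing eigenvalues) and to full flags spanned by $\mathcal C$: $\xi_{\mathfrak a^+}=(\ell_1\oplus\dots\oplus\ell_j)_j$; the chamber of a flag $\xi$ is $\mathfrak a^+_\xi$. A flag $\xi$ spanned by $\mathcal C$ is $\mathfrak b^+$-compatible if $\mathfrak a^+_\xi\subset\mathfrak b^+$;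 $\iota_{\mathfrak b^+}(\xi)$ is the flag of the chamber $\iota_{\mathfrak b^+}(\mathfrak a^+_\xi)$. For flags $\xi,\xi'$ spanned by $\mathcal C$, $w_{\xi\xi'}\in W$ is the unique element with $w_{\xi\xi'}\cdot\xi'=\xi$. $\mathsf F(V)^o$ is the set of full flags $\xi$ such that $o|_{\xi^j}$ is non-degenerate for all $j$, and $\mathsf F(V)^o_\xi=H^o\cdot\xi$. $a^\tau:G\to\mathfrak a^+$ is the Cartan projection of $G=K^\tau\exp(\mathfrak a^+)K^\tau$; $\lambda(g)=\lim_n a^\tau(g^n)/n$ is the Jordan projection. If $\alpha(a^\tau(g))>0$ for all simple roots $\alpha$, then $U^\tau(g)=k\cdot\xi_{\mathfrak a^+}$ where $g=k\exp(a^\tau(g))l$, $k,l\in K^\tau$, and $S^\tau(g)=U^\tau(g^{-1})$. $\mathscr B_{o,G}$ is the set of $g\in G$ mapping some $o$-orthogonal basis of lines of $V$ (set of $d$ pairwise $o$-orthogonal lines spanning $V$) to an $o$-orthogonal basis of lines. One has $\mathscr B_{o,G}=H^o\hat W\exp(\mathfrak b^+)H^o$ with unique $\mathfrak b^+$-component $b^o(g)$. *)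

theory Defs
  imports "HOL-Analysis.Analysis" "HOL-Algebra.Coset"
begin

section \<open>The scalar field\<close>

text \<open>
  By the Gelfand--Mazur theorem a real normed field is isomorphic to the reals or to the complex
  numbers, and the last axiom determines the conjugation. So \<open>scalar_rc\<close> has, up to
  isomorphism, exactly the two instances given below, and quantifying over it treats both fields
  at once.
\<close>

class scalar_rc = real_normed_field + euclidean_space +
  fixes scnj :: "'a \<Rightarrow> 'a"
  assumes scnj_add: "scnj (x + y) = scnj x + scnj y"
    and scnj_mult: "scnj (x * y) = scnj x * scnj y"
    and scnj_scnj: "scnj (scnj x) = x"
    and mult_scnj: "x * scnj x = ((norm x)\<^sup>2) *\<^sub>R 1"

instantiation real :: scalar_rc
begin
definition scnj_real :: "real \<Rightarrow> real" where "scnj_real x = x"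
instance by standard (simp_all add: scnj_real_def power2_eq_square)
end

instantiation complex :: scalar_rc
begin
definition scnj_complex :: "complex \<Rightarrow> complex" where "scnj_complex x = cnj x"
instance by standard (simp_all add: scnj_complex_def complex_norm_square[symmetric] scaleR_conv_of_real)
end


section \<open>The group $\mathrm{PSL}(V)$ and its Lie algebra\<close>

text \<open>Here $V$ is \<open>'k ^ 'n\<close>, and an element of $\mathrm{PSL}(V)$ is a coset, i.e. a set of matrices
  of determinant one.\<close>

definition SL :: "('k::scalar_rc ^ 'n ^ 'n) monoid" where
  "SL = \<lparr>carrier = {A. det A = 1}, mult = (**), one = mat 1\<rparr>"

definition SL_scalars :: "('k::scalar_rc ^ 'n ^ 'n) set" where
  "SL_scalars = {A \<in> carrier SL. \<exists>c. A = mat c}"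

definition PSL :: "('k::scalar_rc ^ 'n ^ 'n) set monoid" where
  "PSL = SL Mod SL_scalars"

definition sl :: "('k::scalar_rc ^ 'n ^ 'n) set" where
  "sl = {X. trace X = 0}"

definition bracket :: "'k::scalar_rc ^ 'n ^ 'n \<Rightarrow> 'k ^ 'n ^ 'n \<Rightarrow> 'k ^ 'n ^ 'n" where
  "bracket X Y = X ** Y - Y ** X"

text \<open>Any representative gives the same value.\<close>

definition Ad :: "('k::scalar_rc ^ 'n ^ 'n) set \<Rightarrow> 'k ^ 'n ^ 'n \<Rightarrow> 'k ^ 'n ^ 'n" where
  "Ad g X = (let A = (SOME A. A \<in> g) in A ** X ** matrix_inv A)"

definition mat_exp :: "'k::scalar_rc ^ 'n ^ 'n \<Rightarrow> 'k ^ 'n ^ 'n" where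
  "mat_exp X = (\<Sum>k. (((**) X ^^ k) (mat 1)) /\<^sub>R fact k)"

definition PSL_exp :: "'k::scalar_rc ^ 'n ^ 'n \<Rightarrow> ('k ^ 'n ^ 'n) set" where
  "PSL_exp X = SL_scalars #>\<^bsub>SL\<^esub> mat_exp X"

text \<open>The image of a linear subspace does not depend on the representative of \<open>g\<close>, so that the
  union below is the image under each of them.\<close>

definition sub_act :: "('k::scalar_rc ^ 'n ^ 'n) set \<Rightarrow> ('k ^ 'n) set \<Rightarrow> ('k ^ 'n) set" where
  "sub_act g S = (\<Union>A\<in>g. (*v) A ` S)"


section \<open>Forms\<close>

definition pos_scalar :: "'k::scalar_rc \<Rightarrow> bool" where
  "pos_scalar x \<longleftrightarrow> (\<exists>r>0. x = of_real r)"

definition neg_scalar :: "'k::scalar_rc \<Rightarrow> bool" where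
  "neg_scalar x \<longleftrightarrow> (\<exists>r<0. x = of_real r)"

text \<open>For real scalars this is a symmetric bilinear form, identified with its quadratic form.\<close>

definition hermitian_form :: "('k::scalar_rc ^ 'n \<Rightarrow> 'k ^ 'n \<Rightarrow> 'k) \<Rightarrow> bool" where
  "hermitian_form B \<longleftrightarrow>
     (\<forall>u v w. B (u + v) w = B u w + B v w) \<and>
     (\<forall>c u v. B (c *s u) v = c * B u v) \<and>
     (\<forall>u v. B v u = scnj (B u v))"

definition form_of_signature :: "nat \<Rightarrow> nat \<Rightarrow> ('k::scalar_rc ^ 'n \<Rightarrow> 'k ^ 'n \<Rightarrow> 'k) \<Rightarrow> bool" where
  "form_of_signature p q B \<longleftrightarrow> hermitian_form B \<and>
     (\<exists>P N. card P = p \<and> card N = q \<and> P \<inter> N = {} \<and>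
        vec.independent (P \<union> N) \<and> vec.span (P \<union> N) = UNIV \<and>
        pairwise (\<lambda>u v. B u v = 0) (P \<union> N) \<and>
        (\<forall>v\<in>P. pos_scalar (B v v)) \<and> (\<forall>v\<in>N. neg_scalar (B v v)))"

definition form_class :: "('k::scalar_rc ^ 'n \<Rightarrow> 'k ^ 'n \<Rightarrow> 'k) \<Rightarrow> ('k ^ 'n \<Rightarrow> 'k ^ 'n \<Rightarrow> 'k) set" where
  "form_class B = {(\<lambda>u v. of_real c * B u v) | c. c > 0}"

definition Q_forms :: "nat \<Rightarrow> nat \<Rightarrow> ('k::scalar_rc ^ 'n \<Rightarrow> 'k ^ 'n \<Rightarrow> 'k) set set" where
  "Q_forms p q = form_class ` {B. form_of_signature p q B}"

definition inner_form :: "('k::scalar_rc ^ 'n \<Rightarrow> 'k ^ 'n \<Rightarrow> 'k) \<Rightarrow> bool" where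
  "inner_form h \<longleftrightarrow> hermitian_form h \<and> (\<forall>v. v \<noteq> 0 \<longrightarrow> pos_scalar (h v v))"

definition adj :: "('k::scalar_rc ^ 'n \<Rightarrow> 'k ^ 'n \<Rightarrow> 'k) \<Rightarrow> 'k ^ 'n ^ 'n \<Rightarrow> 'k ^ 'n ^ 'n" where
  "adj B T = (THE T'. \<forall>u v. B (T *v u) v = B u (T' *v v))"

text \<open>The notions below that take a representative \<open>B\<close> of a class in \<open>Q_forms p q\<close> are unchanged when
  \<open>B\<close> is multiplied by a positive real.\<close>

definition isometry_group :: "('k::scalar_rc ^ 'n \<Rightarrow> 'k ^ 'n \<Rightarrow> 'k) \<Rightarrow> ('k ^ 'n ^ 'n) set set" where
  "isometry_group B = {g \<in> carrier PSL. \<exists>A\<in>g. \<exists>T c.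
     (\<forall>u v. B (T *v u) (T *v v) = B u v) \<and> A = mat c ** T}"

definition sigma_o :: "('k::scalar_rc ^ 'n \<Rightarrow> 'k ^ 'n \<Rightarrow> 'k) \<Rightarrow> ('k ^ 'n ^ 'n) set \<Rightarrow> ('k ^ 'n ^ 'n) set" where
  "sigma_o B g = (\<lambda>A. matrix_inv (adj B A)) ` g"

text \<open>The derivative is that of the same formula on $\mathrm{GL}(V)$, an open subset of the space
  of matrices; only its restriction to \<^term>\<open>sl\<close> matters.\<close>

definition dsigma :: "('k::scalar_rc ^ 'n \<Rightarrow> 'k ^ 'n \<Rightarrow> 'k) \<Rightarrow> 'k ^ 'n ^ 'n \<Rightarrow> 'k ^ 'n ^ 'n" where
  "dsigma B = frechet_derivative (\<lambda>A. matrix_inv (adj B A)) (at (mat 1))"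

definition q_space :: "('k::scalar_rc ^ 'n \<Rightarrow> 'k ^ 'n \<Rightarrow> 'k) \<Rightarrow> ('k ^ 'n ^ 'n) set" where
  "q_space B = {X \<in> sl. dsigma B X = - X}"


section \<open>Cartan involutions\<close>

text \<open>Traces and the Killing form are those of \<^term>\<open>sl\<close> as a real Lie algebra, also when the
  scalars are complex.\<close>

definition trace_on :: "'a::real_vector set \<Rightarrow> ('a \<Rightarrow> 'a) \<Rightarrow> real" where
  "trace_on S f = (let E = (SOME E. independent E \<and> span E = S)
                   in \<Sum>e\<in>E. representation E (f e) e)"

definition killing :: "'k::scalar_rc ^ 'n ^ 'n \<Rightarrow> 'k ^ 'n ^ 'n \<Rightarrow> real" where
  "killing X Y = trace_on sl (\<lambda>Z. bracket X (bracket Y Z))"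

definition cartan_involution :: "('k::scalar_rc ^ 'n ^ 'n \<Rightarrow> 'k ^ 'n ^ 'n) \<Rightarrow> bool" where
  "cartan_involution \<tau> \<longleftrightarrow>
     (\<forall>X\<in>sl. \<tau> X \<in> sl \<and> \<tau> (\<tau> X) = X) \<and>
     (\<forall>X\<in>sl. \<forall>Y\<in>sl. \<tau> (X + Y) = \<tau> X + \<tau> Y \<and> \<tau> (bracket X Y) = bracket (\<tau> X) (\<tau> Y)) \<and>
     (\<forall>X\<in>sl. \<forall>r. \<tau> (r *\<^sub>R X) = r *\<^sub>R \<tau> X) \<and>
     (\<forall>X\<in>sl. X \<noteq> 0 \<longrightarrow> killing X (\<tau> X) < 0)"

text \<open>A Cartan involution of \<^term>\<open>sl\<close> viewed as (the class of) an inner product.\<close>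

definition cartan_inner_form ::
    "('k::scalar_rc ^ 'n ^ 'n \<Rightarrow> 'k ^ 'n ^ 'n) \<Rightarrow> ('k ^ 'n \<Rightarrow> 'k ^ 'n \<Rightarrow> 'k) \<Rightarrow> bool" where
  "cartan_inner_form \<tau> h \<longleftrightarrow> inner_form h \<and> (\<forall>X\<in>sl. \<tau> X = - adj h X)"

definition K_group :: "('k::scalar_rc ^ 'n ^ 'n \<Rightarrow> 'k ^ 'n ^ 'n) \<Rightarrow> ('k ^ 'n ^ 'n) set set" where
  "K_group \<tau> = {g \<in> carrier PSL. \<forall>X\<in>sl. Ad g (\<tau> X) = \<tau> (Ad g X)}"

definition p_space :: "('k::scalar_rc ^ 'n ^ 'n \<Rightarrow> 'k ^ 'n ^ 'n) \<Rightarrow> ('k ^ 'n ^ 'n) set" where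
  "p_space \<tau> = {X \<in> sl. \<tau> X = - X}"

definition fixed_subalgebra ::
    "('k::scalar_rc ^ 'n ^ 'n \<Rightarrow> 'k ^ 'n ^ 'n) \<Rightarrow> ('k ^ 'n \<Rightarrow> 'k ^ 'n \<Rightarrow> 'k) \<Rightarrow> ('k ^ 'n ^ 'n) set" where
  "fixed_subalgebra \<tau> B = {X \<in> sl. \<tau> (dsigma B X) = X}"

definition lie_subalgebra :: "('k::scalar_rc ^ 'n ^ 'n) set \<Rightarrow> bool" where
  "lie_subalgebra S \<longleftrightarrow> subspace S \<and> S \<subseteq> sl \<and> (\<forall>X\<in>S. \<forall>Y\<in>S. bracket X Y \<in> S)"

definition maximal_subalgebra_in :: "('k::scalar_rc ^ 'n ^ 'n) set \<Rightarrow> ('k ^ 'n ^ 'n) set \<Rightarrow> bool" where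
  "maximal_subalgebra_in S b \<longleftrightarrow> lie_subalgebra b \<and> b \<subseteq> S \<and>
     (\<forall>b'. lie_subalgebra b' \<and> b' \<subseteq> S \<and> b \<subseteq> b' \<longrightarrow> b' = b)"


section \<open>Lines, roots and Weyl chambers\<close>

definition is_line :: "('k::scalar_rc ^ 'n) set \<Rightarrow> bool" where
  "is_line l \<longleftrightarrow> vec.subspace l \<and> vec.dim l = 1"

definition basis_of_lines :: "('k::scalar_rc ^ 'n) set set \<Rightarrow> bool" where
  "basis_of_lines E \<longleftrightarrow> card E = CARD('n) \<and> (\<forall>l\<in>E. is_line l) \<and> vec.span (\<Union>E) = UNIV"

definition orth_basis_of_lines :: "('k::scalar_rc ^ 'n \<Rightarrow> 'k ^ 'n \<Rightarrow> 'k) \<Rightarrow> ('k ^ 'n) set set \<Rightarrow> bool" where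
  "orth_basis_of_lines B E \<longleftrightarrow> basis_of_lines E \<and>
     pairwise (\<lambda>l l'. \<forall>u\<in>l. \<forall>v\<in>l'. B u v = 0) E"

definition real_diagonal :: "('k::scalar_rc ^ 'n) set set \<Rightarrow> ('k ^ 'n ^ 'n) set" where
  "real_diagonal E = {X \<in> sl. \<forall>l\<in>E. \<exists>r::real. \<forall>v\<in>l. X *v v = r *\<^sub>R v}"

definition pos_lines :: "('k::scalar_rc ^ 'n \<Rightarrow> 'k ^ 'n \<Rightarrow> 'k) \<Rightarrow> ('k ^ 'n) set set \<Rightarrow> ('k ^ 'n) set set" where
  "pos_lines B E = {l \<in> E. \<forall>v\<in>l. v \<noteq> 0 \<longrightarrow> pos_scalar (B v v)}"

definition neg_lines :: "('k::scalar_rc ^ 'n \<Rightarrow> 'k ^ 'n \<Rightarrow> 'k) \<Rightarrow> ('k ^ 'n) set set \<Rightarrow> ('k ^ 'n) set set" where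
  "neg_lines B E = {l \<in> E. \<forall>v\<in>l. v \<noteq> 0 \<longrightarrow> neg_scalar (B v v)}"

definition eigval :: "('k::scalar_rc ^ 'n) set \<Rightarrow> 'k ^ 'n ^ 'n \<Rightarrow> real" where
  "eigval l X = (THE r::real. \<forall>v\<in>l. X *v v = r *\<^sub>R v)"

text \<open>The restricted roots of \<open>b\<close> acting on \<open>L\<close>. A root is linear on \<open>b\<close> because it is the weight of a
  nonzero vector; \<^const>\<open>extensional\<close> makes it a function on \<open>b\<close> only.\<close>

definition roots ::
    "('k::scalar_rc ^ 'n ^ 'n) set \<Rightarrow> ('k ^ 'n ^ 'n) set \<Rightarrow> ('k ^ 'n ^ 'n \<Rightarrow> real) set" where
  "roots L b = {\<alpha> \<in> extensional b. (\<exists>X\<in>b. \<alpha> X \<noteq> 0) \<and>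
     (\<exists>Y\<in>L. Y \<noteq> 0 \<and> (\<forall>X\<in>b. bracket X Y = \<alpha> X *\<^sub>R Y))}"

definition weyl_chamber ::
    "('k::scalar_rc ^ 'n ^ 'n \<Rightarrow> real) set \<Rightarrow> ('k ^ 'n ^ 'n) set \<Rightarrow> ('k ^ 'n ^ 'n) set \<Rightarrow> bool" where
  "weyl_chamber R b c \<longleftrightarrow>
     (\<exists>D\<in>components (b - (\<Union>\<alpha>\<in>R. {X \<in> b. \<alpha> X = 0})). c = closure D)"

definition pos_roots :: "('k::scalar_rc ^ 'n ^ 'n) set \<Rightarrow> ('k ^ 'n ^ 'n) set \<Rightarrow> ('k ^ 'n ^ 'n \<Rightarrow> real) set" where
  "pos_roots b ap = {\<alpha> \<in> roots sl b. \<forall>X\<in>ap. \<alpha> X \<ge> 0}"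


section \<open>Weyl group\<close>

definition W_hat ::
    "('k::scalar_rc ^ 'n ^ 'n \<Rightarrow> 'k ^ 'n ^ 'n) \<Rightarrow> ('k ^ 'n ^ 'n) set \<Rightarrow> ('k ^ 'n ^ 'n) set set" where
  "W_hat \<tau> b = {g \<in> K_group \<tau>. Ad g ` b = b}"

definition W_centralizer ::
    "('k::scalar_rc ^ 'n ^ 'n \<Rightarrow> 'k ^ 'n ^ 'n) \<Rightarrow> ('k ^ 'n ^ 'n) set \<Rightarrow> ('k ^ 'n ^ 'n) set set" where
  "W_centralizer \<tau> b = {g \<in> K_group \<tau>. \<forall>X\<in>b. Ad g X = X}"

definition W_group ::
    "('k::scalar_rc ^ 'n ^ 'n \<Rightarrow> 'k ^ 'n ^ 'n) \<Rightarrow> ('k ^ 'n ^ 'n) set \<Rightarrow> ('k ^ 'n ^ 'n) set set monoid" where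
  "W_group \<tau> b = (PSL\<lparr>carrier := W_hat \<tau> b\<rparr>) Mod W_centralizer \<tau> b"

text \<open>On \<open>b\<close>, and on subspaces spanned by the lines that diagonalize \<open>b\<close>, these do not depend on
  the representative.\<close>

definition W_act :: "('k::scalar_rc ^ 'n ^ 'n) set set \<Rightarrow> 'k ^ 'n ^ 'n \<Rightarrow> 'k ^ 'n ^ 'n" where
  "W_act w X = Ad (SOME n. n \<in> w) X"

definition W_sub_act :: "('k::scalar_rc ^ 'n ^ 'n) set set \<Rightarrow> ('k ^ 'n) set \<Rightarrow> ('k ^ 'n) set" where
  "W_sub_act w S = sub_act (SOME n. n \<in> w) S"

text \<open>The order of lines induced by a chamber \<open>bp\<close>: \<open>l\<close> comes before \<open>l'\<close>.\<close>

definition line_before :: "('k::scalar_rc ^ 'n ^ 'n) set \<Rightarrow> ('k ^ 'n) set \<Rightarrow> ('k ^ 'n) set \<Rightarrow> bool" where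
  "line_before bp l l' \<longleftrightarrow> (\<forall>X\<in>bp. eigval l X \<ge> eigval l' X)"

definition w_opp :: "('k::scalar_rc ^ 'n \<Rightarrow> 'k ^ 'n \<Rightarrow> 'k) \<Rightarrow> ('k ^ 'n ^ 'n \<Rightarrow> 'k ^ 'n ^ 'n) \<Rightarrow>
    ('k ^ 'n ^ 'n) set \<Rightarrow> ('k ^ 'n) set set \<Rightarrow> ('k ^ 'n ^ 'n) set \<Rightarrow> ('k ^ 'n ^ 'n) set set" where
  "w_opp B \<tau> b E bp = (THE w. w \<in> carrier (W_group \<tau> b) \<and>
     (\<forall>S\<in>{pos_lines B E, neg_lines B E}. W_sub_act w ` S = S \<and>
        (\<forall>l\<in>S. \<forall>l'\<in>S. line_before bp l l' \<longleftrightarrow> line_before bp (W_sub_act w l') (W_sub_act w l))))"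

definition opp_inv :: "('k::scalar_rc ^ 'n \<Rightarrow> 'k ^ 'n \<Rightarrow> 'k) \<Rightarrow> ('k ^ 'n ^ 'n \<Rightarrow> 'k ^ 'n ^ 'n) \<Rightarrow>
    ('k ^ 'n ^ 'n) set \<Rightarrow> ('k ^ 'n) set set \<Rightarrow> ('k ^ 'n ^ 'n) set \<Rightarrow> 'k ^ 'n ^ 'n \<Rightarrow> 'k ^ 'n ^ 'n" where
  "opp_inv B \<tau> b E bp X = - W_act (w_opp B \<tau> b E bp) X"


section \<open>Flags\<close>

text \<open>Full flags are indexed by all naturals, with every term from the dimension of $V$ on equal
  to $V$.\<close>

definition full_flags :: "(nat \<Rightarrow> ('k::scalar_rc ^ 'n) set) set" where
  "full_flags = {\<xi>. mono \<xi> \<and> (\<forall>j. vec.subspace (\<xi> j) \<and> vec.dim (\<xi> j) = min j CARD('n))}"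

definition flag_act ::
    "('k::scalar_rc ^ 'n ^ 'n) set \<Rightarrow> (nat \<Rightarrow> ('k ^ 'n) set) \<Rightarrow> nat \<Rightarrow> ('k ^ 'n) set" where
  "flag_act g \<xi> = (\<lambda>j. sub_act g (\<xi> j))"

text \<open>The topology of a homogeneous space: the quotient topology for the orbit maps of
  $\mathrm{GL}(V)$.\<close>

definition flag_open :: "(nat \<Rightarrow> ('k::scalar_rc ^ 'n) set) set \<Rightarrow> bool" where
  "flag_open U \<longleftrightarrow> U \<subseteq> full_flags \<and>
     (\<forall>\<xi>\<in>full_flags. open {A :: 'k ^ 'n ^ 'n. invertible A \<and> (\<lambda>j. (*v) A ` \<xi> j) \<in> U})"

definition flag_topology :: "(nat \<Rightarrow> ('k::scalar_rc ^ 'n) set) topology" where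
  "flag_topology = topology flag_open"

lemma openin_flag_topology: "openin flag_topology = flag_open"
proof -
  have "istopology (flag_open :: (nat \<Rightarrow> ('k::scalar_rc ^ 'n) set) set \<Rightarrow> bool)"
    unfolding istopology_def
  proof (intro conjI allI impI)
    fix S T :: "(nat \<Rightarrow> ('k ^ 'n) set) set"
    assume ST: "flag_open S" "flag_open T"
    have "{A :: 'k ^ 'n ^ 'n. invertible A \<and> (\<lambda>j. (*v) A ` \<xi> j) \<in> S \<inter> T} =
        {A. invertible A \<and> (\<lambda>j. (*v) A ` \<xi> j) \<in> S} \<inter>
        {A. invertible A \<and> (\<lambda>j. (*v) A ` \<xi> j) \<in> T}" for \<xi>
      by auto
    with ST show "flag_open (S \<inter> T)"
      unfolding flag_open_def by (metis (no_types, lifting) le_infI1 open_Int)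
  next
    fix F :: "(nat \<Rightarrow> ('k ^ 'n) set) set set"
    assume F: "\<forall>S\<in>F. flag_open S"
    have "{A :: 'k ^ 'n ^ 'n. invertible A \<and> (\<lambda>j. (*v) A ` \<xi> j) \<in> \<Union>F} =
        (\<Union>S\<in>F. {A. invertible A \<and> (\<lambda>j. (*v) A ` \<xi> j) \<in> S})" for \<xi>
      by auto
    with F show "flag_open (\<Union>F)"
      unfolding flag_open_def by (auto intro!: open_UN)
  qed
  then show ?thesis
    unfolding flag_topology_def by (rule topology_inverse')
qed

definition nondeg_flags :: "('k::scalar_rc ^ 'n \<Rightarrow> 'k ^ 'n \<Rightarrow> 'k) \<Rightarrow> (nat \<Rightarrow> ('k ^ 'n) set) set" where
  "nondeg_flags B = {\<xi> \<in> full_flags. \<forall>j. \<forall>u\<in>\<xi> j. (\<forall>v\<in>\<xi> j. B u v = 0) \<longrightarrow> u = 0}"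

definition H_orbit :: "('k::scalar_rc ^ 'n \<Rightarrow> 'k ^ 'n \<Rightarrow> 'k) \<Rightarrow>
    (nat \<Rightarrow> ('k ^ 'n) set) \<Rightarrow> (nat \<Rightarrow> ('k ^ 'n) set) set" where
  "H_orbit B \<xi> = (\<lambda>g. flag_act g \<xi>) ` isometry_group B"

definition orderings :: "'a set \<Rightarrow> 'a list set" where
  "orderings E = {ls. distinct ls \<and> set ls = E}"

definition flag_of_list :: "('k::scalar_rc ^ 'n) set list \<Rightarrow> nat \<Rightarrow> ('k ^ 'n) set" where
  "flag_of_list ls = (\<lambda>j. vec.span (\<Union>(set (take j ls))))"

definition chamber_of_list ::
    "('k::scalar_rc ^ 'n ^ 'n) set \<Rightarrow> ('k ^ 'n) set list \<Rightarrow> ('k ^ 'n ^ 'n) set" where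
  "chamber_of_list b ls = {X \<in> b. sorted_wrt (\<lambda>l l'. eigval l X \<ge> eigval l' X) ls}"

definition flags_spanned_by :: "('k::scalar_rc ^ 'n) set set \<Rightarrow> (nat \<Rightarrow> ('k ^ 'n) set) set" where
  "flags_spanned_by E = flag_of_list ` orderings E"

definition flag_of_chamber :: "('k::scalar_rc ^ 'n ^ 'n) set \<Rightarrow> ('k ^ 'n) set set \<Rightarrow>
    ('k ^ 'n ^ 'n) set \<Rightarrow> nat \<Rightarrow> ('k ^ 'n) set" where
  "flag_of_chamber b E ap =
     flag_of_list (THE ls. ls \<in> orderings E \<and> chamber_of_list b ls = ap)"

definition chamber_of_flag :: "('k::scalar_rc ^ 'n ^ 'n) set \<Rightarrow> ('k ^ 'n) set set \<Rightarrow>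
    (nat \<Rightarrow> ('k ^ 'n) set) \<Rightarrow> ('k ^ 'n ^ 'n) set" where
  "chamber_of_flag b E \<xi> =
     chamber_of_list b (THE ls. ls \<in> orderings E \<and> flag_of_list ls = \<xi>)"

definition compatible_flag :: "('k::scalar_rc ^ 'n ^ 'n) set \<Rightarrow> ('k ^ 'n) set set \<Rightarrow>
    ('k ^ 'n ^ 'n) set \<Rightarrow> (nat \<Rightarrow> ('k ^ 'n) set) \<Rightarrow> bool" where
  "compatible_flag b E bp \<xi> \<longleftrightarrow> \<xi> \<in> flags_spanned_by E \<and> chamber_of_flag b E \<xi> \<subseteq> bp"

definition opp_inv_flag :: "('k::scalar_rc ^ 'n \<Rightarrow> 'k ^ 'n \<Rightarrow> 'k) \<Rightarrow> ('k ^ 'n ^ 'n \<Rightarrow> 'k ^ 'n ^ 'n) \<Rightarrow>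
    ('k ^ 'n ^ 'n) set \<Rightarrow> ('k ^ 'n) set set \<Rightarrow> ('k ^ 'n ^ 'n) set \<Rightarrow>
    (nat \<Rightarrow> ('k ^ 'n) set) \<Rightarrow> nat \<Rightarrow> ('k ^ 'n) set" where
  "opp_inv_flag B \<tau> b E bp \<xi> =
     flag_of_chamber b E (opp_inv B \<tau> b E bp ` chamber_of_flag b E \<xi>)"

definition w_flags :: "('k::scalar_rc ^ 'n ^ 'n \<Rightarrow> 'k ^ 'n ^ 'n) \<Rightarrow> ('k ^ 'n ^ 'n) set \<Rightarrow>
    (nat \<Rightarrow> ('k ^ 'n) set) \<Rightarrow> (nat \<Rightarrow> ('k ^ 'n) set) \<Rightarrow> ('k ^ 'n ^ 'n) set set" where
  "w_flags \<tau> b \<xi> \<xi>' =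
     (THE w. w \<in> carrier (W_group \<tau> b) \<and> (\<lambda>j. W_sub_act w (\<xi>' j)) = \<xi>)"


section \<open>Projections\<close>

definition cartan_proj :: "('k::scalar_rc ^ 'n ^ 'n \<Rightarrow> 'k ^ 'n ^ 'n) \<Rightarrow>
    ('k ^ 'n ^ 'n) set \<Rightarrow> ('k ^ 'n ^ 'n) set \<Rightarrow> 'k ^ 'n ^ 'n" where
  "cartan_proj \<tau> ap g = (THE X. X \<in> ap \<and>
     (\<exists>k\<in>K_group \<tau>. \<exists>l\<in>K_group \<tau>. g = k \<otimes>\<^bsub>PSL\<^esub> PSL_exp X \<otimes>\<^bsub>PSL\<^esub> l))"

definition jordan_proj :: "('k::scalar_rc ^ 'n ^ 'n \<Rightarrow> 'k ^ 'n ^ 'n) \<Rightarrow>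
    ('k ^ 'n ^ 'n) set \<Rightarrow> ('k ^ 'n ^ 'n) set \<Rightarrow> 'k ^ 'n ^ 'n" where
  "jordan_proj \<tau> ap g = lim (\<lambda>n. cartan_proj \<tau> ap (g [^]\<^bsub>PSL\<^esub> n) /\<^sub>R real n)"

text \<open>Meaningful only when all simple roots are positive at the Cartan projection of \<open>g\<close>; otherwise
  the flag is not unique.\<close>

definition U_flag :: "('k::scalar_rc ^ 'n ^ 'n \<Rightarrow> 'k ^ 'n ^ 'n) \<Rightarrow> ('k ^ 'n ^ 'n) set \<Rightarrow>
    ('k ^ 'n) set set \<Rightarrow> ('k ^ 'n ^ 'n) set \<Rightarrow> ('k ^ 'n ^ 'n) set \<Rightarrow> nat \<Rightarrow> ('k ^ 'n) set" where
  "U_flag \<tau> b E ap g = (THE \<xi>. \<exists>k\<in>K_group \<tau>. \<exists>l\<in>K_group \<tau>.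
     g = k \<otimes>\<^bsub>PSL\<^esub> PSL_exp (cartan_proj \<tau> ap g) \<otimes>\<^bsub>PSL\<^esub> l \<and>
     \<xi> = flag_act k (flag_of_chamber b E ap))"

definition S_flag :: "('k::scalar_rc ^ 'n ^ 'n \<Rightarrow> 'k ^ 'n ^ 'n) \<Rightarrow> ('k ^ 'n ^ 'n) set \<Rightarrow>
    ('k ^ 'n) set set \<Rightarrow> ('k ^ 'n ^ 'n) set \<Rightarrow> ('k ^ 'n ^ 'n) set \<Rightarrow> nat \<Rightarrow> ('k ^ 'n) set" where
  "S_flag \<tau> b E ap g = U_flag \<tau> b E ap (inv\<^bsub>PSL\<^esub> g)"

definition B_set :: "('k::scalar_rc ^ 'n \<Rightarrow> 'k ^ 'n \<Rightarrow> 'k) \<Rightarrow> ('k ^ 'n ^ 'n) set set" where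
  "B_set B = {g \<in> carrier PSL. \<exists>E. orth_basis_of_lines B E \<and> orth_basis_of_lines B (sub_act g ` E)}"

definition b_proj :: "('k::scalar_rc ^ 'n \<Rightarrow> 'k ^ 'n \<Rightarrow> 'k) \<Rightarrow> ('k ^ 'n ^ 'n \<Rightarrow> 'k ^ 'n ^ 'n) \<Rightarrow>
    ('k ^ 'n ^ 'n) set \<Rightarrow> ('k ^ 'n ^ 'n) set \<Rightarrow> ('k ^ 'n ^ 'n) set \<Rightarrow> 'k ^ 'n ^ 'n" where
  "b_proj B \<tau> b bp g = (THE X. X \<in> bp \<and>
     (\<exists>h\<in>isometry_group B. \<exists>n\<in>W_hat \<tau> b. \<exists>h'\<in>isometry_group B.
        g = h \<otimes>\<^bsub>PSL\<^esub> n \<otimes>\<^bsub>PSL\<^esub> PSL_exp X \<otimes>\<^bsub>PSL\<^esub> h'))"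

end

theory Submission
  imports Defs
begin

text \<open>
  In coordinates that are orthonormal for \<open>\<tau>\<close> and diagonalize the form as \<open>\<epsilon>\<close>, write
  \<open>A = K exp(x) L\<close> with \<open>K\<close>, \<open>L\<close> unitary, and let \<open>GU\<close> and \<open>GS\<close> be the Gram matrices of the form in
  the frames \<open>K\<close> and \<open>L\<^sup>*\<close>. The eigenvalues of \<open>\<sigma>(A\<inverse>) A\<close> are those of the pencil
  \<open>t GS - exp(x) GU exp(x)\<close>. The hypotheses on the flags bound the principal minors of \<open>GU\<close> on initial
  segments and of \<open>GS\<close> on final segments away from zero, so that for large gaps of \<open>x\<close> the determinant
  of the pencil changes sign near each of the \<open>d\<close> scales \<open>\<plusminus> exp(2 x\<^sub>i)\<close>. This gives \<open>d\<close> real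
  eigenvalues of distinct moduli, hence an orthogonal basis that \<open>A\<close> maps to an orthogonal basis. The
  sign of the form on the \<open>i\<close>-th eigenvector is the ratio of two consecutive final minors of \<open>GS\<close>,
  which is constant on the orbit of \<open>\<xi>s\<close>; these signs decide which eigenvalue belongs to which line,
  and this is the Weyl group element in the formula for the projection.
\<close>

section \<open>Scalars\<close>

text \<open>The map \<sigma>(A^-1) A is self-adjoint only for an indefinite form, so its eigenvalues
  need not be real in general and no spectral theorem applies. They are sought instead as zeros of a
  real function: the pencil is Hermitian, so its determinant is real over both fields, and the
  minors decide on which half-line, positive or negative, each sign change occurs.

  Initial segments go with \<open>GU\<close> and final ones with \<open>GS\<close> because the flag
  of the inverse lists the singular directions in the opposite order. A minor depends on the frame
  and not only on the flag, but through a positive factor common to all forms; its quotient by the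
  same minor of an inner product is a function of the flag, which compactness bounds below, and for
  unitary frames the divisor is 1. The constant L therefore depends only on the field, the dimension
  and that bound.

  The projection is a definite description, so uniqueness of the diagonal component must be proved
  as well. It rests on the distinct moduli: another decomposition of g diagonalizes the same pair of
  forms, hence differs by a permutation, and this preserves signs and order.\<close>

lemma scnj_0 [simp]: "scnj (0::'k::scalar_rc) = 0"
  using scnj_add[of "0::'k" 0] by simp

lemma scnj_minus [simp]: "scnj (- x) = - scnj (x::'k::scalar_rc)"
  using scnj_add[of x "- x"] by (simp add: add_eq_0_iff)

lemma scnj_diff [simp]: "scnj (x - y) = scnj x - scnj (y::'k::scalar_rc)"
  using scnj_add[of x "- y"] by simp

lemma mult_scnj': "x * scnj x = of_real ((norm (x::'k::scalar_rc))\<^sup>2)"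
  by (simp add: mult_scnj scaleR_conv_of_real)

lemma scnj_of_real [simp]: "scnj (of_real r) = (of_real r :: 'k::scalar_rc)"
proof (cases "r = 0")
  case False
  have "of_real r * scnj (of_real r :: 'k) = of_real r * of_real r"
    by (simp add: mult_scnj' power2_eq_square)
  with False show ?thesis by simp
qed simp

lemma scnj_1 [simp]: "scnj 1 = (1 :: 'k::scalar_rc)"
  using scnj_of_real[of 1] by simp

lemma scnj_sum: "scnj (sum f A) = (\<Sum>a\<in>A. scnj (f a :: 'k::scalar_rc))"
  by (induction A rule: infinite_finite_induct) (simp_all add: scnj_add)

lemma scnj_prod: "scnj (prod f A) = (\<Prod>a\<in>A. scnj (f a :: 'k::scalar_rc))"
  by (induction A rule: infinite_finite_induct) (simp_all add: scnj_mult)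

lemma scnj_eq_0 [simp]: "scnj x = 0 \<longleftrightarrow> (x::'k::scalar_rc) = 0"
  by (metis scnj_0 scnj_scnj)

lemma norm_scnj [simp]: "norm (scnj x) = norm (x::'k::scalar_rc)"
proof (cases "x = 0")
  case False
  have "norm x * norm (scnj x) = norm x * norm x"
    by (metis mult_scnj' norm_mult norm_of_real abs_norm_cancel power2_eq_square)
  with False show ?thesis by simp
qed simp

lemma scnj_scaleR [simp]: "scnj (r *\<^sub>R x) = r *\<^sub>R scnj (x::'k::scalar_rc)"
  by (simp add: scaleR_conv_of_real scnj_mult)

lemma bounded_linear_scnj: "bounded_linear (scnj :: 'k::scalar_rc \<Rightarrow> 'k)"
  by (rule bounded_linear_intro[of _ 1]) (simp_all add: scnj_add)

lemmas continuous_on_scnj [continuous_intros] =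
  bounded_linear.continuous_on[OF bounded_linear_scnj]

text \<open>The real part for both fields at once: \<open>1\<close> is a unit vector of the
  Euclidean scalar space, and the inner product with it reads off the real coordinate.\<close>

definition rp :: "'k::scalar_rc \<Rightarrow> real" where "rp x = x \<bullet> 1"

lemma rp_of_real [simp]: "rp (of_real r :: 'k::scalar_rc) = r"
  by (simp add: rp_def of_real_def power2_norm_eq_inner[symmetric])

lemma rp_0 [simp]: "rp 0 = 0"
  using rp_of_real[of 0] rp_of_real[of 1] by simp_all

lemma rp_add: "rp (x + y) = rp x + rp y"
  by (simp add: rp_def inner_add_left)

lemma rp_scaleR: "rp (r *\<^sub>R x) = r * rp x"
  by (simp add: rp_def)

lemma rp_of_real_mult: "rp (of_real r * x) = r * rp x"
  by (simp add: scaleR_conv_of_real[symmetric] rp_scaleR)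

lemma continuous_on_rp [continuous_intros]: "continuous_on S f \<Longrightarrow> continuous_on S (\<lambda>x. rp (f x))"
  unfolding rp_def by (intro continuous_intros)

text \<open>A fixed point of the conjugation satisfies
  \<open>x * x = of_real ((norm x)\<^sup>2)\<close>, so in a field it is \<open>norm x\<close> or
  its negative. This is what makes Hermitian determinants and diagonal form values real.\<close>

lemma scnj_fixed_real:
  assumes "scnj x = (x::'k::scalar_rc)"
  shows "of_real (rp x) = x"
proof -
  have "(x - of_real (norm x)) * (x + of_real (norm x)) = 0"
    using mult_scnj'[of x] assms by (simp add: algebra_simps power2_eq_square)
  then have "x = of_real (norm x) \<or> x = of_real (- norm x)"
    by (auto simp: eq_neg_iff_add_eq_0)
  then show ?thesis by (metis rp_of_real)
qed

lemma pos_scalar_of_real [simp]: "pos_scalar (of_real r :: 'k::scalar_rc) \<longleftrightarrow> 0 < r"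
  by (auto simp: pos_scalar_def)

lemma neg_scalar_of_real [simp]: "neg_scalar (of_real r :: 'k::scalar_rc) \<longleftrightarrow> r < 0"
  by (auto simp: neg_scalar_def)


section \<open>Matrices\<close>

definition mstar :: "'k::scalar_rc ^ 'n ^ 'n \<Rightarrow> 'k ^ 'n ^ 'n" where
  "mstar A = (\<chi> i j. scnj (A $ j $ i))"

definition diagm :: "('n \<Rightarrow> 'k::scalar_rc) \<Rightarrow> 'k ^ 'n ^ 'n" where
  "diagm x = (\<chi> i j. if i = j then x i else 0)"

definition rdiag :: "('n \<Rightarrow> real) \<Rightarrow> 'k::scalar_rc ^ 'n ^ 'n" where
  "rdiag x = diagm (\<lambda>i. of_real (x i))"

definition sdot :: "'k::scalar_rc ^ 'n \<Rightarrow> 'k ^ 'n \<Rightarrow> 'k" where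
  "sdot u v = (\<Sum>i\<in>UNIV. u $ i * scnj (v $ i))"

lemma mstar_nth [simp]: "mstar A $ i $ j = scnj (A $ j $ i)"
  by (simp add: mstar_def)

lemma diagm_nth: "diagm x $ i $ j = (if i = j then x i else 0)"
  by (simp add: diagm_def)

lemma mstar_mstar [simp]: "mstar (mstar A) = A"
  by (simp add: vec_eq_iff scnj_scnj)

lemma mstar_mult: "mstar (A ** B) = mstar B ** mstar A"
  by (simp add: vec_eq_iff matrix_matrix_mult_def scnj_sum scnj_mult mult.commute)

lemma mstar_1 [simp]: "mstar (mat 1) = mat 1"
  by (simp add: vec_eq_iff mat_def)

lemma mstar_mat: "mstar (mat c) = mat (scnj c)"
  by (simp add: vec_eq_iff mat_def)

lemma mat_eq_diagm: "mat c = diagm (\<lambda>_. c)"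
  by (simp add: vec_eq_iff mat_def diagm_nth)

lemma mstar_diagm: "mstar (diagm x) = diagm (\<lambda>i. scnj (x i))"
  by (simp add: vec_eq_iff diagm_nth)

lemma mstar_rdiag [simp]: "mstar (rdiag x) = rdiag x"
  by (simp add: rdiag_def mstar_diagm)

lemma diagm_mult_left_nth: "(diagm x ** A) $ i $ j = x i * A $ i $ j"
  by (simp add: matrix_matrix_mult_def diagm_nth if_distrib[of "\<lambda>z. z * _"] cong: if_cong)

lemma diagm_mult_right_nth: "(A ** diagm x) $ i $ j = A $ i $ j * x j"
  by (simp add: matrix_matrix_mult_def diagm_nth if_distrib[of "\<lambda>z. _ * z"] cong: if_cong)

lemma diagm_mult: "diagm x ** diagm y = diagm (\<lambda>i. x i * y i)"
  by (simp add: vec_eq_iff diagm_mult_left_nth diagm_nth)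

lemma rdiag_mult: "rdiag x ** rdiag y = rdiag (\<lambda>i. x i * y i)"
  by (simp add: rdiag_def diagm_mult)

lemma diagm_1 [simp]: "diagm (\<lambda>_. 1) = mat 1" and rdiag_1 [simp]: "rdiag (\<lambda>_. 1) = mat 1"
  by (simp_all add: rdiag_def mat_eq_diagm)

lemma diagm_mult_vec_nth: "(diagm x *v u) $ i = x i * u $ i"
  by (simp add: matrix_vector_mult_def diagm_nth if_distrib[of "\<lambda>z. z * _"] cong: if_cong)

lemma det_diagm: "det (diagm x) = (\<Prod>i\<in>UNIV. x i)"
  by (subst det_diagonal) (simp_all add: diagm_nth)

lemma det_rdiag: "det (rdiag x :: 'k::scalar_rc^'n^'n) = of_real (\<Prod>i\<in>UNIV. x i)"
  by (simp add: rdiag_def det_diagm)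

lemma rdiag_inject: "rdiag x = (rdiag y :: 'k::scalar_rc^'n^'n) \<longleftrightarrow> x = y"
  by (auto simp: rdiag_def vec_eq_iff diagm_nth fun_eq_iff split: if_splits)

lemma det_mstar: "det (mstar A) = scnj (det (A::'k::scalar_rc^'n^'n))"
proof -
  have "det (mstar A) = det (transpose (mstar A))" by simp
  also have "\<dots> = scnj (det A)"
  proof -
    have *: "scnj (of_int (sign p)) = (of_int (sign p) :: 'k)" for p :: "'n \<Rightarrow> 'n"
      by (simp add: sign_def)
    show ?thesis
      by (simp add: det_def transpose_def scnj_sum scnj_mult scnj_prod *)
  qed
  finally show ?thesis .
qed

lemma sdot_add_left: "sdot (u + v) w = sdot u w + sdot v w"
  by (simp add: sdot_def sum.distrib algebra_simps)
lemma sdot_add_right: "sdot w (u + v) = sdot w u + sdot w v"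
  by (simp add: sdot_def sum.distrib algebra_simps scnj_add)
lemma sdot_smult_left: "sdot (c *s u) v = c * sdot u v"
  by (simp add: sdot_def sum_distrib_left algebra_simps)
lemma sdot_smult_right: "sdot u (c *s v) = scnj c * sdot u v"
  by (simp add: sdot_def sum_distrib_left algebra_simps scnj_mult)
lemma sdot_scnj: "sdot v u = scnj (sdot u v)"
  by (simp add: sdot_def scnj_sum scnj_mult scnj_scnj mult.commute)
lemma sdot_0 [simp]: "sdot 0 u = 0" "sdot u 0 = 0"
  by (simp_all add: sdot_def)

lemma sdot_self: "sdot u u = of_real ((norm u)\<^sup>2)"
proof -
  have "sdot u u = of_real (\<Sum>i\<in>UNIV. (norm (u $ i))\<^sup>2)"
    by (simp add: sdot_def mult_scnj')
  also have "(\<Sum>i\<in>UNIV. (norm (u $ i))\<^sup>2) = (norm u)\<^sup>2"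
    by (simp add: norm_vec_def L2_set_def sum_nonneg)
  finally show ?thesis .
qed

lemma sdot_self_eq_0 [simp]: "sdot u u = 0 \<longleftrightarrow> u = 0"
  by (simp add: sdot_self)

lemma sdot_axis_right: "sdot u (axis i 1) = u $ i"
  by (simp add: sdot_def axis_def if_distrib[of scnj] if_distrib[of "\<lambda>z. _ * z"] cong: if_cong)

lemma sdot_mult_left: "sdot (A *v u) v = sdot u (mstar A *v v)"
proof -
  have "sdot (A *v u) v = (\<Sum>i\<in>UNIV. \<Sum>j\<in>UNIV. u $ j * (A $ i $ j * scnj (v $ i)))"
    by (simp add: sdot_def matrix_vector_mult_def sum_distrib_right mult_ac sum_distrib_left)
  also have "\<dots> = (\<Sum>j\<in>UNIV. \<Sum>i\<in>UNIV. u $ j * (A $ i $ j * scnj (v $ i)))"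
    by (rule sum.swap)
  also have "\<dots> = sdot u (mstar A *v v)"
    by (simp add: sdot_def matrix_vector_mult_def sum_distrib_left scnj_sum scnj_mult scnj_scnj)
  finally show ?thesis .
qed

lemma sdot_eqI: "(\<And>v. sdot u v = sdot u' v) \<Longrightarrow> u = u'"
  by (metis sdot_axis_right vec_eq_iff)

lemma matrix_eqI_sdot:
  assumes "\<And>u v. sdot (A *v u) v = sdot (A' *v u) v"
  shows "A = A'"
  by (metis assms sdot_eqI matrix_eq)

lemma mult_axis_nth: "(A *v axis j 1) $ i = A $ i $ j"
  by (simp add: matrix_vector_mult_def axis_def if_distrib[of "\<lambda>z. _ * z"] cong: if_cong)

text \<open>Reads a congruence as the Gram matrix of the columns of \<open>Q\<close>; the indices
  appear exchanged because \<open>sdot\<close> is linear in its first argument.\<close>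

lemma conj_entry: "(mstar Q ** G ** Q) $ i $ j = sdot (G *v (Q *v axis j 1)) (Q *v axis i 1)"
proof -
  have "(mstar Q ** G ** Q) $ i $ j = ((mstar Q ** G ** Q) *v axis j 1) $ i"
    by (simp add: mult_axis_nth)
  also have "\<dots> = sdot (mstar Q *v (G *v (Q *v axis j 1))) (axis i 1)"
    by (simp add: sdot_axis_right matrix_vector_mul_assoc matrix_mul_assoc)
  also have "\<dots> = sdot (G *v (Q *v axis j 1)) (Q *v axis i 1)"
    by (simp add: sdot_mult_left)
  finally show ?thesis .
qed

section \<open>Hermitian matrices and determinants\<close>

definition hermitian :: "'k::scalar_rc ^ 'n ^ 'n \<Rightarrow> bool" where
  "hermitian G \<longleftrightarrow> mstar G = G"

lemma hermitian_det: "hermitian G \<Longrightarrow> of_real (rp (det G)) = det G"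
  by (metis hermitian_def det_mstar scnj_fixed_real)

lemma hermitian_conj: "hermitian G \<Longrightarrow> hermitian (mstar Q ** G ** Q)"
  by (simp add: hermitian_def mstar_mult matrix_mul_assoc)

lemma hermitian_nth: "hermitian G \<Longrightarrow> scnj (G $ i $ j) = G $ j $ i"
  by (metis hermitian_def mstar_nth)

lemma hermitianI: "(\<And>i j. scnj (G $ i $ j) = G $ j $ i) \<Longrightarrow> hermitian G"
  by (simp add: hermitian_def vec_eq_iff)

lemma det_conj: "det (mstar Q ** G ** Q) = of_real ((norm (det Q))\<^sup>2) * det G"
  by (simp add: det_mul det_mstar mult_scnj'[symmetric] mult_ac del: of_real_power)

lemma det_eq_0_kernel:
  fixes A :: "'k::scalar_rc^'n^'n"
  shows "det A = 0 \<longleftrightarrow> (\<exists>u. u \<noteq> 0 \<and> A *v u = 0)"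
  using matrix_left_invertible_ker[of A] invertible_det_nz[of A] invertible_left_inverse[of A] by auto

lemma continuous_on_det [continuous_intros]:
  fixes f :: "'a::topological_space \<Rightarrow> 'k::real_normed_field^'n^'n"
  assumes "\<And>i j. continuous_on S (\<lambda>x. f x $ i $ j)"
  shows "continuous_on S (\<lambda>x. det (f x))"
  unfolding det_def by (intro continuous_intros assms)

section \<open>Principal minors\<close>

text \<open>The size of a matrix is fixed by its type, so the block of \<open>G\<close> on
  \<open>I\<close> is padded with an identity block; the determinant of the result is the principal
  minor.\<close>

definition sub_matrix :: "'n set \<Rightarrow> 'k::scalar_rc ^ 'n ^ 'n \<Rightarrow> 'k ^ 'n ^ 'n" where
  "sub_matrix I G = (\<chi> i j. if i \<in> I \<and> j \<in> I then G $ i $ j else if i = j then 1 else 0)"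

text \<open>Principal minors of a Hermitian matrix are real, so taking the real part loses nothing
  there and yields a number that has a sign.\<close>

definition pminor :: "'n set \<Rightarrow> 'k::scalar_rc ^ 'n ^ 'n \<Rightarrow> real" where
  "pminor I G = rp (det (sub_matrix I G))"

lemma sub_matrix_nth: "sub_matrix I G $ i $ j =
    (if i \<in> I \<and> j \<in> I then G $ i $ j else if i = j then 1 else 0)"
  by (simp add: sub_matrix_def)

lemma sub_matrix_UNIV [simp]: "sub_matrix UNIV G = G"
  by (simp add: vec_eq_iff sub_matrix_nth)

lemma hermitian_sub_matrix: "hermitian G \<Longrightarrow> hermitian (sub_matrix I G)"
  by (rule hermitianI) (auto simp: sub_matrix_nth hermitian_nth)

lemma of_real_pminor: "hermitian G \<Longrightarrow> of_real (pminor I G) = det (sub_matrix I G)"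
  by (simp add: pminor_def hermitian_det hermitian_sub_matrix)

lemma det_sub_matrix_scale:
  "det (sub_matrix I (\<chi> i j. c * G $ i $ j)) = c ^ card I * det (sub_matrix I (G :: 'k::scalar_rc^'n^'n))"
proof -
  have "sub_matrix I (\<chi> i j. c * G $ i $ j) = diagm (\<lambda>i. if i \<in> I then c else 1) ** sub_matrix I G"
    by (auto simp: vec_eq_iff diagm_mult_left_nth sub_matrix_nth)
  then show ?thesis
    by (simp add: det_mul det_diagm prod.If_cases)
qed

text \<open>The hypothesis says that \<open>Q\<close> preserves the coordinate subspace of
  \<open>I\<close>. The block on \<open>I\<close> of the congruence then only sees the blocks of
  \<open>Q\<close> and \<open>G\<close> on \<open>I\<close>, so that passing to padded blocks
  commutes with the congruence.\<close>

lemma det_sub_matrix_conj: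
  fixes Q G :: "'k::scalar_rc^'n^'n"
  assumes "\<And>i j. j \<in> I \<Longrightarrow> i \<notin> I \<Longrightarrow> Q $ i $ j = 0"
  shows "det (sub_matrix I (mstar Q ** G ** Q)) =
    of_real ((norm (det (sub_matrix I Q)))\<^sup>2) * det (sub_matrix I G)"
proof -
  have "sub_matrix I (mstar Q ** G ** Q) =
      mstar (sub_matrix I Q) ** sub_matrix I G ** sub_matrix I Q" (is "?L = ?R")
  proof (subst vec_eq_iff, intro allI, subst vec_eq_iff, intro allI)
    fix i j
    have inner: "(\<Sum>k\<in>UNIV. scnj (sub_matrix I Q $ k $ i) * sub_matrix I G $ k $ l)
        = (if i \<in> I \<and> l \<in> I then (\<Sum>k\<in>UNIV. scnj (Q $ k $ i) * G $ k $ l) else if i = l then 1 else 0)"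
for l
    proof (cases "i \<in> I")
      case True
      show ?thesis
      proof (cases "l \<in> I")
        case l: True
        have "scnj (sub_matrix I Q $ k $ i) * sub_matrix I G $ k $ l = scnj (Q $ k $ i) * G $ k $ l" for k
        proof (cases "k \<in> I")
          case False
          then have "Q $ k $ i = 0" "sub_matrix I Q $ k $ i = 0" using True assms(1)[of i k] by (auto simp: sub_matrix_nth)
          then show ?thesis by simp
        qed (use True l in \<open>simp add: sub_matrix_nth\<close>)
        then show ?thesis using True l by simp
      next
        case l: False
        have "(\<Sum>k\<in>UNIV. scnj (sub_matrix I Q $ k $ i) * sub_matrix I G $ k $ l) = 0"
          by (rule sum.neutral) (use True l in \<open>auto simp: sub_matrix_nth\<close>)
        moreover have "i \<noteq> l" using True l by auto
        ultimately show ?thesis using l by simp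
      qed
    next
      case False
      have "scnj (sub_matrix I Q $ k $ i) * sub_matrix I G $ k $ l =
          (if k = i then (if i = l then 1 else 0) else 0)" for k
        using False by (auto simp: sub_matrix_nth)
      with False show ?thesis by simp
    qed
    have "?R $ i $ j = (\<Sum>l\<in>UNIV. (if i \<in> I \<and> l \<in> I then (\<Sum>k\<in>UNIV. scnj (Q $ k $ i) * G $ k $ l)
          else if i = l then 1 else 0) * sub_matrix I Q $ l $ j)"
      by (simp add: matrix_matrix_mult_def inner)
    also have "\<dots> = ?L $ i $ j"
    proof (cases "i \<in> I \<and> j \<in> I")
      case True
      have "(if i \<in> I \<and> l \<in> I then (\<Sum>k\<in>UNIV. scnj (Q $ k $ i) * G $ k $ l)
          else if i = l then 1 else 0) * sub_matrix I Q $ l $ j =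
          (\<Sum>k\<in>UNIV. scnj (Q $ k $ i) * G $ k $ l) * Q $ l $ j" for l
      proof (cases "l \<in> I")
        case False
        then have "Q $ l $ j = 0" "sub_matrix I Q $ l $ j = 0" using True assms(1)[of j l] by (auto simp: sub_matrix_nth)
        then show ?thesis by simp
      qed (use True in \<open>simp add: sub_matrix_nth\<close>)
      with True show ?thesis
        by (simp add: matrix_matrix_mult_def sub_matrix_nth)
    next
      case False
      have "(if i \<in> I \<and> l \<in> I then s else if i = l then 1 else 0) * sub_matrix I Q $ l $ j =
          (if l = i then (if i = j then 1 else 0) else 0)" for l s
      proof (cases "i \<in> I")
        case True
        then have "j \<notin> I" using False by simp
        then have "l \<in> I \<Longrightarrow> l \<noteq> j" "i \<noteq> j" using True by metis+
        then show ?thesis using True \<open>j \<notin> I\<close> by (cases "l \<in> I") (simp_all add: sub_matrix_nth)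
      qed (simp add: sub_matrix_nth)
      then have "(\<Sum>l\<in>UNIV. (if i \<in> I \<and> l \<in> I then (\<Sum>k\<in>UNIV. scnj (Q $ k $ i) * G $ k $ l)
          else if i = l then 1 else 0) * sub_matrix I Q $ l $ j) = (if i = j then 1 else 0)"
        by simp
      moreover have "?L $ i $ j = (if i = j then 1 else 0)"
        using False by (subst sub_matrix_nth) auto
      ultimately show ?thesis by simp
    qed
    finally show "?L $ i $ j = ?R $ i $ j" ..
  qed
  then show ?thesis by (simp only: det_conj)
qed

lemma pminor_conj:
  fixes Q G :: "'k::scalar_rc^'n^'n"
  assumes "\<And>i j. j \<in> I \<Longrightarrow> i \<notin> I \<Longrightarrow> Q $ i $ j = 0"
  shows "pminor I (mstar Q ** G ** Q) = (norm (det (sub_matrix I Q)))\<^sup>2 * pminor I G"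
proof -
  have "det (sub_matrix I (mstar Q ** G ** Q)) =
      of_real ((norm (det (sub_matrix I Q)))\<^sup>2) * det (sub_matrix I G)"
    by (rule det_sub_matrix_conj) (rule assms)
  then show ?thesis by (simp only: pminor_def rp_of_real_mult)
qed

lemma pminor_rdiag: "pminor I (rdiag f :: 'k::scalar_rc^'n^'n) = (\<Prod>i\<in>I. f i)"
proof -
  have "sub_matrix I (rdiag f :: 'k^'n^'n) = rdiag (\<lambda>i. if i \<in> I then f i else 1)"
    by (auto simp: vec_eq_iff sub_matrix_nth rdiag_def diagm_nth)
  then have "pminor I (rdiag f :: 'k^'n^'n) = (\<Prod>i\<in>UNIV. if i \<in> I then f i else 1)"
    by (simp only: pminor_def det_rdiag rp_of_real)
  then show ?thesis by (simp add: prod.If_cases)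
qed

text \<open>Laplace expansion along a column with a single entry. The matrix is the padded
  complementary minor times the identity with row \<open>a\<close> replaced, and Cramer's rule gives
  the determinant \<open>t\<close> of the latter.\<close>

lemma det_col_axis:
  fixes M :: "'k::scalar_rc^'n^'n"
  shows "det (\<chi> i j. if j = a then (if i = a then t else 0) else M $ i $ j) =
    t * det (sub_matrix (- {a}) M)"
proof -
  define x where "x = (\<chi> j. if j = a then t else M $ a $ j)"
  define R where "R = (\<chi> i. if i = a then (\<Sum>j\<in>UNIV. x $ j *s row j (mat 1)) else row i (mat 1 :: 'k^'n^'n))"
  have rowx: "(\<Sum>j\<in>UNIV. x $ j *s row j (mat 1 :: 'k^'n^'n)) = x"
    by (simp add: vec_eq_iff row_def mat_def if_distrib[of "\<lambda>z. _ * z"] cong: if_cong)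
  have Ra: "R $ a = x" by (simp add: R_def rowx)
  have "(\<chi> i j. if j = a then (if i = a then t else 0) else M $ i $ j) = sub_matrix (- {a}) M ** R"
  proof -
    have "(sub_matrix (- {a}) M ** R) $ i $ j =
        (if j = a then (if i = a then t else 0) else M $ i $ j)" for i j
    proof (cases "i = a")
      case True
      have "(sub_matrix (- {a}) M ** R) $ i $ j = R $ a $ j"
        using True by (simp add: matrix_matrix_mult_def sub_matrix_nth if_distrib[of "\<lambda>z. z * _"] cong: if_cong)
      then show ?thesis using True by (simp add: Ra x_def)
    next
      case False
      have "sub_matrix (- {a}) M $ i $ k * R $ k $ j =
          (if k = j then (if j = a then 0 else M $ i $ j) else 0)" for k
        using False by (auto simp: sub_matrix_nth R_def rowx row_def mat_def)
      then show ?thesis using False by (simp add: matrix_matrix_mult_def)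
    qed
    then show ?thesis by (simp add: vec_eq_iff)
  qed
  moreover have "det R = t"
    unfolding R_def by (subst cramer_lemma_transpose) (simp add: x_def)
  ultimately show ?thesis by (simp add: det_mul)
qed

lemma det_row_axis:
  fixes v :: "'k::scalar_rc^'n"
  shows "det (\<chi> i j. if i = a then v $ j else if i = j then 1 else 0) = v $ a"
proof -
  have "(\<chi> i j. if i = a then v $ j else if i = j then 1 else 0) =
      (\<chi> i. if i = a then (\<Sum>j\<in>UNIV. v $ j *s row j (mat 1)) else row i (mat 1 :: 'k^'n^'n))"
    by (simp add: vec_eq_iff row_def mat_def if_distrib[of "\<lambda>z. _ * z"] cong: if_cong)
  then show ?thesis by (simp add: cramer_lemma_transpose)
qed

lemma norm_matrix_le:
  fixes A :: "'k::real_normed_vector^'n^'n" and R :: real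
  assumes "\<And>i j. norm (A $ i $ j) \<le> R"
  shows "norm A \<le> CARD('n) * (CARD('n) * R)"
proof -
  have "norm (A $ i) \<le> CARD('n) * R" for i
  proof -
    have "norm (A $ i) \<le> (\<Sum>j\<in>UNIV. norm (A $ i $ j))"
      unfolding norm_vec_def[of "A $ i"] by (rule L2_set_le_sum) simp
    also have "\<dots> \<le> CARD('n) * R" using sum_bounded_above[of UNIV "\<lambda>j. norm (A $ i $ j)" R] assms by simp
    finally show ?thesis .
  qed
  moreover have "norm A \<le> (\<Sum>i\<in>UNIV. norm (A $ i))"
    unfolding norm_vec_def[of A] by (rule L2_set_le_sum) simp
  ultimately show ?thesis
    using sum_bounded_above[of UNIV "\<lambda>i. norm (A $ i)" "CARD('n) * R"] by fastforce
qed

text \<open>Uniform continuity on a compact ball containing all matrices with entries bounded by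
  \<open>R\<close>. That \<open>\<delta>\<close> depends only on \<open>\<epsilon>\<close> and
  \<open>R\<close> is why the final constant does not depend on the group element.\<close>

lemma det_uniformly_continuous:
  assumes "\<epsilon> > 0"
  obtains \<delta> where "\<delta> > 0" and "\<And>A A' :: 'k::scalar_rc^'n^'n.
    (\<And>i j. norm (A $ i $ j) \<le> R) \<Longrightarrow> (\<And>i j. norm (A' $ i $ j) \<le> R) \<Longrightarrow>
    (\<And>i j. norm (A $ i $ j - A' $ i $ j) \<le> \<delta>) \<Longrightarrow> norm (det A - det A') < \<epsilon>"
proof -
  let ?K = "cball 0 (CARD('n) * (CARD('n) * R)) :: ('k^'n^'n) set"
  have "continuous_on ?K det" by (intro continuous_intros)
  then have "uniformly_continuous_on ?K det" by (rule compact_uniformly_continuous) simp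
  then obtain d where d: "d > 0" "\<And>A A'. A \<in> ?K \<Longrightarrow> A' \<in> ?K \<Longrightarrow> dist A A' < d \<Longrightarrow> dist (det A) (det A') < \<epsilon>"
    using assms unfolding uniformly_continuous_on_def by (metis dist_commute)
  define \<delta> where "\<delta> = d / (2 * (CARD('n) * CARD('n)))"
  have c: "(0::real) < CARD('n)" by simp
  show ?thesis
  proof
    show "\<delta> > 0" using d c by (simp add: \<delta>_def)
    fix A A' :: "'k^'n^'n"
    assume A: "\<And>i j. norm (A $ i $ j) \<le> R" "\<And>i j. norm (A' $ i $ j) \<le> R"
      "\<And>i j. norm (A $ i $ j - A' $ i $ j) \<le> \<delta>"
    have "norm (A - A') \<le> CARD('n) * (CARD('n) * \<delta>)"
      by (rule norm_matrix_le) (simp add: A)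
    also have "\<dots> = d / 2" by (simp add: \<delta>_def field_simps)
    finally have "dist A A' < d" using d by (simp add: dist_norm)
    then have "dist (det A) (det A') < \<epsilon>"
      using d(2) norm_matrix_le[of A, OF A(1)] norm_matrix_le[of A', OF A(2)] by simp
    then show "norm (det A - det A') < \<epsilon>" by (simp add: dist_norm)
  qed
qed


section \<open>Pencils of Hermitian forms\<close>

text \<open>If \<open>G\<close> is the Gram matrix of a form in a frame \<open>K\<close>, this is
  its Gram matrix in the frame \<open>K ** rdiag (\<lambda>i. exp (x i))\<close>.\<close>

definition scaled :: "('n \<Rightarrow> real) \<Rightarrow> 'k::scalar_rc ^ 'n ^ 'n \<Rightarrow> 'k ^ 'n ^ 'n" where
  "scaled x G = rdiag (\<lambda>i. exp (x i)) ** G ** rdiag (\<lambda>i. exp (x i))"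

definition pencil :: "'k::scalar_rc ^ 'n ^ 'n \<Rightarrow> 'k ^ 'n ^ 'n \<Rightarrow> real \<Rightarrow> 'k ^ 'n ^ 'n" where
  "pencil G1 G2 t = t *\<^sub>R G1 - G2"

lemma scaled_nth: "scaled x G $ i $ j = of_real (exp (x i) * exp (x j)) * G $ i $ j"
  by (simp add: scaled_def rdiag_def diagm_mult_left_nth diagm_mult_right_nth mult_ac)

lemma pencil_nth: "pencil G1 G2 t $ i $ j = of_real t * G1 $ i $ j - G2 $ i $ j"
  by (simp add: pencil_def scaleR_conv_of_real[of t "G1 $ i $ j"])

lemma hermitian_scaled: "hermitian G \<Longrightarrow> hermitian (scaled x G)"
  by (rule hermitianI) (simp add: scaled_nth scnj_mult hermitian_nth mult_ac flip: of_real_mult)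

lemma hermitian_pencil: "hermitian G1 \<Longrightarrow> hermitian G2 \<Longrightarrow> hermitian (pencil G1 G2 t)"
  by (rule hermitianI) (simp add: pencil_nth scnj_mult hermitian_nth)

text \<open>The two padded blocks act on disjoint sets of coordinates, so their product is the block
  matrix itself.\<close>

lemma det_block:
  fixes G H :: "'k::scalar_rc^'n^'n"
  assumes "I \<inter> T = {}"
  shows "det (\<chi> i j. if i \<in> I \<and> j \<in> I then G $ i $ j else if i \<in> T \<and> j \<in> T then H $ i $ j
      else if i = j then 1 else (0::'k)) = det (sub_matrix I G) * det (sub_matrix T H)"
proof -
  have "(sub_matrix I G ** sub_matrix T H) $ i $ j =
      (if i \<in> I \<and> j \<in> I then G $ i $ j else if i \<in> T \<and> j \<in> T then H $ i $ j
      else if i = j then 1 else 0)" (is "_ = ?r") for i j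
  proof (cases "i \<in> I")
    case True
    have "sub_matrix I G $ i $ k * sub_matrix T H $ k $ j = (if k = j then ?r else 0)" for k
      using True assms by (auto simp: sub_matrix_nth)
    then show ?thesis by (simp add: matrix_matrix_mult_def)
  next
    case False
    have "sub_matrix I G $ i $ k * sub_matrix T H $ k $ j = (if k = i then ?r else 0)" for k
      using False assms by (auto simp: sub_matrix_nth)
    then show ?thesis by (simp add: matrix_matrix_mult_def)
  qed
  then have "sub_matrix I G ** sub_matrix T H = (\<chi> i j. if i \<in> I \<and> j \<in> I then G $ i $ j
      else if i \<in> T \<and> j \<in> T then H $ i $ j else if i = j then 1 else 0)"
    by (simp add: vec_eq_iff)
  then show ?thesis by (metis det_mul)
qed

lemma sgn_eq_if_close:
  fixes a b c :: real
  assumes "\<bar>a - b\<bar> < c" "c \<le> \<bar>b\<bar>"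
  shows "sgn a = sgn b"
  using assms by (auto simp: sgn_if abs_if split: if_splits)

text \<open>At a value \<open>t\<close> well between the scales \<open>exp (2 * x j)\<close>, \<open>j \<in> I\<close>, and \<open>exp (2 * x k)\<close>,
  \<open>k \<in> T\<close>, the pencil is after rescaling close to a block matrix with blocks \<open>- GU\<close> and \<open>\<plusminus> GS\<close>.\<close>

lemma pencil_minor_sign:
  assumes "c > 0" "R \<ge> 0"
  shows "\<exists>\<theta>>0. \<theta> \<le> 1 \<and> (\<forall>(GU :: 'k::scalar_rc^'n^'n) GS I T x t.
    hermitian GU \<longrightarrow> hermitian GS \<longrightarrow> (\<forall>i j. norm (GU $ i $ j) \<le> R) \<longrightarrow> (\<forall>i j. norm (GS $ i $ j) \<le> R) \<longrightarrow>
    I \<inter> T = {} \<longrightarrow> t \<noteq> 0 \<longrightarrow> (\<forall>j. j \<in> I \<longrightarrow> sqrt \<bar>t\<bar> \<le> \<theta> * exp (x j)) \<longrightarrow>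
    (\<forall>k. k \<in> T \<longrightarrow> exp (x k) \<le> \<theta> * sqrt \<bar>t\<bar>) \<longrightarrow> \<bar>pminor I GU\<bar> \<ge> c \<longrightarrow> \<bar>pminor T GS\<bar> \<ge> c \<longrightarrow>
    sgn (pminor (I \<union> T) (pencil GS (scaled x GU) t)) =
      (-1) ^ card I * sgn t ^ card T * sgn (pminor I GU) * sgn (pminor T GS))"
proof -
  obtain \<delta> where \<delta>: "\<delta> > 0" "\<And>A A' :: 'k^'n^'n.
    (\<And>i j. norm (A $ i $ j) \<le> 3 * R + 1) \<Longrightarrow> (\<And>i j. norm (A' $ i $ j) \<le> 3 * R + 1) \<Longrightarrow>
    (\<And>i j. norm (A $ i $ j - A' $ i $ j) \<le> \<delta>) \<Longrightarrow> norm (det A - det A') < c * c"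
    using det_uniformly_continuous[of "c * c"] assms by (metis mult_pos_pos)
  \<comment> \<open>\<open>\<theta>\<close> makes the entrywise error
    \<open>2 * R * \<theta>\<close> at most \<open>\<delta>\<close>; the \<open>1\<close> in the
    denominator covers \<open>R = 0\<close>, and \<open>\<theta> \<le> 1\<close> keeps all rescaled
    coefficients at most \<open>1\<close>.\<close>
  define \<theta> where "\<theta> = min 1 (\<delta> / (2 * R + 1))"
  have \<theta>: "\<theta> > 0" "\<theta> \<le> 1" "2 * R * \<theta> \<le> \<delta>"
  proof -
    show "\<theta> > 0" "\<theta> \<le> 1" using \<delta> assms by (simp_all add: \<theta>_def)
    have "2 * R * \<theta> \<le> (2 * R + 1) * \<theta>" using \<open>\<theta> > 0\<close> by simp
    also have "\<dots> \<le> (2 * R + 1) * (\<delta> / (2 * R + 1))"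
      using assms by (intro mult_left_mono) (auto simp: \<theta>_def)
    also have "\<dots> = \<delta>" using assms by simp
    finally show "2 * R * \<theta> \<le> \<delta>" .
  qed
  show ?thesis
  proof (rule exI[of _ \<theta>], intro conjI)
    show "0 < \<theta>" "\<theta> \<le> 1" by fact+
    show "\<forall>(GU :: 'k^'n^'n) GS I T x t. hermitian GU \<longrightarrow> hermitian GS \<longrightarrow>
      (\<forall>i j. norm (GU $ i $ j) \<le> R) \<longrightarrow> (\<forall>i j. norm (GS $ i $ j) \<le> R) \<longrightarrow>
      I \<inter> T = {} \<longrightarrow> t \<noteq> 0 \<longrightarrow> (\<forall>j. j \<in> I \<longrightarrow> sqrt \<bar>t\<bar> \<le> \<theta> * exp (x j)) \<longrightarrow>
      (\<forall>k. k \<in> T \<longrightarrow> exp (x k) \<le> \<theta> * sqrt \<bar>t\<bar>) \<longrightarrow> \<bar>pminor I GU\<bar> \<ge> c \<longrightarrow> \<bar>pminor T GS\<bar> \<ge> c \<longrightarrow>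
      sgn (pminor (I \<union> T) (pencil GS (scaled x GU) t)) =
        (-1) ^ card I * sgn t ^ card T * sgn (pminor I GU) * sgn (pminor T GS)"
    proof (intro allI impI)
    fix GU GS :: "'k^'n^'n" and I T x and t :: real
    assume H: "hermitian GU" "hermitian GS"
      and R': "\<forall>i j. norm (GU $ i $ j) \<le> R" "\<forall>i j. norm (GS $ i $ j) \<le> R"
      and IT: "I \<inter> T = {}" and t: "t \<noteq> 0"
      and xI': "\<forall>j. j \<in> I \<longrightarrow> sqrt \<bar>t\<bar> \<le> \<theta> * exp (x j)"
      and xT': "\<forall>k. k \<in> T \<longrightarrow> exp (x k) \<le> \<theta> * sqrt \<bar>t\<bar>"
      and cI: "\<bar>pminor I GU\<bar> \<ge> c" and cT: "\<bar>pminor T GS\<bar> \<ge> c"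
    note R = R'[rule_format] and xI = xI'[rule_format] and xT = xT'[rule_format]
    define s where "s = sqrt \<bar>t\<bar>"
    have s: "s > 0" "s * s = \<bar>t\<bar>" using t by (simp_all add: s_def)
    \<comment> \<open>Congruence by \<open>rdiag l\<close> turns the coefficient of
      \<open>GS\<close> in the entry \<open>(i, j)\<close> into \<open>sgn t * (u i * u j)\<close>
      and that of \<open>GU\<close>, up to sign, into \<open>w i * w j\<close>. On \<open>I\<close>
      this choice gives \<open>w = 1\<close> and \<open>u\<close> small, on \<open>T\<close> it
      gives \<open>u = 1\<close> and \<open>w\<close> small; elsewhere the padding is left
      alone.\<close>
    define l where "l j = (if j \<in> I then exp (- x j) else if j \<in> T then 1 / s else 1)" for j
    define u where "u j = s * l j" for j
    define w where "w j = l j * exp (x j)" for j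
    have l: "l j > 0" for j using s by (simp add: l_def)
    have uI: "u j \<le> \<theta>" "w j = 1" if "j \<in> I" for j
      using xI[OF that] that by (simp_all add: u_def w_def l_def s_def exp_minus field_simps)
    have wT: "w j \<le> \<theta>" "u j = 1" if "j \<in> T" for j
      using xT[OF that] that IT s by (auto simp: u_def w_def l_def s_def[symmetric] field_simps)
    have pos: "u j > 0" "w j > 0" for j using l s by (simp_all add: u_def w_def)
    define F where "F = pencil GS (scaled x GU) t"
    define A where "A = rdiag l ** sub_matrix (I \<union> T) F ** rdiag l"
    define L where "L = (\<chi> i j. if i \<in> I \<and> j \<in> I then (\<chi> i j. (-1) * GU $ i $ j) $ i $ j
        else if i \<in> T \<and> j \<in> T then (\<chi> i j. of_real (sgn t) * GS $ i $ j) $ i $ j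
        else if i = j then 1 else (0::'k))"
    have A_nth: "A $ i $ j = of_real (sgn t * (u i * u j)) * GS $ i $ j - of_real (w i * w j) * GU $ i $ j"
      if "i \<in> I \<union> T" "j \<in> I \<union> T" for i j
    proof -
      have "of_real (sgn t * (u i * u j)) = (of_real (l i * l j * t) :: 'k)"
      proof -
        have "sgn t * (u i * u j) = l i * l j * (sgn t * (s * s))" by (simp add: u_def mult_ac)
        then show ?thesis by (simp add: s sgn_mult_abs)
      qed
      then show ?thesis using that
        by (simp add: A_def rdiag_def diagm_mult_left_nth diagm_mult_right_nth sub_matrix_nth F_def
            pencil_nth scaled_nth w_def algebra_simps)
    qed
    have A_nth': "A $ i $ j = (if i = j then 1 else 0)" if "\<not> (i \<in> I \<union> T \<and> j \<in> I \<union> T)" for i j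
      using that by (auto simp: A_def rdiag_def diagm_mult_left_nth diagm_mult_right_nth sub_matrix_nth l_def)
    \<comment> \<open>On a diagonal block one of the two terms is kept by \<open>L\<close> and the
      other is at most \<open>R * \<theta>\<close>; on the mixed blocks both are that small, whence
      the factor \<open>2\<close>.\<close>
    have diff: "norm (A $ i $ j - L $ i $ j) \<le> 2 * R * \<theta>" for i j
    proof -
      have small: "norm (of_real (a * b) * g) \<le> R * \<theta>" if "0 \<le> a" "a \<le> 1" "0 \<le> b" "b \<le> \<theta>" "norm g \<le> R"
        for a b :: real and g :: 'k
      proof -
        have "norm (of_real (a * b) * g) = (a * b) * norm g" using that by (simp add: norm_mult)
        also have "\<dots> \<le> (1 * \<theta>) * R" using that \<theta> by (intro mult_mono) auto
        finally show ?thesis by (simp add: mult.commute)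
      qed
      have small': "norm (of_real (sgn t * (a * b)) * g) \<le> R * \<theta>" if "0 \<le> a" "a \<le> 1" "0 \<le> b" "b \<le> \<theta>" "norm g \<le> R"
        for a b :: real and g :: 'k
      proof -
        have "norm (of_real (sgn t * (a * b)) * g) = norm (of_real (a * b) * g)"
          using t by (simp add: norm_mult abs_mult)
        then show ?thesis using small[OF that] by simp
      qed
      have R\<theta>: "0 \<le> R * \<theta>" using \<theta> assms by simp
      have p: "0 \<le> u i" "0 \<le> u j" "0 \<le> w i" "0 \<le> w j" using pos less_imp_le by blast+
      consider "i \<in> I" "j \<in> I" | "i \<in> T" "j \<in> T" | "i \<in> I" "j \<in> T" | "i \<in> T" "j \<in> I"
        | "\<not> (i \<in> I \<union> T \<and> j \<in> I \<union> T)" by blast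
      then show ?thesis
      proof cases
        case 1
        have "norm (of_real (sgn t * (u i * u j)) * GS $ i $ j) \<le> R * \<theta>"
          using 1 uI[of i] uI[of j] \<theta> p R by (intro small') auto
        moreover have "A $ i $ j - L $ i $ j = of_real (sgn t * (u i * u j)) * GS $ i $ j"
          using 1 by (simp add: A_nth L_def uI)
        ultimately show ?thesis using R\<theta> by simp
      next
        case 2
        have "norm (of_real (w i * w j) * GU $ i $ j) \<le> R * \<theta>"
          using 2 wT[of i] wT[of j] \<theta> p R by (intro small) auto
        moreover have "A $ i $ j - L $ i $ j = - (of_real (w i * w j) * GU $ i $ j)"
          using 2 IT by (auto simp: A_nth L_def wT)
        ultimately show ?thesis using R\<theta> by simp
      next
        case 3
        have "norm (of_real (w i * w j) * GU $ i $ j) \<le> R * \<theta>"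
          using 3 wT[of j] uI[of i] \<theta> p R by (intro small) auto
        moreover have "norm (of_real (sgn t * (u j * u i)) * GS $ i $ j) \<le> R * \<theta>"
          using 3 wT[of j] uI[of i] \<theta> p R by (intro small') auto
        moreover have "A $ i $ j - L $ i $ j = of_real (sgn t * (u j * u i)) * GS $ i $ j - of_real (w i * w j) * GU $ i $ j"
          using 3 IT by (auto simp: A_nth L_def mult_ac)
        ultimately have "norm (A $ i $ j - L $ i $ j) \<le> R * \<theta> + R * \<theta>"
          using norm_triangle_le_diff[of "of_real (sgn t * (u j * u i)) * GS $ i $ j" "of_real (w i * w j) * GU $ i $ j" "R * \<theta> + R * \<theta>"]
          by (simp only: add_mono)
        then show ?thesis by simp
      next
        case 4
        have "norm (of_real (w j * w i) * GU $ i $ j) \<le> R * \<theta>"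
          using 4 wT[of i] uI[of j] \<theta> p R by (intro small) auto
        moreover have "norm (of_real (sgn t * (u i * u j)) * GS $ i $ j) \<le> R * \<theta>"
          using 4 wT[of i] uI[of j] \<theta> p R by (intro small') auto
        moreover have "A $ i $ j - L $ i $ j = of_real (sgn t * (u i * u j)) * GS $ i $ j - of_real (w j * w i) * GU $ i $ j"
          using 4 IT by (auto simp: A_nth L_def mult_ac)
        ultimately have "norm (A $ i $ j - L $ i $ j) \<le> R * \<theta> + R * \<theta>"
          using norm_triangle_le_diff[of "of_real (sgn t * (u i * u j)) * GS $ i $ j" "of_real (w j * w i) * GU $ i $ j" "R * \<theta> + R * \<theta>"]
          by (simp only: add_mono)
        then show ?thesis by simp
      next
        case 5
        then have "A $ i $ j - L $ i $ j = 0" by (auto simp: A_nth' L_def)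
        then show ?thesis using R\<theta> by simp
      qed
    qed
    have L_le: "norm (L $ i $ j) \<le> R + 1" for i j
      using R[of i j] t assms by (auto simp: L_def norm_mult)
    have "R * \<theta> \<le> R * 1" using \<theta> assms by (intro mult_left_mono) auto
    \<comment> \<open>\<open>R + 1\<close> bounds the entries of \<open>L\<close> and
      \<open>2 * R\<close> bounds the error; their sum is the radius for which
      \<open>\<delta>\<close> was obtained.\<close>
    then have A_le: "norm (A $ i $ j) \<le> 3 * R + 1" for i j
      using norm_triangle_sub[of "A $ i $ j" "L $ i $ j"] diff[of i j] L_le[of i j] by linarith
    have "norm (det A - det L) < c * c"
    proof (rule \<delta>(2))
      show "norm (A $ i $ j) \<le> 3 * R + 1" for i j by (rule A_le)
      show "norm (L $ i $ j) \<le> 3 * R + 1" for i j using L_le[of i j] assms by simp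
      show "norm (A $ i $ j - L $ i $ j) \<le> \<delta>" for i j using diff[of i j] \<theta> by simp
    qed
    moreover have "det A = of_real ((\<Prod>i\<in>UNIV. l i)\<^sup>2 * pminor (I \<union> T) F)"
      by (simp add: A_def det_mul det_rdiag of_real_pminor F_def hermitian_pencil hermitian_scaled H
          power2_eq_square)
    moreover have detL: "det L = of_real ((-1) ^ card I * pminor I GU * (sgn t ^ card T * pminor T GS))"
      unfolding L_def det_block[OF IT] det_sub_matrix_scale by (simp add: of_real_pminor H)
    ultimately have "\<bar>(\<Prod>i\<in>UNIV. l i)\<^sup>2 * pminor (I \<union> T) F -
        (-1) ^ card I * pminor I GU * (sgn t ^ card T * pminor T GS)\<bar> < c * c"
      by (simp only: of_real_diff[symmetric] norm_of_real)
    \<comment> \<open>Both minors are at least \<open>c\<close> in modulus, so an error below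
      \<open>c * c\<close> cannot change the sign of their product.\<close>
    moreover have "c * c \<le> \<bar>(-1) ^ card I * pminor I GU * (sgn t ^ card T * pminor T GS)\<bar>"
      using cI cT t assms by (simp add: abs_mult power_abs mult_mono)
    ultimately have "sgn ((\<Prod>i\<in>UNIV. l i)\<^sup>2 * pminor (I \<union> T) F) =
        sgn ((-1) ^ card I * pminor I GU * (sgn t ^ card T * pminor T GS))"
      by (rule sgn_eq_if_close)
    moreover have "0 < (\<Prod>i\<in>UNIV. l i)\<^sup>2" using l by (intro zero_less_power prod_pos) auto
    then have "sgn ((\<Prod>i\<in>UNIV. l i)\<^sup>2) = 1" by (rule sgn_pos)
    ultimately show "sgn (pminor (I \<union> T) (pencil GS (scaled x GU) t)) =
      (-1) ^ card I * sgn t ^ card T * sgn (pminor I GU) * sgn (pminor T GS)"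
      by (simp only: sgn_mult F_def power_sgn mult_ac) (simp add: mult_ac)
    qed
  qed
qed

section \<open>Zeros of the determinant and eigenvectors\<close>

lemma ivt_sgn:
  fixes f :: "real \<Rightarrow> real"
  assumes "continuous_on {a..b} f" "a \<le> b" "sgn (f a) * sgn (f b) = -1"
  obtains x where "a < x" "x < b" "f x = 0"
proof -
  have "(f a < 0 \<and> f b > 0) \<or> (f a > 0 \<and> f b < 0)"
    using assms(3) by (auto simp: sgn_if split: if_splits)
  then obtain x where x: "a \<le> x" "x \<le> b" "f x = 0"
    using IVT'[of f a 0 b] IVT2'[of f b 0 a] assms(1,2) by force
  moreover have "f a \<noteq> 0" "f b \<noteq> 0" using assms(3) by auto
  ultimately show ?thesis using that by (metis order_le_less)
qed

text \<open>Stands in for the cancellation of a common linear factor of two polynomials: after the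
  division an identity holds away from the zero, and continuity extends it.\<close>

lemma eq_at_if_eq_near:
  fixes f g :: "real \<Rightarrow> real"
  assumes "continuous_on UNIV f" "continuous_on UNIV g" "\<And>x. x \<noteq> a \<Longrightarrow> f x = g x"
  shows "f a = g a"
proof -
  have "f \<midarrow>a\<rightarrow> f a" "g \<midarrow>a\<rightarrow> g a"
    using assms(1,2) by (simp_all add: continuous_on_def)
  moreover from this(2) have "f \<midarrow>a\<rightarrow> g a"
    by (rule Lim_transform_eventually) (simp add: assms(3) eventually_at_filter)
  ultimately show ?thesis using LIM_unique by blast
qed

lemma mult_vec_sum: "A *v (\<Sum>a\<in>S. f a) = (\<Sum>a\<in>S. A *v f a)"
  for A :: "'k::scalar_rc^'n^'n"
  by (induction S rule: infinite_finite_induct) (simp_all add: matrix_vector_right_distrib)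

lemma scaleR_mult_vec: "(t *\<^sub>R A) *v w = t *\<^sub>R (A *v w)" "A *v (t *\<^sub>R w) = t *\<^sub>R (A *v w)"
  for A :: "'k::scalar_rc^'n^'n"
  by (simp_all add: vec_eq_iff matrix_vector_mult_def scaleR_sum_right)

lemma sdot_scaleR: "sdot (t *\<^sub>R u) v = of_real t * sdot u v" "sdot u (t *\<^sub>R v) = of_real t * sdot u v"
  by (simp_all add: sdot_def scaleR_sum_right flip: scaleR_conv_of_real)

lemma scaleR_vec: "t *\<^sub>R v = of_real t *s v" for v :: "'k::scalar_rc^'n"
  by (simp add: vec_eq_iff scaleR_conv_of_real[where 'a='k])

lemma sgn_prod: "sgn (prod f A) = (\<Prod>a\<in>A. sgn (f a :: real))"
  by (induction A rule: infinite_finite_induct) (simp_all add: sgn_mult)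

lemma sdot_diff: "sdot (u - u') v = sdot u v - sdot u' v"
  by (simp add: sdot_def sum_subtractf algebra_simps)

text \<open>Applying \<open>N\<close> to a linear relation and subtracting \<open>\<mu> b\<close>
  times the relation removes the vector \<open>v b\<close> and multiplies the other coefficients by
  nonzero factors.\<close>

lemma eigenvectors_independent:
  fixes N :: "'k::scalar_rc^'n^'n" and v :: "'n \<Rightarrow> 'k^'n"
  assumes "\<And>a. N *v v a = \<mu> a *s v a" "\<And>a. v a \<noteq> 0" "inj \<mu>"
  shows "det (\<chi> i a. v a $ i) \<noteq> 0"
proof
  have *: "\<forall>a\<in>S. w a = 0" if "finite S" "(\<Sum>a\<in>S. w a *s v a) = 0" for S w
    using that
  proof (induction S arbitrary: w)
    case (insert b S)
    have eq: "w b *s v b + (\<Sum>a\<in>S. w a *s v a) = 0" using insert by simp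
    then have "N *v (w b *s v b + (\<Sum>a\<in>S. w a *s v a)) = 0" by (simp only: matrix_vector_mult_0_right)
    then have "w b *s (\<mu> b *s v b) + (\<Sum>a\<in>S. w a *s (\<mu> a *s v a)) = 0"
      by (simp only: matrix_vector_right_distrib vector_scalar_commute mult_vec_sum assms(1))
    moreover have "\<mu> b *s (w b *s v b + (\<Sum>a\<in>S. w a *s v a)) = 0" using eq by simp
    moreover have "w b *s (\<mu> b *s v b) = \<mu> b *s (w b *s v b)"
      by (simp add: vector_smult_assoc mult.commute)
    moreover have "(\<Sum>a\<in>S. w a *s (\<mu> a *s v a)) - \<mu> b *s (\<Sum>a\<in>S. w a *s v a) =
        (w b *s (\<mu> b *s v b) + (\<Sum>a\<in>S. w a *s (\<mu> a *s v a))) -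
        (\<mu> b *s (w b *s v b) + \<mu> b *s (\<Sum>a\<in>S. w a *s v a))" if "w b *s (\<mu> b *s v b) = \<mu> b *s (w b *s v b)"
      using that by (simp only: add_diff_cancel_left)
    ultimately have "(\<Sum>a\<in>S. w a *s (\<mu> a *s v a)) - \<mu> b *s (\<Sum>a\<in>S. w a *s v a) = 0"
      by (simp only: vector_add_ldistrib diff_self)
    then have "(\<Sum>a\<in>S. (w a * (\<mu> a - \<mu> b)) *s v a) = 0"
      by (simp add: vec.scale_sum_right sum_subtractf[symmetric] vec.scale_left_diff_distrib algebra_simps)
    then have "\<forall>a\<in>S. w a * (\<mu> a - \<mu> b) = 0" by (rule insert.IH)
    moreover have "\<mu> a \<noteq> \<mu> b" if "a \<in> S" for a using that insert.hyps assms(3) by (metis injD)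
    ultimately have "\<forall>a\<in>S. w a = 0" by auto
    moreover from this have "w b *s v b = 0" using eq by simp
    ultimately show ?case using assms(2) by simp
  qed simp
  assume "det (\<chi> i a. v a $ i) = 0"
  then obtain w where w: "w \<noteq> 0" "(\<chi> i a. v a $ i) *v w = 0"
    unfolding det_eq_0_kernel by blast
  have "(\<chi> i a. v a $ i) *v w = (\<Sum>a\<in>UNIV. w $ a *s v a)"
    by (simp add: vec_eq_iff matrix_vector_mult_def mult.commute)
  then have "\<forall>a\<in>UNIV. w $ a = 0" using w(2) by (intro *) simp_all
  with w(1) show False by (simp add: vec_eq_iff)
qed

lemma ord_sets:
  assumes ord: "bij_betw ord (UNIV :: 'n::finite set) {..<CARD('n)}" and "i \<le> CARD('n)"
  shows "card {j::'n. ord j < i} = i" and "card {j::'n. i \<le> ord j} = CARD('n) - i"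
proof -
  have "card {j::'n. ord j < i} = card (ord ` {j. ord j < i})"
    using ord by (metis bij_betw_def card_image inj_on_subset subset_UNIV)
  also have "ord ` {j. ord j < i} = {..<i}"
  proof -
    have "k \<in> ord ` {j. ord j < i}" if "k < i" for k
    proof -
      have "k \<in> range ord" using ord that assms(2) by (simp add: bij_betw_def)
      then show ?thesis using that by auto
    qed
    then show ?thesis by auto
  qed
  finally show *: "card {j::'n. ord j < i} = i" by simp
  have "{j::'n. i \<le> ord j} = UNIV - {j. ord j < i}" by auto
  then show "card {j::'n. i \<le> ord j} = CARD('n) - i"
    by (simp add: card_Diff_subset *)
qed

text \<open>The signs of the pencil of \<open>GS\<close> and \<open>scaled x GU\<close> on both sides of the scale \<open>exp (2 * x a)\<close>
  force a real root of its determinant there. Hence there are as many real eigenvalues as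
  coordinates; comparing with the minors that omit \<open>a\<close> yields the sign of \<open>GS\<close> on the
  eigenvectors.\<close>

theorem simultaneous_diagonalization:
  fixes ord :: "'n::finite \<Rightarrow> nat" and c R :: real
  assumes ord: "bij_betw ord UNIV {..<CARD('n)}" and c: "c > 0" and R: "R \<ge> 0"
  obtains L where "L > 0" and "\<And>(GU :: 'k::scalar_rc^'n^'n) GS x.
    hermitian GU \<Longrightarrow> hermitian GS \<Longrightarrow> (\<And>i j. norm (GU $ i $ j) \<le> R) \<Longrightarrow> (\<And>i j. norm (GS $ i $ j) \<le> R) \<Longrightarrow>
    (\<And>i. i \<le> CARD('n) \<Longrightarrow> c \<le> \<bar>pminor {j. ord j < i} GU\<bar>) \<Longrightarrow>
    (\<And>i. i \<le> CARD('n) \<Longrightarrow> c \<le> \<bar>pminor {j. i \<le> ord j} GS\<bar>) \<Longrightarrow>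
    (\<And>i j. ord i < ord j \<Longrightarrow> x j + L < x i) \<Longrightarrow>
    \<exists>V \<mu> t. det V \<noteq> 0 \<and> mstar V ** GS ** V = rdiag t \<and>
      mstar V ** scaled x GU ** V = rdiag (\<lambda>a. \<mu> a * t a) \<and>
      (\<forall>a b. ord a < ord b \<longrightarrow> \<bar>\<mu> b\<bar> < \<bar>\<mu> a\<bar>) \<and>
      (\<forall>a. \<mu> a \<noteq> 0 \<and> t a \<noteq> 0 \<and>
        sgn (t a) = sgn (pminor {j. ord a \<le> ord j} GS) * sgn (pminor {j. ord a < ord j} GS))"
proof -
  let ?d = "CARD('n)"
  obtain \<theta> where \<theta>: "0 < \<theta>" and \<theta>1: "\<theta> \<le> 1" and sgn_minor: "\<forall>(GU :: 'k^'n^'n) GS I T x t.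
    hermitian GU \<longrightarrow> hermitian GS \<longrightarrow> (\<forall>i j. norm (GU $ i $ j) \<le> R) \<longrightarrow> (\<forall>i j. norm (GS $ i $ j) \<le> R) \<longrightarrow>
    I \<inter> T = {} \<longrightarrow> t \<noteq> 0 \<longrightarrow> (\<forall>j. j \<in> I \<longrightarrow> sqrt \<bar>t\<bar> \<le> \<theta> * exp (x j)) \<longrightarrow>
    (\<forall>k. k \<in> T \<longrightarrow> exp (x k) \<le> \<theta> * sqrt \<bar>t\<bar>) \<longrightarrow> \<bar>pminor I GU\<bar> \<ge> c \<longrightarrow> \<bar>pminor T GS\<bar> \<ge> c \<longrightarrow>
    sgn (pminor (I \<union> T) (pencil GS (scaled x GU) t)) =
      (-1) ^ card I * sgn t ^ card T * sgn (pminor I GU) * sgn (pminor T GS)"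
    using pencil_minor_sign[OF c R, where 'k='k and 'n='n] by (elim exE conjE)
  \<comment> \<open>A gap \<open>L\<close> between logarithms means a factor of at most
    \<open>\<theta>\<close> between exponentials; the \<open>1\<close> ensures positivity when
    \<open>\<theta> = 1\<close>.\<close>
  define L where "L = max 1 (- ln \<theta>)"
  have L: "L > 0" "exp (- L) \<le> \<theta>"
  proof -
    show "L > 0" by (simp add: L_def)
    have "exp (- L) \<le> exp (ln \<theta>)" by (simp add: L_def)
    with \<theta> show "exp (- L) \<le> \<theta>" by simp
  qed
  have inj: "inj ord" using ord by (rule bij_betw_imp_inj_on)
  have ex: "\<exists>a. ord a = i" if "i < ?d" for i
  proof -
    have "i \<in> range ord" unfolding bij_betw_imp_surj_on[OF ord] using that by simp
    then show ?thesis by (rule rangeE) blast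
  qed
  have ord_less: "ord a < ?d" for a using ord by (metis UNIV_I bij_betwE lessThan_iff)
  show ?thesis
  proof
    \<comment> \<open>Between two consecutive scales there must be a value at distance at least
      \<open>L\<close> from both, so the gap that is demanded is \<open>2 * L\<close>.\<close>
    show "2 * L > 0" using L by simp
    fix GU GS :: "'k^'n^'n" and x
    assume H: "hermitian GU" "hermitian GS"
      and bd: "\<And>i j. norm (GU $ i $ j) \<le> R" "\<And>i j. norm (GS $ i $ j) \<le> R"
      and cU: "\<And>i. i \<le> ?d \<Longrightarrow> c \<le> \<bar>pminor {j. ord j < i} GU\<bar>"
      and cS: "\<And>i. i \<le> ?d \<Longrightarrow> c \<le> \<bar>pminor {j. i \<le> ord j} GS\<bar>"
      and gap: "\<And>i j. ord i < ord j \<Longrightarrow> x j + 2 * L < x i"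
    define G2 where "G2 = scaled x GU"
    define F where "F = pencil GS G2"
    have HF: "hermitian (F t)" for t by (simp add: F_def G2_def hermitian_pencil hermitian_scaled H)
    define u where "u i = sgn (pminor {j. ord j < i} GU)" for i
    define s where "s i = sgn (pminor {j. i \<le> ord j} GS)" for i
    have us: "u i * u i = 1" "s i * s i = 1" if "i \<le> ?d" for i
      using cU[OF that] cS[OF that] c by (auto simp: u_def s_def sgn_if)
    \<comment> \<open>\<open>r\<close> is a threshold separating the first \<open>i\<close> scales
      from the remaining ones. Thresholds are indexed from \<open>0\<close> up to and including the
      dimension, so that each scale lies between two of them; the last one has no scale below it and
      is chosen separately.\<close>
    have "\<exists>r>0. (\<forall>j. ord j < i \<longrightarrow> r \<le> \<theta> * exp (x j)) \<and> (\<forall>k. i \<le> ord k \<longrightarrow> exp (x k) \<le> \<theta> * r)"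
      if "i \<le> ?d" for i
    proof -
      have "\<exists>y. (\<forall>j. ord j < i \<longrightarrow> y \<le> x j - L) \<and> (\<forall>k. i \<le> ord k \<longrightarrow> x k \<le> y - L)"
      proof (cases "i < ?d")
        case True
        then obtain a where a: "ord a = i" using ex by blast
        have "x k \<le> x a" if "i \<le> ord k" for k
          using gap[of a k] that a L inj by (cases "a = k") (auto simp: inj_def order_le_less)
        moreover have "x a + L \<le> x j - L" if "ord j < i" for j using gap[of j a] that a by simp
        ultimately show ?thesis by (intro exI[of _ "x a + L"]) auto
      next
        case False
        have "?d - 1 < ?d" by simp
        then obtain a where a: "ord a = ?d - 1" using ex by blast
        have "x a \<le> x j" for j
        proof (cases "j = a")
          case False
          then have "ord j < ord a" using ord_less[of j] a inj by (metis Suc_pred' injD less_Suc_eq zero_less_card_finite)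
          then show ?thesis using gap[of j a] L by simp
        qed simp
        moreover have "\<not> i \<le> ord k" for k using False ord_less[of k] by simp
        ultimately show ?thesis by (intro exI[of _ "x a - L"]) simp
      qed
      then obtain y where y: "\<And>j. ord j < i \<Longrightarrow> y \<le> x j - L" "\<And>k. i \<le> ord k \<Longrightarrow> x k \<le> y - L"
        by blast
      have shrink: "exp z \<le> \<theta> * exp z'" if "z \<le> z' - L" for z z'
      proof -
        have "exp z \<le> exp (- L) * exp z'" using that by (simp add: exp_add[symmetric])
        also have "\<dots> \<le> \<theta> * exp z'" using L by simp
        finally show ?thesis .
      qed
      show ?thesis by (intro exI[of _ "exp y"] conjI allI impI shrink y) auto
    qed
    then obtain \<rho> where \<rho>: "\<And>i. i \<le> ?d \<Longrightarrow> \<rho> i > 0"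
      "\<And>i j. i \<le> ?d \<Longrightarrow> ord j < i \<Longrightarrow> \<rho> i \<le> \<theta> * exp (x j)"
      "\<And>i k. i \<le> ?d \<Longrightarrow> i \<le> ord k \<Longrightarrow> exp (x k) \<le> \<theta> * \<rho> i"
      by metis
    \<comment> \<open>\<open>\<rho>\<close> is measured on the scale of \<open>exp (x i)\<close>,
      whereas the parameter of the pencil is measured on that of its square.\<close>
    define r where "r i = (\<rho> i)\<^sup>2" for i
    have r: "r i > 0" "sqrt (r i) = \<rho> i" if "i \<le> ?d" for i
      using \<rho>(1)[OF that] by (simp_all add: r_def)
    \<comment> \<open>\<open>i = i'\<close> gives the full determinant at a threshold;
      \<open>i' = Suc i\<close> gives the minor that omits the coordinate of rank \<open>i\<close>,
      for \<open>t\<close> between two consecutive thresholds.\<close>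
    have sign: "sgn (pminor ({j. ord j < i} \<union> {j. i' \<le> ord j}) (F t)) =
        (-1) ^ i * sgn t ^ (?d - i') * u i * s i'"
      if "i \<le> i'" "i' \<le> ?d" "t \<noteq> 0" "\<bar>t\<bar> \<le> r i" "r i' \<le> \<bar>t\<bar>" for i i' t
    proof -
      have "sqrt \<bar>t\<bar> \<le> \<rho> i" "\<rho> i' \<le> sqrt \<bar>t\<bar>"
        using that r[of i] r[of i'] by (metis le_trans real_sqrt_le_mono)+
      then have "sqrt \<bar>t\<bar> \<le> \<theta> * exp (x j)" if "ord j < i" for j
        using \<rho>(2)[of i j] that \<open>i \<le> i'\<close> \<open>i' \<le> ?d\<close> by linarith
      moreover have "exp (x k) \<le> \<theta> * sqrt \<bar>t\<bar>" if "i' \<le> ord k" for k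
        using \<rho>(3)[of i' k] that \<open>i' \<le> ?d\<close> \<open>\<rho> i' \<le> sqrt \<bar>t\<bar>\<close> \<theta> by (meson mult_le_cancel_left_pos order_trans)
      moreover have "{j. ord j < i} \<inter> {j. i' \<le> ord j} = {}" using that by auto
      ultimately show ?thesis
        using sgn_minor[rule_format, OF H bd, of "{j. ord j < i}" "{j. i' \<le> ord j}" t x] cU[of i] cS[of i'] that
        by (simp add: F_def G2_def u_def s_def ord_sets[OF ord])
    qed
    define p where "p t = rp (det (F t))" for t
    have UNIV_split: "{j. ord j < i} \<union> {j. i \<le> ord j} = UNIV" for i by auto
    have p_sign: "sgn (p (\<sigma> * r i)) = (-1) ^ i * \<sigma> ^ (?d - i) * u i * s i"
      if "\<bar>\<sigma>\<bar> = 1" "i \<le> ?d" for \<sigma> i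
    proof -
      have "sgn (pminor UNIV (F (\<sigma> * r i))) = (-1) ^ i * sgn (\<sigma> * r i) ^ (?d - i) * u i * s i"
        using sign[of i i "\<sigma> * r i"] that r[of i] unfolding UNIV_split by (auto simp: abs_mult)
      moreover have "sgn (\<sigma> * r i) = \<sigma>" using that r[of i] by (auto simp: sgn_mult sgn_if abs_if split: if_splits)
      ultimately show ?thesis by (simp add: p_def pminor_def)
    qed
    have "continuous_on S (\<lambda>t. F t $ i $ j)" for S i j
      unfolding F_def pencil_nth by (intro continuous_intros)
    then have cont_p: "continuous_on S p" for S
      unfolding p_def by (intro continuous_on_rp continuous_on_det)
    have r_mono: "r j \<le> r i" if "i \<le> j" "j \<le> ?d" for i j
    proof (cases "i = j")
      case False
      then have "i < ?d" using that by simp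
      then obtain a where a: "ord a = i" using ex by blast
      define y where "y = exp (x a)"
      have "0 < y" "\<rho> j \<le> \<theta> * y" "y \<le> \<theta> * \<rho> i"
        using \<rho>(2)[of j a] \<rho>(3)[of i a] that a False by (simp_all add: y_def)
      moreover from this have "\<theta> * y \<le> \<theta> * (\<theta> * \<rho> i)" using \<theta> by simp
      moreover have "\<theta> * (\<theta> * \<rho> i) \<le> \<rho> i"
        using mult_le_one[of \<theta> \<theta>] \<theta> \<theta>1 \<rho>(1)[of i] \<open>i < ?d\<close>
        by (simp add: mult_left_le_one_le mult.assoc[symmetric])
      ultimately have "\<rho> j \<le> \<rho> i" by linarith
      then show ?thesis using \<rho>(1)[OF that(2)] by (simp add: r_def power_mono)
    qed simp
    have root: "\<exists>m. r (Suc (ord a)) < \<bar>m\<bar> \<and> \<bar>m\<bar> < r (ord a) \<and> p m = 0" for a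
    proof -
      define i where "i = ord a"
      have i: "i < ?d" using ord_less by (simp add: i_def)
      \<comment> \<open>The half-line on which the determinant changes sign. The signs of
        \<open>p\<close> at its two thresholds multiply to an odd power of \<open>-1\<close>, times
        an odd power of \<open>\<sigma>\<close>, times the four signs whose product is
        \<open>\<sigma>\<close>: in all \<open>- \<sigma> * \<sigma> = -1\<close>.\<close>
      define \<sigma> where "\<sigma> = u i * s i * (u (Suc i) * s (Suc i))"
      have us1: "\<bar>u i\<bar> = 1" "\<bar>s i\<bar> = 1" "\<bar>u (Suc i)\<bar> = 1" "\<bar>s (Suc i)\<bar> = 1"
        using us[of i] us[of "Suc i"] i by (auto simp: abs_if square_eq_1_iff)
      then have \<sigma>: "\<bar>\<sigma>\<bar> = 1" by (simp add: \<sigma>_def abs_mult)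
      then have \<sigma>\<sigma>: "\<sigma> * \<sigma> = 1" by (auto simp: abs_if split: if_splits)
      have "?d - i = Suc (?d - Suc i)" using i by simp
      then have pw: "\<sigma> ^ (?d - i) * \<sigma> ^ (?d - Suc i) = \<sigma>"
        by (simp add: power_mult_distrib[symmetric] \<sigma>\<sigma> mult.assoc)
      have "sgn (p (\<sigma> * r (Suc i))) * sgn (p (\<sigma> * r i)) =
          ((-1) ^ Suc i * \<sigma> ^ (?d - Suc i) * u (Suc i) * s (Suc i)) * ((-1) ^ i * \<sigma> ^ (?d - i) * u i * s i)"
        using p_sign[OF \<sigma>, of i] p_sign[OF \<sigma>, of "Suc i"] i by simp
      also have "\<dots> = ((-1) ^ Suc i * (-1) ^ i) * (\<sigma> ^ (?d - i) * \<sigma> ^ (?d - Suc i)) * \<sigma>"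
        by (simp add: \<sigma>_def mult_ac)
      also have "\<dots> = -1"
        by (simp only: pw mult.assoc \<sigma>\<sigma>) (simp add: power_mult_distrib[symmetric])
      finally have "sgn (p (\<sigma> * r (Suc i))) * sgn (p (\<sigma> * r i)) = -1" .
      moreover have "r (Suc i) \<le> r i" using r_mono[of i "Suc i"] i by simp
      moreover have "continuous_on {r (Suc i)..r i} (\<lambda>t. p (\<sigma> * t))"
        by (rule continuous_on_compose2[OF cont_p[of UNIV]]) (intro continuous_intros, simp)
      ultimately obtain t where t: "r (Suc i) < t" "t < r i" "p (\<sigma> * t) = 0"
        using ivt_sgn[of "r (Suc i)" "r i" "\<lambda>t. p (\<sigma> * t)"] by blast
      moreover have "0 < t" using t(1) r(1)[of "Suc i"] i by simp
      ultimately show ?thesis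
        using \<sigma> by (intro exI[of _ "\<sigma> * t"]) (simp add: abs_mult i_def)
    qed
    then obtain \<mu> where \<mu>: "\<And>a. r (Suc (ord a)) < \<bar>\<mu> a\<bar>" "\<And>a. \<bar>\<mu> a\<bar> < r (ord a)" "\<And>a. p (\<mu> a) = 0"
      by metis
    have \<mu>_less: "\<bar>\<mu> b\<bar> < \<bar>\<mu> a\<bar>" if "ord a < ord b" for a b
      using \<mu>(1)[of a] \<mu>(2)[of b] r_mono[of "Suc (ord a)" "ord b"] that ord_less[of b] by simp
    have \<mu>0: "\<mu> a \<noteq> 0" for a using \<mu>(1)[of a] r(1)[of "Suc (ord a)"] ord_less[of a] by auto
    have inj_\<mu>: "inj \<mu>"
      using \<mu>_less inj by (metis injI injD linorder_neqE_nat order_less_irrefl)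
    have "det (F (\<mu> a)) = 0" for a
      using \<mu>(3)[of a] HF hermitian_det[of "F (\<mu> a)"] by (simp add: p_def)
    then obtain v where v: "\<And>a. v a \<noteq> 0" "\<And>a. F (\<mu> a) *v v a = 0"
      unfolding det_eq_0_kernel by metis
    have F_mult: "F t *v w = t *\<^sub>R (GS *v w) - G2 *v w" for t w
      by (simp add: F_def pencil_def matrix_vector_mult_diff_rdistrib scaleR_mult_vec)
    have G2v: "G2 *v v a = \<mu> a *\<^sub>R (GS *v v a)" for a
      using v(2)[of a] by (simp add: F_mult)
    define t where "t a = rp (sdot (GS *v v a) (v a))" for a
    define V where "V = (\<chi> i a. v a $ i)"
    have V: "V *v axis a 1 = v a" for a
      by (simp add: vec_eq_iff mult_axis_nth V_def)
    have sym: "sdot (A *v y) z = sdot y (A *v z)" if "hermitian A" for A :: "'k^'n^'n" and y z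
      using that by (simp add: sdot_mult_left hermitian_def)
    have HG2: "hermitian G2" by (simp add: G2_def hermitian_scaled H)
    \<comment> \<open>\<open>GS\<close> and \<open>G2\<close> are Hermitian and the
      \<open>\<mu>\<close> are real, so moving \<open>G2\<close> from one argument to the other
      exhibits the same value with the factors \<open>\<mu> a\<close> and
      \<open>\<mu> b\<close>.\<close>
    have orth: "sdot (GS *v v a) (v b) = 0" if "a \<noteq> b" for a b
    proof -
      have "of_real (\<mu> a) * sdot (GS *v v a) (v b) = sdot (G2 *v v a) (v b)"
        by (simp add: G2v sdot_scaleR)
      also have "\<dots> = of_real (\<mu> b) * sdot (GS *v v a) (v b)"
        by (subst sym[OF HG2]) (simp add: G2v sdot_scaleR sym[OF H(2)])
      finally have "(of_real (\<mu> a) - of_real (\<mu> b) :: 'k) * sdot (GS *v v a) (v b) = 0"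
        by (simp add: algebra_simps)
      then show ?thesis using inj_\<mu> that by (auto dest: injD)
    qed
    have self: "sdot (GS *v v a) (v a) = of_real (t a)" for a
    proof -
      have "scnj (sdot (GS *v v a) (v a)) = sdot (GS *v v a) (v a)"
        by (metis sdot_scnj sym[OF H(2)])
      then show ?thesis unfolding t_def by (rule scnj_fixed_real[symmetric])
    qed
    have sdot_v: "sdot (GS *v v a) (v b) = (if a = b then of_real (t a) else 0)" for a b
      by (simp add: self orth)
    have VS: "mstar V ** GS ** V = rdiag t"
      by (auto simp: vec_eq_iff conj_entry V sdot_v rdiag_def diagm_nth)
    have V2: "mstar V ** G2 ** V = rdiag (\<lambda>a. \<mu> a * t a)"
      by (auto simp: vec_eq_iff conj_entry V G2v sdot_scaleR sdot_v rdiag_def diagm_nth)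
    have VF: "mstar V ** F y ** V = rdiag (\<lambda>a. t a * (y - \<mu> a))" for y
      by (auto simp: vec_eq_iff conj_entry V F_mult G2v sdot_diff sdot_scaleR sdot_v rdiag_def diagm_nth algebra_simps)
    have detV: "det V \<noteq> 0"
    proof -
      \<comment> \<open>The final segment starting at rank \<open>0\<close> is everything, so the
        bounds on the minors include one on the determinant of \<open>GS\<close>.\<close>
      have "pminor UNIV GS \<noteq> 0" using cS[of 0] c by auto
      then have "det GS \<noteq> 0" by (auto simp: pminor_def)
      then obtain N where N: "N ** GS = mat 1"
        using invertible_det_nz[of GS] invertible_left_inverse[of GS] by blast
      have "(N ** G2) *v v a = of_real (\<mu> a) *s v a" for a
      proof -
        have "(N ** G2) *v v a = N *v (\<mu> a *\<^sub>R (GS *v v a))"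
          by (simp add: G2v flip: matrix_vector_mul_assoc)
        also have "\<dots> = \<mu> a *\<^sub>R v a"
          by (simp add: scaleR_mult_vec matrix_vector_mul_assoc N)
        finally show ?thesis by (simp add: scaleR_vec)
      qed
      moreover have "inj (\<lambda>a. of_real (\<mu> a) :: 'k)" using inj_\<mu> by (auto simp: inj_def)
      ultimately show ?thesis unfolding V_def using v(1) by (intro eigenvectors_independent[of "N ** G2" v])
    qed
    define \<kappa> where "\<kappa> = (norm (det V))\<^sup>2"
    have \<kappa>: "\<kappa> > 0" using detV by (simp add: \<kappa>_def)
    have p_prod: "\<kappa> * p y = (\<Prod>b\<in>UNIV. t b * (y - \<mu> b))" for y
      using arg_cong[OF VF[of y], of "\<lambda>A. rp (det A)"]
      by (simp only: det_conj det_rdiag rp_of_real_mult rp_of_real p_def \<kappa>_def)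
    \<comment> \<open>Otherwise \<open>p\<close> would vanish identically, against its known sign at
      the largest threshold \<open>r 0\<close>.\<close>
    have t0: "t a \<noteq> 0" for a
    proof
      assume "t a = 0"
      then have "\<kappa> * p (1 * r 0) = 0" unfolding p_prod by (intro prod_zero) auto
      then have "sgn (p (1 * r 0)) = 0" using \<kappa> by simp
      moreover have "sgn (p (1 * r 0)) = u 0 * s 0" by (subst p_sign) simp_all
      ultimately show False using us[of 0] by auto
    qed
    have "sgn (t a) = s (ord a) * s (Suc (ord a))" for a
    proof -
      define i where "i = ord a"
      have i: "i < ?d" using ord_less by (simp add: i_def)
      define \<sigma> where "\<sigma> = sgn (\<mu> a)"
      have \<sigma>: "\<bar>\<sigma>\<bar> = 1" "\<sigma> * \<sigma> = 1" using \<mu>0[of a] by (simp_all add: \<sigma>_def sgn_if)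
      \<comment> \<open>Comparing the full determinant at the outer threshold
        \<open>\<sigma> * r i\<close> with the minor omitting \<open>a\<close>, taken at the root
        \<open>\<mu> a\<close> itself, isolates the sign of \<open>t a\<close>.\<close>
      define q where "q = pminor (- {a}) (F (\<mu> a))"
      have ord_eq: "ord j = i \<longleftrightarrow> j = a" for j using injD[OF inj, of j a] by (auto simp: i_def)
      have "(ord j < i \<or> Suc i \<le> ord j) \<longleftrightarrow> j \<noteq> a" for j using ord_eq[of j] by linarith
      then have "{j. ord j < i} \<union> {j. Suc i \<le> ord j} = - {a}" by auto
      then have q: "sgn q = (-1) ^ i * \<sigma> ^ (?d - Suc i) * u i * s (Suc i)"
        using sign[of i "Suc i" "\<mu> a"] i \<mu>0[of a] \<mu>(1,2)[of a] by (simp add: q_def \<sigma>_def i_def)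
      \<comment> \<open>The identity with column \<open>a\<close> replaced by the eigenvector
        \<open>v a\<close>. After congruence by it, row \<open>a\<close> of the pencil is divisible
        by \<open>y - \<mu> a\<close>, and \<open>Z\<close> below is what remains after the
        division.\<close>
      define Q where "Q = transpose (\<chi> i j. if i = a then v a $ j else if i = j then 1 else 0)"
      have detQ: "det Q = v a $ a" by (simp add: Q_def det_row_axis)
      have Qa: "Q *v axis j 1 = (if j = a then v a else axis j 1)" for j
        by (cases "j = a"; simp add: vec_eq_iff mult_axis_nth; simp add: Q_def transpose_def axis_def)
      define Z where "Z y = (\<chi> i j. if i = a then sdot (Q *v axis j 1) (GS *v v a)
          else (mstar Q ** F y ** Q) $ i $ j)" for y
      have F_v: "F y *v v a = (y - \<mu> a) *\<^sub>R (GS *v v a)" for y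
        by (simp add: F_mult G2v scaleR_left_diff_distrib)
      have Z: "mstar Q ** F y ** Q = diagm (\<lambda>i. if i = a then of_real (y - \<mu> a) else 1) ** Z y" for y
      proof -
        have "(mstar Q ** F y ** Q) $ a $ j = of_real (y - \<mu> a) * sdot (Q *v axis j 1) (GS *v v a)" for j
          by (simp only: conj_entry sym[OF HF]) (simp add: Qa[of a] F_v sdot_scaleR)
        then show ?thesis by (simp add: vec_eq_iff diagm_mult_left_nth Z_def)
      qed
      have detZ: "(norm (v a $ a))\<^sup>2 * p y = (y - \<mu> a) * rp (det (Z y))" for y
      proof -
        have "det (diagm (\<lambda>i. if i = a then of_real (y - \<mu> a) else 1) :: 'k^'n^'n) = of_real (y - \<mu> a)"
          by (simp add: det_diagm prod.If_cases)
        then show ?thesis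
          using arg_cong[OF Z[of y], of "\<lambda>A. rp (det A)"]
          by (simp only: det_conj detQ det_mul[of "diagm _"] rp_of_real_mult p_def)
      qed
      \<comment> \<open>The factorization \<open>p_prod\<close>, multiplied by the squared modulus
        of \<open>det Q\<close> and divided by the same factor \<open>y - \<mu> a\<close>. Up to
        \<open>\<kappa>\<close> it agrees with \<open>det (Z y)\<close> off the root, hence also at
        the root.\<close>
      define w where "w y = (norm (v a $ a))\<^sup>2 * (t a * (\<Prod>b\<in>- {a}. t b * (y - \<mu> b)))" for y
      have split: "(\<Prod>b\<in>UNIV. g b) = g a * (\<Prod>b\<in>- {a}. g b)" for g :: "'n \<Rightarrow> real"
        by (simp add: prod.remove[of UNIV a] Compl_eq_Diff_UNIV)
      have weq: "w y = \<kappa> * rp (det (Z y))" if "y \<noteq> \<mu> a" for y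
      proof -
        have "(y - \<mu> a) * w y = (norm (v a $ a))\<^sup>2 * (\<kappa> * p y)"
          unfolding p_prod split by (simp add: w_def mult_ac)
        also have "\<dots> = \<kappa> * ((y - \<mu> a) * rp (det (Z y)))"
          by (simp only: detZ[symmetric] mult_ac)
        finally show ?thesis using that by simp
      qed
      have cw: "continuous_on UNIV w"
        unfolding w_def by (intro continuous_intros)
      have cz: "continuous_on UNIV (\<lambda>y. \<kappa> * rp (det (Z y)))"
      proof (intro continuous_on_mult_left continuous_on_rp continuous_on_det)
        fix i j
        have "continuous_on UNIV (\<lambda>y. (mstar Q ** F y ** Q) $ i $ j)"
          unfolding conj_entry F_mult sdot_diff sdot_scaleR by (intro continuous_intros)
        then show "continuous_on UNIV (\<lambda>y. Z y $ i $ j)" by (cases "i = a") (simp_all add: Z_def)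
      qed
      have "w (\<mu> a) = \<kappa> * rp (det (Z (\<mu> a)))"
        using cw cz weq by (rule eq_at_if_eq_near)
      also have "det (Z (\<mu> a)) = of_real (t a) * det (sub_matrix (- {a}) (F (\<mu> a)))"
      proof -
        \<comment> \<open>At the root, column \<open>a\<close> vanishes off the diagonal too, since
          \<open>F (\<mu> a)\<close> annihilates \<open>v a\<close>; the diagonal entry is the form
          value \<open>t a\<close>.\<close>
        have "Z (\<mu> a) = (\<chi> i j. if j = a then (if i = a then of_real (t a) else 0) else Z (\<mu> a) $ i $ j)"
          using sym[OF H(2), of "v a" "v a"]
          by (auto simp: vec_eq_iff Z_def Qa[of a] self conj_entry F_v)
        also have "det \<dots> = of_real (t a) * det (sub_matrix (- {a}) (Z (\<mu> a)))" by (rule det_col_axis)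
        also have "sub_matrix (- {a}) (Z (\<mu> a)) = sub_matrix (- {a}) (F (\<mu> a))"
          by (auto simp: vec_eq_iff sub_matrix_nth Z_def conj_entry Qa sdot_axis_right mult_axis_nth)
        finally show ?thesis .
      qed
      finally have "w (\<mu> a) = \<kappa> * (t a * q)"
        by (simp only: rp_of_real_mult q_def pminor_def)
      then have qw: "(norm (v a $ a))\<^sup>2 * (\<Prod>b\<in>- {a}. t b * (\<mu> a - \<mu> b)) = \<kappa> * q"
        using t0[of a] by (simp add: w_def)
      then have "\<kappa> * q = (norm (v a $ a))\<^sup>2 * (\<Prod>b\<in>- {a}. t b * (\<mu> a - \<mu> b))" ..
      moreover have "q \<noteq> 0" using q us[of i] us[of "Suc i"] i \<sigma>(1) by auto
      moreover note \<kappa>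
      ultimately have "0 < (norm (v a $ a))\<^sup>2" by auto
      from sgn_pos[OF this] have sgn_q: "sgn q = (\<Prod>b\<in>- {a}. sgn (t b) * sgn (\<mu> a - \<mu> b))"
        using arg_cong[OF qw, of sgn] sgn_pos[OF \<kappa>]
        by (simp only: sgn_mult sgn_prod mult_1_left)
      \<comment> \<open>No other root lies between \<open>\<mu> a\<close> and
        \<open>\<sigma> * r i\<close>: roots of lower rank exceed \<open>r i\<close> in modulus, and
        roots of higher rank have smaller modulus than \<open>\<mu> a\<close>.\<close>
      have "sgn (\<sigma> * r i - \<mu> b) = sgn (\<mu> a - \<mu> b)" if "b \<noteq> a" for b
      proof (cases "ord b < i")
        case True
        then have "r i < \<bar>\<mu> b\<bar>" using \<mu>(1)[of b] r_mono[of "Suc (ord b)" i] i by simp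
        moreover have "\<bar>\<mu> a\<bar> < r i" using \<mu>(2)[of a] by (simp add: i_def)
        moreover have "\<sigma> = 1 \<or> \<sigma> = -1" using \<sigma>(1) by linarith
        ultimately show ?thesis by (auto simp: sgn_if)
      next
        case False
        then have "ord a < ord b" using that inj by (metis i_def injD linorder_neqE_nat)
        then have "\<bar>\<mu> b\<bar> < \<bar>\<mu> a\<bar>" by (rule \<mu>_less)
        moreover have "\<bar>\<mu> a\<bar> < r i" using \<mu>(2)[of a] by (simp add: i_def)
        ultimately show ?thesis unfolding \<sigma>_def by (auto simp: sgn_if)
      qed
      then have "sgn (p (\<sigma> * r i)) = sgn (t a) * sgn (\<sigma> * r i - \<mu> a) * sgn q"
        using arg_cong[OF p_prod[of "\<sigma> * r i"], of sgn] sgn_pos[OF \<kappa>]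
        by (simp add: split sgn_mult sgn_prod sgn_q)
      moreover have "sgn (\<sigma> * r i - \<mu> a) = \<sigma>"
        using \<mu>(2)[of a] unfolding \<sigma>_def i_def by (auto simp: sgn_if)
      ultimately have "sgn (p (\<sigma> * r i)) = sgn (t a) * \<sigma> * sgn q" by simp
      \<comment> \<open>Two evaluations of one sign; everything cancels except \<open>s i\<close>,
        \<open>s (Suc i)\<close> and \<open>sgn (t a)\<close>.\<close>
      then have "(-1) ^ i * \<sigma> ^ (?d - i) * u i * s i =
          sgn (t a) * \<sigma> * ((-1) ^ i * \<sigma> ^ (?d - Suc i) * u i * s (Suc i))"
        using p_sign[OF \<sigma>(1), of i] i by (simp add: q)
      moreover have "?d - i = Suc (?d - Suc i)" using i by simp
      moreover have "\<sigma> \<noteq> 0" "u i \<noteq> 0" using \<sigma> us[of i] i by auto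
      ultimately have "s i = sgn (t a) * s (Suc i)" by simp
      then show ?thesis using us(2)[of "Suc i"] i by (simp add: i_def mult.assoc)
    qed
    then have "sgn (t a) = sgn (pminor {j. ord a \<le> ord j} GS) * sgn (pminor {j. ord a < ord j} GS)" for a
      by (simp add: s_def Suc_le_eq)
    then show "\<exists>V \<mu> t. det V \<noteq> 0 \<and> mstar V ** GS ** V = rdiag t \<and>
      mstar V ** scaled x GU ** V = rdiag (\<lambda>a. \<mu> a * t a) \<and>
      (\<forall>a b. ord a < ord b \<longrightarrow> \<bar>\<mu> b\<bar> < \<bar>\<mu> a\<bar>) \<and>
      (\<forall>a. \<mu> a \<noteq> 0 \<and> t a \<noteq> 0 \<and>
        sgn (t a) = sgn (pminor {j. ord a \<le> ord j} GS) * sgn (pminor {j. ord a < ord j} GS))"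
      using detV VS V2 \<mu>_less \<mu>0 t0 unfolding G2_def by blast
  qed
qed

section \<open>Unitary matrices and singular values\<close>

definition unitary :: "'k::scalar_rc ^ 'n ^ 'n \<Rightarrow> bool" where
  "unitary U \<longleftrightarrow> mstar U ** U = mat 1"

lemma unitary_right: "unitary U \<Longrightarrow> U ** mstar U = mat 1"
  unfolding unitary_def matrix_left_right_inverse[of "mstar U" U] .

lemma unitary_mult: "unitary U \<Longrightarrow> unitary V \<Longrightarrow> unitary (U ** V)"
proof -
  assume "unitary U" "unitary V"
  moreover have "mstar (U ** V) ** (U ** V) = mstar V ** (mstar U ** U) ** V"
    by (simp only: mstar_mult matrix_mul_assoc)
  ultimately show ?thesis by (simp add: unitary_def)
qed

lemma unitary_mstar: "unitary U \<Longrightarrow> unitary (mstar U)"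
  by (simp add: unitary_right unitary_def[of "mstar U"])

lemma unitary_1 [simp]: "unitary (mat 1)"
  by (simp add: unitary_def)

lemma unitary_det: "unitary U \<Longrightarrow> norm (det U) = 1"
proof -
  assume "unitary U"
  then have "det (mstar U) * det U = 1" by (metis det_I det_mul unitary_def)
  then have "of_real ((norm (det U))\<^sup>2) = (1::'a)"
    by (simp only: det_mstar mult_scnj'[symmetric] mult.commute)
  then have "(norm (det U))\<^sup>2 = 1" using of_real_eq_1_iff by blast
  then show ?thesis using norm_ge_zero[of "det U"] by (simp add: power2_eq_1_iff)
qed

lemma norm_unitary: "unitary U \<Longrightarrow> norm (U *v u) = norm u"
proof -
  assume "unitary U"
  then have "sdot (U *v u) (U *v u) = sdot u u"
    by (simp add: sdot_mult_left matrix_vector_mul_assoc unitary_def)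
  then have "(norm (U *v u))\<^sup>2 = (norm u)\<^sup>2" unfolding sdot_self of_real_eq_iff .
  then show ?thesis by simp
qed

lemma unitary_diagm: "unitary (diagm x) \<longleftrightarrow> (\<forall>i. norm (x i) = 1)"
proof -
  have "unitary (diagm x) \<longleftrightarrow> (\<forall>i. scnj (x i) * x i = 1)"
    by (auto simp: unitary_def mstar_diagm diagm_mult vec_eq_iff diagm_nth mat_def)
  also have "\<dots> \<longleftrightarrow> (\<forall>i. norm (x i) = 1)"
    by (simp add: mult.commute[of "scnj _"] mult_scnj' power2_eq_1_iff flip: of_real_power)
       (metis abs_norm_cancel norm_of_real of_real_1 of_real_eq_1_iff power2_eq_1_iff power_one
          one_neq_neg_one norm_ge_zero neg_0_le_iff_le not_one_le_zero)
  finally show ?thesis .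
qed

lemma sdot_diff_right: "sdot u (v - v') = sdot u v - sdot u v'"
  by (simp add: sdot_def sum_subtractf algebra_simps)

text \<open>Dimension count: vectors supported on ranks up to that of \<open>i\<close> form a space
  whose dimension exceeds by one the number of conditions on \<open>C *v u\<close>. All conditions
  are collected in a square matrix whose row \<open>i\<close> stays zero, so it is singular.\<close>

lemma exists_common_zero:
  fixes C :: "'k::scalar_rc^'n^'n" and ord :: "'n \<Rightarrow> nat"
  assumes "inj ord"
  shows "\<exists>u. u \<noteq> 0 \<and> (\<forall>j. ord i < ord j \<longrightarrow> u $ j = 0) \<and> (\<forall>j. ord j < ord i \<longrightarrow> (C *v u) $ j = 0)"
proof -
  define D where "D = (\<chi> j. if ord j < ord i then C $ j else if ord i < ord j then axis j 1 else 0)"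
  have "row i D = 0" by (simp add: row_def D_def vec_eq_iff)
  then have "det D = 0" by (rule det_zero_row)
  then obtain u where u: "u \<noteq> 0" "D *v u = 0" unfolding det_eq_0_kernel by blast
  have "(D *v u) $ j = u $ j" if "ord i < ord j" for j
    using that by (simp add: D_def matrix_vector_mult_def axis_def if_distrib[of "\<lambda>z. z * _"] cong: if_cong)
  moreover have "(D *v u) $ j = (C *v u) $ j" if "ord j < ord i" for j
    using that by (simp add: D_def matrix_vector_mult_def)
  ultimately show ?thesis using u by (intro exI[of _ u]) auto
qed

text \<open>A maximum of the Rayleigh quotient on the unit sphere of the invariant subspace
  \<open>W\<close> is an eigenvector: were the residue \<open>z\<close> nonzero, moving slightly
  from \<open>v\<close> towards \<open>z\<close> would increase the quotient.\<close>

lemma exists_eigenvector_in: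
  fixes G :: "'k::scalar_rc^'n^'n"
  assumes G: "hermitian G" and W: "closed W" "\<And>u v. u \<in> W \<Longrightarrow> v \<in> W \<Longrightarrow> u + v \<in> W"
    "\<And>t u. u \<in> W \<Longrightarrow> t *\<^sub>R u \<in> W" "\<And>u. u \<in> W \<Longrightarrow> G *v u \<in> W" and ne: "w0 \<in> W" "w0 \<noteq> 0"
  obtains v l where "v \<in> W" "norm v = 1" "G *v v = l *\<^sub>R v"
    "\<forall>w\<in>W. rp (sdot (G *v w) w) \<le> l * (norm w)\<^sup>2"
proof -
  define \<phi> where "\<phi> w = rp (sdot (G *v w) w)" for w
  let ?K = "W \<inter> sphere 0 1"
  have "continuous_on ?K \<phi>"
    unfolding \<phi>_def sdot_def matrix_vector_mult_def by (simp, intro continuous_intros)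
  moreover have "compact ?K" using W(1) by (simp add: closed_Int_compact)
  moreover have "(1 / norm w0) *\<^sub>R w0 \<in> ?K" using ne W(3) by simp
  ultimately obtain v where v: "v \<in> ?K" "\<And>w. w \<in> ?K \<Longrightarrow> \<phi> w \<le> \<phi> v"
    using continuous_attains_sup[of ?K \<phi>] by blast
  define l where "l = \<phi> v"
  have \<phi>_scale: "\<phi> (t *\<^sub>R w) = t\<^sup>2 * \<phi> w" for t w
    by (simp add: \<phi>_def scaleR_mult_vec sdot_scaleR rp_of_real_mult power2_eq_square)
  have le: "\<phi> w \<le> l * (norm w)\<^sup>2" if "w \<in> W" for w
  proof (cases "w = 0")
    case False
    then have "\<phi> ((1 / norm w) *\<^sub>R w) \<le> l" unfolding l_def using that W(3) by (intro v(2)) simp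
    then show ?thesis using False by (simp add: \<phi>_scale field_simps)
  qed (simp add: \<phi>_def)
  define z where "z = G *v v - l *\<^sub>R v"
  define H where "H w = G *v w - l *\<^sub>R w" for w
  have "z = G *v v + (- l) *\<^sub>R v" by (simp add: z_def)
  then have zW: "z \<in> W" using v(1) by (metis IntD1 W(2,3,4))
  have H_le: "rp (sdot (H w) w) \<le> 0" if "w \<in> W" for w
    using le[OF that] by (simp add: H_def sdot_diff sdot_scaleR sdot_self rp_def \<phi>_def inner_diff_left
        flip: of_real_mult of_real_power)
  have Hsym: "sdot (H y) w = sdot y (H w)" for y w
    using G by (simp add: H_def sdot_diff sdot_diff_right sdot_scaleR sdot_mult_left hermitian_def)
  have "norm v = 1" using v(1) by simp
  then have zv: "rp (sdot z v) = 0"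
    by (simp add: z_def sdot_diff sdot_scaleR sdot_self rp_def inner_diff_left) (simp flip: rp_def add: l_def \<phi>_def)
  have "z = 0"
  proof (rule ccontr)
    assume "z \<noteq> 0"
    define m where "m = (norm z)\<^sup>2"
    define c where "c = rp (sdot (H z) z)"
    \<comment> \<open>The first order gain is \<open>2 * s * m\<close> and the second order term is
      \<open>s * s * c\<close>; this step size keeps the latter at most half as large as the
      former.\<close>
    define s where "s = m / (\<bar>c\<bar> + 1)"
    have m: "m > 0" using \<open>z \<noteq> 0\<close> by (simp add: m_def)
    then have s: "s > 0" by (simp add: s_def)
    have Hlin: "H (v + s *\<^sub>R z) = z + s *\<^sub>R H z"
      by (simp add: H_def z_def matrix_vector_right_distrib scaleR_mult_vec algebra_simps)
    have "sdot (H (v + s *\<^sub>R z)) (v + s *\<^sub>R z) =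
        sdot z v + of_real s * sdot z z + of_real s * sdot z (H v) + of_real s * (of_real s * sdot (H z) z)"
      unfolding Hlin by (simp add: sdot_add_left sdot_add_right sdot_scaleR Hsym[of z v] algebra_simps)
    also have "H v = z" by (simp add: H_def z_def)
    finally have "rp (sdot (H (v + s *\<^sub>R z)) (v + s *\<^sub>R z)) = s * m + s * m + s * (s * c)"
      by (simp only: rp_add rp_of_real_mult zv sdot_self rp_of_real m_def c_def)
    moreover have "v + s *\<^sub>R z \<in> W" using v(1) zW W(2,3) by auto
    ultimately have "s * (m + m + s * c) \<le> 0" using H_le[of "v + s *\<^sub>R z"] by (simp add: algebra_simps)
    then have "m + m + s * c \<le> 0" using s by (simp add: mult_le_0_iff)
    moreover have "\<bar>s * c\<bar> \<le> m"
    proof -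
      have "\<bar>s * c\<bar> = s * \<bar>c\<bar>" using s by (simp add: abs_mult)
      also have "\<dots> \<le> s * (\<bar>c\<bar> + 1)" using s by simp
      also have "\<dots> = m" by (simp add: s_def)
      finally show ?thesis .
    qed
    ultimately show False using m by linarith
  qed
  then show ?thesis using that[of v l] v(1) le by (simp add: z_def \<phi>_def)
qed

section \<open>Ordered diagonalization and singular values\<close>

definition decr :: "('n \<Rightarrow> nat) \<Rightarrow> ('n \<Rightarrow> real) \<Rightarrow> bool" where
  "decr ord x \<longleftrightarrow> (\<forall>i j. ord i < ord j \<longrightarrow> x j \<le> x i)"

theorem hermitian_diagonalization:
  fixes G :: "'k::scalar_rc^'n^'n" and ord :: "'n \<Rightarrow> nat"
  assumes G: "hermitian G" and ord: "bij_betw ord UNIV {..<CARD('n)}"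
  obtains U y where "unitary U" "mstar U ** G ** U = rdiag y" "decr ord y"
proof -
  \<comment> \<open>The last clause bounds the quotient on the orthogonal complement by every
    eigenvalue found so far; it is what keeps the next eigenvalue below the previous ones.\<close>
  have "\<exists>f l. (\<forall>i<k. \<forall>j<k. sdot (f i) (f j) = (if i = j then 1 else 0)) \<and>
      (\<forall>i<k. G *v f i = l i *\<^sub>R f i) \<and> (\<forall>i j. i < j \<longrightarrow> j < k \<longrightarrow> l j \<le> l i) \<and>
      (\<forall>w. (\<forall>i<k. sdot w (f i) = 0) \<longrightarrow> (\<forall>i<k. rp (sdot (G *v w) w) \<le> l i * (norm w)\<^sup>2))"
    (is "\<exists>f l. ?P k f l") if "k \<le> CARD('n)" for k
    using that
  proof (induction k)
    case (Suc k)
    then obtain f l where fl: "?P k f l" by auto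
    have k: "k < CARD('n)" using Suc.prems by simp
    define W where "W = {w. \<forall>i<k. sdot w (f i) = 0}"
    obtain a where a: "ord a = k"
    proof -
      have "k \<in> range ord" using k unfolding bij_betw_imp_surj_on[OF ord] by simp
      then show ?thesis using that by (rule rangeE) blast
    qed
    \<comment> \<open>A nonzero vector orthogonal to the \<open>k\<close> vectors found so far:
      their conjugates are placed as the rows of rank below \<open>k\<close>, and
      \<open>exists_common_zero\<close> is applied at rank \<open>k\<close>.\<close>
    obtain w0 where w0: "w0 \<in> W" "w0 \<noteq> 0"
    proof -
      obtain u where u: "u \<noteq> 0" "\<And>j. ord j < ord a \<Longrightarrow> ((\<chi> b i. scnj (f (ord b) $ i)) *v u) $ j = 0"
        using exists_common_zero[OF bij_betw_imp_inj_on[OF ord], of a "\<chi> b i. scnj (f (ord b) $ i)"] by blast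
      have "sdot u (f i) = 0" if "i < k" for i
      proof -
        have "i \<in> range ord" using k that unfolding bij_betw_imp_surj_on[OF ord] by simp
        then obtain b where "i = ord b" by (rule rangeE)
        then show ?thesis using u(2)[of b] that a by (simp add: matrix_vector_mult_def sdot_def mult.commute)
      qed
      then show ?thesis using that[of u] u(1) by (simp add: W_def)
    qed
    have "closed W"
    proof -
      have "closed {w. sdot w (f i) = 0}" for i
        unfolding sdot_def by (intro closed_Collect_eq continuous_intros)
      moreover have "W = (\<Inter>i\<in>{..<k}. {w. sdot w (f i) = 0})" by (auto simp: W_def)
      ultimately show ?thesis by (simp add: closed_INT)
    qed
    moreover have "u + v \<in> W" "t *\<^sub>R u \<in> W" if "u \<in> W" "v \<in> W" for u v t
      using that by (simp_all add: W_def sdot_add_left sdot_scaleR)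
    moreover have "G *v w \<in> W" if "w \<in> W" for w
      using that fl G by (simp add: W_def sdot_mult_left hermitian_def sdot_scaleR)
    ultimately obtain v m where v: "v \<in> W" "norm v = 1" "G *v v = m *\<^sub>R v"
      and vmax: "\<forall>w\<in>W. rp (sdot (G *v w) w) \<le> m * (norm w)\<^sup>2"
      using w0 by (elim exists_eigenvector_in[OF G]; blast)
    note v = v bspec[OF vmax]
    have vf: "sdot v (f i) = 0" "sdot (f i) v = 0" if "i < k" for i
      using v(1) that sdot_scnj[of "f i" v] by (simp_all add: W_def)
    have vv: "sdot v v = 1" by (simp add: sdot_self v(2))
    have ml: "m \<le> l i" if "i < k" for i
    proof -
      have "rp (sdot (G *v v) v) \<le> l i * (norm v)\<^sup>2" using fl that v(1) by (simp add: W_def)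
      then show ?thesis by (simp add: v(2,3) sdot_scaleR vv)
    qed
    have "?P (Suc k) (f(k := v)) (l(k := m))"
    proof (intro conjI allI impI)
      fix i j assume "i < Suc k" "j < Suc k"
      then show "sdot ((f(k := v)) i) ((f(k := v)) j) = (if i = j then 1 else 0)"
        using fl vf vv by (auto simp: less_Suc_eq)
    next
      fix i assume "i < Suc k"
      then show "G *v (f(k := v)) i = (l(k := m)) i *\<^sub>R (f(k := v)) i"
        using fl v(3) by (auto simp: less_Suc_eq)
    next
      fix i j assume "i < j" "j < Suc k"
      then show "(l(k := m)) j \<le> (l(k := m)) i" using fl ml by (auto simp: less_Suc_eq)
    next
      fix w i assume w: "\<forall>i<Suc k. sdot w ((f(k := v)) i) = 0" and i: "i < Suc k"
      have "sdot w (f j) = 0" if "j < k" for j using w[rule_format, of j] that by simp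
      then have wW: "w \<in> W" by (simp add: W_def)
      show "rp (sdot (G *v w) w) \<le> (l(k := m)) i * (norm w)\<^sup>2"
      proof (cases "i = k")
        case False
        then show ?thesis using fl wW i by (simp add: W_def)
      qed (use v(4)[OF wW] in simp)
    qed
    then show ?case by (intro exI)
  qed (intro exI[of _ "\<lambda>_. 0"], simp)
  from this[OF order_refl] obtain f l where FL: "?P (CARD('n)) f l" by (elim exE)
  note fl = FL[THEN conjunct1, rule_format] FL[THEN conjunct2, THEN conjunct1, rule_format]
    FL[THEN conjunct2, THEN conjunct2, THEN conjunct1, rule_format]
  have ordl: "ord a < CARD('n)" for a using bij_betw_apply[OF ord, of a] by simp
  have ordeq: "ord a = ord b \<longleftrightarrow> a = b" for a b using bij_betw_imp_inj_on[OF ord] by (simp add: inj_eq)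
  define U where "U = (\<chi> i a. f (ord a) $ i)"
  have U: "U *v axis a 1 = f (ord a)" for a by (simp add: vec_eq_iff mult_axis_nth U_def)
  have "(mstar U ** mat 1 ** U) $ a $ b = mat 1 $ a $ b" for a b
    unfolding conj_entry by (simp add: U fl(1)[OF ordl ordl] ordeq) (simp add: mat_def)
  then have "unitary U" by (simp add: unitary_def vec_eq_iff)
  moreover have "mstar U ** G ** U = rdiag (\<lambda>a. l (ord a))"
    by (auto simp: vec_eq_iff conj_entry U rdiag_def diagm_nth fl(1)[OF ordl ordl] fl(2)[OF ordl] sdot_scaleR ordeq)
  moreover have "decr ord (\<lambda>a. l (ord a))" using fl(3) ordl by (simp add: decr_def)
  ultimately show ?thesis by (rule that)
qed

theorem singular_value_decomposition:
  fixes A :: "'k::scalar_rc^'n^'n" and ord :: "'n \<Rightarrow> nat"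
  assumes A: "det A = 1" and ord: "bij_betw ord UNIV {..<CARD('n)}"
  obtains K L x where "unitary K" "unitary L" "det K = 1" "det L = 1" "decr ord x" "sum x UNIV = 0"
    "A = K ** rdiag (\<lambda>i. exp (x i)) ** L"
proof -
  have HG: "hermitian (mstar A ** A)" by (simp add: hermitian_def mstar_mult)
  obtain U y where U: "unitary U" "mstar U ** (mstar A ** A) ** U = rdiag y" "decr ord y"
    using hermitian_diagonalization[OF HG ord] by blast
  fix a0 :: 'n
  \<comment> \<open>One column is multiplied by a phase to give \<open>U'\<close> determinant one,
    so that the unitary factors represent elements of the group.\<close>
  define ph where "ph i = (if i = a0 then scnj (det U) else 1 :: 'k)" for i
  have nph: "norm (ph i) = 1" for i using unitary_det[OF U(1)] by (simp add: ph_def)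
  define U' where "U' = U ** diagm ph"
  have U': "unitary U'" unfolding U'_def using U(1) nph by (intro unitary_mult) (simp_all add: unitary_diagm)
  have "(\<Prod>i\<in>UNIV. ph i) = scnj (det U)" by (simp add: ph_def)
  then have detU': "det U' = 1"
    using unitary_det[OF U(1)] by (simp add: U'_def det_mul det_diagm mult_scnj')
  have phph: "scnj (ph i) * (of_real r * ph i) = of_real r" for i r
    using mult_scnj'[of "ph i"] nph[of i] by (simp add: mult_ac)
  have "mstar U' ** (mstar A ** A) ** U' = mstar (diagm ph) ** (mstar U ** (mstar A ** A) ** U) ** diagm ph"
    by (simp add: U'_def mstar_mult matrix_mul_assoc)
  also have "\<dots> = rdiag y"
    unfolding U(2) by (simp add: rdiag_def mstar_diagm diagm_mult mult.assoc phph)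
  finally have UG: "mstar U' ** (mstar A ** A) ** U' = rdiag y" .
  have y: "y a > 0" for a
  proof -
    have "of_real (y a) = (mstar U' ** (mstar A ** A) ** U') $ a $ a" by (simp add: UG rdiag_def diagm_nth)
    also have "\<dots> = sdot (A *v (U' *v axis a 1)) (A *v (U' *v axis a 1))"
      by (simp add: conj_entry sdot_mult_left matrix_vector_mul_assoc[symmetric])
    finally have "y a = (norm (A *v (U' *v axis a 1)))\<^sup>2" unfolding sdot_self of_real_eq_iff .
    moreover have "det (A ** U') \<noteq> 0" by (simp add: det_mul A detU')
    then have "(A ** U') *v axis a 1 \<noteq> 0"
      using det_eq_0_kernel[of "A ** U'"] axis_eq_0_iff[of a "1::'k"] by fastforce
    then have "A *v (U' *v axis a 1) \<noteq> 0" by (simp add: matrix_vector_mul_assoc)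
    ultimately show ?thesis by simp
  qed
  define x where "x a = ln (y a) / 2" for a
  have ex: "exp (x a) * exp (x a) = y a" for a
    using y[of a] by (simp add: x_def flip: exp_add)
  define K where "K = A ** U' ** rdiag (\<lambda>i. exp (- x i))"
  have "mstar K ** K = rdiag (\<lambda>i. exp (- x i)) ** (mstar U' ** (mstar A ** A) ** U') ** rdiag (\<lambda>i. exp (- x i))"
    by (simp add: K_def mstar_mult matrix_mul_assoc)
  also have "\<dots> = mat 1"
    unfolding UG rdiag_mult by (simp add: ex[symmetric] exp_minus field_simps)
  finally have K: "unitary K" by (simp add: unitary_def)
  \<comment> \<open>\<open>det K\<close> is a positive real number of modulus one, which gives both
    \<open>det K = 1\<close> and the vanishing of the sum of \<open>x\<close>.\<close>
  have detK: "det K = of_real (\<Prod>i\<in>UNIV. exp (- x i))" by (simp add: K_def det_mul A detU' det_rdiag)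
  moreover have "(\<Prod>i\<in>UNIV. exp (- x i)) > 0" by (intro prod_pos) simp
  ultimately have p1: "(\<Prod>i\<in>UNIV. exp (- x i)) = 1" using unitary_det[OF K] by (simp only: norm_of_real)
  then have "exp (- sum x UNIV) = 1" by (simp add: exp_sum sum_negf[symmetric])
  then have "sum x UNIV = 0" by simp
  moreover have "A = K ** rdiag (\<lambda>i. exp (x i)) ** mstar U'"
  proof -
    have "K ** rdiag (\<lambda>i. exp (x i)) = A ** U'"
      by (simp add: K_def matrix_mul_assoc[symmetric] rdiag_mult flip: exp_add)
    then show ?thesis by (simp add: matrix_mul_assoc[symmetric] unitary_right[OF U'])
  qed
  moreover have "decr ord x" using U(3) y by (simp add: decr_def x_def)
  moreover have "det K = 1" "det (mstar U') = 1" using detK p1 by (simp_all add: det_mstar detU')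
  ultimately show ?thesis using that K unitary_mstar[OF U'] by blast
qed

lemma norm_rdiag_le:
  fixes u :: "'k::scalar_rc^'n"
  assumes "\<And>j. u $ j \<noteq> 0 \<Longrightarrow> \<bar>y j\<bar> \<le> m" "0 \<le> m"
  shows "norm (rdiag y *v u) \<le> m * norm u"
proof -
  have "norm ((rdiag y *v u) $ j) \<le> m * norm (u $ j)" for j
    using assms(1)[of j] by (cases "u $ j = 0") (simp_all add: rdiag_def diagm_mult_vec_nth norm_mult)
  then have "norm (rdiag y *v u) \<le> L2_set (\<lambda>j. m * norm (u $ j)) UNIV"
    unfolding norm_vec_def[of "rdiag y *v u"] by (intro L2_set_mono) auto
  also have "\<dots> = m * norm u" using assms(2) by (simp add: norm_vec_def L2_set_right_distrib)
  finally show ?thesis .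
qed

lemma norm_rdiag_ge:
  fixes u :: "'k::scalar_rc^'n"
  assumes "\<And>j. u $ j \<noteq> 0 \<Longrightarrow> m \<le> \<bar>y j\<bar>" "0 \<le> m"
  shows "m * norm u \<le> norm (rdiag y *v u)"
proof -
  have "m * norm u = L2_set (\<lambda>j. m * norm (u $ j)) UNIV"
    using assms(2) by (simp add: norm_vec_def L2_set_right_distrib)
  also have "\<dots> \<le> norm (rdiag y *v u)"
  proof -
    have "m * norm (u $ j) \<le> norm ((rdiag y *v u) $ j)" for j
      using assms(1)[of j] by (cases "u $ j = 0") (simp_all add: rdiag_def diagm_mult_vec_nth norm_mult)
    then show ?thesis
      unfolding norm_vec_def[of "rdiag y *v u"] using assms(2) by (intro L2_set_mono) auto
  qed
  finally show ?thesis .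
qed

text \<open>One half of the minimax principle: a vector supported on the first ranks is stretched by
  at least \<open>exp (x' i)\<close>, and it can be chosen so that what reaches the diagonal factor
  of the other product is supported on the last ranks and is stretched by at most
  \<open>exp (x i)\<close>. With trivial \<open>g1\<close>, \<open>g2\<close> this gives uniqueness
  of singular values; with fixed ones it compares powers of conjugate matrices.\<close>

lemma singular_values_le:
  fixes K L K' L' g1 g2 :: "'k::scalar_rc^'n^'n" and ord :: "'n \<Rightarrow> nat"
  assumes inj: "inj ord" and U: "unitary K" "unitary L" "unitary K'" "unitary L'"
    and dec: "decr ord x" "decr ord x'"
    and eq: "K' ** rdiag (\<lambda>i. exp (x' i)) ** L' = g1 ** (K ** rdiag (\<lambda>i. exp (x i)) ** L) ** g2"
    and c: "\<And>v. norm (g1 *v v) \<le> c1 * norm v" "\<And>v. norm (g2 *v v) \<le> c2 * norm v" "c1 > 0" "c2 > 0"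
  shows "x' i \<le> x i + ln (c1 * c2)"
proof -
  obtain u where u: "u \<noteq> 0" "\<And>j. ord i < ord j \<Longrightarrow> u $ j = 0"
    "\<And>j. ord j < ord i \<Longrightarrow> ((L ** g2 ** mstar L') *v u) $ j = 0"
    using exists_common_zero[OF inj] by metis
  define v where "v = mstar L' *v u"
  have mono: "ord a \<le> ord b \<Longrightarrow> x b \<le> x a \<and> x' b \<le> x' a" for a b
    using dec inj by (cases "a = b") (auto simp: decr_def le_less dest: injD)
  have nv: "norm v = norm u" unfolding v_def by (rule norm_unitary[OF unitary_mstar[OF U(4)]])
  have "exp (x' i) * norm u \<le> norm (rdiag (\<lambda>i. exp (x' i)) *v u)"
    using u(2) mono by (intro norm_rdiag_ge) (auto simp: not_less[symmetric])
  also have "\<dots> = norm ((K' ** rdiag (\<lambda>i. exp (x' i)) ** L') *v v)"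
    by (simp add: v_def matrix_vector_mul_assoc[symmetric] norm_unitary[OF U(3)])
       (simp add: matrix_vector_mul_assoc unitary_right[OF U(4)])
  also have "\<dots> = norm (g1 *v ((K ** rdiag (\<lambda>i. exp (x i)) ** L) *v (g2 *v v)))"
    unfolding eq by (simp add: matrix_vector_mul_assoc matrix_mul_assoc)
  also have "\<dots> \<le> c1 * norm ((K ** rdiag (\<lambda>i. exp (x i)) ** L) *v (g2 *v v))" by (rule c)
  also have "norm ((K ** rdiag (\<lambda>i. exp (x i)) ** L) *v (g2 *v v)) =
      norm (rdiag (\<lambda>i. exp (x i)) *v ((L ** g2 ** mstar L') *v u))"
    by (simp add: v_def matrix_vector_mul_assoc[symmetric] norm_unitary[OF U(1)])
  also have "\<dots> \<le> exp (x i) * norm ((L ** g2 ** mstar L') *v u)"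
    using u(3) mono by (intro norm_rdiag_le) (auto simp: not_less[symmetric])
  also have "norm ((L ** g2 ** mstar L') *v u) = norm (g2 *v v)"
    by (simp add: v_def matrix_vector_mul_assoc[symmetric] norm_unitary[OF U(2)])
  also have "norm (g2 *v v) \<le> c2 * norm u" using c(2)[of v] nv by simp
  finally have "exp (x' i) * norm u \<le> (c1 * (exp (x i) * c2)) * norm u"
    using c(3) by (simp add: mult.assoc)
  then have "exp (x' i) \<le> exp (x i) * (c1 * c2)" using u(1) by (simp add: mult_ac)
  also have "\<dots> = exp (x i + ln (c1 * c2))" using c by (simp add: exp_add)
  finally show ?thesis by simp
qed

lemma singular_values_unique:
  fixes K L K' L' :: "'k::scalar_rc^'n^'n" and ord :: "'n \<Rightarrow> nat"
  assumes "inj ord" "unitary K" "unitary L" "unitary K'" "unitary L'" "decr ord x" "decr ord x'"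
    and "K' ** rdiag (\<lambda>i. exp (x' i)) ** L' = K ** rdiag (\<lambda>i. exp (x i)) ** L"
  shows "x' = x"
proof
  fix i
  have "x' i \<le> x i + ln (1 * 1)"
    using assms by (intro singular_values_le[of ord K L K' L' x x' "mat 1" "mat 1"]) simp_all
  moreover have "x i \<le> x' i + ln (1 * 1)"
    using assms by (intro singular_values_le[of ord K' L' K L x' x "mat 1" "mat 1"]) simp_all
  ultimately show "x' i = x i" by simp
qed

text \<open>Multiplying each product by its adjoint eliminates \<open>L\<close> and
  \<open>L'\<close>. Hence \<open>mstar K' ** K\<close> commutes with a diagonal matrix with
  distinct entries.\<close>

lemma singular_frames_unique:
  fixes K L K' L' :: "'k::scalar_rc^'n^'n"
  assumes "unitary K" "unitary L" "unitary K'" "unitary L'" "inj x"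
    and eq: "K' ** rdiag (\<lambda>i. exp (x i)) ** L' = K ** rdiag (\<lambda>i. exp (x i)) ** L"
    and "i \<noteq> j"
  shows "(mstar K' ** K) $ i $ j = 0"
proof -
  let ?E = "rdiag (\<lambda>i. exp (x i)) :: 'k^'n^'n"
  have *: "(M ** ?E ** N) ** mstar (M ** ?E ** N) = M ** (?E ** ?E) ** mstar M" if "unitary N" for M N
  proof -
    have "(M ** ?E ** N) ** mstar (M ** ?E ** N) = M ** ?E ** (N ** mstar N) ** ?E ** mstar M"
      by (simp only: mstar_mult mstar_rdiag matrix_mul_assoc)
    then show ?thesis by (simp add: unitary_right[OF that] matrix_mul_assoc)
  qed
  have eq1: "K' ** (?E ** ?E) ** mstar K' = K ** (?E ** ?E) ** mstar K"
    using *[OF assms(4), of K'] *[OF assms(2), of K] eq by simp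
  have "(?E ** ?E) ** (mstar K' ** K) = (mstar K' ** K') ** (?E ** ?E) ** (mstar K' ** K)"
    using assms(3) by (simp add: unitary_def)
  also have "\<dots> = mstar K' ** (K' ** (?E ** ?E) ** mstar K') ** K" by (simp only: matrix_mul_assoc)
  also have "\<dots> = (mstar K' ** K) ** (?E ** ?E) ** (mstar K ** K)" unfolding eq1 by (simp only: matrix_mul_assoc)
  also have "\<dots> = (mstar K' ** K) ** (?E ** ?E)" using assms(1) by (simp add: unitary_def)
  finally have "(rdiag (\<lambda>i. exp (x i) * exp (x i)) ** (mstar K' ** K)) $ i $ j =
      ((mstar K' ** K) ** rdiag (\<lambda>i. exp (x i) * exp (x i))) $ i $ j" by (simp only: rdiag_mult)
  then have "of_real (exp (x i) * exp (x i)) * (mstar K' ** K) $ i $ j =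
      of_real (exp (x j) * exp (x j)) * (mstar K' ** K) $ i $ j"
    unfolding rdiag_def diagm_mult_left_nth diagm_mult_right_nth by (simp only: mult.commute)
  moreover have "exp (x i) * exp (x i) \<noteq> exp (x j) * exp (x j)"
    using assms(5,7) by (auto simp: exp_add[symmetric] inj_def)
  ultimately show ?thesis using mult_right_cancel of_real_eq_iff by blast
qed

section \<open>Flags given by frames\<close>

definition coord_flag :: "('n \<Rightarrow> nat) \<Rightarrow> nat \<Rightarrow> ('k::scalar_rc ^ 'n) set" where
  "coord_flag ord j = {u. \<forall>a. j \<le> ord a \<longrightarrow> u $ a = 0}"

text \<open>The flag spanned by the columns of \<open>Q\<close> in the order \<open>ord\<close>.
  Every full flag arises in this way, which turns statements on flags into statements on matrices
  modulo the stabilizer of \<open>coord_flag\<close>.\<close>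

definition frame_flag :: "('n \<Rightarrow> nat) \<Rightarrow> 'k::scalar_rc ^ 'n ^ 'n \<Rightarrow> nat \<Rightarrow> ('k ^ 'n) set" where
  "frame_flag ord Q = (\<lambda>j. (*v) Q ` coord_flag ord j)"

lemma matrix_inv_mult: 
  assumes "invertible (A :: 'k::scalar_rc^'n^'n)"
  shows "matrix_inv A ** A = mat 1" "A ** matrix_inv A = mat 1"
  using assms unfolding invertible_def matrix_inv_def by (metis (mono_tags, lifting) someI_ex)+

lemma matrix_inv_unique: "A ** A' = mat 1 \<Longrightarrow> matrix_inv A = (A' :: 'k::scalar_rc^'n^'n)"
proof -
  assume a: "A ** A' = mat 1"
  then have "A' ** A = mat 1" unfolding matrix_left_right_inverse[of A A'] .
  with a have "invertible A" unfolding invertible_def by blast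
  then have "matrix_inv A = matrix_inv A ** (A ** A')" using a by simp
  also have "\<dots> = A'" using matrix_inv_mult(1)[OF \<open>invertible A\<close>] by (simp add: matrix_mul_assoc)
  finally show ?thesis .
qed

lemma inj_mult_vec: "invertible (A :: 'k::scalar_rc^'n^'n) \<Longrightarrow> inj ((*v) A)"
  using matrix_inv_mult(1)[of A] by (metis injI matrix_vector_mul_assoc matrix_vector_mul_lid)

lemma frame_flag_mult: "frame_flag ord (A ** Q) = (\<lambda>j. (*v) A ` frame_flag ord Q j)"
  by (simp add: frame_flag_def image_image matrix_vector_mul_assoc)

lemma frame_flag_cancel:
  fixes A :: "'k::scalar_rc^'n^'n"
  assumes "invertible A"
  shows "frame_flag ord (A ** Q) = frame_flag ord (A ** Q') \<longleftrightarrow> frame_flag ord Q = frame_flag ord Q'"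
  using inj_image_eq_iff[OF inj_mult_vec[OF assms]] by (simp add: frame_flag_mult fun_eq_iff)

lemma coord_flag_subspace: "vec.subspace (coord_flag ord j)"
  by (auto simp: vec.subspace_def coord_flag_def)

lemma coord_flag_mono: "i \<le> j \<Longrightarrow> coord_flag ord i \<subseteq> coord_flag ord j"
  by (auto simp: coord_flag_def)

lemma axis_in_coord_flag: "axis a (1::'k::scalar_rc) \<in> coord_flag ord j \<longleftrightarrow> ord a < j"
  by (auto simp: coord_flag_def axis_def not_le)

lemma frame_flag_1: "frame_flag ord (mat 1) = coord_flag ord"
  by (simp add: frame_flag_def fun_eq_iff)

lemma frame_flag_entry:
  fixes C :: "'k::scalar_rc^'n^'n"
  assumes "frame_flag ord C = coord_flag ord" "ord j < k" "\<not> ord i < k"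
  shows "C $ i $ j = 0"
proof -
  have "C *v axis j 1 \<in> coord_flag ord k"
    using assms(1,2) axis_in_coord_flag[of j ord k] by (metis frame_flag_def image_eqI)
  then show ?thesis using assms(3) by (simp add: coord_flag_def mult_axis_nth)
qed

lemma frame_flag_diag:
  fixes C :: "'k::scalar_rc^'n^'n"
  assumes "invertible C" "\<And>i j. i \<noteq> j \<Longrightarrow> C $ i $ j = 0"
  shows "frame_flag ord C = coord_flag ord"
proof
  fix k
  have C: "C = diagm (\<lambda>i. C $ i $ i)" using assms(2) by (auto simp: vec_eq_iff diagm_nth)
  then have "det C = (\<Prod>i\<in>UNIV. C $ i $ i)" by (metis det_diagm)
  then have nz: "C $ i $ i \<noteq> 0" for i using assms(1) by (simp add: invertible_det_nz)
  have Cu: "(C *v u) $ i = C $ i $ i * u $ i" for u i by (subst C) (rule diagm_mult_vec_nth)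
  show "frame_flag ord C k = coord_flag ord k"
  proof (intro equalityI subsetI)
    fix u :: "'k^'n" assume u: "u \<in> coord_flag ord k"
    define w where "w = (\<chi> i. u $ i / C $ i $ i)"
    have "C *v w = u" using nz by (simp add: vec_eq_iff Cu w_def)
    moreover have "w \<in> coord_flag ord k" using u by (simp add: w_def coord_flag_def)
    ultimately show "u \<in> frame_flag ord C k" unfolding frame_flag_def by blast
  qed (auto simp: frame_flag_def coord_flag_def Cu)
qed

lemma frame_flag_eqD:
  fixes Q Q' :: "'k::scalar_rc^'n^'n"
  assumes "invertible Q" "frame_flag ord Q' = frame_flag ord Q"
  obtains C where "Q' = Q ** C" "frame_flag ord C = coord_flag ord"
proof
  show "Q' = Q ** (matrix_inv Q ** Q')"
    by (simp add: matrix_mul_assoc matrix_inv_mult[OF assms(1)])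
  then have "frame_flag ord (Q ** (matrix_inv Q ** Q')) = frame_flag ord (Q ** mat 1)"
    using assms(2) by simp
  then show "frame_flag ord (matrix_inv Q ** Q') = coord_flag ord"
    unfolding frame_flag_cancel[OF assms(1)] by (simp add: frame_flag_1)
qed

text \<open>The transition matrix between two frames of one flag preserves all initial coordinate
  subspaces, so \<open>pminor_conj\<close> applies. The factor \<open>N k\<close> is the same for
  every \<open>G\<close>; hence the quotient of the minors of two forms depends on the flag
  only.\<close>

lemma pminor_frame:
  fixes Q Q' G :: "'k::scalar_rc^'n^'n"
  assumes "invertible Q" "frame_flag ord Q' = frame_flag ord Q"
  shows "\<exists>N. (\<forall>k G. pminor {a. ord a < k} (mstar Q' ** G ** Q') =
    N k * pminor {a. ord a < k} (mstar Q ** G ** Q)) \<and> (\<forall>k. N k \<ge> (0::real))"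
proof -
  obtain C where C: "Q' = Q ** C" "frame_flag ord C = coord_flag ord"
    using frame_flag_eqD[OF assms] .
  have "pminor {a. ord a < k} (mstar Q' ** G ** Q') =
      (norm (det (sub_matrix {a. ord a < k} C)))\<^sup>2 * pminor {a. ord a < k} (mstar Q ** G ** Q)" for k G
  proof -
    have "mstar Q' ** G ** Q' = mstar C ** (mstar Q ** G ** Q) ** C"
      unfolding C(1) mstar_mult by (simp only: matrix_mul_assoc)
    then show ?thesis
      by (simp only:) (rule pminor_conj, use frame_flag_entry[OF C(2)] in simp)
  qed
  then show ?thesis
    by (intro exI[of _ "\<lambda>k. (norm (det (sub_matrix {a. ord a < k} C)))\<^sup>2"]) simp
qed

lemma dim_coord_flag:
  assumes "bij_betw ord (UNIV::'n::finite set) {..<CARD('n)}"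
  shows "vec.dim (coord_flag ord j :: ('k::scalar_rc^'n) set) = min j CARD('n)"
proof -
  have "coord_flag ord j = {x :: 'k^'n. \<forall>i. i \<notin> {a. ord a < j} \<longrightarrow> x $ i = 0}"
    by (simp add: coord_flag_def not_less)
  then have "vec.dim (coord_flag ord j :: ('k^'n) set) = card {a. ord a < j}"
    by (simp only: dim_substandard_cart)
  also have "{a. ord a < j} = {a. ord a < min j CARD('n)}"
    using bij_betw_apply[OF assms] by auto
  finally show ?thesis using ord_sets(1)[OF assms, of "min j CARD('n)"] by simp
qed

lemma frame_flag_full:
  assumes ord: "bij_betw ord (UNIV::'n::finite set) {..<CARD('n)}" and Q: "invertible (Q :: 'k::scalar_rc^'n^'n)"
  shows "frame_flag ord Q \<in> full_flags"
proof -
  have "vec.subspace (frame_flag ord Q j)" for j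
    unfolding frame_flag_def by (rule vec.linear_subspace_image[OF matrix_vector_mul_linear_gen coord_flag_subspace])
  moreover have "vec.dim (frame_flag ord Q j) = min j CARD('n)" for j
    unfolding frame_flag_def
    using vec.dim_image_eq[OF matrix_vector_mul_linear_gen, of Q "coord_flag ord j"]
      dim_coord_flag[OF ord] inj_mult_vec[OF Q] by (simp add: inj_on_subset)
  moreover have "mono (frame_flag ord Q)"
    by (auto simp: mono_def frame_flag_def dest: coord_flag_mono)
  ultimately show ?thesis by (simp add: full_flags_def)
qed

text \<open>Each column is picked in a term of the flag and outside the preceding term; inclusion
  and dimension then force equality term by term.\<close>

lemma full_flag_frame:
  fixes \<xi> :: "nat \<Rightarrow> ('k::scalar_rc^'n) set"
  assumes ord: "bij_betw ord (UNIV::'n::finite set) {..<CARD('n)}" and \<xi>: "\<xi> \<in> full_flags"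
  obtains Q where "invertible Q" "frame_flag ord Q = \<xi>"
proof -
  have sub: "vec.subspace (\<xi> j)" and dim: "vec.dim (\<xi> j) = min j CARD('n)" and mono: "i \<le> j \<Longrightarrow> \<xi> i \<subseteq> \<xi> j" for i j
    using \<xi> by (auto simp: full_flags_def mono_def)
  have ordl: "ord a < CARD('n)" for a using bij_betw_apply[OF ord, of a] by simp
  have "\<exists>w. w \<in> \<xi> (Suc j) \<and> w \<notin> \<xi> j" if "j < CARD('n)" for j
  proof (rule ccontr)
    assume "\<not> ?thesis"
    then have "\<xi> (Suc j) \<subseteq> \<xi> j" by blast
    then have "vec.dim (\<xi> (Suc j)) \<le> vec.dim (\<xi> j)" by (rule vec.dim_subset)
    then show False using that by (simp add: dim)
  qed
  then obtain w where w: "\<And>j. j < CARD('n) \<Longrightarrow> w j \<in> \<xi> (Suc j)" "\<And>j. j < CARD('n) \<Longrightarrow> w j \<notin> \<xi> j" by metis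
  define Q where "Q = (\<chi> i a. w (ord a) $ i)"
  have Qa: "Q *v axis a 1 = w (ord a)" for a by (simp add: vec_eq_iff mult_axis_nth Q_def)
  have eq: "frame_flag ord Q j = \<xi> j" if "j \<le> CARD('n)" for j
    using that
  proof (induction j)
    case 0
    have "\<xi> 0 = {0}" using dim[of 0] vec.subspace_0[OF sub[of 0]] by auto
    moreover have "coord_flag ord 0 = {0 :: 'k^'n}" by (auto simp: coord_flag_def vec_eq_iff)
    ultimately show ?case by (simp add: frame_flag_def)
  next
    case (Suc j)
    then have IH: "frame_flag ord Q j = \<xi> j" and j: "j < CARD('n)" by simp_all
    obtain a where a: "ord a = j"
    proof -
      have "j \<in> range ord" using j unfolding bij_betw_imp_surj_on[OF ord] by simp
      then show ?thesis using that by (rule rangeE) blast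
    qed
    have subQ: "vec.subspace (frame_flag ord Q (Suc j))"
      unfolding frame_flag_def by (rule vec.linear_subspace_image[OF matrix_vector_mul_linear_gen coord_flag_subspace])
    have le: "frame_flag ord Q (Suc j) \<subseteq> \<xi> (Suc j)"
    proof
      fix y assume "y \<in> frame_flag ord Q (Suc j)"
      then obtain u where u: "u \<in> coord_flag ord (Suc j)" "y = Q *v u" by (auto simp: frame_flag_def)
      have "u - u $ a *s axis a 1 \<in> coord_flag ord j"
        using u(1) a bij_betw_imp_inj_on[OF ord]
        by (auto simp: coord_flag_def axis_def inj_eq) (metis inj_eq le_antisym not_less_eq_eq)
      then have "Q *v (u - u $ a *s axis a 1) \<in> \<xi> j" unfolding IH[symmetric] frame_flag_def by blast
      moreover have "y = Q *v (u - u $ a *s axis a 1) + u $ a *s w j"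
        using u(2) Qa[of a] a by (simp add: matrix_vector_mult_diff_distrib vector_scalar_commute)
      ultimately show "y \<in> \<xi> (Suc j)"
        using mono[of j "Suc j"] w(1)[OF j] sub[of "Suc j"] by (auto intro!: vec.subspace_add vec.subspace_scale)
    qed
    have "w j \<in> frame_flag ord Q (Suc j)"
      using Qa[of a] a axis_in_coord_flag[of a ord "Suc j"] unfolding frame_flag_def by (metis image_eqI lessI)
    moreover have "\<xi> j \<subseteq> frame_flag ord Q (Suc j)"
      unfolding IH[symmetric] frame_flag_def using coord_flag_mono[of j "Suc j" ord] by (intro image_mono) simp
    ultimately have "\<xi> j \<subset> frame_flag ord Q (Suc j)" using w(2)[OF j] by blast
    then have "vec.dim (\<xi> j) < vec.dim (frame_flag ord Q (Suc j))"
      using vec.subspace_dim_equal[OF sub[of j] subQ] by (cases "vec.dim (frame_flag ord Q (Suc j)) \<le> vec.dim (\<xi> j)") auto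
    then have "vec.dim (\<xi> (Suc j)) \<le> vec.dim (frame_flag ord Q (Suc j))" using j by (simp add: dim)
    then show ?case using vec.subspace_dim_equal[OF subQ sub le] by blast
  qed
  have top: "\<xi> CARD('n) = UNIV"
    using vec.subspace_dim_equal[OF sub[of "CARD('n)"] vec.subspace_UNIV] dim[of "CARD('n)"] vec_dim_card[where 'n='n and 'a='k]
    by simp
  have ctop: "coord_flag ord j = (UNIV :: ('k^'n) set)" if "CARD('n) \<le> j" for j
    using ordl that by (auto simp: coord_flag_def not_le[symmetric]) (metis leD order_trans)
  have surjQ: "surj ((*v) Q)" using eq[of "CARD('n)"] ctop[of "CARD('n)"] by (simp add: frame_flag_def top)
  show ?thesis
  proof
    show "invertible Q" using surjQ matrix_right_invertible_surjective[of Q] invertible_right_inverse[of Q] by blast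
    show "frame_flag ord Q = \<xi>"
    proof
      fix j
      show "frame_flag ord Q j = \<xi> j"
      proof (cases "j \<le> CARD('n)")
        case False
        then have "\<xi> j = UNIV" using mono[of "CARD('n)" j] top by auto
        then show ?thesis using False ctop[of j] surjQ by (simp add: frame_flag_def)
      qed (rule eq)
    qed
  qed
qed

text \<open>The identity block of the padding forces a kernel vector to vanish off \<open>I\<close>.
  It is thus a vector of the coordinate subspace of \<open>I\<close> that is orthogonal to this
  subspace.\<close>

lemma pminor_eq_0_kernel:
  fixes G :: "'k::scalar_rc^'n^'n"
  assumes "hermitian G" "pminor I G = 0"
  obtains u where "u \<noteq> 0" "\<And>i. i \<notin> I \<Longrightarrow> u $ i = 0" "\<And>i. i \<in> I \<Longrightarrow> (G *v u) $ i = 0"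
proof -
  have "det (sub_matrix I G) = 0" using of_real_pminor[OF assms(1), of I] assms(2) by simp
  then obtain u where u: "u \<noteq> 0" "sub_matrix I G *v u = 0" unfolding det_eq_0_kernel by blast
  have out: "u $ i = 0" if "i \<notin> I" for i
  proof -
    have "(sub_matrix I G *v u) $ i = u $ i" using that
      by (simp add: matrix_vector_mult_def sub_matrix_nth if_distrib[of "\<lambda>z. z * _"] cong: if_cong)
    then show ?thesis using u(2) by simp
  qed
  moreover have "(G *v u) $ i = 0" if "i \<in> I" for i
  proof -
    have "(G *v u) $ i = (sub_matrix I G *v u) $ i"
      unfolding matrix_vector_mult_def using that out
      by (simp add: sub_matrix_nth) (rule sum.cong, simp_all)
    then show ?thesis using u(2) by simp
  qed
  ultimately show ?thesis using that u(1) by blast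
qed

lemma pminor_positive_nz:
  fixes Y :: "'k::scalar_rc^'n^'n"
  assumes "invertible Y"
  shows "pminor I (mstar Y ** Y) \<noteq> 0"
proof
  assume "pminor I (mstar Y ** Y) = 0"
  then obtain u where u: "u \<noteq> 0" "\<And>i. i \<notin> I \<Longrightarrow> u $ i = 0" "\<And>i. i \<in> I \<Longrightarrow> ((mstar Y ** Y) *v u) $ i = 0"
    by (rule pminor_eq_0_kernel[rotated]) (auto simp: hermitian_def mstar_mult)
  have "sdot ((mstar Y ** Y) *v u) u = 0"
    unfolding sdot_def using u(2,3) by (intro sum.neutral ballI) (metis mult_eq_0_iff scnj_0)
  then have "sdot (Y *v u) (Y *v u) = 0"
    by (simp add: sdot_mult_left matrix_vector_mul_assoc[symmetric])
  then have "Y *v u = 0" by simp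
  then show False using u(1) assms det_eq_0_kernel[of Y] by (auto simp: invertible_det_nz)
qed

section \<open>Minors on compact sets of flags\<close>

lemma continuous_on_matrix_mult [continuous_intros]:
  fixes f g :: "'a::topological_space \<Rightarrow> 'k::real_normed_field^'n^'n"
  assumes "continuous_on S f" "continuous_on S g"
  shows "continuous_on S (\<lambda>x. f x ** g x)"
  unfolding matrix_matrix_mult_def using assms by (intro continuous_intros)

lemma continuous_on_mstar [continuous_intros]:
  "continuous_on S f \<Longrightarrow> continuous_on S (\<lambda>x. mstar (f x))"
  unfolding mstar_def by (intro continuous_intros)

lemma continuous_on_pminor [continuous_intros]:
  fixes f :: "'a::topological_space \<Rightarrow> 'k::scalar_rc^'n^'n"
  assumes "continuous_on S f"
  shows "continuous_on S (\<lambda>x. pminor I (f x))"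
proof -
  have "continuous_on S (\<lambda>x. sub_matrix I (f x) $ i $ j)" for i j
    using assms by (cases "i \<in> I \<and> j \<in> I"; cases "i = j") (auto simp: sub_matrix_nth intro!: continuous_intros)
  then show ?thesis unfolding pminor_def by (intro continuous_on_rp continuous_on_det)
qed

lemma open_invertible: "open {A :: 'k::scalar_rc^'n^'n. invertible A}"
  unfolding invertible_det_nz by (intro open_Collect_neq continuous_intros)

text \<open>By \<open>pminor_frame\<close> the ratio of the minors of the form and of an inner
  product is a function of the flag. It is continuous and nonzero on \<open>C\<close>, so
  compactness bounds it below. The matrix \<open>S\<close> selects the inner product, later the one
  for which the frames at hand are unitary.\<close>

lemma compact_flags_minor_bound:
  fixes C :: "(nat \<Rightarrow> ('k::scalar_rc^'n) set) set" and S :: "'k^'n^'n"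
  assumes ord: "bij_betw ord (UNIV::'n::finite set) {..<CARD('n)}"
    and C: "compactin flag_topology C"
    and nz: "\<And>\<xi>. \<xi> \<in> C \<Longrightarrow> \<exists>Q. invertible Q \<and> frame_flag ord Q = \<xi> \<and>
      (\<forall>k\<le>CARD('n). pminor {a. ord a < k} (mstar Q ** B0 ** Q) \<noteq> 0)"
    and S: "invertible S"
  obtains c where "c > 0" "\<And>Q k. invertible Q \<Longrightarrow> frame_flag ord Q \<in> C \<Longrightarrow> k \<le> CARD('n) \<Longrightarrow>
    c * \<bar>pminor {a. ord a < k} (mstar (S ** Q) ** (S ** Q))\<bar> \<le> \<bar>pminor {a. ord a < k} (mstar Q ** B0 ** Q)\<bar>"
proof -
  define pB where "pB k Q = \<bar>pminor {a. ord a < k} (mstar Q ** B0 ** Q)\<bar>" for k Q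
  define pH where "pH k Q = \<bar>pminor {a. ord a < k} (mstar (S ** Q) ** (S ** Q))\<bar>" for k Q
  have pH_pos: "pH k Q > 0" if "invertible Q" for k Q
    using pminor_positive_nz[of "S ** Q"] that S by (simp add: pH_def invertible_mult)
  \<comment> \<open>Strict inequalities cleared of denominators are open conditions on the
    frame.\<close>
  define good where "good c Q \<longleftrightarrow> (\<forall>k\<le>CARD('n). c * pH k Q < pB k Q)" for c Q
  have good_cong: "good c Q'" if "good c Q" "invertible Q" "invertible Q'" "frame_flag ord Q' = frame_flag ord Q" for c Q Q'
  proof -
    note h = pminor_frame[OF that(2,4)]
    obtain N where N': "\<forall>k G. pminor {a. ord a < k} (mstar Q' ** G ** Q') =
      N k * pminor {a. ord a < k} (mstar Q ** G ** Q)" "\<forall>k. N k \<ge> (0::real)"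
      using h by (elim exE conjE)
    note N = N'[rule_format]
    have "pB k Q' = N k * pB k Q" for k by (simp add: pB_def N abs_mult)
    moreover have H: "pH k Q' = N k * pH k Q" for k
      using N(1)[of k "mstar S ** S"] N(2)[of k] by (simp add: pH_def mstar_mult matrix_mul_assoc abs_mult)
    moreover have "N k > 0" for k using pH_pos[OF that(3), of k] N(2)[of k] unfolding H by (simp add: less_le)
    ultimately show ?thesis using that(1) by (simp add: good_def mult.left_commute)
  qed
  \<comment> \<open>The superlevel sets of the ratio, as sets of flags. They are open because their
    preimages under the orbit maps are given by \<open>good\<close>, and they grow as
    \<open>c\<close> decreases.\<close>
  define Og where "Og c = {frame_flag ord Q |Q. invertible Q \<and> good c Q}" for c
  have openOg: "openin flag_topology (Og c)" for c
    unfolding openin_flag_topology flag_open_def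
  proof (intro conjI ballI)
    show "Og c \<subseteq> full_flags" using frame_flag_full[OF ord] by (auto simp: Og_def)
    fix \<xi> :: "nat \<Rightarrow> ('k^'n) set" assume "\<xi> \<in> full_flags"
    then obtain Q where Q: "invertible Q" "frame_flag ord Q = \<xi>" by (rule full_flag_frame[OF ord])
    have "(\<lambda>j. (*v) A ` \<xi> j) \<in> Og c \<longleftrightarrow> good c (A ** Q)" if A: "invertible A" for A
    proof -
      have AQ: "invertible (A ** Q)" using A Q by (simp add: invertible_mult)
      have "(\<lambda>j. (*v) A ` \<xi> j) = frame_flag ord (A ** Q)" by (simp add: frame_flag_mult Q)
      then show ?thesis using AQ good_cong by (auto simp: Og_def)
    qed
    then have "{A. invertible A \<and> (\<lambda>j. (*v) A ` \<xi> j) \<in> Og c} =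
        {A. invertible A} \<inter> (\<Inter>k\<in>{..CARD('n)}. {A. c * pH k (A ** Q) < pB k (A ** Q)})"
      by (auto simp: good_def)
    moreover have "open {A. c * pH k (A ** Q) < pB k (A ** Q)}" for k
      unfolding pH_def pB_def by (intro open_Collect_less continuous_intros)
    ultimately show "open {A. invertible A \<and> (\<lambda>j. (*v) A ` \<xi> j) \<in> Og c}"
      using open_invertible by (simp only:) (intro open_Int open_INT ballI, auto)
  qed
  have Og_mono: "Og c \<subseteq> Og c'" if "c' \<le> c" for c c'
  proof -
    have "good c' Q" if "good c Q" "invertible Q" for Q
      using that pH_pos[OF that(2)] \<open>c' \<le> c\<close> unfolding good_def
      by (meson less_imp_le mult_right_mono order_le_less_trans)
    then show ?thesis by (auto simp: Og_def)
  qed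
  \<comment> \<open>The finitely many ratios at one flag have a positive minimum, which exceeds some
    \<open>1 / Suc m\<close>. The sets of this cover are nested, so a finite subcover reduces to a
    single one.\<close>
  have "C \<subseteq> (\<Union>m::nat. Og (1 / Suc m))"
  proof
    fix \<xi> assume "\<xi> \<in> C"
    then obtain Q where Q: "invertible Q" "frame_flag ord Q = \<xi>" "\<And>k. k \<le> CARD('n) \<Longrightarrow> pB k Q > 0"
      using nz unfolding pB_def by (metis zero_less_abs_iff)
    define c where "c = Min ((\<lambda>k. pB k Q / pH k Q) ` {..CARD('n)})"
    have "c > 0" unfolding c_def using Q(3) pH_pos[OF Q(1)] by (subst Min_gr_iff) auto
    then obtain m where m: "1 / Suc m < c" using nat_approx_posE by metis
    have "1 / Suc m * pH k Q < pB k Q" if "k \<le> CARD('n)" for k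
    proof -
      have "c \<le> pB k Q / pH k Q" unfolding c_def using that by (intro Min_le) auto
      then have "1 / Suc m < pB k Q / pH k Q" using m by simp
      then show ?thesis using pH_pos[OF Q(1), of k] by (simp add: field_simps)
    qed
    then show "\<xi> \<in> (\<Union>m::nat. Og (1 / Suc m))" using Q by (auto simp: Og_def good_def)
  qed
  then obtain F where F: "finite F" "F \<subseteq> range (\<lambda>m::nat. Og (1 / Suc m))" "C \<subseteq> \<Union>F"
    using C openOg unfolding compactin_def by (metis (no_types, lifting) imageE)
  then obtain M where M: "finite M" "F = (\<lambda>m::nat. Og (1 / Suc m)) ` M" using finite_subset_image by metis
  define m where "m = Max (insert 0 M)"
  have "C \<subseteq> Og (1 / Suc m)"
  proof -
    have "Og (1 / Suc k) \<subseteq> Og (1 / Suc m)" if "k \<in> M" for k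
    proof (rule Og_mono)
      have "k \<le> m" unfolding m_def using that M(1) by simp
      then show "1 / real (Suc m) \<le> 1 / real (Suc k)" by (simp add: frac_le)
    qed
    then show ?thesis using F(3) M(2) by blast
  qed
  have bound: "1 / Suc m * pH k Q \<le> pB k Q" if "invertible Q" "frame_flag ord Q \<in> C" "k \<le> CARD('n)" for Q k
  proof -
    have "frame_flag ord Q \<in> Og (1 / Suc m)" using that(2) \<open>C \<subseteq> Og (1 / Suc m)\<close> by blast
    then obtain Q' where Q': "invertible Q'" "good (1 / Suc m) Q'" "frame_flag ord Q = frame_flag ord Q'"
      by (auto simp: Og_def)
    then show ?thesis using good_cong[OF Q'(2,1) that(1)] that(3) by (auto simp: good_def less_imp_le)
  qed
  show ?thesis
    using bound by (intro that[of "1 / Suc m"]) (simp_all add: pH_def pB_def)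
qed

section \<open>The group $\mathrm{PSL}(V)$ through representatives\<close>

definition cl :: "'k::scalar_rc ^ 'n ^ 'n \<Rightarrow> ('k ^ 'n ^ 'n) set" where
  "cl A = SL_scalars #>\<^bsub>SL\<^esub> A"

lemma mat_mult_nth: "(mat c ** A) $ i $ j = c * A $ i $ j" "(A ** mat c) $ i $ j = c * A $ i $ j"
  for A :: "'k::scalar_rc^'n^'n"
  unfolding mat_eq_diagm diagm_mult_left_nth diagm_mult_right_nth by (simp_all add: mult.commute)

lemma mat_commute: "A ** mat c = mat c ** A" for A :: "'k::scalar_rc^'n^'n"
  by (simp add: vec_eq_iff mat_mult_nth)

lemma mat_mult_vec: "mat c *v u = c *s u" for u :: "'k::scalar_rc^'n"
  by (simp add: vec_eq_iff mat_eq_diagm diagm_mult_vec_nth)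

lemma mat_mat: "mat c ** mat c' = (mat (c * c') :: 'k::scalar_rc^'n^'n)"
  by (simp add: mat_eq_diagm diagm_mult)

lemma det_mat: "det (mat c :: 'k::scalar_rc^'n^'n) = c ^ CARD('n)"
  by (simp add: mat_eq_diagm det_diagm)

lemma norm_root_of_unity: "(c::'k::scalar_rc) ^ n = 1 \<Longrightarrow> n > 0 \<Longrightarrow> norm c = 1"
  by (metis norm_ge_zero norm_one norm_power power_eq_1_iff zero_less_iff_neq_zero)

lemma SL_simps [simp]: "carrier SL = {A. det A = 1}" "x \<otimes>\<^bsub>SL\<^esub> y = x ** y" "\<one>\<^bsub>SL\<^esub> = mat 1"
  by (simp_all add: SL_def)

lemma det_matrix_inv: "det A = 1 \<Longrightarrow> det (matrix_inv A) = 1" for A :: "'k::scalar_rc^'n^'n"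
proof -
  assume A: "det A = 1"
  then have "invertible A" by (simp add: invertible_det_nz)
  then have "det (matrix_inv A) * det A = 1" by (metis det_I det_mul matrix_inv_mult(1))
  then show ?thesis by (simp add: A)
qed

lemma group_SL: "group (SL :: ('k::scalar_rc^'n^'n) monoid)"
proof (rule groupI)
  fix x :: "'k^'n^'n" assume "x \<in> carrier SL"
  then have "det x = 1" by simp
  moreover from this have "invertible x" by (simp add: invertible_det_nz)
  ultimately show "\<exists>y\<in>carrier SL. y \<otimes>\<^bsub>SL\<^esub> x = \<one>\<^bsub>SL\<^esub>"
    by (intro bexI[of _ "matrix_inv x"]) (simp_all add: matrix_inv_mult det_matrix_inv)
qed (simp_all add: det_mul matrix_mul_assoc)

lemma SL_inv: "det A = 1 \<Longrightarrow> inv\<^bsub>SL\<^esub> A = matrix_inv (A :: 'k::scalar_rc^'n^'n)"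
  using matrix_inv_mult(1)[of A]
  by (intro group.inv_equality[OF group_SL]) (simp_all add: det_matrix_inv invertible_det_nz)

lemma SL_scalars_eq: "SL_scalars = {mat c :: 'k::scalar_rc^'n^'n | c. c ^ CARD('n) = 1}"
  by (auto simp: SL_scalars_def det_mat)

lemma normal_SL_scalars: "normal SL_scalars (SL :: ('k::scalar_rc^'n^'n) monoid)"
proof -
  interpret group "SL :: ('k^'n^'n) monoid" by (rule group_SL)
  have inv: "inv\<^bsub>SL\<^esub> (mat c) = (mat (inverse c) :: 'k^'n^'n)" if "c ^ CARD('n) = 1" for c
  proof -
    have "c \<noteq> 0" using that by (metis power_0_left zero_neq_one zero_less_card_finite less_irrefl)
    then show ?thesis using that
      by (intro inv_equality) (simp_all add: mat_mat det_mat power_inverse)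
  qed
  have "subgroup SL_scalars (SL :: ('k^'n^'n) monoid)"
  proof (rule subgroupI)
    show "SL_scalars \<noteq> ({} :: ('k^'n^'n) set)" unfolding SL_scalars_eq by (auto intro: exI[of _ 1])
  next
    fix a :: "'k^'n^'n" assume "a \<in> SL_scalars"
    then show "inv\<^bsub>SL\<^esub> a \<in> SL_scalars" unfolding SL_scalars_eq by (auto simp: inv power_inverse)
  next
    fix a a' :: "'k^'n^'n" assume "a \<in> SL_scalars" "a' \<in> SL_scalars"
    then show "a \<otimes>\<^bsub>SL\<^esub> a' \<in> SL_scalars"
      unfolding SL_scalars_eq by (force simp: mat_mat power_mult_distrib)
  qed (auto simp: SL_scalars_def)
  moreover have "x ** h ** matrix_inv x \<in> SL_scalars" if x: "det x = 1" and h: "h \<in> SL_scalars" for x h :: "'k^'n^'n"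
  proof -
    obtain c where c: "h = mat c" using h by (auto simp: SL_scalars_eq)
    have "x ** h ** matrix_inv x = h ** (x ** matrix_inv x)" unfolding c mat_commute by (simp add: matrix_mul_assoc)
    then show ?thesis using h matrix_inv_mult(2)[of x] x by (simp add: invertible_det_nz)
  qed
  ultimately show ?thesis unfolding normal_inv_iff by (simp add: SL_inv)
qed

lemma group_PSL: "group PSL"
  unfolding PSL_def by (rule normal.factorgroup_is_group[OF normal_SL_scalars])

lemma carrier_PSL: "carrier PSL = {cl A |A. det A = 1}"
  by (auto simp: PSL_def FactGroup_def RCOSETS_def cl_def)

lemma cl_carrier: "det A = 1 \<Longrightarrow> cl A \<in> carrier PSL"
  by (auto simp: carrier_PSL)

lemma cl_mult: "det A = 1 \<Longrightarrow> det A' = 1 \<Longrightarrow> cl A \<otimes>\<^bsub>PSL\<^esub> cl A' = cl (A ** A')"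
  unfolding PSL_def cl_def FactGroup_def by (simp add: normal.rcos_sum[OF normal_SL_scalars])

lemma cl_eq: "cl A = {mat c ** A |c. c ^ CARD('n) = 1}" for A :: "'k::scalar_rc^'n^'n"
  by (auto simp: cl_def r_coset_def SL_scalars_eq)

lemma mem_cl: "A \<in> cl A" for A :: "'k::scalar_rc^'n^'n"
  unfolding cl_eq by (auto intro!: exI[of _ 1])

lemma cl_eqD:
  assumes "cl A = cl A'"
  obtains c where "c ^ CARD('n) = 1" "A' = mat c ** (A :: 'k::scalar_rc^'n^'n)"
  using mem_cl[of A'] assms by (auto simp: cl_eq)

lemma cl_scalar: "c ^ CARD('n) = 1 \<Longrightarrow> det A = 1 \<Longrightarrow> cl (mat c ** A) = cl (A :: 'k::scalar_rc^'n^'n)"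
proof -
  assume c: "c ^ CARD('n) = 1" and A: "det A = 1"
  have "mat c ** A \<in> cl A" using c by (auto simp: cl_eq)
  then show ?thesis
    unfolding cl_def
    using group.repr_independence[OF group_SL, of "mat c ** A" SL_scalars A] A
      normal_imp_subgroup[OF normal_SL_scalars] by auto
qed

lemma cl_one: "\<one>\<^bsub>PSL\<^esub> = cl (mat 1 :: 'k::scalar_rc^'n^'n)"
  unfolding PSL_def FactGroup_def by (auto simp: cl_eq SL_scalars_eq)

lemma cl_inv: "det A = 1 \<Longrightarrow> inv\<^bsub>PSL\<^esub> (cl A) = cl (matrix_inv A)"
  using matrix_inv_mult(1)[of A] det_matrix_inv[of A]
  by (intro group.inv_equality[OF group_PSL]) (simp_all add: cl_mult cl_one cl_carrier invertible_det_nz)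

primrec mpow :: "'k::scalar_rc ^ 'n ^ 'n \<Rightarrow> nat \<Rightarrow> 'k ^ 'n ^ 'n" where
  "mpow A 0 = mat 1"
| "mpow A (Suc n) = mpow A n ** A"

lemma det_mpow: "det A = 1 \<Longrightarrow> det (mpow A n) = 1"
  by (induction n) (simp_all add: det_mul)

lemma cl_pow: "det A = 1 \<Longrightarrow> cl A [^]\<^bsub>PSL\<^esub> n = cl (mpow A n)"
proof (induction n)
  case 0
  show ?case by (simp add: nat_pow_def cl_one)
next
  case (Suc n)
  then show ?case
    using det_mpow[OF Suc.prems, of n]
    by (simp add: group.is_monoid[OF group_PSL] monoid.nat_pow_Suc cl_mult)
qed

lemma matrix_inv_mat_mult:
  assumes "c \<noteq> 0" "det A = 1"
  shows "matrix_inv (mat c ** A) = mat (inverse c) ** matrix_inv (A :: 'k::scalar_rc^'n^'n)"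
proof (rule matrix_inv_unique)
  have "(mat c ** A) ** (mat (inverse c) ** matrix_inv A) = (mat c ** mat (inverse c)) ** (A ** matrix_inv A)"
    by (metis mat_commute matrix_mul_assoc)
  then show "(mat c ** A) ** (mat (inverse c) ** matrix_inv A) = mat 1"
    using assms matrix_inv_mult(2)[of A] by (simp add: mat_mat invertible_det_nz)
qed

lemma root_nz: "c ^ CARD('n::finite) = 1 \<Longrightarrow> c \<noteq> (0::'k::scalar_rc)"
  by (metis power_0_left zero_neq_one zero_less_card_finite less_irrefl)

text \<open>The scalars of the coset cancel in a conjugation, so the choice of a representative in
  \<open>Ad\<close> is immaterial.\<close>

lemma Ad_cl:
  assumes "det A = 1"
  shows "Ad (cl A) X = A ** X ** matrix_inv (A :: 'k::scalar_rc^'n^'n)"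
proof -
  define A' where "A' = (SOME A'. A' \<in> cl A)"
  have "A' \<in> cl A" unfolding A'_def using mem_cl by (rule someI)
  then obtain c where c: "c ^ CARD('n) = 1" "A' = mat c ** A" by (auto simp: cl_eq)
  have "A' ** X ** matrix_inv A' = (mat c ** mat (inverse c)) ** (A ** X ** matrix_inv A)"
    unfolding c(2) matrix_inv_mat_mult[OF root_nz[OF c(1)] assms] by (metis mat_commute matrix_mul_assoc)
  then show ?thesis using root_nz[OF c(1)] by (simp add: Ad_def A'_def[symmetric] mat_mat)
qed

lemma sub_act_cl:
  fixes A :: "'k::scalar_rc^'n^'n"
  assumes "vec.subspace S"
  shows "sub_act (cl A) S = (*v) A ` S"
proof
  show "(*v) A ` S \<subseteq> sub_act (cl A) S" using mem_cl[of A] by (auto simp: sub_act_def)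
  show "sub_act (cl A) S \<subseteq> (*v) A ` S"
  proof
    fix y assume "y \<in> sub_act (cl A) S"
    then obtain c u where "u \<in> S" "y = (mat c ** A) *v u" by (auto simp: sub_act_def cl_eq)
    then have "y = A *v (c *s u)" "c *s u \<in> S"
      using assms by (simp_all add: matrix_vector_mul_assoc[symmetric] mat_mult_vec vector_scalar_commute vec.subspace_scale)
    then show "y \<in> (*v) A ` S" by blast
  qed
qed

lemma frame_flag_subspace: "vec.subspace (frame_flag ord Q j)"
  unfolding frame_flag_def by (rule vec.linear_subspace_image[OF matrix_vector_mul_linear_gen coord_flag_subspace])

lemma flag_act_frame: "flag_act (cl A) (frame_flag ord Q) = frame_flag ord (A ** Q)"
  by (simp add: flag_act_def sub_act_cl frame_flag_subspace frame_flag_mult)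


section \<open>Monomial matrices\<close>

text \<open>The matrix that sends the basis vector of index \<open>j\<close> to \<open>c j\<close>
  times the one of index \<open>\<pi> j\<close>. Such matrices represent the elements of the Weyl
  group.\<close>

definition monomat :: "('n \<Rightarrow> 'n) \<Rightarrow> ('n \<Rightarrow> 'k::scalar_rc) \<Rightarrow> 'k ^ 'n ^ 'n" where
  "monomat \<pi> c = (\<chi> i j. if i = \<pi> j then c j else 0)"

lemma monomat_nth: "monomat \<pi> c $ i $ j = (if i = \<pi> j then c j else 0)"
  by (simp add: monomat_def)

lemma monomat_axis: "monomat \<pi> c *v axis j 1 = c j *s axis (\<pi> j) 1"
  by (auto simp: vec_eq_iff mult_axis_nth monomat_nth) (auto simp: axis_def)

lemma monomat_mult_nth: "(A ** monomat \<pi> c) $ i $ j = A $ i $ \<pi> j * c j"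
  by (simp add: matrix_matrix_mult_def monomat_nth if_distrib[of "\<lambda>z. _ * z"] cong: if_cong)

lemma monomat_mult_rdiag:
  assumes "bij \<pi>"
  shows "monomat \<pi> c ** rdiag (\<lambda>i. x (\<pi> i)) = rdiag x ** monomat \<pi> c"
  by (auto simp: vec_eq_iff rdiag_def diagm_mult_left_nth diagm_mult_right_nth monomat_nth)

lemma mstar_monomat_mult:
  assumes "bij \<pi>"
  shows "mstar (monomat \<pi> c) ** monomat \<pi> c = diagm (\<lambda>i. scnj (c i) * c i)"
  using assms by (auto simp: vec_eq_iff monomat_mult_nth monomat_nth diagm_nth bij_def inj_eq)

lemma unitary_monomat:
  assumes "bij \<pi>" "\<And>i. norm (c i) = 1"
  shows "unitary (monomat \<pi> c)"
proof -
  have "scnj (c i) * c i = 1" for i using mult_scnj'[of "c i"] assms(2)[of i] by (simp add: mult.commute)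
  then show ?thesis unfolding unitary_def mstar_monomat_mult[OF assms(1)] by simp
qed

definition monomial_unit :: "('n::finite \<Rightarrow> 'n) \<Rightarrow> ('n \<Rightarrow> 'k::scalar_rc) \<Rightarrow> bool" where
  "monomial_unit \<pi> c \<longleftrightarrow> bij \<pi> \<and> (\<forall>i. norm (c i) = 1) \<and> det (monomat \<pi> c) = 1"

text \<open>The determinant of a permutation matrix has modulus one, so changing a single
  coefficient by a phase normalizes it.\<close>

lemma monomial_unit_exists:
  fixes \<pi> :: "'n::finite \<Rightarrow> 'n"
  assumes "bij \<pi>"
  obtains c :: "'n \<Rightarrow> 'k::scalar_rc" where "monomial_unit \<pi> c"
proof -
  fix a :: 'n
  define D where "D = det (monomat \<pi> (\<lambda>_. 1) :: 'k^'n^'n)"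
  have D: "norm D = 1" unfolding D_def using assms by (intro unitary_det unitary_monomat) simp_all
  define c where "c i = (if i = a then scnj D else 1)" for i
  have "monomat \<pi> c = monomat \<pi> (\<lambda>_. 1) ** diagm c"
    by (simp add: vec_eq_iff diagm_mult_right_nth monomat_nth)
  then have "det (monomat \<pi> c) = D * scnj D"
    by (simp add: det_mul det_diagm D_def c_def)
  then have "monomial_unit \<pi> c" using assms D by (simp add: monomial_unit_def c_def mult_scnj')
  then show ?thesis by (rule that)
qed

lemma pminor_monomat:
  assumes "bij \<pi>" "\<And>i. norm (c i) = 1"
  shows "pminor I (mstar (monomat \<pi> c) ** G ** monomat \<pi> c) = pminor (\<pi> ` I) (G :: 'k::scalar_rc^'n^'n)"
proof -
  have e: "(mstar (monomat \<pi> c) ** M ** monomat \<pi> c) $ i $ j = scnj (c i) * M $ \<pi> i $ \<pi> j * c j" for M :: "'k^'n^'n" and i j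
    by (simp add: monomat_mult_nth) (simp add: matrix_matrix_mult_def monomat_nth if_distrib[of scnj] if_distrib[of "\<lambda>z. z * _"] cong: if_cong)
  have cc: "scnj (c i) * c i = 1" for i using mult_scnj'[of "c i"] assms(2)[of i] by (simp add: mult.commute)
  have "sub_matrix I (mstar (monomat \<pi> c) ** G ** monomat \<pi> c) = mstar (monomat \<pi> c) ** sub_matrix (\<pi> ` I) G ** monomat \<pi> c"
    using assms(1) cc by (auto simp: vec_eq_iff e sub_matrix_nth bij_def inj_eq inj_image_mem_iff)
  then show ?thesis
    using unitary_det[OF unitary_monomat[OF assms]] by (simp add: pminor_def det_conj)
qed

text \<open>The coefficients only rescale the columns, so the flag remembers nothing but the
  permutation.\<close>

lemma frame_flag_monomat:
  assumes "bij \<pi>" "\<And>i. c i \<noteq> 0"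
  shows "frame_flag ord (monomat \<pi> c) j = {u :: 'k::scalar_rc^'n. \<forall>a. j \<le> ord a \<longrightarrow> u $ \<pi> a = 0}"
proof (intro equalityI subsetI)
  have m: "(monomat \<pi> c *v u) $ \<pi> a = c a * u $ a" for u a
  proof -
    have "(if \<pi> a = \<pi> k then c k else 0) * u $ k = (if k = a then c a * u $ a else 0)" for k
      using assms(1) by (auto simp: bij_def inj_eq)
    then show ?thesis by (simp add: matrix_vector_mult_def monomat_nth)
  qed
  {
    fix u assume "u \<in> frame_flag ord (monomat \<pi> c) j"
    then show "u \<in> {u. \<forall>a. j \<le> ord a \<longrightarrow> u $ \<pi> a = 0}" by (auto simp: frame_flag_def coord_flag_def m)
  next
    fix u :: "'k^'n" assume u: "u \<in> {u. \<forall>a. j \<le> ord a \<longrightarrow> u $ \<pi> a = 0}"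
    define w where "w = (\<chi> a. u $ \<pi> a / c a)"
    have "(monomat \<pi> c *v w) $ \<pi> a = u $ \<pi> a" for a using assms(2)[of a] by (simp add: m w_def)
    then have "monomat \<pi> c *v w = u"
      using assms(1) by (metis (no_types, lifting) bij_is_surj surj_f_inv_f vec_eq_iff)
    moreover have "w \<in> coord_flag ord j" using u by (simp add: w_def coord_flag_def)
    ultimately show "u \<in> frame_flag ord (monomat \<pi> c) j" unfolding frame_flag_def by blast
  }
qed

text \<open>Comparing entries, \<open>U $ i $ j\<close> can be nonzero only if
  \<open>x j = y i\<close>. Since the \<open>x j\<close> are distinct and no column of
  \<open>U\<close> vanishes, each row and each column has exactly one nonzero entry.\<close>

lemma unitary_normalizer_monomat:
  fixes U :: "'k::scalar_rc^'n^'n"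
  assumes U: "unitary U" and x: "inj x" and eq: "U ** rdiag x = rdiag y ** U"
  obtains \<pi> c where "bij \<pi>" "\<And>i. norm (c i) = 1" "U = monomat \<pi> c"
proof -
  have xy: "x j = y i" if "U $ i $ j \<noteq> 0" for i j
  proof -
    have "U $ i $ j * of_real (x j) = of_real (y i) * U $ i $ j"
      using arg_cong[OF eq, of "\<lambda>M. M $ i $ j"] by (simp add: rdiag_def diagm_mult_left_nth diagm_mult_right_nth)
    with that show ?thesis by (simp add: mult.commute)
  qed
  have "\<exists>i. U $ i $ j \<noteq> 0" for j
  proof (rule ccontr)
    assume "\<not> ?thesis"
    then have "(mstar U ** U) $ j $ j = 0" by (simp add: matrix_matrix_mult_def)
    then show False using U by (simp add: unitary_def mat_def)
  qed
  then obtain \<pi> where \<pi>: "\<And>j. U $ \<pi> j $ j \<noteq> 0" by metis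
  have "inj \<pi>"
  proof (rule injI)
    fix j j' assume "\<pi> j = \<pi> j'"
    then have "x j = x j'" using xy[OF \<pi>[of j]] xy[OF \<pi>[of j']] by simp
    then show "j = j'" using x by (simp add: inj_eq)
  qed
  then have bij: "bij \<pi>" by (simp add: bij_def finite_UNIV_inj_surj)
  define c where "c j = U $ \<pi> j $ j" for j
  have "U $ i $ j = (if i = \<pi> j then c j else 0)" for i j
  proof (cases "i = \<pi> j")
    case False
    obtain j' where j': "i = \<pi> j'" using bij by (metis bij_pointE)
    have "U $ i $ j = 0"
    proof (rule ccontr)
      assume "U $ i $ j \<noteq> 0"
      then have "x j = x j'" using xy \<pi>[of j'] j' by metis
      then show False using x False j' by (simp add: inj_eq)
    qed
    then show ?thesis using False by simp
  qed (simp add: c_def)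
  then have Uc: "U = monomat \<pi> c" by (simp add: vec_eq_iff monomat_nth)
  have "norm (c j) = 1" for j
  proof -
    have "scnj (c j) * c j = 1"
      using arg_cong[OF U[unfolded unitary_def Uc mstar_monomat_mult[OF bij]], of "\<lambda>M. M $ j $ j"]
      by (simp add: diagm_nth mat_def)
    then have "of_real ((norm (c j))\<^sup>2) = (1::'k)" by (simp add: mult_scnj'[symmetric] mult.commute del: of_real_power)
    then have "(norm (c j))\<^sup>2 = 1" using of_real_eq_1_iff by blast
    then show ?thesis using norm_ge_zero[of "c j"] by (simp add: power2_eq_1_iff)
  qed
  then show ?thesis using that bij Uc by blast
qed

definition munit :: "'n \<Rightarrow> 'n \<Rightarrow> 'k::scalar_rc ^ 'n ^ 'n" where
  "munit i j = (\<chi> a b. if a = i \<and> b = j then 1 else 0)"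

lemma munit_mult: "(G ** munit i j) $ a $ b = (if b = j then G $ a $ i else 0)"
  "(munit i j ** G) $ a $ b = (if a = i then G $ j $ b else 0)" for G :: "'k::scalar_rc^'n^'n"
  by (auto simp: matrix_matrix_mult_def munit_def if_distrib[of "\<lambda>z. _ * z"] if_distrib[of "\<lambda>z. z * _"] cong: if_cong)

lemma munit_sl: "i \<noteq> j \<Longrightarrow> munit i j \<in> sl"
  by (auto simp: sl_def trace_def munit_def intro!: sum.neutral)

text \<open>Commuting with the off-diagonal elementary matrices, which have trace zero, is enough to
  be scalar; dimension at least two provides the second index.\<close>

lemma commutes_sl_scalar:
  fixes G :: "'k::scalar_rc^'n^'n"
  assumes "\<And>Z. Z \<in> sl \<Longrightarrow> G ** Z = Z ** G" "CARD('n) \<ge> 2"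
  obtains c where "G = mat c"
proof -
  have e: "G $ a $ i = (if a = i then G $ j $ j else 0)" if "i \<noteq> j" for a i j
    using arg_cong[OF assms(1)[OF munit_sl[OF that]], of "\<lambda>M. M $ a $ j"] by (simp add: munit_mult)
  have "\<exists>j. j \<noteq> i" for i :: 'n
  proof (rule ccontr)
    assume "\<not> ?thesis"
    then have "UNIV = {i}" by auto
    from arg_cong[OF this, of card] show False using assms(2) by simp
  qed
  then have off: "a \<noteq> i \<Longrightarrow> G $ a $ i = 0" for a i using e by metis
  fix i0 :: 'n
  have "G $ i $ i = G $ i0 $ i0" for i using e[of i i0 i] by (cases "i = i0") simp_all
  then have "G = mat (G $ i0 $ i0)" using off by (auto simp: vec_eq_iff mat_def)
  then show ?thesis by (rule that)
qed

section \<open>Coordinates adapted to the form and the Cartan involution\<close>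

text \<open>The columns of \<open>P\<close> form a basis in which the form is diagonal with signs
  \<open>\<epsilon>\<close>. The Cartan involution is kept out so that the same locale serves for an
  inner product as well, with all signs equal to \<open>1\<close>.\<close>

locale form_coords =
  fixes P :: "'k::scalar_rc^'n^'n" and B :: "'k^'n \<Rightarrow> 'k^'n \<Rightarrow> 'k" and \<epsilon> :: "'n \<Rightarrow> real"
  assumes P: "invertible P"
    and B: "B (P *v u) (P *v v) = sdot (rdiag \<epsilon> *v u) v"
    and eps: "\<bar>\<epsilon> i\<bar> = 1"
begin

text \<open>\<open>em\<close> transports a matrix from the coordinates to the space and
  \<open>co\<close> is its inverse. Group elements are written \<open>cl (em A)\<close>, so that all
  computations take place in the coordinates.\<close>

definition em :: "'k^'n^'n \<Rightarrow> 'k^'n^'n" where "em A = P ** A ** matrix_inv P"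
definition co :: "'k^'n^'n \<Rightarrow> 'k^'n^'n" where "co A = matrix_inv P ** A ** P"

lemma PP: "matrix_inv P ** P = mat 1" "P ** matrix_inv P = mat 1"
  using matrix_inv_mult[OF P] .

lemma PPv: "matrix_inv P *v (P *v u) = u" "P *v (matrix_inv P *v u) = u"
  by (simp_all add: matrix_vector_mul_assoc PP)

lemma em_co [simp]: "em (co A) = A" and co_em [simp]: "co (em A) = A"
proof -
  have "em (co A) = (P ** matrix_inv P) ** A ** (P ** matrix_inv P)"
    unfolding em_def co_def by (simp only: matrix_mul_assoc)
  then show "em (co A) = A" by (simp add: PP)
  have "co (em A) = (matrix_inv P ** P) ** A ** (matrix_inv P ** P)"
    unfolding em_def co_def by (simp only: matrix_mul_assoc)
  then show "co (em A) = A" by (simp add: PP)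
qed

lemma em_mult: "em A ** em A' = em (A ** A')"
proof -
  have "em A ** em A' = P ** A ** (matrix_inv P ** P) ** A' ** matrix_inv P"
    unfolding em_def by (simp only: matrix_mul_assoc)
  then show ?thesis by (simp add: PP em_def matrix_mul_assoc)
qed

lemma em_1 [simp]: "em (mat 1) = mat 1" by (simp add: em_def PP)
lemma em_mat: "em (mat c) = mat c" by (simp add: em_def mat_commute[of P] matrix_mul_assoc[symmetric] PP)
lemma em_inject: "em A = em A' \<longleftrightarrow> A = A'" by (metis co_em)
lemma em_P: "em A ** P = P ** A" by (simp add: em_def matrix_mul_assoc[symmetric] PP)
lemma em_vec: "em A *v (P *v u) = P *v (A *v u)"
  by (simp add: matrix_vector_mul_assoc em_P)

lemma det_em [simp]: "det (em A) = det A"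
  using arg_cong[OF PP(1), of det] by (simp add: em_def det_mul mult.commute mult.left_commute)

lemma inv_em: "det A = 1 \<Longrightarrow> matrix_inv (em A) = em (matrix_inv A)"
  by (rule matrix_inv_unique) (simp add: em_mult matrix_inv_mult invertible_det_nz)

lemma trace_em: "trace (em A) = trace A"
  unfolding em_def trace_mul_sym[of "P ** A"] by (simp add: matrix_mul_assoc PP)

lemma linear_em: "linear em"
  by (rule linearI) (simp_all add: em_def vec_eq_iff matrix_matrix_mult_def scaleR_sum_right sum.distrib algebra_simps sum_distrib_left sum_distrib_right)

lemma em_uminus: "em (- A) = - em A" using linear_em by (rule linear_neg)
lemma em_scaleR: "em (r *\<^sub>R A) = r *\<^sub>R em A" using linear_em by (rule linear_cmul)
lemma em_0 [simp]: "em 0 = 0" using linear_em by (rule linear_0)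

lemma em_sl: "em Y \<in> sl \<longleftrightarrow> trace Y = 0" by (simp add: sl_def trace_em)

lemma trace_mstar: "trace (mstar Y) = scnj (trace Y)" by (simp add: trace_def scnj_sum)

text \<open>The adjoint for the form, expressed in the coordinates.\<close>

definition bstar :: "'k^'n^'n \<Rightarrow> 'k^'n^'n" where "bstar A = rdiag \<epsilon> ** mstar A ** rdiag \<epsilon>"

lemma eps_sq: "\<epsilon> i * \<epsilon> i = 1" using eps[of i] by (auto simp: abs_if split: if_splits)

lemma rdiag_eps_sq: "rdiag \<epsilon> ** rdiag \<epsilon> = (mat 1 :: 'k^'n^'n)"
  by (simp add: rdiag_mult eps_sq)

lemma det_eps_sq: "det (rdiag \<epsilon> :: 'k^'n^'n) * det (rdiag \<epsilon>) = (1 :: 'k)"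
  by (metis det_I det_mul rdiag_eps_sq)

lemma det_bstar: "det (bstar A) = scnj (det A)"
  using det_eps_sq by (simp add: bstar_def det_mul det_mstar mult_ac)

lemma bstar_adj: "sdot (rdiag \<epsilon> *v (A *v u)) v = sdot (rdiag \<epsilon> *v u) (bstar A *v v)"
proof -
  have "sdot (rdiag \<epsilon> *v (A *v u)) v = sdot u (mstar A *v (rdiag \<epsilon> *v v))"
    by (simp add: sdot_mult_left)
  also have "\<dots> = sdot u ((rdiag \<epsilon> ** rdiag \<epsilon>) *v (mstar A *v (rdiag \<epsilon> *v v)))"
    by (simp add: rdiag_eps_sq)
  also have "\<dots> = sdot (rdiag \<epsilon> *v u) (bstar A *v v)"
    by (simp add: sdot_mult_left bstar_def matrix_vector_mul_assoc matrix_mul_assoc)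
  finally show ?thesis .
qed

lemma bstar_mult: "bstar (A ** A') = bstar A' ** bstar A"
proof -
  have "bstar A' ** bstar A = rdiag \<epsilon> ** mstar A' ** (rdiag \<epsilon> ** rdiag \<epsilon>) ** mstar A ** rdiag \<epsilon>"
    unfolding bstar_def by (simp only: matrix_mul_assoc)
  then show ?thesis by (simp add: rdiag_eps_sq bstar_def mstar_mult matrix_mul_assoc)
qed

lemma adj_em: "adj B (em A) = em (bstar A)"
  unfolding adj_def
proof (rule the_equality)
  have BP: "B u v = sdot (rdiag \<epsilon> *v (matrix_inv P *v u)) (matrix_inv P *v v)" for u v
    using B[of "matrix_inv P *v u" "matrix_inv P *v v"] by (simp add: PPv)
  have emP: "matrix_inv P *v (em A *v u) = A *v (matrix_inv P *v u)" for A u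
    using em_vec[of A "matrix_inv P *v u"] by (metis PPv)
  show *: "\<forall>u v. B (em A *v u) v = B u (em (bstar A) *v v)"
    unfolding BP emP by (simp add: bstar_adj)
  \<comment> \<open>Uniqueness of the adjoint is nondegeneracy of the form:
    \<open>rdiag \<epsilon>\<close> is its own inverse, so every vector occurs as a left argument of
    \<open>sdot\<close>.\<close>
  fix T' assume T': "\<forall>u v. B (em A *v u) v = B u (T' *v v)"
  have "sdot (rdiag \<epsilon> *v u) (co T' *v w) = sdot (rdiag \<epsilon> *v u) (bstar A *v w)" for u w
  proof -
    have "B (P *v u) (em (co T') *v (P *v w)) = B (P *v u) (em (bstar A) *v (P *v w))"
      using T' * by (simp add: em_co)
    then show ?thesis unfolding em_vec B .
  qed
  then have "sdot (co T' *v w) (rdiag \<epsilon> *v (rdiag \<epsilon> *v u)) = sdot (bstar A *v w) (rdiag \<epsilon> *v (rdiag \<epsilon> *v u))" for u w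
    using sdot_scnj by metis
  then have "co T' = bstar A"
    by (intro matrix_eqI_sdot) (simp add: matrix_vector_mul_assoc rdiag_eps_sq)
  then show "T' = em (bstar A)" by (metis em_co)
qed

lemma adj_co: "adj B A = em (bstar (co A))"
  using adj_em[of "co A"] by simp

end

text \<open>Adds that \<open>\<tau>\<close> is minus the conjugate transpose in the same
  coordinates, so that the columns of \<open>P\<close> are orthonormal for an inner product in the
  class of \<open>\<tau>\<close>.\<close>

locale coords = form_coords P B \<epsilon> for P :: "'k::scalar_rc^'n^'n" and B
    and \<tau> :: "'k^'n^'n \<Rightarrow> 'k^'n^'n" and \<epsilon> +
  assumes tau: "X \<in> sl \<Longrightarrow> \<tau> X = - (P ** mstar (matrix_inv P ** X ** P) ** matrix_inv P)"
    and card_ge2: "CARD('n) \<ge> 2"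
begin

lemma tau_em: "em Y \<in> sl \<Longrightarrow> \<tau> (em Y) = - em (mstar Y)"
  using co_em[of Y] by (simp add: tau em_def[of "mstar Y"] co_def)

section \<open>The groups K and H in coordinates\<close>

lemma sigma_cl:
  assumes "det A = 1"
  shows "sigma_o B (cl (em A)) = cl (em (matrix_inv (bstar A)))"
proof -
  have detb: "det (bstar A) = 1" using assms by (simp add: det_bstar)
  \<comment> \<open>The scalars in the coset are roots of unity, so conjugation followed by
    inversion leaves them unchanged and cosets go to cosets.\<close>
  have "matrix_inv (adj B (mat c ** em A)) = mat c ** em (matrix_inv (bstar A))" if c: "c ^ CARD('n) = 1" for c
  proof -
    have nc: "norm c = 1" using norm_root_of_unity[OF c] by simp
    have "mat c ** em A = em (mat c ** A)" by (simp add: em_mult[symmetric] em_mat)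
    then have "adj B (mat c ** em A) = em (bstar (mat c ** A))" by (simp add: adj_em)
    also have "bstar (mat c ** A) = mat (scnj c) ** bstar A"
      by (simp add: bstar_def mstar_mult mstar_mat mat_commute) (metis mat_commute matrix_mul_assoc)
    also have "em \<dots> = mat (scnj c) ** em (bstar A)" by (simp add: em_mult[symmetric] em_mat)
    finally have "matrix_inv (adj B (mat c ** em A)) = mat (inverse (scnj c)) ** matrix_inv (em (bstar A))"
      using nc by (simp add: matrix_inv_mat_mult detb) (metis detb det_em matrix_inv_mat_mult norm_zero scnj_eq_0 zero_neq_one)
    moreover have "inverse (scnj c) = c"
      using mult_scnj'[of c] nc by (intro inverse_unique) (simp add: mult.commute)
    ultimately show ?thesis by (simp add: inv_em detb)
  qed
  then show ?thesis unfolding sigma_o_def cl_eq[of "em A"] cl_eq[of "em (matrix_inv _)"] 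
    by (simp add: setcompr_eq_image image_image cong: image_cong_simp)
qed

lemma sigma_inv_mult:
  assumes "det A = 1"
  shows "sigma_o B (inv\<^bsub>PSL\<^esub> (cl (em A))) \<otimes>\<^bsub>PSL\<^esub> cl (em A) = cl (em (bstar A ** A))"
proof -
  have iA: "invertible A" using assms by (simp add: invertible_det_nz)
  have "bstar (matrix_inv A) ** bstar A = mat 1"
    by (simp add: bstar_mult[symmetric] matrix_inv_mult[OF iA]) (simp add: bstar_def rdiag_eps_sq)
  then have "matrix_inv (bstar (matrix_inv A)) = bstar A" by (rule matrix_inv_unique)
  then have "sigma_o B (inv\<^bsub>PSL\<^esub> (cl (em A))) = cl (em (bstar A))"
    using assms det_matrix_inv[OF assms] by (simp add: cl_inv inv_em sigma_cl)
  then show ?thesis using assms by (simp add: cl_mult det_bstar em_mult)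
qed

text \<open>If conjugation by \<open>U\<close> commutes with \<open>\<tau>\<close>, then
  \<open>mstar U ** U\<close> commutes with \<open>sl\<close> and is a scalar. The scalar is a
  nonnegative real because the matrix is a Gram matrix, and a root of unity because the determinant
  is one; hence it is \<open>1\<close>.\<close>

lemma K_group_eq: "K_group \<tau> = {cl (em U) |U. unitary U \<and> det U = 1}"
proof (intro equalityI subsetI)
  fix g assume "g \<in> {cl (em U) |U. unitary U \<and> det U = 1}"
  then obtain U where U: "unitary U" "det U = 1" "g = cl (em U)" by blast
  have inv: "matrix_inv (em U) = em (mstar U)"
    using U by (intro matrix_inv_unique) (simp add: em_mult unitary_right)
  have "Ad g (\<tau> X) = \<tau> (Ad g X)" if "X \<in> sl" for X
  proof -
    obtain Y where Y: "X = em Y" by (metis em_co)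
    have t: "trace (U ** Y ** mstar U) = 0"
      using that U unfolding Y em_sl
      by (subst trace_mul_sym) (simp add: matrix_mul_assoc unitary_def)
    have "Ad g (\<tau> X) = em U ** (- em (mstar Y)) ** em (mstar U)"
      using U that by (simp add: Ad_cl inv tau_em Y)
    also have "\<dots> = - em (U ** mstar Y ** mstar U)"
      by (simp add: em_uminus[symmetric] em_mult) (simp add: em_def vec_eq_iff matrix_matrix_mult_def sum_negf)
    also have "\<dots> = \<tau> (em (U ** Y ** mstar U))"
      using t by (simp add: tau_em em_sl mstar_mult matrix_mul_assoc)
    also have "em (U ** Y ** mstar U) = Ad g X" using U by (simp add: Ad_cl inv Y em_mult)
    finally show ?thesis .
  qed
  then show "g \<in> K_group \<tau>" using U by (simp add: K_group_def cl_carrier)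
next
  fix g assume g: "g \<in> K_group \<tau>"
  then obtain A where A: "det A = 1" "g = cl A" by (auto simp: K_group_def carrier_PSL)
  define U where "U = co A"
  have AU: "A = em U" and detU: "det U = 1" using A det_em[of "co A"] by (simp_all add: U_def)
  define V where "V = matrix_inv U"
  have iU: "invertible U" using detU by (simp add: invertible_det_nz)
  have UV: "U ** V = mat 1" "V ** U = mat 1" using matrix_inv_mult[OF iU] by (simp_all add: V_def)
  have "(mstar U ** U) ** Z = Z ** (mstar U ** U)" if "Z \<in> sl" for Z
  proof -
    define Y where "Y = mstar Z"
    have tY: "trace Y = 0" using that by (simp add: Y_def trace_mstar sl_def)
    have "trace (U ** Y ** V) = trace (V ** (U ** Y))" by (rule trace_mul_sym)
    then have t: "trace (U ** Y ** V) = 0" using tY by (simp add: matrix_mul_assoc UV)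
    have Ad: "Ad g (em Y) = em (U ** Y ** V)" for Y
      using A(1) detU by (simp add: A(2) AU Ad_cl inv_em em_mult V_def)
    have "Ad g (\<tau> (em Y)) = \<tau> (Ad g (em Y))" using g tY by (simp add: K_group_def em_sl)
    moreover have "\<tau> (em Y) = em (- mstar Y)" using tY by (simp add: tau_em em_sl em_uminus)
    moreover have "\<tau> (em (U ** Y ** V)) = em (- mstar (U ** Y ** V))" using t by (simp add: tau_em em_sl em_uminus)
    ultimately have "U ** (- mstar Y) ** V = - mstar (U ** Y ** V)" by (simp only: Ad em_inject)
    then have "U ** Z ** V = mstar V ** Z ** mstar U"
      by (simp add: Y_def mstar_mult matrix_mul_assoc) (simp add: vec_eq_iff matrix_matrix_mult_def sum_negf)
    then have "mstar U ** (U ** Z ** V) ** U = mstar U ** (mstar V ** Z ** mstar U) ** U" by simp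
    moreover have "mstar U ** (U ** Z ** V) ** U = (mstar U ** U) ** Z ** (V ** U)" by (simp only: matrix_mul_assoc)
    moreover have "mstar U ** (mstar V ** Z ** mstar U) ** U = mstar (V ** U) ** Z ** (mstar U ** U)"
      by (simp only: matrix_mul_assoc mstar_mult)
    ultimately show ?thesis by (simp add: UV)
  qed
  then obtain c where c: "mstar U ** U = mat c" using commutes_sl_scalar card_ge2 by blast
  have cn: "c ^ CARD('n) = 1" using arg_cong[OF c, of det] by (simp add: det_mul det_mstar detU det_mat)
  fix i :: 'n
  have "c = mat c $ i $ i" by (simp add: mat_def)
  also have "\<dots> = (mstar U ** mat 1 ** U) $ i $ i" by (simp add: c)
  also have "\<dots> = of_real ((norm (U *v axis i 1))\<^sup>2)" unfolding conj_entry by (simp add: sdot_self)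
  finally have "c = of_real (norm c)" by (metis abs_of_nonneg norm_of_real zero_le_power2)
  then have "c = 1" using norm_root_of_unity[OF cn] by simp
  then have "unitary U" using c by (simp add: unitary_def)
  then show "g \<in> {cl (em U) |U. unitary U \<and> det U = 1}" using A AU detU by blast
qed

text \<open>The definition allows an isometry times a scalar. The isometry and the representative
  have determinants of modulus one, so the scalar has modulus one and can be absorbed in the
  isometry.\<close>

lemma isometry_group_eq: "isometry_group B = {cl (em T) |T. det T = 1 \<and> mstar T ** rdiag \<epsilon> ** T = rdiag \<epsilon>}"
proof -
  have iso: "(\<forall>u v. B (em T *v u) (em T *v v) = B u v) \<longleftrightarrow> mstar T ** rdiag \<epsilon> ** T = rdiag \<epsilon>" for T
  proof -
    have "(\<forall>u v. B (em T *v u) (em T *v v) = B u v) \<longleftrightarrow>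
        (\<forall>u v. B (em T *v (P *v u)) (em T *v (P *v v)) = B (P *v u) (P *v v))"
      by (metis PPv(2))
    also have "\<dots> \<longleftrightarrow> (\<forall>u v. sdot ((mstar T ** rdiag \<epsilon> ** T) *v u) v = sdot (rdiag \<epsilon> *v u) v)"
      unfolding em_vec B by (simp add: matrix_vector_mul_assoc[symmetric] sdot_mult_left[of "mstar T"])
    also have "\<dots> \<longleftrightarrow> mstar T ** rdiag \<epsilon> ** T = rdiag \<epsilon>" using matrix_eqI_sdot by metis
    finally show ?thesis .
  qed
  show ?thesis
  proof (intro equalityI subsetI)
    fix g assume "g \<in> isometry_group B"
    then obtain A T c where g: "g \<in> carrier PSL" "A \<in> g" and T: "\<forall>u v. B (T *v u) (T *v v) = B u v" "A = mat c ** T"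
      unfolding isometry_group_def by blast
    obtain A0 c0 where A0: "det A0 = 1" "g = cl A0" "c0 ^ CARD('n) = 1" "A = mat c0 ** A0"
      using g by (auto simp: carrier_PSL cl_eq)
    have gA: "g = cl A" using A0 by (simp add: cl_scalar)
    have detA: "det A = 1" using A0 by (simp add: det_mul det_mat)
    define T' where "T' = co T"
    have T': "mstar T' ** rdiag \<epsilon> ** T' = rdiag \<epsilon>" using T(1) iso[of T'] by (simp add: T'_def)
    have "of_real ((norm (det T'))\<^sup>2) * det (rdiag \<epsilon> :: 'k^'n^'n) = det (rdiag \<epsilon>)"
      using arg_cong[OF T', of det] by (simp only: det_conj)
    moreover have "det (rdiag \<epsilon> :: 'k^'n^'n) \<noteq> 0" using det_eps_sq by auto
    ultimately have "of_real ((norm (det T'))\<^sup>2) = (1::'k)" by simp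
    then have "(norm (det T'))\<^sup>2 = 1" using of_real_eq_1_iff by blast
    then have nT: "norm (det T') = 1" using norm_ge_zero[of "det T'"] by (simp add: power2_eq_1_iff)
    have "1 = norm (det A)" by (simp add: detA)
    also have "\<dots> = norm c ^ CARD('n)"
      using nT det_em[of T'] by (simp add: T(2) det_mul det_mat norm_mult norm_power T'_def)
    finally have "norm c ^ CARD('n) = 1 ^ CARD('n)" by simp
    then have nc: "norm c = 1" by (rule power_eq_imp_eq_base) simp_all
    have "mstar (mat c ** T') ** rdiag \<epsilon> ** (mat c ** T') = mstar T' ** (mat (scnj c) ** rdiag \<epsilon> ** mat c) ** T'"
      by (simp only: mstar_mult mstar_mat matrix_mul_assoc)
    moreover have "mat (scnj c) ** rdiag \<epsilon> ** mat c = (rdiag \<epsilon> :: 'k^'n^'n)"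
    proof -
      have "c * scnj c = 1" using mult_scnj'[of c] nc by simp
      then have "c * (scnj c * y) = y" for y by (simp only: mult.assoc[symmetric] mult_1_left)
      then show ?thesis by (simp only: vec_eq_iff mat_mult_nth simp_thms)
    qed
    ultimately have "mstar (mat c ** T') ** rdiag \<epsilon> ** (mat c ** T') = rdiag \<epsilon>" using T' by simp
    moreover have AT: "A = em (mat c ** T')" by (simp add: T(2) em_mult[symmetric] em_mat T'_def)
    moreover have "det (mat c ** T') = 1" using detA unfolding AT by simp
    ultimately show "g \<in> {cl (em T) |T. det T = 1 \<and> mstar T ** rdiag \<epsilon> ** T = rdiag \<epsilon>}"
      using gA by blast
  next
    fix g assume "g \<in> {cl (em T) |T. det T = 1 \<and> mstar T ** rdiag \<epsilon> ** T = rdiag \<epsilon>}"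
    then obtain T where T: "det T = 1" "mstar T ** rdiag \<epsilon> ** T = rdiag \<epsilon>" "g = cl (em T)" by blast
    then have "(\<forall>u v. B (em T *v u) (em T *v v) = B u v) \<and> em T = mat 1 ** em T" using iso[of T] by simp
    moreover have "g \<in> carrier PSL" using T by (simp add: cl_carrier)
    ultimately show "g \<in> isometry_group B"
      unfolding isometry_group_def T(3) using mem_cl[of "em T"] by blast
  qed
qed

section \<open>The diagonal subalgebra and its lines\<close>

definition dg :: "('n \<Rightarrow> real) \<Rightarrow> 'k^'n^'n" where "dg x = em (rdiag x)"

definition line :: "'n \<Rightarrow> ('k^'n) set" where "line i = vec.span {P *v axis i 1}"

definition bsp :: "('k^'n^'n) set" where "bsp = {dg x |x. sum x UNIV = 0}"

lemma dg_inject: "dg x = dg y \<longleftrightarrow> x = y" by (simp add: dg_def em_inject rdiag_inject)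

lemma line_eq: "line i = {P *v (c *s axis i 1) |c. True}"
  unfolding line_def vec.span_singleton by (auto simp: vector_scalar_commute)

lemma axis_in_line: "P *v axis i 1 \<in> line i" unfolding line_def by (rule vec.span_base) simp

lemma P_axis_nz: "P *v axis i 1 \<noteq> 0"
proof
  assume "P *v axis i 1 = 0"
  then have "P *v axis i 1 = P *v 0" by simp
  then have "axis i (1::'k) = 0" by (rule injD[OF inj_mult_vec[OF P]])
  then show False by (simp add: axis_eq_0_iff)
qed

lemma line_inject: "line i = line j \<longleftrightarrow> i = j"
proof
  assume "line i = line j"
  then obtain c where "P *v axis i 1 = P *v (c *s axis j 1)" using axis_in_line[of i] by (auto simp: line_eq)
  then have "axis i 1 = c *s axis j (1::'k)" using inj_mult_vec[OF P] by (simp add: inj_eq)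
  then have "axis i (1::'k) $ i = (c *s axis j 1) $ i" by simp
  then show "i = j" by (auto simp: axis_def split: if_splits)
qed simp

lemma dg_vec: "dg x *v (P *v axis i 1) = x i *\<^sub>R (P *v axis i 1)"
proof -
  have "rdiag x *v axis i 1 = x i *\<^sub>R axis i (1::'k)"
    by (auto simp: vec_eq_iff rdiag_def diagm_mult_vec_nth axis_def scaleR_conv_of_real[where 'a='k])
  then show ?thesis by (simp add: dg_def em_vec scaleR_mult_vec)
qed

lemma dg_line: "v \<in> line i \<Longrightarrow> dg x *v v = x i *\<^sub>R v"
  by (auto simp: line_eq vector_scalar_commute dg_vec scaleR_vec mult.commute)

lemma eigval_dg [simp]: "eigval (line i) (dg x) = x i"
  unfolding eigval_def
proof (rule the_equality)
  fix r :: real assume "\<forall>v\<in>line i. dg x *v v = r *\<^sub>R v"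
  then have "x i *\<^sub>R (P *v axis i 1) = r *\<^sub>R (P *v axis i 1)" using axis_in_line[of i] dg_vec by metis
  then show "r = x i" using P_axis_nz[of i] by simp
qed (simp add: dg_line)

lemma trace_rdiag: "trace (rdiag x :: 'k^'n^'n) = of_real (sum x UNIV)"
  by (simp add: trace_def rdiag_def diagm_nth)

lemma dg_sl: "dg x \<in> sl \<longleftrightarrow> sum x UNIV = 0"
  unfolding dg_def em_sl trace_rdiag of_real_eq_0_iff ..

lemma real_diagonal_lines: "real_diagonal (range line) = bsp"
proof (intro equalityI subsetI)
  fix X assume "X \<in> real_diagonal (range line)"
  then have X: "X \<in> sl" "\<And>i. \<exists>r::real. \<forall>v\<in>line i. X *v v = r *\<^sub>R v" by (auto simp: real_diagonal_def)
  then obtain x where x: "\<And>i v. v \<in> line i \<Longrightarrow> X *v v = x i *\<^sub>R v" by metis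
  have "(X ** P) *v axis i 1 = (dg x ** P) *v axis i 1" for i
    using x[OF axis_in_line[of i]] by (simp add: matrix_vector_mul_assoc[symmetric] dg_vec)
  then have "X ** P = dg x ** P" by (metis mult_axis_nth vec_eq_iff)
  then have "X ** P ** matrix_inv P = dg x ** P ** matrix_inv P" by simp
  then have "X = dg x" by (simp add: matrix_mul_assoc[symmetric] PP)
  then show "X \<in> bsp" using X(1) by (auto simp: bsp_def dg_sl)
next
  fix X assume "X \<in> bsp"
  then show "X \<in> real_diagonal (range line)" by (auto simp: bsp_def real_diagonal_def dg_sl dg_line)
qed

lemma linear_dg_vec: "linear (\<lambda>y :: real^'n. dg (\<lambda>i. y $ i))"
  unfolding dg_def
  by (rule linear_compose[OF _ linear_em, unfolded o_def], rule linearI)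
     (simp_all add: vec_eq_iff rdiag_def diagm_nth scaleR_conv_of_real[where 'a='k])

lemma dg_scaleR: "dg (\<lambda>i. r * x i) = r *\<^sub>R dg x"
  using linear_cmul[OF linear_dg_vec, of r "\<chi> i. x i"] by simp

lemma dg_uminus: "dg (\<lambda>i. - x i) = - dg x"
  using linear_neg[OF linear_dg_vec, of "\<chi> i. x i"] by simp

lemma tendsto_dg:
  assumes "\<And>i. ((\<lambda>n. f n i) \<longlongrightarrow> x i) F"
  shows "((\<lambda>n. dg (f n)) \<longlongrightarrow> dg x) F"
proof -
  have "((\<lambda>n. \<chi> i. f n i) \<longlongrightarrow> (\<chi> i. x i)) F" by (intro tendsto_vec_lambda assms)
  then have "((\<lambda>n. dg (\<lambda>i. (\<chi> i. f n i) $ i)) \<longlongrightarrow> dg (\<lambda>i. (\<chi> i. x i) $ i)) F"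
    using linear_conv_bounded_linear linear_dg_vec bounded_linear.tendsto by blast
  then show ?thesis by simp
qed

lemma mat_exp_dg: "mat_exp (dg x) = dg (\<lambda>i. exp (x i))"
proof -
  have pow: "((**) (dg x) ^^ k) (mat 1) = dg (\<lambda>i. x i ^ k)" for k
    by (induction k) (simp_all add: dg_def em_mult rdiag_mult)
  have "(\<lambda>n. \<Sum>k<n. dg (\<lambda>i. x i ^ k) /\<^sub>R fact k) \<longlonglongrightarrow> dg (\<lambda>i. exp (x i))"
  proof -
    have "(\<Sum>k<n. dg (\<lambda>i. x i ^ k) /\<^sub>R fact k) = dg (\<lambda>i. \<Sum>k<n. x i ^ k /\<^sub>R fact k)" for n
    proof -
      have "(\<Sum>k<n. dg (\<lambda>i. x i ^ k) /\<^sub>R fact k) = (\<Sum>k<n. dg (\<lambda>i. (\<chi> i. x i ^ k /\<^sub>R fact k) $ i))"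
        by (simp add: dg_scaleR[symmetric])
      also have "\<dots> = dg (\<lambda>i. (\<Sum>k<n. (\<chi> i. x i ^ k /\<^sub>R fact k)) $ i)"
        by (rule linear_sum[OF linear_dg_vec, symmetric])
      finally show ?thesis by simp
    qed
    moreover have "(\<lambda>n. \<Sum>k<n. x i ^ k /\<^sub>R fact k) \<longlonglongrightarrow> exp (x i)" for i
      using exp_converges[of "x i"] by (simp add: sums_def)
    ultimately show ?thesis by (simp only:) (rule tendsto_dg)
  qed
  then show ?thesis unfolding mat_exp_def pow by (intro sums_unique[symmetric]) (simp add: sums_def)
qed

lemma PSL_exp_dg: "PSL_exp (dg x) = cl (em (rdiag (\<lambda>i. exp (x i))))"
  by (simp only: PSL_exp_def mat_exp_dg) (simp only: cl_def dg_def)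

lemma det_exp: "sum x UNIV = 0 \<Longrightarrow> det (rdiag (\<lambda>i. exp (x i)) :: 'k^'n^'n) = 1"
  by (simp add: det_rdiag exp_sum[symmetric] del: of_real_prod)

end

section \<open>Roots and chambers\<close>

lemma matrix_diff_mult:
  fixes A B C :: "'k::scalar_rc^'n^'n"
  shows "A ** (B - C) = A ** B - A ** C" "(B - C) ** A = B ** A - C ** A"
  by (simp_all add: vec_eq_iff matrix_matrix_mult_def sum_subtractf right_diff_distrib left_diff_distrib)

text \<open>With \<open>H = A - mat 1\<close> the remainder is
  \<open>matrix_inv A ** (H ** H)\<close>, and \<open>matrix_inv A\<close> stays bounded near the
  identity.\<close>

lemma matrix_inv_derivative:
  "((\<lambda>A :: 'k::scalar_rc^'n^'n. matrix_inv A) has_derivative uminus) (at (mat 1))"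
proof -
  have "bilinear (\<lambda>(A :: 'k^'n^'n) (A' :: 'k^'n^'n). A ** A')"
    unfolding bilinear_def
    by (intro conjI allI linearI)
       (simp_all add: vec_eq_iff matrix_matrix_mult_def sum.distrib distrib_left distrib_right scaleR_sum_right)
  then have "bounded_bilinear (\<lambda>(A :: 'k^'n^'n) (A' :: 'k^'n^'n). A ** A')"
    by (simp add: bilinear_conv_bounded_bilinear)
  then obtain K where K: "K > 0" "\<And>(A :: 'k^'n^'n) (A' :: 'k^'n^'n). norm (A ** A') \<le> norm A * norm A' * K"
    using bounded_bilinear.pos_bounded by blast
  let ?I = "mat 1 :: 'k^'n^'n"
  have "eventually (\<lambda>A :: 'k^'n^'n. A \<in> {A. invertible A}) (nhds ?I)"
    by (rule eventually_nhds_in_open[OF open_invertible]) (simp add: invertible_det_nz)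
  then have inv: "eventually (\<lambda>A :: 'k^'n^'n. invertible A) (at ?I)"
    by (simp add: eventually_at_filter eventually_mono)
  have small: "eventually (\<lambda>A :: 'k^'n^'n. norm (A - ?I) * K \<le> 1/2) (at ?I)"
  proof -
    have "((\<lambda>A :: 'k^'n^'n. norm (A - ?I) * K) \<longlongrightarrow> norm (?I - ?I) * K) (at ?I)" by (intro tendsto_intros)
    then have "eventually (\<lambda>A :: 'k^'n^'n. norm (A - ?I) * K < 1/2) (at ?I)" by (rule order_tendstoD) simp
    then show ?thesis by (rule eventually_mono) simp
  qed
  have bound: "norm (matrix_inv A - ?I + (A - ?I)) \<le> 2 * K * K * norm ?I * (norm (A - ?I))\<^sup>2"
    if "invertible A" "norm (A - ?I) * K \<le> 1/2" for A :: "'k^'n^'n"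
  proof -
    let ?H = "A - ?I"
    note i = matrix_inv_mult[OF that(1)]
    have "matrix_inv A = ?I - matrix_inv A ** ?H"
      by (simp add: matrix_diff_mult i)
    then have "norm (matrix_inv A) \<le> norm ?I + norm (matrix_inv A ** ?H)"
      by (metis norm_triangle_ineq4)
    also have "norm (matrix_inv A ** ?H) \<le> norm (matrix_inv A) * (norm ?H * K)"
      using K(2)[of "matrix_inv A" ?H] by (simp add: mult.assoc)
    also have "\<dots> \<le> norm (matrix_inv A) * (1/2)" by (rule mult_left_mono[OF that(2)]) simp
    finally have n: "norm (matrix_inv A) \<le> 2 * norm ?I" by simp
    have h: "matrix_inv A ** ?H = ?I - matrix_inv A" by (simp add: matrix_diff_mult i)
    have "matrix_inv A ** (?H ** ?H) = (matrix_inv A ** ?H) ** ?H" by (simp only: matrix_mul_assoc)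
    also have "\<dots> = ?H - matrix_inv A ** ?H" by (simp only: h matrix_diff_mult(2) matrix_mul_lid)
    also have "\<dots> = matrix_inv A - ?I + ?H" unfolding h by simp
    finally have "matrix_inv A - ?I + ?H = matrix_inv A ** (?H ** ?H)" ..
    then have "norm (matrix_inv A - ?I + ?H) \<le> norm (matrix_inv A) * norm (?H ** ?H) * K"
      using K(2)[of "matrix_inv A" "?H ** ?H"] by simp
    also have "\<dots> \<le> (2 * norm ?I) * (norm ?H * norm ?H * K) * K"
      using n K by (intro mult_mono mult_nonneg_nonneg) auto
    finally show ?thesis by (simp add: power2_eq_square mult_ac)
  qed
  show ?thesis
    unfolding has_derivative_at_within
  proof (intro conjI)
    show "bounded_linear (uminus :: 'k^'n^'n \<Rightarrow> _)" by (rule bounded_linear_minus[OF bounded_linear_ident])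
    let ?c = "2 * K * K * norm ?I"
    have lim: "((\<lambda>A :: 'k^'n^'n. ?c * norm (A - ?I)) \<longlongrightarrow> 0) (at ?I)"
    proof -
      have "((\<lambda>A :: 'k^'n^'n. ?c * norm (A - ?I)) \<longlongrightarrow> ?c * norm (?I - ?I)) (at ?I)" by (intro tendsto_intros)
      then show ?thesis by simp
    qed
    show "((\<lambda>A. (matrix_inv A - matrix_inv ?I - - (A - ?I)) /\<^sub>R norm (A - ?I)) \<longlongrightarrow> 0) (at ?I)"
    proof (rule Lim_null_comparison[OF _ lim])
      have I: "matrix_inv ?I = ?I" by (rule matrix_inv_unique) simp
      show "eventually (\<lambda>A. norm ((matrix_inv A - matrix_inv ?I - - (A - ?I)) /\<^sub>R norm (A - ?I)) \<le> ?c * norm (A - ?I)) (at ?I)"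
        using inv small
      proof eventually_elim
        case (elim A)
        have e: "norm ((matrix_inv A - matrix_inv ?I - - (A - ?I)) /\<^sub>R norm (A - ?I)) =
            norm (matrix_inv A - ?I + (A - ?I)) / norm (A - ?I)"
          by (simp add: I divide_inverse mult.commute)
        show ?case
        proof (cases "norm (A - ?I) = 0")
          case False
          then show ?thesis unfolding e using bound[OF elim] by (simp add: divide_le_eq power2_eq_square mult.assoc)
        qed (simp add: e)
      qed
    qed
  qed
qed

context form_coords
begin

text \<open>Taking adjoints is real linear, hence its own derivative, and the chain rule leaves only
  the derivative of the inversion at the identity.\<close>

lemma dsigma_eq: "dsigma B X = - em (bstar (co X))"
proof -
  have "linear bstar"
    by (rule linearI)
       (simp_all add: vec_eq_iff bstar_def rdiag_def diagm_mult_left_nth diagm_mult_right_nth scnj_add distrib_left distrib_right)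
  moreover have "linear co"
    by (rule linearI)
       (simp_all add: vec_eq_iff co_def matrix_matrix_mult_def sum.distrib distrib_left distrib_right scaleR_sum_right
         sum_distrib_right)
  ultimately have lin: "linear (\<lambda>A. em (bstar (co A)))"
    using linear_compose[of co bstar] linear_compose[OF _ linear_em, of "bstar \<circ> co"] by (simp add: o_def)
  have 1: "em (bstar (co (mat 1))) = mat 1"
    by (simp add: co_def matrix_mul_assoc[symmetric] PP bstar_def rdiag_eps_sq)
  have "((\<lambda>A. em (bstar (co A))) has_derivative (\<lambda>A. em (bstar (co A)))) (at (mat 1))"
    by (rule linear_imp_has_derivative[OF lin])
  moreover have "((\<lambda>A. matrix_inv A) has_derivative uminus) (at (em (bstar (co (mat 1)))))"
    unfolding 1 by (rule matrix_inv_derivative)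
  ultimately have "((\<lambda>A. matrix_inv (em (bstar (co A)))) has_derivative (\<lambda>A. - em (bstar (co A)))) (at (mat 1))"
    by (rule has_derivative_compose)
  then have "frechet_derivative (\<lambda>A. matrix_inv (em (bstar (co A)))) (at (mat 1)) = (\<lambda>A. - em (bstar (co A)))"
    by (rule frechet_derivative_at[symmetric])
  then show ?thesis unfolding dsigma_def adj_co by simp
qed

end

context coords
begin

text \<open>In the coordinates the composite of the two involutions is conjugation by
  \<open>rdiag \<epsilon>\<close>, which multiplies the entry \<open>(i, j)\<close> by
  \<open>\<epsilon> i * \<epsilon> j\<close>.\<close>

lemma fixed_subalgebra_eq:
  "fixed_subalgebra \<tau> B = {em Y |Y. trace Y = 0 \<and> (\<forall>i j. Y $ i $ j \<noteq> 0 \<longrightarrow> \<epsilon> i = \<epsilon> j)}"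
proof -
  have fixY: "\<tau> (dsigma B (em Y)) = em Y \<longleftrightarrow> (\<forall>i j. Y $ i $ j \<noteq> 0 \<longrightarrow> \<epsilon> i = \<epsilon> j)" if Y: "trace Y = 0" for Y
  proof -
    have "trace (bstar Y) = trace (mstar Y ** (rdiag \<epsilon> ** rdiag \<epsilon>))"
      unfolding bstar_def by (subst trace_mul_sym) (simp add: matrix_mul_assoc trace_mul_sym[of _ "rdiag \<epsilon>"])
    then have "trace (bstar Y) = 0" using Y by (simp add: rdiag_eps_sq trace_mstar)
    then have t: "trace (- bstar Y) = 0" by (simp add: trace_def sum_negf)
    have "\<tau> (dsigma B (em Y)) = \<tau> (em (- bstar Y))" by (simp add: dsigma_eq em_uminus)
    also have "\<dots> = em (mstar (bstar Y))"
    proof -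
      have "- mstar (- bstar Y) = mstar (bstar Y)" by (simp add: vec_eq_iff)
      then show ?thesis using t by (simp only: tau_em em_sl em_uminus[symmetric])
    qed
    also have "mstar (bstar Y) = rdiag \<epsilon> ** Y ** rdiag \<epsilon>" by (simp add: bstar_def mstar_mult matrix_mul_assoc)
    finally have "\<tau> (dsigma B (em Y)) = em Y \<longleftrightarrow> (\<forall>i j. of_real (\<epsilon> i * \<epsilon> j) * Y $ i $ j = Y $ i $ j)"
      by (simp only: em_inject) (simp add: vec_eq_iff rdiag_def diagm_mult_left_nth diagm_mult_right_nth mult_ac)
    also have "\<dots> \<longleftrightarrow> (\<forall>i j. Y $ i $ j \<noteq> 0 \<longrightarrow> \<epsilon> i * \<epsilon> j = 1)"
      by (metis mult_cancel_right1 of_real_1 of_real_eq_iff mult_1_left)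
    also have "\<dots> \<longleftrightarrow> (\<forall>i j. Y $ i $ j \<noteq> 0 \<longrightarrow> \<epsilon> i = \<epsilon> j)"
      using eps_sq by (metis mult.commute mult.left_commute mult.right_neutral)
    finally show ?thesis .
  qed
  show ?thesis
  proof (intro equalityI subsetI)
    fix X assume X: "X \<in> fixed_subalgebra \<tau> B"
    obtain Y where Y: "X = em Y" by (metis em_co)
    then show "X \<in> {em Y |Y. trace Y = 0 \<and> (\<forall>i j. Y $ i $ j \<noteq> 0 \<longrightarrow> \<epsilon> i = \<epsilon> j)}"
      using X fixY[of Y] by (auto simp: fixed_subalgebra_def em_sl)
  next
    fix X assume "X \<in> {em Y |Y. trace Y = 0 \<and> (\<forall>i j. Y $ i $ j \<noteq> 0 \<longrightarrow> \<epsilon> i = \<epsilon> j)}"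
    then show "X \<in> fixed_subalgebra \<tau> B" using fixY by (auto simp: fixed_subalgebra_def em_sl)
  qed
qed

definition root :: "'n \<Rightarrow> 'n \<Rightarrow> 'k^'n^'n \<Rightarrow> real" where
  "root i j = restrict (\<lambda>X. eigval (line i) X - eigval (line j) X) bsp"

lemma root_dg: "sum x UNIV = 0 \<Longrightarrow> root i j (dg x) = x i - x j"
  by (auto simp: root_def bsp_def)

lemma bracket_dg: "bracket (dg x) (em Y) = em (\<chi> i j. (x i - x j) *\<^sub>R Y $ i $ j)"
proof -
  have "bracket (dg x) (em Y) = em (rdiag x ** Y) - em (Y ** rdiag x)" by (simp add: bracket_def dg_def em_mult)
  also have "\<dots> = em (rdiag x ** Y - Y ** rdiag x)" by (rule linear_diff[OF linear_em, symmetric])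
  also have "rdiag x ** Y - Y ** rdiag x = (\<chi> i j. (x i - x j) *\<^sub>R Y $ i $ j)"
    by (simp add: vec_eq_iff rdiag_def diagm_mult_left_nth diagm_mult_right_nth scaleR_conv_of_real[where 'a='k] algebra_simps)
  finally show ?thesis .
qed

lemma separating: "i \<noteq> j \<Longrightarrow> \<exists>x::'n \<Rightarrow> real. sum x UNIV = 0 \<and> x i - x j \<noteq> 0" for i j :: 'n
proof (intro exI[of _ "\<lambda>k. (if k = i then 1 else 0) - (if k = j then 1 else 0)"] conjI)
  assume "i \<noteq> j"
  then show "(if i = i then 1 else 0) - (if i = j then 1 else 0) -
      ((if j = i then 1 else 0) - (if j = j then 1 else (0::real))) \<noteq> 0" by auto
qed (simp add: sum_subtractf)

text \<open>The relation \<open>R\<close> treats both root systems at once: always true for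
  \<open>sl\<close>, equality of signs for \<open>fixed_subalgebra\<close>. The bracket with
  \<open>dg x\<close> multiplies the entry \<open>(i, j)\<close> by \<open>x i - x j\<close>, so any
  nonzero entry of a common eigenvector reveals its weight.\<close>

lemma roots_eq:
  assumes L: "L = {em Y |Y. trace Y = 0 \<and> (\<forall>i j. Y $ i $ j \<noteq> 0 \<longrightarrow> R i j)}"
  shows "roots L bsp = {root i j |i j. i \<noteq> j \<and> R i j}"
proof (intro equalityI subsetI)
  fix \<alpha> assume "\<alpha> \<in> roots L bsp"
  then obtain Y where ext: "\<alpha> \<in> extensional bsp" and nz: "\<exists>X\<in>bsp. \<alpha> X \<noteq> 0" and Y: "em Y \<noteq> 0"
    "\<And>i j. Y $ i $ j \<noteq> 0 \<Longrightarrow> R i j" "\<And>X. X \<in> bsp \<Longrightarrow> bracket X (em Y) = \<alpha> X *\<^sub>R em Y"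
    unfolding roots_def L by blast
  have "Y \<noteq> 0" using Y(1) by auto
  then obtain i j where ij: "Y $ i $ j \<noteq> 0" by (auto simp: vec_eq_iff)
  have a: "\<alpha> (dg x) = x i - x j" if "sum x UNIV = 0" for x
  proof -
    have "em (\<chi> i j. (x i - x j) *\<^sub>R Y $ i $ j) = em (\<alpha> (dg x) *\<^sub>R Y)"
      using Y(3)[of "dg x"] that by (auto simp: bracket_dg em_scaleR bsp_def)
    then have "(x i - x j) *\<^sub>R Y $ i $ j = \<alpha> (dg x) *\<^sub>R Y $ i $ j"
      unfolding em_inject by (simp add: vec_eq_iff)
    then show ?thesis using ij by simp
  qed
  have "\<alpha> = root i j"
  proof
    fix X show "\<alpha> X = root i j X"
    proof (cases "X \<in> bsp")
      case True
      then show ?thesis using a by (auto simp: bsp_def root_def)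
    next
      case False
      then show ?thesis using ext by (simp add: root_def extensional_def)
    qed
  qed
  moreover have "i \<noteq> j" using nz a by (auto simp: bsp_def)
  ultimately show "\<alpha> \<in> {root i j |i j. i \<noteq> j \<and> R i j}" using Y(2)[OF ij] by blast
next
  fix \<alpha> assume "\<alpha> \<in> {root i j |i j. i \<noteq> j \<and> R i j}"
  then obtain i j where ij: "i \<noteq> j" "R i j" "\<alpha> = root i j" by blast
  obtain x :: "'n \<Rightarrow> real" where x: "sum x UNIV = 0" "x i - x j \<noteq> 0" using separating[OF ij(1)] by blast
  have "bracket X (em (munit i j)) = root i j X *\<^sub>R em (munit i j)" if "X \<in> bsp" for X
  proof -
    obtain y where y: "X = dg y" "sum y UNIV = 0" using \<open>X \<in> bsp\<close> by (auto simp: bsp_def)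
    have "(\<chi> a b. (y a - y b) *\<^sub>R munit i j $ a $ b) = (y i - y j) *\<^sub>R (munit i j :: 'k^'n^'n)"
      by (auto simp: vec_eq_iff munit_def)
    then show ?thesis using y by (simp add: bracket_dg root_dg em_scaleR)
  qed
  moreover have "em (munit i j) \<noteq> 0" using em_inject[of "munit i j" 0] by (auto simp: vec_eq_iff munit_def)
  moreover have "em (munit i j) \<in> L"
    unfolding L using ij munit_sl[OF ij(1)] by (auto simp: sl_def munit_def split: if_splits)
  moreover have "\<exists>X\<in>bsp. root i j X \<noteq> 0" using x by (intro bexI[of _ "dg x"]) (auto simp: root_dg bsp_def)
  moreover have "root i j \<in> extensional bsp" by (simp add: root_def)
  ultimately show "\<alpha> \<in> roots L bsp" unfolding roots_def ij(3) by blast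
qed

lemma sl_eq: "sl = {em Y |Y. trace Y = 0 \<and> (\<forall>i j. Y $ i $ j \<noteq> 0 \<longrightarrow> True)}"
  by (auto simp: em_sl) (metis em_co em_sl)

text \<open>Extends the eigenvalue on a line from \<open>bsp\<close> to a continuous function of all
  matrices, for the topological arguments.\<close>

definition coordf :: "'n \<Rightarrow> 'k^'n^'n \<Rightarrow> real" where "coordf i X = rp (co X $ i $ i)"

lemma coordf_dg [simp]: "coordf i (dg x) = x i"
  by (simp add: coordf_def dg_def rdiag_def diagm_nth)

lemma continuous_coordf [continuous_intros]: "continuous_on S f \<Longrightarrow> continuous_on S (\<lambda>X. coordf i (f X))"
  unfolding coordf_def co_def by (intro continuous_intros)

lemma bsp_coordf: "bsp = {X. dg (\<lambda>i. coordf i X) = X \<and> (\<Sum>i\<in>UNIV. coordf i X) = 0}"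
proof (intro equalityI subsetI)
  fix X assume "X \<in> {X. dg (\<lambda>i. coordf i X) = X \<and> (\<Sum>i\<in>UNIV. coordf i X) = 0}"
  then show "X \<in> bsp" unfolding bsp_def by (metis (mono_tags, lifting) mem_Collect_eq)
qed (auto simp: bsp_def)

lemma closed_bsp: "closed bsp"
proof -
  have "continuous_on UNIV (\<lambda>X. dg (\<lambda>i. coordf i X))"
  proof -
    have "continuous_on UNIV (\<lambda>X. if i = j then of_real (coordf i X) else (0::'k))" for i j
      by (cases "i = j") (auto intro!: continuous_intros)
    then show ?thesis
      unfolding dg_def em_def rdiag_def diagm_def by (intro continuous_intros)
  qed
  then show ?thesis unfolding bsp_coordf
    by (intro closed_Collect_conj closed_Collect_eq continuous_intros)
qed

definition cone :: "('n \<Rightarrow> 'n \<Rightarrow> bool) \<Rightarrow> ('k^'n^'n) set" where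
  "cone S = {dg x |x. sum x UNIV = 0 \<and> (\<forall>i j. S i j \<longrightarrow> x j \<le> x i)}"

text \<open>A component is connected and avoids the walls, so each root keeps on it the sign that it
  has at a base point \<open>x0\<close>; conversely the open cone given by these signs is convex and
  avoids the walls. The closed chamber is thus described by the order of the coordinates of
  \<open>x0\<close>.\<close>

lemma weyl_chamber_cone:
  assumes ch: "weyl_chamber {root i j |i j. i \<noteq> j \<and> R i j} bsp c" and sym: "\<And>i j. R i j \<Longrightarrow> R j i"
  obtains x0 :: "'n \<Rightarrow> real" where "sum x0 UNIV = 0" "\<And>i j. i \<noteq> j \<Longrightarrow> R i j \<Longrightarrow> x0 i \<noteq> x0 j"
    "c = cone (\<lambda>i j. R i j \<and> x0 j < x0 i)"
proof -
  define U where "U = bsp - (\<Union>\<alpha>\<in>{root i j |i j. i \<noteq> j \<and> R i j}. {X \<in> bsp. \<alpha> X = 0})"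
  have U: "U = {dg x |x. sum x UNIV = 0 \<and> (\<forall>i j. i \<noteq> j \<longrightarrow> R i j \<longrightarrow> x i \<noteq> x j)}"
  proof -
    have "dg x \<in> U \<longleftrightarrow> (\<forall>i j. i \<noteq> j \<longrightarrow> R i j \<longrightarrow> x i \<noteq> x j)" if x: "sum x UNIV = 0" for x
    proof -
      have "dg x \<in> bsp" using x by (auto simp: bsp_def)
      then have "dg x \<in> U \<longleftrightarrow> (\<forall>i j. i \<noteq> j \<longrightarrow> R i j \<longrightarrow> root i j (dg x) \<noteq> 0)"
        unfolding U_def by blast
      then show ?thesis using x by (simp add: root_dg)
    qed
    note iff = this
    show ?thesis
    proof (intro equalityI subsetI)
      fix X assume X: "X \<in> U"
      then have "X \<in> bsp" by (auto simp: U_def)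
      then obtain x where x: "X = dg x" "sum x UNIV = 0" by (auto simp: bsp_def)
      then show "X \<in> {dg x |x. sum x UNIV = 0 \<and> (\<forall>i j. i \<noteq> j \<longrightarrow> R i j \<longrightarrow> x i \<noteq> x j)}"
        using iff[OF x(2)] X x(2) unfolding x(1) mem_Collect_eq by (intro exI[of _ x]) simp
    next
      fix X assume "X \<in> {dg x |x. sum x UNIV = 0 \<and> (\<forall>i j. i \<noteq> j \<longrightarrow> R i j \<longrightarrow> x i \<noteq> x j)}"
      then obtain x where x: "X = dg x" "sum x UNIV = 0" "\<forall>i j. i \<noteq> j \<longrightarrow> R i j \<longrightarrow> x i \<noteq> x j" by blast
      then show "X \<in> U" using iff[OF x(2)] by simp
    qed
  qed
  obtain D where D: "D \<in> components U" "c = closure D" using ch by (auto simp: weyl_chamber_def U_def)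
  obtain X0 where X0: "X0 \<in> U" "D = connected_component_set U X0" using D(1) by (auto simp: components_iff)
  then obtain x0 where x0: "X0 = dg x0" "sum x0 UNIV = 0" "\<And>i j. i \<noteq> j \<Longrightarrow> R i j \<Longrightarrow> x0 i \<noteq> x0 j"
    unfolding U by blast
  define D' where "D' = {dg x |x. sum x UNIV = 0 \<and> (\<forall>i j. R i j \<and> x0 j < x0 i \<longrightarrow> x j < x i)}"
  have "D \<subseteq> D'"
  proof
    fix X assume X: "X \<in> D"
    have DU: "D \<subseteq> U" unfolding X0 by (rule connected_component_subset)
    then have "X \<in> U" using X by (rule subsetD)
    then obtain x where x: "X = dg x" "sum x UNIV = 0" unfolding U mem_Collect_eq by (elim exE conjE)
    have "x j < x i" if R: "R i j" "x0 j < x0 i" for i j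
    proof (rule ccontr)
      assume "\<not> x j < x i"
      let ?f = "\<lambda>X. coordf i X - coordf j X"
      have "connected D" unfolding X0 by (rule connected_connected_component)
      then have "connected (?f ` D)" by (intro connected_continuous_image continuous_intros)
      moreover have "X0 \<in> D" unfolding X0(2) using connected_component_refl[OF X0(1)] by simp
      then have "?f X \<in> ?f ` D" "?f X0 \<in> ?f ` D" using X by (auto intro: imageI)
      ultimately have "{?f X..?f X0} \<subseteq> ?f ` D" by (rule connected_contains_Icc)
      moreover have "0 \<in> {?f X..?f X0}" using \<open>\<not> x j < x i\<close> R(2) by (simp add: x x0)
      ultimately have "0 \<in> ?f ` D" by blast
      then obtain Z where "0 = ?f Z" "Z \<in> D" by (rule imageE)
      then have Z: "Z \<in> D" "?f Z = 0" by simp_all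
      have "Z \<in> U" using DU Z(1) by (rule subsetD)
      then obtain z where z': "Z = dg z" "\<forall>i j. i \<noteq> j \<longrightarrow> R i j \<longrightarrow> z i \<noteq> z j"
        unfolding U mem_Collect_eq by (elim exE conjE)
      have z: "Z = dg z" "i \<noteq> j \<Longrightarrow> z i \<noteq> z j" using z' R(1) by blast+
      then show False using Z(2) R(2) by auto
    qed
    then show "X \<in> D'" using x by (auto simp: D'_def)
  qed
  moreover have "D' \<subseteq> D"
    unfolding X0
  proof (rule connected_component_maximal)
    show "X0 \<in> D'" using x0 by (auto simp: D'_def)
    show "D' \<subseteq> U"
    proof
      fix X assume "X \<in> D'"
      then obtain x where x: "X = dg x" "sum x UNIV = 0" "\<And>i j. R i j \<Longrightarrow> x0 j < x0 i \<Longrightarrow> x j < x i"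
        by (auto simp: D'_def)
      have "x i \<noteq> x j" if "i \<noteq> j" "R i j" for i j
        using x(3)[of i j] x(3)[of j i] sym[of i j] that x0(3)[OF that] by (cases "x0 i < x0 j") force+
      then show "X \<in> U" using x unfolding U by blast
    qed
    have "convex D'"
      unfolding convex_def
    proof (intro ballI allI impI)
      fix X Y and u v :: real assume XY: "X \<in> D'" "Y \<in> D'" and uv: "0 \<le> u" "0 \<le> v" "u + v = 1"
      obtain x where x: "X = dg x" "sum x UNIV = 0" "\<And>i j. R i j \<Longrightarrow> x0 j < x0 i \<Longrightarrow> x j < x i"
        using XY(1) by (auto simp: D'_def)
      obtain y where y: "Y = dg y" "sum y UNIV = 0" "\<And>i j. R i j \<Longrightarrow> x0 j < x0 i \<Longrightarrow> y j < y i"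
        using XY(2) by (auto simp: D'_def)
      have "u *\<^sub>R X + v *\<^sub>R Y = dg (\<lambda>i. u * x i + v * y i)"
        using linear_add[OF linear_dg_vec, of "\<chi> i. u * x i" "\<chi> i. v * y i"] by (simp add: x y dg_scaleR)
      moreover have "(\<Sum>i\<in>UNIV. u * x i + v * y i) = 0"
        by (simp add: sum.distrib sum_distrib_left[symmetric] x y)
      moreover have "u * x j + v * y j < u * x i + v * y i" if "R i j" "x0 j < x0 i" for i j
      proof (cases "u = 0")
        case False
        then have "u * x j < u * x i" using uv x(3)[OF that] by simp
        moreover have "v * y j \<le> v * y i" using uv y(3)[OF that] by (simp add: mult_left_mono)
        ultimately show ?thesis by simp
      qed (use uv y(3)[OF that] in simp)
      ultimately show "u *\<^sub>R X + v *\<^sub>R Y \<in> D'" by (auto simp: D'_def)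
    qed
    then show "connected D'" by (rule convex_connected)
  qed
  ultimately have "D = D'" by blast
  have "closure D' = cone (\<lambda>i j. R i j \<and> x0 j < x0 i)"
  proof
    have "cone (\<lambda>i j. R i j \<and> x0 j < x0 i) =
        bsp \<inter> (\<Inter>(i, j)\<in>{(i, j). R i j \<and> x0 j < x0 i}. {X. coordf j X \<le> coordf i X})"
      by (auto simp: cone_def bsp_def)
    moreover have "closed {X. coordf j X \<le> coordf i X}" for i j by (intro closed_Collect_le continuous_intros)
    ultimately have "closed (cone (\<lambda>i j. R i j \<and> x0 j < x0 i))"
      using closed_bsp by (auto intro!: closed_Int closed_INT)
    moreover have "D' \<subseteq> cone (\<lambda>i j. R i j \<and> x0 j < x0 i)" by (auto simp: D'_def cone_def less_imp_le)
    ultimately show "closure D' \<subseteq> cone (\<lambda>i j. R i j \<and> x0 j < x0 i)" by (simp add: closure_minimal)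
    show "cone (\<lambda>i j. R i j \<and> x0 j < x0 i) \<subseteq> closure D'"
    proof
      fix X assume "X \<in> cone (\<lambda>i j. R i j \<and> x0 j < x0 i)"
      then obtain x where x: "X = dg x" "sum x UNIV = 0" "\<And>i j. R i j \<Longrightarrow> x0 j < x0 i \<Longrightarrow> x j \<le> x i"
        by (auto simp: cone_def)
      \<comment> \<open>Adding a vanishing positive multiple of the interior point \<open>x0\<close>
        moves a point of the closed cone into the open one.\<close>
      define f where "f n i = x i + x0 i / real (Suc n)" for n i
      have "(\<lambda>n. f n i) \<longlonglongrightarrow> x i" for i
        unfolding f_def using tendsto_add[OF tendsto_const[of "x i"] lim_const_over_n[of "x0 i", THEN LIMSEQ_Suc]] by simp
      then have "(\<lambda>n. dg (f n)) \<longlonglongrightarrow> X" unfolding x by (rule tendsto_dg)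
      moreover have "dg (f n) \<in> D'" for n
      proof -
        have "sum (f n) UNIV = 0" by (simp add: f_def sum.distrib sum_divide_distrib[symmetric] x x0)
        moreover have "f n j < f n i" if "R i j" "x0 j < x0 i" for i j
          using x(3)[OF that] that(2) unfolding f_def by (intro add_le_less_mono) (simp_all add: divide_strict_right_mono)
        ultimately show ?thesis by (auto simp: D'_def)
      qed
      ultimately show "X \<in> closure D'"
        unfolding closure_sequential by (intro exI[of _ "\<lambda>n. dg (f n)"]) simp
    qed
  qed
  then have "c = cone (\<lambda>i j. R i j \<and> x0 j < x0 i)" using D(2) \<open>D = D'\<close> by simp
  then show ?thesis by (intro that[OF x0(2)] x0(3))
qed

end

section \<open>Orders, flags and the Weyl group\<close>

text \<open>A monotone permutation preserves the number of predecessors, and this number determines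
  the element.\<close>

lemma strict_mono_perm_id:
  fixes ord :: "'n::finite \<Rightarrow> nat"
  assumes ord: "inj ord" and \<theta>: "bij \<theta>" and mono: "\<And>a b. ord a < ord b \<Longrightarrow> ord (\<theta> a) \<le> ord (\<theta> b)"
  shows "\<theta> = id"
proof -
  have strict: "ord (\<theta> a) < ord (\<theta> b) \<longleftrightarrow> ord a < ord b" for a b
  proof
    assume "ord a < ord b"
    then have "ord (\<theta> a) \<le> ord (\<theta> b)" "a \<noteq> b" using mono by auto
    moreover have "ord (\<theta> a) \<noteq> ord (\<theta> b)" using ord \<theta> \<open>a \<noteq> b\<close> by (simp add: inj_eq bij_is_inj)
    ultimately show "ord (\<theta> a) < ord (\<theta> b)" by simp
  next
    assume l: "ord (\<theta> a) < ord (\<theta> b)"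
    show "ord a < ord b"
    proof (rule ccontr)
      assume "\<not> ord a < ord b"
      then have "a = b \<or> ord b < ord a" using ord by (auto simp: not_less le_less inj_eq)
      then show False using l mono[of b a] by auto
    qed
  qed
  have rank: "inj_on (\<lambda>a. card {b. ord b < ord a}) UNIV"
  proof (rule injI)
    fix a b assume e: "card {c. ord c < ord a} = card {c. ord c < ord b}"
    have "\<not> ord a < ord b" if "card {c. ord c < ord a} = card {c. ord c < ord b}" for a b :: 'n
    proof
      assume "ord a < ord b"
      then have "{c. ord c < ord a} \<subset> {c. ord c < ord b}" by auto
      then have "card {c. ord c < ord a} < card {c. ord c < ord b}" by (intro psubset_card_mono) simp_all
      then show False using that by simp
    qed
    from this[OF e] this[OF e[symmetric]] show "a = b" using ord by (simp add: inj_eq)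
  qed
  show ?thesis
  proof
    fix a
    have "{c. ord c < ord (\<theta> a)} = \<theta> ` {b. ord b < ord a}"
    proof (intro equalityI subsetI)
      fix c assume "c \<in> {c. ord c < ord (\<theta> a)}"
      moreover obtain b where "c = \<theta> b" using \<theta> by (rule bij_pointE)
      ultimately show "c \<in> \<theta> ` {b. ord b < ord a}" by (simp add: strict)
    qed (auto simp: strict)
    then have "card {c. ord c < ord (\<theta> a)} = card {b. ord b < ord a}"
      using \<theta> by (simp add: card_image inj_on_subset[OF bij_is_inj])
    then show "\<theta> a = id a" using rank by (simp add: inj_on_def)
  qed
qed

text \<open>Each fibre of \<open>f\<close> is reversed separately: the element of rank
  \<open>rk i\<close> in its fibre goes to the one of complementary rank.\<close>

lemma order_reversing_exists:
  fixes ord :: "'n::finite \<Rightarrow> nat" and f :: "'n \<Rightarrow> 'b"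
  assumes ord: "inj ord"
  obtains \<omega> where "bij \<omega>" "\<And>i. f (\<omega> i) = f i"
    "\<And>i j. f i = f j \<Longrightarrow> ord i < ord j \<Longrightarrow> ord (\<omega> j) < ord (\<omega> i)"
proof -
  define S where "S i = {k. f k = f i}" for i
  define rk where "rk i = card {k \<in> S i. ord k < ord i}" for i
  have rk_less: "rk i < rk j" if "f i = f j" "ord i < ord j" for i j
    unfolding rk_def by (rule psubset_card_mono) (use that in \<open>auto simp: S_def\<close>)
  have rk_iff: "rk i < rk j \<longleftrightarrow> ord i < ord j" if "f i = f j" for i j
    using rk_less[of i j] rk_less[of j i] that ord by (cases "ord i" "ord j" rule: linorder_cases) (auto simp: inj_eq)
  have rk_inj: "i = j" if "f i = f j" "rk i = rk j" for i j
    using rk_less[of i j] rk_less[of j i] that ord by (cases "ord i" "ord j" rule: linorder_cases) (auto simp: inj_eq)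
  have rk_bound: "rk i < card (S i)" for i
    unfolding rk_def by (rule psubset_card_mono) (auto simp: S_def)
  have rk_surj: "\<exists>j\<in>S i. rk j = m" if "m < card (S i)" for i m
  proof -
    have "rk j < card (S i)" if "j \<in> S i" for j using rk_bound[of j] that by (simp add: S_def)
    then have "rk ` S i \<subseteq> {..<card (S i)}" by auto
    moreover have "card (rk ` S i) = card (S i)" by (rule card_image) (auto simp: inj_on_def S_def intro: rk_inj)
    ultimately have "rk ` S i = {..<card (S i)}" by (intro card_subset_eq) simp_all
    then show ?thesis using that by (metis imageE lessThan_iff)
  qed
  have "\<exists>j. j \<in> S i \<and> rk j = card (S i) - 1 - rk i" for i
    using rk_surj[of "card (S i) - 1 - rk i" i] rk_bound[of i] by (metis diff_Suc_less diff_diff_left less_imp_diff_less plus_1_eq_Suc gr_implies_not0 not_gr_zero)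
  then obtain \<omega> where \<omega>: "\<And>i. \<omega> i \<in> S i" "\<And>i. rk (\<omega> i) = card (S i) - 1 - rk i" by metis
  have f\<omega>: "f (\<omega> i) = f i" for i using \<omega>(1)[of i] by (simp add: S_def)
  have rev: "ord (\<omega> j) < ord (\<omega> i)" if "f i = f j" "ord i < ord j" for i j
  proof -
    have "S i = S j" using that(1) by (simp add: S_def)
    then have "rk (\<omega> j) < rk (\<omega> i)" using \<omega>(2)[of i] \<omega>(2)[of j] rk_less[OF that] rk_bound[of j] by simp
    then show ?thesis using rk_iff f\<omega> that(1) by simp
  qed
  have "inj \<omega>"
  proof (rule injI)
    fix i j assume e: "\<omega> i = \<omega> j"
    then have "f i = f j" using f\<omega>[of i] f\<omega>[of j] by simp
    then show "i = j" using rev[of i j] rev[of j i] e ord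
      by (cases "ord i" "ord j" rule: linorder_cases) (auto simp: inj_eq)
  qed
  then have "bij \<omega>" by (simp add: bij_def finite_UNIV_inj_surj)
  then show ?thesis using f\<omega> rev by (rule that)
qed

lemma bij_factor:
  assumes "bij \<psi>" obtains \<theta> where "\<And>a. \<psi>' a = \<psi> (\<theta> a)"
proof (rule that)
  show "\<psi>' a = \<psi> (inv_into UNIV \<psi> (\<psi>' a))" for a
    using bij_is_surj[OF assms] by (simp add: f_inv_into_f)
qed

text \<open>\<open>ord\<close> ranks the lines by decreasing eigenvalue in the fixed chamber of all
  roots. This chamber becomes \<open>cham id\<close>, and every other order of the lines is a
  permutation relative to it.\<close>

locale ocoords = coords P B \<tau> \<epsilon> for P :: "'k::scalar_rc^'n^'n" and B \<tau> \<epsilon> +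
  fixes ord :: "'n \<Rightarrow> nat"
  assumes ord: "bij_betw ord UNIV {..<CARD('n)}"
begin

lemma inj_ord: "inj ord" using ord by (rule bij_betw_imp_inj_on)

lemma ord_eq_iff: "ord a = ord b \<longleftrightarrow> a = b" using inj_ord by (simp add: inj_eq)

lemma ord_less: "ord a < CARD('n)" using bij_betw_apply[OF ord, of a] by simp

definition oinv :: "nat \<Rightarrow> 'n" where "oinv k = (THE a. ord a = k)"

lemma oinv_ord [simp]: "oinv (ord a) = a" by (simp add: oinv_def ord_eq_iff)

lemma ord_oinv [simp]: "k < CARD('n) \<Longrightarrow> ord (oinv k) = k"
proof -
  assume "k < CARD('n)"
  then have "k \<in> range ord" unfolding bij_betw_imp_surj_on[OF ord] by simp
  then show ?thesis by auto
qed

definition rv :: "'n \<Rightarrow> 'n" where "rv a = oinv (CARD('n) - 1 - ord a)"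

lemma ord_rv [simp]: "ord (rv a) = CARD('n) - 1 - ord a"
  using ord_less[of a] by (simp add: rv_def)

lemma rv_rv [simp]: "rv (rv a) = a"
  using ord_less[of a] by (simp add: ord_eq_iff[symmetric])

lemma bij_rv: "bij rv" by (rule o_bij[of rv]) (auto simp: fun_eq_iff)

lemma ord_rv_less: "ord (rv a) < ord (rv b) \<longleftrightarrow> ord b < ord a"
  using ord_less[of a] ord_less[of b] by auto

text \<open>A regular element of the chamber: consecutive eigenvalues differ by one, and starting
  from the mean rank makes the trace zero.\<close>

definition ramp :: "'n \<Rightarrow> real" where "ramp a = (\<Sum>b\<in>UNIV. real (ord b)) / CARD('n) - ord a"

lemma sum_ramp: "sum ramp UNIV = 0"
  by (simp add: ramp_def sum_subtractf)

lemma ramp_less: "ramp a < ramp b \<longleftrightarrow> ord b < ord a"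
  by (simp add: ramp_def)

lemma inj_ramp: "inj ramp"
  using inj_ord by (auto simp: inj_def ramp_def)

text \<open>The permutation \<open>\<psi>\<close> lists the lines: \<open>line (\<psi> a)\<close>
  takes the rank of \<open>a\<close>. Flags (\<open>pflag\<close>) and orderings
  (\<open>list_of\<close>) are indexed by permutations in the same way.\<close>

definition cham :: "('n \<Rightarrow> 'n) \<Rightarrow> ('k^'n^'n) set" where
  "cham \<psi> = {dg x |x. sum x UNIV = 0 \<and> decr ord (\<lambda>a. x (\<psi> a))}"

definition pflag :: "('n \<Rightarrow> 'n) \<Rightarrow> nat \<Rightarrow> ('k^'n) set" where
  "pflag \<psi> = frame_flag ord (P ** monomat \<psi> (\<lambda>_. 1))"

definition list_of :: "('n \<Rightarrow> 'n) \<Rightarrow> ('k^'n) set list" where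
  "list_of \<psi> = map (\<lambda>k. line (\<psi> (oinv k))) [0..<CARD('n)]"

lemma frame_flag_pflag:
  assumes "bij \<psi>" "\<And>i. c i \<noteq> 0"
  shows "frame_flag ord (P ** monomat \<psi> c) = pflag \<psi>"
  unfolding pflag_def frame_flag_mult fun_eq_iff
  using frame_flag_monomat[OF assms(1), of c ord] frame_flag_monomat[OF assms(1), of "\<lambda>_. 1 :: 'k" ord] assms(2) by simp

lemma pflag_eq: "bij \<psi> \<Longrightarrow> pflag \<psi> j = (*v) P ` {u. \<forall>a. j \<le> ord a \<longrightarrow> u $ \<psi> a = 0}"
  by (simp add: pflag_def frame_flag_mult frame_flag_monomat)

lemma pflag_axis: "bij \<psi> \<Longrightarrow> P *v axis (\<psi> a) 1 \<in> pflag \<psi> j \<longleftrightarrow> ord a < j"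
proof -
  assume b: "bij \<psi>"
  have "P *v axis (\<psi> a) 1 \<in> pflag \<psi> j \<longleftrightarrow> axis (\<psi> a) (1::'k) \<in> {u. \<forall>a. j \<le> ord a \<longrightarrow> u $ \<psi> a = 0}"
    unfolding pflag_eq[OF b] by (rule inj_image_mem_iff[OF inj_mult_vec[OF P]])
  also have "\<dots> \<longleftrightarrow> ord a < j"
    using bij_is_inj[OF b] by (auto simp: axis_def inj_eq not_le)
  finally show ?thesis .
qed

lemma perm_eqI:
  assumes "bij \<psi>" "bij \<psi>'" "\<And>a b. \<psi> a = \<psi>' b \<Longrightarrow> ord a = ord b"
  shows "\<psi> = \<psi>'"
proof
  fix a obtain b where b: "\<psi> a = \<psi>' b" using assms(2) by (rule bij_pointE)
  then show "\<psi> a = \<psi>' a" using assms(3)[OF b] by (simp add: ord_eq_iff)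
qed

lemma pflag_inject:
  assumes "bij \<psi>" "bij \<psi>'" "pflag \<psi> = pflag \<psi>'"
  shows "\<psi> = \<psi>'"
proof (rule perm_eqI[OF assms(1,2)])
  fix a b assume e: "\<psi> a = \<psi>' b"
  have "ord a < j \<longleftrightarrow> ord b < j" for j
    using pflag_axis[OF assms(1), of a j] pflag_axis[OF assms(2), of b j] assms(3) e by simp
  from this[of "Suc (ord a)"] this[of "Suc (ord b)"] show "ord a = ord b" by simp
qed

lemma cham_dg: "dg x \<in> cham \<psi> \<longleftrightarrow> sum x UNIV = 0 \<and> decr ord (\<lambda>a. x (\<psi> a))"
  by (auto simp: cham_def dg_inject)

lemma sum_perm: "bij \<psi> \<Longrightarrow> (\<Sum>a\<in>UNIV. x (\<psi> a)) = sum x (UNIV :: 'n set)" for x :: "'n \<Rightarrow> real"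
  using sum.reindex_bij_betw[of \<psi> UNIV UNIV x] by simp

lemma perm_shift:
  fixes y :: "'n \<Rightarrow> real" and \<psi> :: "'n \<Rightarrow> 'n"
  assumes "bij \<psi>" obtains x where "\<And>a. x (\<psi> a) = y a" "sum x UNIV = sum y UNIV"
proof -
  have inv: "(THE a. \<psi> a = \<psi> b) = b" for b using bij_is_inj[OF assms] by (simp add: inj_eq)
  define x where "x i = y (THE a. \<psi> a = i)" for i
  have x: "x (\<psi> a) = y a" for a by (simp add: x_def inv)
  then have "sum x UNIV = sum y UNIV" using sum_perm[OF assms, of x] by simp
  then show ?thesis using x that by blast
qed

text \<open>The ramp transported to \<open>cham \<psi>\<close> has distinct eigenvalues, which can
  be listed in decreasing order in one way only.\<close>

lemma cham_inject:
  assumes "bij \<psi>" "bij \<psi>'" "cham \<psi> = cham \<psi>'"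
  shows "\<psi> = \<psi>'"
proof -
  obtain x where x: "\<And>a. x (\<psi> a) = ramp a" "sum x UNIV = sum ramp UNIV" using perm_shift[OF assms(1)] by metis
  have "dg x \<in> cham \<psi>'" unfolding assms(3)[symmetric] by (simp add: cham_dg x sum_ramp decr_def) (simp add: ramp_def)
  then have dec: "decr ord (\<lambda>a. x (\<psi>' a))" by (simp add: cham_dg)
  obtain \<theta> where \<theta>: "\<And>a. \<psi>' a = \<psi> (\<theta> a)" using bij_factor[OF assms(1)] by blast
  have "inj \<theta>" using bij_is_inj[OF assms(2)] by (auto simp: inj_def \<theta>)
  then have "bij \<theta>" by (simp add: bij_def finite_UNIV_inj_surj)
  moreover have "ord (\<theta> a) \<le> ord (\<theta> b)" if "ord a < ord b" for a b
    using dec that ramp_less[of "\<theta> a" "\<theta> b"] by (auto simp: decr_def \<theta> x not_less[symmetric])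
  ultimately have "\<theta> = id" by (rule strict_mono_perm_id[OF inj_ord])
  then show ?thesis using \<theta> by (simp add: fun_eq_iff)
qed

lemma length_list_of: "length (list_of \<psi>) = CARD('n)" by (simp add: list_of_def)

lemma nth_list_of: "k < CARD('n) \<Longrightarrow> list_of \<psi> ! k = line (\<psi> (oinv k))" by (simp add: list_of_def)

lemma list_of_orderings: "bij \<psi> \<Longrightarrow> list_of \<psi> \<in> orderings (range line)"
proof -
  assume b: "bij \<psi>"
  have "inj_on (\<lambda>k. line (\<psi> (oinv k))) {0..<CARD('n)}"
  proof (rule inj_onI)
    fix k l assume kl: "k \<in> {0..<CARD('n)}" "l \<in> {0..<CARD('n)}" and e: "line (\<psi> (oinv k)) = line (\<psi> (oinv l))"
    from e have "oinv k = oinv l" unfolding line_inject by (rule injD[OF bij_is_inj[OF b]])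
    then have "ord (oinv k) = ord (oinv l)" by simp
    with kl show "k = l" by simp
  qed
  then have "distinct (list_of \<psi>)" by (simp add: list_of_def distinct_map)
  moreover have "line i \<in> set (list_of \<psi>)" for i
  proof -
    obtain a where "i = \<psi> a" using b by (rule bij_pointE)
    then show ?thesis using ord_less[of a] by (auto simp: list_of_def intro!: image_eqI[of _ _ "ord a"])
  qed
  then have "set (list_of \<psi>) = range line" by (auto simp: list_of_def)
  ultimately show ?thesis by (simp add: orderings_def)
qed

lemma orderings_list_of:
  assumes "ls \<in> orderings (range line)"
  obtains \<psi> where "bij \<psi>" "ls = list_of \<psi>"
proof -
  have ls: "distinct ls" "set ls = range line" using assms by (auto simp: orderings_def)
  have len: "length ls = CARD('n)"
    using distinct_card[OF ls(1)] ls(2) card_image[of line UNIV] line_inject by (simp add: inj_on_def)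
  have "\<exists>i. ls ! ord a = line i" for a
    using nth_mem[of "ord a" ls] ord_less[of a] ls(2) len by auto
  then obtain \<psi> where \<psi>: "\<And>a. ls ! ord a = line (\<psi> a)" by metis
  have "inj \<psi>"
  proof (rule injI)
    fix a b assume "\<psi> a = \<psi> b"
    then have "ls ! ord a = ls ! ord b" by (simp add: \<psi>)
    then show "a = b" using nth_eq_iff_index_eq[OF ls(1)] ord_less len by (simp add: ord_eq_iff)
  qed
  then have "bij \<psi>" by (simp add: bij_def finite_UNIV_inj_surj)
  moreover have "ls = list_of \<psi>"
    by (rule nth_equalityI) (simp_all add: len length_list_of nth_list_of \<psi>[symmetric])
  ultimately show ?thesis by (rule that)
qed

lemma chamber_of_list_of: "chamber_of_list bsp (list_of \<psi>) = cham \<psi>"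
proof -
  have "sorted_wrt (\<lambda>l l'. eigval l' (dg x) \<le> eigval l (dg x)) (list_of \<psi>) \<longleftrightarrow> decr ord (\<lambda>a. x (\<psi> a))" for x
  proof
    assume s: "sorted_wrt (\<lambda>l l'. eigval l' (dg x) \<le> eigval l (dg x)) (list_of \<psi>)"
    show "decr ord (\<lambda>a. x (\<psi> a))"
      unfolding decr_def
    proof (intro allI impI)
      fix i j assume "ord i < ord j"
      then show "x (\<psi> j) \<le> x (\<psi> i)"
        using sorted_wrt_nth_less[OF s, of "ord i" "ord j"] ord_less[of i] ord_less[of j]
        by (simp add: length_list_of nth_list_of)
    qed
  next
    assume d: "decr ord (\<lambda>a. x (\<psi> a))"
    show "sorted_wrt (\<lambda>l l'. eigval l' (dg x) \<le> eigval l (dg x)) (list_of \<psi>)"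
      unfolding sorted_wrt_iff_nth_less
    proof (intro allI impI)
      fix i j assume "i < j" "j < length (list_of \<psi>)"
      then show "eigval (list_of \<psi> ! j) (dg x) \<le> eigval (list_of \<psi> ! i) (dg x)"
        using d by (simp add: length_list_of nth_list_of decr_def)
    qed
  qed
  then show ?thesis by (auto simp: chamber_of_list_def cham_def bsp_def)
qed

lemma flag_of_list_of: "bij \<psi> \<Longrightarrow> flag_of_list (list_of \<psi>) = pflag \<psi>"
proof
  fix j assume b: "bij \<psi>"
  have tk: "set (take j (list_of \<psi>)) = {line (\<psi> a) |a. ord a < j}"
  proof (intro equalityI subsetI)
    fix l assume "l \<in> set (take j (list_of \<psi>))"
    then obtain k where "k < j" "k < CARD('n)" "l = line (\<psi> (oinv k))"
      by (auto simp: in_set_conv_nth length_list_of nth_list_of)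
    then show "l \<in> {line (\<psi> a) |a. ord a < j}" by (auto intro!: exI[of _ "oinv k"])
  next
    fix l assume "l \<in> {line (\<psi> a) |a. ord a < j}"
    then obtain a where "l = line (\<psi> a)" "ord a < j" by blast
    then show "l \<in> set (take j (list_of \<psi>))"
      using ord_less[of a] by (auto simp: in_set_conv_nth length_list_of nth_list_of intro!: exI[of _ "ord a"])
  qed
  show "flag_of_list (list_of \<psi>) j = pflag \<psi> j"
    unfolding flag_of_list_def tk
  proof
    have "line (\<psi> a) \<subseteq> pflag \<psi> j" if "ord a < j" for a
      unfolding line_def using pflag_axis[OF b, of a j] that frame_flag_subspace[of ord "P ** monomat \<psi> (\<lambda>_. 1)" j]
      by (intro vec.span_minimal) (simp_all add: pflag_def)
    then show "vec.span (\<Union>{line (\<psi> a) |a. ord a < j}) \<subseteq> pflag \<psi> j"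
      using frame_flag_subspace[of ord "P ** monomat \<psi> (\<lambda>_. 1)" j] by (intro vec.span_minimal) (auto simp: pflag_def)
    show "pflag \<psi> j \<subseteq> vec.span (\<Union>{line (\<psi> a) |a. ord a < j})"
    proof
      fix y assume "y \<in> pflag \<psi> j"
      then obtain u where u: "y = P *v u" "\<And>a. j \<le> ord a \<Longrightarrow> u $ \<psi> a = 0" by (auto simp: pflag_eq[OF b])
      have "u = (\<Sum>i\<in>UNIV. u $ i *s axis i 1)" by (simp add: basis_expansion)
      then have y: "y = (\<Sum>i\<in>UNIV. u $ i *s (P *v axis i 1))"
        using u(1) mult_vec_sum[of P "\<lambda>i. u $ i *s axis i 1" UNIV] by (simp add: vector_scalar_commute)
      have "u $ i *s (P *v axis i 1) \<in> vec.span (\<Union>{line (\<psi> a) |a. ord a < j})" for i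
      proof -
        obtain a where a: "i = \<psi> a" using b by (rule bij_pointE)
        show ?thesis
        proof (cases "ord a < j")
          case True
          then have "P *v axis i 1 \<in> \<Union>{line (\<psi> a) |a. ord a < j}" using axis_in_line[of i] a by blast
          then show ?thesis by (intro vec.span_scale vec.span_base)
        next
          case False
          then show ?thesis using u(2)[of a] a by (simp add: vec.span_zero)
        qed
      qed
      then show "y \<in> vec.span (\<Union>{line (\<psi> a) |a. ord a < j})" unfolding y by (intro vec.span_sum)
    qed
  qed
qed

lemma flag_of_cham: "bij \<psi> \<Longrightarrow> flag_of_chamber bsp (range line) (cham \<psi>) = pflag \<psi>"
proof -
  assume b: "bij \<psi>"
  have "(THE ls. ls \<in> orderings (range line) \<and> chamber_of_list bsp ls = cham \<psi>) = list_of \<psi>"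
  proof (rule the_equality)
    fix ls assume ls: "ls \<in> orderings (range line) \<and> chamber_of_list bsp ls = cham \<psi>"
    then obtain \<psi>' where "bij \<psi>'" "ls = list_of \<psi>'" using orderings_list_of by blast
    then show "ls = list_of \<psi>" using ls cham_inject[OF b, of \<psi>'] by (simp add: chamber_of_list_of)
  qed (simp add: list_of_orderings b chamber_of_list_of)
  then show ?thesis using b by (simp add: flag_of_chamber_def flag_of_list_of)
qed

lemma chamber_of_pflag: "bij \<psi> \<Longrightarrow> chamber_of_flag bsp (range line) (pflag \<psi>) = cham \<psi>"
proof -
  assume b: "bij \<psi>"
  have "(THE ls. ls \<in> orderings (range line) \<and> flag_of_list ls = pflag \<psi>) = list_of \<psi>"
  proof (rule the_equality)
    fix ls assume ls: "ls \<in> orderings (range line) \<and> flag_of_list ls = pflag \<psi>"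
    then obtain \<psi>' where "bij \<psi>'" "ls = list_of \<psi>'" using orderings_list_of by blast
    then show "ls = list_of \<psi>" using ls pflag_inject[OF b, of \<psi>'] by (simp add: flag_of_list_of)
  qed (simp add: list_of_orderings b flag_of_list_of)
  then show ?thesis by (simp add: chamber_of_flag_def chamber_of_list_of)
qed

lemma flags_spanned: "\<xi> \<in> flags_spanned_by (range line) \<Longrightarrow> \<exists>\<psi>. bij \<psi> \<and> \<xi> = pflag \<psi>"
  unfolding flags_spanned_by_def by (auto elim!: orderings_list_of simp: flag_of_list_of)

section \<open>The Weyl group as the group of permutations of the lines\<close>

definition wcl :: "('n \<Rightarrow> 'n) \<Rightarrow> ('k^'n^'n) set set" where
  "wcl \<pi> = {cl (em (monomat \<pi> c)) |c. monomial_unit \<pi> c}"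

lemma mstar_inv: "unitary U \<Longrightarrow> matrix_inv (em U) = em (mstar U)"
  by (rule matrix_inv_unique) (simp add: em_mult unitary_right)

lemma Ad_em: "unitary U \<Longrightarrow> det U = 1 \<Longrightarrow> Ad (cl (em U)) (em X) = em (U ** X ** mstar U)"
  by (simp add: Ad_cl mstar_inv em_mult)

lemma monomial_unitD:
  assumes "monomial_unit \<pi> c"
  shows "bij \<pi>" "norm (c i) = 1" "det (monomat \<pi> c) = 1" "unitary (monomat \<pi> c)" "c i \<noteq> 0"
proof -
  show "bij \<pi>" "norm (c i) = 1" "det (monomat \<pi> c) = 1" using assms by (auto simp: monomial_unit_def)
  then show "c i \<noteq> 0" by auto
  show "unitary (monomat \<pi> c)" using assms by (intro unitary_monomat) (auto simp: monomial_unit_def)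
qed

lemma Ad_monomial:
  assumes "monomial_unit \<pi> c"
  shows "Ad (cl (em (monomat \<pi> c))) (dg (\<lambda>i. x (\<pi> i))) = dg x"
proof -
  note m = monomial_unitD[OF assms]
  have "monomat \<pi> c ** rdiag (\<lambda>i. x (\<pi> i)) ** mstar (monomat \<pi> c) = rdiag x"
    unfolding monomat_mult_rdiag[OF m(1)] by (simp add: matrix_mul_assoc[symmetric] unitary_right[OF m(4)])
  then show ?thesis unfolding dg_def by (simp add: Ad_em m)
qed

text \<open>A unitary element that normalizes the subalgebra sends the regular element
  \<open>ramp\<close> to a diagonal matrix; by \<open>unitary_normalizer_monomat\<close> this alone
  makes it monomial.\<close>

lemma W_hat_eq: "W_hat \<tau> bsp = {cl (em (monomat \<pi> c)) |\<pi> c. monomial_unit \<pi> c}"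
proof (intro equalityI subsetI)
  fix g assume "g \<in> W_hat \<tau> bsp"
  then have g: "g \<in> K_group \<tau>" "Ad g ` bsp = bsp" by (auto simp: W_hat_def)
  then obtain U where U: "g = cl (em U)" "unitary U" "det U = 1" by (auto simp: K_group_eq)
  have "dg ramp \<in> bsp" using sum_ramp by (auto simp: bsp_def)
  then have "Ad g (dg ramp) \<in> bsp" using g(2) by blast
  then obtain y where "Ad g (dg ramp) = dg y" by (auto simp: bsp_def)
  then have "em (U ** rdiag ramp ** mstar U) = em (rdiag y)"
    unfolding dg_def U(1) Ad_em[OF U(2,3)] .
  then have "U ** rdiag ramp ** mstar U ** U = rdiag y ** U" by (simp only: em_inject)
  then have "U ** rdiag ramp = rdiag y ** U" using U(2) by (simp add: matrix_mul_assoc[symmetric] unitary_def)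
  then have "\<exists>\<pi> c. bij \<pi> \<and> (\<forall>i. norm (c i) = 1) \<and> U = monomat \<pi> c"
    by (rule unitary_normalizer_monomat[OF U(2) inj_ramp]) blast
  then obtain \<pi> c where pc: "bij \<pi>" "\<forall>i. norm (c i) = 1" "U = monomat \<pi> c" by blast
  then have "monomial_unit \<pi> c" using U(3) by (simp add: monomial_unit_def)
  then show "g \<in> {cl (em (monomat \<pi> c)) |\<pi> c. monomial_unit \<pi> c}" using U(1) pc(3) by blast
next
  fix g assume "g \<in> {cl (em (monomat \<pi> c)) |\<pi> c. monomial_unit \<pi> c}"
  then obtain \<pi> c where g: "g = cl (em (monomat \<pi> c))" "monomial_unit \<pi> c" by blast
  note m = monomial_unitD[OF g(2)]
  have "g \<in> K_group \<tau>" unfolding K_group_eq g(1) using m by blast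
  moreover have "Ad g ` bsp = bsp"
  proof (intro equalityI subsetI)
    fix X assume "X \<in> Ad g ` bsp"
    then obtain x where x: "sum x UNIV = 0" "X = Ad g (dg x)" by (auto simp: bsp_def)
    obtain x' where x': "\<And>a. x' (\<pi> a) = x a" "sum x' UNIV = sum x UNIV" using perm_shift[OF m(1)] by metis
    have "X = dg x'" using Ad_monomial[OF g(2), of x'] by (simp add: x x' g(1))
    then show "X \<in> bsp" using x x' by (auto simp: bsp_def)
  next
    fix X assume "X \<in> bsp"
    then obtain x where x: "sum x UNIV = 0" "X = dg x" by (auto simp: bsp_def)
    have "X = Ad g (dg (\<lambda>i. x (\<pi> i)))" using Ad_monomial[OF g(2), of x] by (simp add: x g(1))
    moreover have "dg (\<lambda>i. x (\<pi> i)) \<in> bsp" using sum_perm[OF m(1), of x] x by (auto simp: bsp_def)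
    ultimately show "X \<in> Ad g ` bsp" by blast
  qed
  ultimately show "g \<in> W_hat \<tau> bsp" by (simp add: W_hat_def)
qed

lemma W_centralizer_eq: "W_centralizer \<tau> bsp = wcl id"
proof (intro equalityI subsetI)
  fix g assume "g \<in> W_centralizer \<tau> bsp"
  then have g: "g \<in> K_group \<tau>" "\<And>X. X \<in> bsp \<Longrightarrow> Ad g X = X" by (auto simp: W_centralizer_def)
  then have "Ad g ` bsp = bsp" by force
  then have "g \<in> W_hat \<tau> bsp" using g(1) by (simp add: W_hat_def)
  then obtain \<pi> c where c: "g = cl (em (monomat \<pi> c))" "monomial_unit \<pi> c" unfolding W_hat_eq by blast
  note b = monomial_unitD(1)[OF c(2)]
  have "dg (\<lambda>i. ramp (\<pi> i)) \<in> bsp" using sum_perm[OF b, of ramp] sum_ramp by (auto simp: bsp_def)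
  then have "dg ramp = dg (\<lambda>i. ramp (\<pi> i))" using g(2) Ad_monomial[OF c(2), of ramp] c(1) by simp
  then have "ramp = (\<lambda>i. ramp (\<pi> i))" unfolding dg_inject .
  then have "\<pi> i = i" for i using injD[OF inj_ramp, of "\<pi> i" i] by (metis)
  then have "\<pi> = id" by auto
  then show "g \<in> wcl id" using c by (auto simp: wcl_def)
next
  fix g assume "g \<in> wcl id"
  then obtain c where c: "g = cl (em (monomat id c))" "monomial_unit id c" by (auto simp: wcl_def)
  have "g \<in> K_group \<tau>" unfolding K_group_eq c(1) using monomial_unitD[OF c(2)] by blast
  moreover have "Ad g X = X" if "X \<in> bsp" for X
    using that Ad_monomial[OF c(2)] by (auto simp: bsp_def c(1))
  ultimately show "g \<in> W_centralizer \<tau> bsp" by (simp add: W_centralizer_def)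
qed

text \<open>Two monomial matrices with the same permutation differ by a diagonal one, that is by an
  element of the centralizer.\<close>

lemma wcl_coset:
  assumes "monomial_unit \<pi> c"
  shows "(\<Union>h\<in>wcl id. {h \<otimes>\<^bsub>PSL\<^esub> cl (em (monomat \<pi> c))}) = wcl \<pi>"
proof (intro equalityI subsetI)
  note m = monomial_unitD[OF assms]
  have mm: "monomat id e ** monomat \<pi> c = monomat \<pi> (\<lambda>j. e (\<pi> j) * c j)" for e
    by (auto simp: vec_eq_iff monomat_mult_nth monomat_nth)
  {
    fix g assume "g \<in> (\<Union>h\<in>wcl id. {h \<otimes>\<^bsub>PSL\<^esub> cl (em (monomat \<pi> c))})"
    then obtain e where e: "monomial_unit id e" "g = cl (em (monomat id e)) \<otimes>\<^bsub>PSL\<^esub> cl (em (monomat \<pi> c))"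
      by (auto simp: wcl_def)
    note me = monomial_unitD[OF e(1)]
    have "g = cl (em (monomat \<pi> (\<lambda>j. e (\<pi> j) * c j)))" by (simp add: e(2) cl_mult m me em_mult mm)
    moreover have "monomial_unit \<pi> (\<lambda>j. e (\<pi> j) * c j)"
      using m me mm[of e] det_mul[of "monomat id e" "monomat \<pi> c"] by (simp add: monomial_unit_def norm_mult)
    ultimately show "g \<in> wcl \<pi>" by (auto simp: wcl_def)
  next
    fix g assume "g \<in> wcl \<pi>"
    then obtain d where d: "monomial_unit \<pi> d" "g = cl (em (monomat \<pi> d))" by (auto simp: wcl_def)
    note md = monomial_unitD[OF d(1)]
    have inv: "(THE a. \<pi> a = \<pi> b) = b" for b using bij_is_inj[OF m(1)] by (simp add: inj_eq)
    define e where "e i = d (THE a. \<pi> a = i) / c (THE a. \<pi> a = i)" for i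
    have ec: "e (\<pi> j) * c j = d j" for j using m(5)[of j] by (simp add: e_def inv)
    then have dm: "monomat \<pi> d = monomat id e ** monomat \<pi> c" by (simp add: mm)
    have "norm (e i) = 1" for i
    proof -
      obtain j where "i = \<pi> j" using m(1) by (rule bij_pointE)
      then show ?thesis using m(2)[of j] md(2)[of j] by (simp add: e_def inv norm_divide)
    qed
    moreover have "det (monomat id e) = 1" using md(3) m(3) unfolding dm by (simp add: det_mul)
    ultimately have e: "monomial_unit id e" by (simp add: monomial_unit_def)
    have "g = cl (em (monomat id e)) \<otimes>\<^bsub>PSL\<^esub> cl (em (monomat \<pi> c))"
      by (simp add: d(2) dm cl_mult m monomial_unitD[OF e] em_mult)
    then show "g \<in> (\<Union>h\<in>wcl id. {h \<otimes>\<^bsub>PSL\<^esub> cl (em (monomat \<pi> c))})" using e by (auto simp: wcl_def)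
  }
qed

text \<open>Every permutation has a monomial representative of determinant one, so the Weyl group is
  the full symmetric group on the lines.\<close>

lemma carrier_W: "carrier (W_group \<tau> bsp) = {wcl \<pi> |\<pi>. bij \<pi>}"
proof -
  have "carrier (W_group \<tau> bsp) = (\<Union>a\<in>W_hat \<tau> bsp. {\<Union>h\<in>wcl id. {h \<otimes>\<^bsub>PSL\<^esub> a}})"
    by (simp add: W_group_def FactGroup_def RCOSETS_def r_coset_def W_centralizer_eq)
  also have "\<dots> = {wcl \<pi> |\<pi>. bij \<pi>}"
  proof (intro equalityI subsetI)
    fix w assume "w \<in> (\<Union>a\<in>W_hat \<tau> bsp. {\<Union>h\<in>wcl id. {h \<otimes>\<^bsub>PSL\<^esub> a}})"
    then obtain a where a: "a \<in> W_hat \<tau> bsp" "w = (\<Union>h\<in>wcl id. {h \<otimes>\<^bsub>PSL\<^esub> a})" by blast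
    then obtain \<pi> c where c: "a = cl (em (monomat \<pi> c))" "monomial_unit \<pi> c" unfolding W_hat_eq by blast
    then show "w \<in> {wcl \<pi> |\<pi>. bij \<pi>}" using a(2) wcl_coset[OF c(2)] monomial_unitD(1)[OF c(2)] by auto
  next
    fix w assume "w \<in> {wcl \<pi> |\<pi>. bij \<pi>}"
    then obtain \<pi> where \<pi>: "bij \<pi>" "w = wcl \<pi>" by blast
    obtain c where c: "monomial_unit \<pi> (c :: 'n \<Rightarrow> 'k)" using monomial_unit_exists[OF \<pi>(1)] by blast
    have "cl (em (monomat \<pi> c)) \<in> W_hat \<tau> bsp" unfolding W_hat_eq using c by blast
    then show "w \<in> (\<Union>a\<in>W_hat \<tau> bsp. {\<Union>h\<in>wcl id. {h \<otimes>\<^bsub>PSL\<^esub> a}})"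
      using wcl_coset[OF c] \<pi>(2) by auto
  qed
  finally show ?thesis .
qed

lemma some_wcl:
  assumes "bij \<pi>"
  obtains c where "monomial_unit \<pi> c" "(SOME n. n \<in> wcl \<pi>) = cl (em (monomat \<pi> c))"
proof -
  obtain c where "monomial_unit \<pi> (c :: 'n \<Rightarrow> 'k)" using monomial_unit_exists[OF assms] by blast
  then have "cl (em (monomat \<pi> c)) \<in> wcl \<pi>" by (auto simp: wcl_def)
  then have "(SOME n. n \<in> wcl \<pi>) \<in> wcl \<pi>" by (rule someI)
  then show ?thesis using that by (auto simp: wcl_def)
qed

lemma W_act_dg: "bij \<pi> \<Longrightarrow> W_act (wcl \<pi>) (dg (\<lambda>i. x (\<pi> i))) = dg x"
  by (rule some_wcl[of \<pi>]) (simp_all add: W_act_def Ad_monomial)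

lemma W_sub_act_line: "bij \<pi> \<Longrightarrow> W_sub_act (wcl \<pi>) (line i) = line (\<pi> i)"
proof (rule some_wcl[of \<pi>])
  fix c assume c: "monomial_unit \<pi> c" "(SOME n. n \<in> wcl \<pi>) = cl (em (monomat \<pi> c))"
  note m = monomial_unitD[OF c(1)]
  have ln: "line i = range (\<lambda>a. P *v (a *s axis i 1))" by (auto simp: line_eq)
  have "W_sub_act (wcl \<pi>) (line i) = (*v) (em (monomat \<pi> c)) ` line i"
    unfolding W_sub_act_def c(2) by (rule sub_act_cl) (simp add: line_def)
  also have "\<dots> = range (\<lambda>a. P *v ((a * c i) *s axis (\<pi> i) 1))"
    unfolding ln by (simp add: image_image em_vec vector_scalar_commute monomat_axis vector_smult_assoc)
  also have "\<dots> = line (\<pi> i)"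
  proof (intro equalityI subsetI)
    fix y assume "y \<in> line (\<pi> i)"
    then obtain a where "y = P *v (a *s axis (\<pi> i) 1)" by (auto simp: line_eq)
    then have "y = P *v ((a / c i * c i) *s axis (\<pi> i) 1)" using m(5)[of i] by simp
    then show "y \<in> range (\<lambda>a. P *v ((a * c i) *s axis (\<pi> i) 1))" by (rule range_eqI)
  qed (auto simp: line_eq)
  finally show "W_sub_act (wcl \<pi>) (line i) = line (\<pi> i)" .
qed

lemma W_sub_act_pflag:
  assumes "bij \<pi>" "bij \<psi>"
  shows "(\<lambda>j. W_sub_act (wcl \<pi>) (pflag \<psi> j)) = pflag (\<pi> \<circ> \<psi>)"
proof (rule some_wcl[OF assms(1)])
  fix c assume c: "monomial_unit \<pi> c" "(SOME n. n \<in> wcl \<pi>) = cl (em (monomat \<pi> c))"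
  note m = monomial_unitD[OF c(1)]
  have "(\<lambda>j. W_sub_act (wcl \<pi>) (pflag \<psi> j)) = flag_act (cl (em (monomat \<pi> c))) (pflag \<psi>)"
    by (simp add: W_sub_act_def flag_act_def c(2))
  also have "\<dots> = frame_flag ord (P ** (monomat \<pi> c ** monomat \<psi> (\<lambda>_. 1)))"
    unfolding pflag_def flag_act_frame by (simp add: matrix_mul_assoc em_P)
  also have "monomat \<pi> c ** monomat \<psi> (\<lambda>_. 1) = monomat (\<pi> \<circ> \<psi>) (\<lambda>j. c (\<psi> j))"
    by (auto simp: vec_eq_iff monomat_mult_nth monomat_nth)
  also have "frame_flag ord (P ** \<dots>) = pflag (\<pi> \<circ> \<psi>)"
    using m(5) by (intro frame_flag_pflag bij_comp assms)
  finally show "(\<lambda>j. W_sub_act (wcl \<pi>) (pflag \<psi> j)) = pflag (\<pi> \<circ> \<psi>)" .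
qed

lemma w_flags_eq:
  assumes "bij \<psi>"
  shows "w_flags \<tau> bsp (pflag \<psi>) (pflag id) = wcl \<psi>"
  unfolding w_flags_def
proof (rule the_equality)
  show "wcl \<psi> \<in> carrier (W_group \<tau> bsp) \<and> (\<lambda>j. W_sub_act (wcl \<psi>) (pflag id j)) = pflag \<psi>"
    using assms by (auto simp: carrier_W W_sub_act_pflag)
  fix w assume w: "w \<in> carrier (W_group \<tau> bsp) \<and> (\<lambda>j. W_sub_act w (pflag id j)) = pflag \<psi>"
  then obtain \<pi> where \<pi>: "bij \<pi>" "w = wcl \<pi>" by (auto simp: carrier_W)
  then have "pflag \<pi> = pflag \<psi>" using w by (simp add: W_sub_act_pflag)
  then show "w = wcl \<psi>" using \<pi> assms pflag_inject by blast
qed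

text \<open>The chamber of the fixed subalgebra that contains \<open>cham id\<close>: the order of
  eigenvalues is prescribed only among lines of the same sign.\<close>

definition bpc :: "('k^'n^'n) set" where
  "bpc = cone (\<lambda>i j. \<epsilon> i = \<epsilon> j \<and> ord i < ord j)"

lemma bpc_dg: "dg x \<in> bpc \<longleftrightarrow> sum x UNIV = 0 \<and> (\<forall>i j. \<epsilon> i = \<epsilon> j \<longrightarrow> ord i < ord j \<longrightarrow> x j \<le> x i)"
  by (auto simp: bpc_def cone_def dg_inject)

lemma line_before_iff:
  assumes "\<epsilon> i = \<epsilon> j" shows "line_before bpc (line i) (line j) \<longleftrightarrow> ord i \<le> ord j"
proof
  assume l: "line_before bpc (line i) (line j)"
  have "dg ramp \<in> bpc" by (simp add: bpc_dg sum_ramp) (simp add: ramp_def)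
  then have "ramp j \<le> ramp i" using l by (auto simp: line_before_def)
  then show "ord i \<le> ord j" by (simp add: ramp_def)
next
  assume l: "ord i \<le> ord j"
  show "line_before bpc (line i) (line j)"
    unfolding line_before_def
  proof
    fix X assume X: "X \<in> bpc"
    then obtain x where x: "X = dg x" by (auto simp: bpc_def cone_def)
    have "x j \<le> x i"
      using X l assms unfolding x by (cases "i = j") (auto simp: bpc_dg le_less ord_eq_iff)
    then show "eigval (line j) X \<le> eigval (line i) X" by (simp add: x)
  qed
qed

lemma B_line: "B (P *v (c *s axis i 1)) (P *v (c *s axis i 1)) = of_real (\<epsilon> i * (norm c)\<^sup>2)"
proof -
  have "rdiag \<epsilon> *v (c *s axis i 1) = of_real (\<epsilon> i) *s (c *s axis i (1::'k))"
    by (auto simp: vec_eq_iff rdiag_def diagm_mult_vec_nth axis_def)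
  then have "B (P *v (c *s axis i 1)) (P *v (c *s axis i 1)) = of_real (\<epsilon> i) * (c * (scnj c * sdot (axis i 1) (axis i 1)))"
    by (simp add: B sdot_smult_left sdot_smult_right)
  also have "sdot (axis i 1) (axis i (1::'k)) = 1" unfolding sdot_axis_right by (simp add: axis_def)
  finally show ?thesis by (simp only: of_real_mult mult_scnj'[symmetric] mult_1_right)
qed

lemma line_nz: "P *v (c *s axis i 1) = 0 \<longleftrightarrow> c = 0"
  using P_axis_nz[of i] by (simp add: vector_scalar_commute)

lemma pos_lines_eq: "pos_lines B (range line) = line ` {i. \<epsilon> i = 1}"
  and neg_lines_eq: "neg_lines B (range line) = line ` {i. \<epsilon> i = -1}"
proof -
  have p: "(\<forall>v\<in>line i. v \<noteq> 0 \<longrightarrow> pos_scalar (B v v)) \<longleftrightarrow> 0 < \<epsilon> i" for i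
  proof
    assume a: "\<forall>v\<in>line i. v \<noteq> 0 \<longrightarrow> pos_scalar (B v v)"
    have "P *v (1 *s axis i 1) \<in> line i" "P *v (1 *s axis i 1) \<noteq> 0"
      using axis_in_line[of i] P_axis_nz[of i] by simp_all
    then have "pos_scalar (B (P *v (1 *s axis i 1)) (P *v (1 *s axis i 1)))" using a by blast
    then show "0 < \<epsilon> i" unfolding B_line pos_scalar_of_real by simp
  next
    assume e: "0 < \<epsilon> i"
    show "\<forall>v\<in>line i. v \<noteq> 0 \<longrightarrow> pos_scalar (B v v)"
    proof (intro ballI impI)
      fix v assume "v \<in> line i" "v \<noteq> 0"
      then obtain c where c: "v = P *v (c *s axis i 1)" by (auto simp: line_eq)
      then have "c \<noteq> 0" using \<open>v \<noteq> 0\<close> line_nz by blast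
      then show "pos_scalar (B v v)" unfolding c B_line pos_scalar_of_real using e by (simp add: zero_less_mult_iff)
    qed
  qed
  have n: "(\<forall>v\<in>line i. v \<noteq> 0 \<longrightarrow> neg_scalar (B v v)) \<longleftrightarrow> \<epsilon> i < 0" for i
  proof
    assume a: "\<forall>v\<in>line i. v \<noteq> 0 \<longrightarrow> neg_scalar (B v v)"
    have "P *v (1 *s axis i 1) \<in> line i" "P *v (1 *s axis i 1) \<noteq> 0"
      using axis_in_line[of i] P_axis_nz[of i] by simp_all
    then have "neg_scalar (B (P *v (1 *s axis i 1)) (P *v (1 *s axis i 1)))" using a by blast
    then show "\<epsilon> i < 0" unfolding B_line neg_scalar_of_real by simp
  next
    assume e: "\<epsilon> i < 0"
    show "\<forall>v\<in>line i. v \<noteq> 0 \<longrightarrow> neg_scalar (B v v)"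
    proof (intro ballI impI)
      fix v assume "v \<in> line i" "v \<noteq> 0"
      then obtain c where c: "v = P *v (c *s axis i 1)" by (auto simp: line_eq)
      then have "c \<noteq> 0" using \<open>v \<noteq> 0\<close> line_nz by blast
      then show "neg_scalar (B v v)" unfolding c B_line neg_scalar_of_real using e by (simp add: mult_less_0_iff)
    qed
  qed
  have "0 < \<epsilon> i \<longleftrightarrow> \<epsilon> i = 1" "\<epsilon> i < 0 \<longleftrightarrow> \<epsilon> i = -1" for i using eps[of i] by auto
  with p n show "pos_lines B (range line) = line ` {i. \<epsilon> i = 1}" "neg_lines B (range line) = line ` {i. \<epsilon> i = -1}"
    unfolding pos_lines_def neg_lines_def by auto
qed

lemma eps_cases: "\<epsilon> i = 1 \<or> \<epsilon> i = -1" using eps[of i] by auto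

text \<open>The orders on the two sign classes are merged into one ranking \<open>key\<close>, with
  the positive lines first, to which \<open>strict_mono_perm_id\<close> applies.\<close>

lemma sign_mono_perm_id:
  assumes "bij \<theta>" "\<And>a. \<epsilon> (\<theta> a) = \<epsilon> a" "\<And>a b. \<epsilon> a = \<epsilon> b \<Longrightarrow> ord a < ord b \<Longrightarrow> ord (\<theta> a) \<le> ord (\<theta> b)"
  shows "\<theta> = id"
proof -
  define key where "key a = (if \<epsilon> a = 1 then ord a else CARD('n) + ord a)" for a
  have "inj key"
  proof (rule injI)
    fix a b assume "key a = key b"
    then show "a = b" using ord_less[of a] ord_less[of b] by (simp add: key_def ord_eq_iff split: if_splits)
  qed
  moreover have "key (\<theta> a) \<le> key (\<theta> b)" if "key a < key b" for a b
    using that assms(3)[of a b] eps_cases[of a] eps_cases[of b] ord_less[of a] ord_less[of b] ord_less[of "\<theta> a"]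
    by (auto simp: key_def assms(2) split: if_splits)
  ultimately show ?thesis using assms(1) by (intro strict_mono_perm_id[of key])
qed

text \<open>Existence comes from reversing the order in each sign class. Two such elements differ by
  a permutation that preserves the signs and the order within each class, which is the
  identity.\<close>

lemma w_opp_eq:
  obtains \<omega> where "bij \<omega>" "\<And>i. \<epsilon> (\<omega> i) = \<epsilon> i"
    "\<And>i j. \<epsilon> i = \<epsilon> j \<Longrightarrow> ord i < ord j \<Longrightarrow> ord (\<omega> j) < ord (\<omega> i)"
    "w_opp B \<tau> bsp (range line) bpc = wcl \<omega>"
proof -
  obtain \<omega> where \<omega>: "bij \<omega>" "\<And>i. \<epsilon> (\<omega> i) = \<epsilon> i"
    "\<And>i j. \<epsilon> i = \<epsilon> j \<Longrightarrow> ord i < ord j \<Longrightarrow> ord (\<omega> j) < ord (\<omega> i)"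
    using order_reversing_exists[OF inj_ord, of \<epsilon>] by blast
  define good where "good w \<longleftrightarrow> (\<forall>S\<in>{pos_lines B (range line), neg_lines B (range line)}. W_sub_act w ` S = S \<and>
        (\<forall>l\<in>S. \<forall>l'\<in>S. line_before bpc l l' \<longleftrightarrow> line_before bpc (W_sub_act w l') (W_sub_act w l)))" for w
  define sg where "sg s = line ` {i. \<epsilon> i = s}" for s
  \<comment> \<open>The conditions in \<open>w_opp\<close> concern sets of lines; here they become
    conditions on the permutation alone.\<close>
  have good_iff: "good (wcl \<pi>) \<longleftrightarrow> (\<forall>i. \<epsilon> (\<pi> i) = \<epsilon> i) \<and>
      (\<forall>i j. \<epsilon> i = \<epsilon> j \<longrightarrow> (ord i \<le> ord j \<longleftrightarrow> ord (\<pi> j) \<le> ord (\<pi> i)))" if \<pi>: "bij \<pi>" for \<pi>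
  proof -
    have img: "W_sub_act (wcl \<pi>) ` sg s = line ` \<pi> ` {i. \<epsilon> i = s}" for s
      by (simp add: sg_def image_image W_sub_act_line[OF \<pi>])
    have inj_line: "inj line" by (simp add: inj_def line_inject)
    have img_eq: "W_sub_act (wcl \<pi>) ` sg s = sg s \<longleftrightarrow> \<pi> ` {i. \<epsilon> i = s} = {i. \<epsilon> i = s}" for s
      unfolding img unfolding sg_def by (rule inj_image_eq_iff[OF inj_line])
    have "good (wcl \<pi>) \<longleftrightarrow> (\<forall>s\<in>{1,-1}. W_sub_act (wcl \<pi>) ` sg s = sg s \<and>
        (\<forall>i j. \<epsilon> i = s \<longrightarrow> \<epsilon> j = s \<longrightarrow> (line_before bpc (line i) (line j) \<longleftrightarrow> line_before bpc (line (\<pi> j)) (line (\<pi> i)))))"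
      unfolding good_def pos_lines_eq neg_lines_eq by (simp add: sg_def W_sub_act_line[OF \<pi>])
    also have "\<dots> \<longleftrightarrow> (\<forall>s\<in>{1,-1}. \<pi> ` {i. \<epsilon> i = s} = {i. \<epsilon> i = s} \<and>
        (\<forall>i j. \<epsilon> i = s \<longrightarrow> \<epsilon> j = s \<longrightarrow> (ord i \<le> ord j \<longleftrightarrow> ord (\<pi> j) \<le> ord (\<pi> i))))"
    proof (intro ball_cong refl conj_cong img_eq iff_allI imp_cong)
      fix s i j assume e: "\<pi> ` {i. \<epsilon> i = s} = {i. \<epsilon> i = s}" "\<epsilon> i = s" "\<epsilon> j = s"
      then have "\<epsilon> (\<pi> i) = s" "\<epsilon> (\<pi> j) = s" by blast+
      then show "(line_before bpc (line i) (line j) = line_before bpc (line (\<pi> j)) (line (\<pi> i))) =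
          ((ord i \<le> ord j) = (ord (\<pi> j) \<le> ord (\<pi> i)))"
        using e by (simp add: line_before_iff)
    qed
    also have "\<dots> \<longleftrightarrow> (\<forall>i. \<epsilon> (\<pi> i) = \<epsilon> i) \<and>
      (\<forall>i j. \<epsilon> i = \<epsilon> j \<longrightarrow> (ord i \<le> ord j \<longleftrightarrow> ord (\<pi> j) \<le> ord (\<pi> i)))" (is "?A \<longleftrightarrow> ?B")
    proof
      assume A: ?A
      have "\<epsilon> (\<pi> i) = \<epsilon> i" for i using A eps_cases[of i] by blast
      moreover have "ord i \<le> ord j \<longleftrightarrow> ord (\<pi> j) \<le> ord (\<pi> i)" if "\<epsilon> i = \<epsilon> j" for i j
        using A eps_cases[of i] that by (metis insertI1 insertI2)
      ultimately show ?B by blast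
    next
      assume Bq: ?B
      note B1 = Bq[THEN conjunct1, rule_format] and B2 = Bq[THEN conjunct2, rule_format]
      have "\<pi> ` {i. \<epsilon> i = s} = {i. \<epsilon> i = s}" for s
      proof (rule card_subset_eq)
        show "\<pi> ` {i. \<epsilon> i = s} \<subseteq> {i. \<epsilon> i = s}" using B1 by auto
        show "card (\<pi> ` {i. \<epsilon> i = s}) = card {i. \<epsilon> i = s}"
          by (rule card_image[OF inj_on_subset[OF bij_is_inj[OF \<pi>] subset_UNIV]])
      qed simp
      then show ?A by (intro ballI conjI allI impI B2) simp_all
    qed
    finally show ?thesis .
  qed
  have "w_opp B \<tau> bsp (range line) bpc = wcl \<omega>"
    unfolding w_opp_def good_def[symmetric]
  proof (rule the_equality)
    have "ord i \<le> ord j \<longleftrightarrow> ord (\<omega> j) \<le> ord (\<omega> i)" if "\<epsilon> i = \<epsilon> j" for i j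
      using \<omega>(3)[of i j] \<omega>(3)[of j i] that by (cases "ord i" "ord j" rule: linorder_cases) (auto simp: ord_eq_iff)
    then have "good (wcl \<omega>)" unfolding good_iff[OF \<omega>(1)] by (intro conjI allI impI \<omega>(2))
    then show "wcl \<omega> \<in> carrier (W_group \<tau> bsp) \<and> good (wcl \<omega>)"
      unfolding carrier_W using \<omega>(1) by blast
    fix w assume w: "w \<in> carrier (W_group \<tau> bsp) \<and> good w"
    then obtain \<pi> where \<pi>: "bij \<pi>" "w = wcl \<pi>" by (auto simp: carrier_W)
    have "good (wcl \<pi>)" using w \<pi>(2) by simp
    then have G: "(\<forall>i. \<epsilon> (\<pi> i) = \<epsilon> i) \<and>
        (\<forall>i j. \<epsilon> i = \<epsilon> j \<longrightarrow> (ord i \<le> ord j \<longleftrightarrow> ord (\<pi> j) \<le> ord (\<pi> i)))"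
      unfolding good_iff[OF \<pi>(1)] .
    note g = G[THEN conjunct1, rule_format] G[THEN conjunct2, rule_format]
    have "\<pi> = \<omega>"
    proof -
      obtain \<theta> where \<theta>: "\<And>a. \<pi> a = \<omega> (\<theta> a)" using bij_factor[OF \<omega>(1)] by blast
      have "inj \<theta>" using bij_is_inj[OF \<pi>(1)] by (auto simp: inj_def \<theta>)
      then have b\<theta>: "bij \<theta>" by (simp add: bij_def finite_UNIV_inj_surj)
      have e\<theta>: "\<epsilon> (\<theta> a) = \<epsilon> a" for a using g(1)[of a] \<omega>(2)[of "\<theta> a"] \<theta>[of a] by simp
      have mono: "ord (\<theta> a) < ord (\<theta> b)" if "\<epsilon> a = \<epsilon> b" "ord a < ord b" for a b
      proof (rule ccontr)
        assume "\<not> ord (\<theta> a) < ord (\<theta> b)"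
        then have "ord (\<theta> b) \<le> ord (\<theta> a)" by simp
        then have "\<theta> a = \<theta> b \<or> ord (\<omega> (\<theta> a)) < ord (\<omega> (\<theta> b))"
          using \<omega>(3)[of "\<theta> b" "\<theta> a"] e\<theta> that(1) by (auto simp: le_less ord_eq_iff)
        then have "ord (\<pi> a) \<le> ord (\<pi> b)" using \<theta> by auto
        then have "ord b \<le> ord a" using g(2)[of b a] that(1) by simp
        then show False using that(2) by simp
      qed
      have "\<theta> = id" using b\<theta> e\<theta> less_imp_le[OF mono] by (rule sign_mono_perm_id)
      then show ?thesis using \<theta> by (simp add: fun_eq_iff)
    qed
    then show "w = wcl \<omega>" using \<pi> by simp
  qed
  then show ?thesis using \<omega> that by blast
qed

text \<open>The factor \<open>rv\<close> is the effect of the minus sign: negating the eigenvalues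
  reverses their order, so the list of lines is read backwards.\<close>

lemma opp_inv_flag_eq:
  obtains \<omega> where "bij \<omega>" "\<And>i. \<epsilon> (\<omega> i) = \<epsilon> i"
    "\<And>i j. \<epsilon> i = \<epsilon> j \<Longrightarrow> ord i < ord j \<Longrightarrow> ord (\<omega> j) < ord (\<omega> i)"
    "\<And>\<psi>. bij \<psi> \<Longrightarrow> opp_inv_flag B \<tau> bsp (range line) bpc (pflag \<psi>) = pflag (\<omega> \<circ> \<psi> \<circ> rv)"
proof -
  obtain \<omega> where \<omega>: "bij \<omega>" "\<And>i. \<epsilon> (\<omega> i) = \<epsilon> i"
    "\<And>i j. \<epsilon> i = \<epsilon> j \<Longrightarrow> ord i < ord j \<Longrightarrow> ord (\<omega> j) < ord (\<omega> i)"
    "w_opp B \<tau> bsp (range line) bpc = wcl \<omega>" using w_opp_eq by blast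
  have opp: "opp_inv B \<tau> bsp (range line) bpc (dg (\<lambda>i. x (\<omega> i))) = dg (\<lambda>i. - x i)" for x
    by (simp add: opp_inv_def \<omega>(4) W_act_dg[OF \<omega>(1)] dg_uminus)
  have dec_rv: "decr ord (\<lambda>a. - y (rv a)) \<longleftrightarrow> decr ord y" for y
  proof
    assume d: "decr ord (\<lambda>a. - y (rv a))"
    show "decr ord y" unfolding decr_def
    proof (intro allI impI)
      fix i j assume "ord i < ord j"
      then have "ord (rv j) < ord (rv i)" by (simp only: ord_rv_less)
      then show "y j \<le> y i" using d unfolding decr_def by (metis neg_le_iff_le rv_rv)
    qed
  next
    assume d: "decr ord y"
    show "decr ord (\<lambda>a. - y (rv a))" unfolding decr_def
    proof (intro allI impI)
      fix i j assume "ord i < ord j"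
      then have "ord (rv j) < ord (rv i)" by (simp only: ord_rv_less)
      then show "- y (rv j) \<le> - y (rv i)" using d by (simp add: decr_def)
    qed
  qed
  have "opp_inv_flag B \<tau> bsp (range line) bpc (pflag \<psi>) = pflag (\<omega> \<circ> \<psi> \<circ> rv)" if \<psi>: "bij \<psi>" for \<psi>
  proof -
    have "opp_inv B \<tau> bsp (range line) bpc ` cham \<psi> = cham (\<omega> \<circ> \<psi> \<circ> rv)"
    proof (intro equalityI subsetI)
      fix X assume "X \<in> opp_inv B \<tau> bsp (range line) bpc ` cham \<psi>"
      then obtain z where z: "sum z UNIV = 0" "decr ord (\<lambda>a. z (\<psi> a))" "X = opp_inv B \<tau> bsp (range line) bpc (dg z)"
        by (auto simp: cham_def)
      obtain x where x: "\<And>a. x (\<omega> a) = z a" "sum x UNIV = sum z UNIV" using perm_shift[OF \<omega>(1)] by metis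
      have "X = dg (\<lambda>i. - x i)" using opp[of x] by (simp add: x z(3))
      moreover have "decr ord (\<lambda>a. - x ((\<omega> \<circ> \<psi> \<circ> rv) a))" using dec_rv[of "\<lambda>a. z (\<psi> a)"] z(2) by (simp add: x)
      ultimately show "X \<in> cham (\<omega> \<circ> \<psi> \<circ> rv)" using x z(1) by (simp add: cham_dg sum_negf)
    next
      fix X assume "X \<in> cham (\<omega> \<circ> \<psi> \<circ> rv)"
      then obtain y where y: "sum y UNIV = 0" "decr ord (\<lambda>a. y ((\<omega> \<circ> \<psi> \<circ> rv) a))" "X = dg y"
        by (auto simp: cham_def)
      have "X = opp_inv B \<tau> bsp (range line) bpc (dg (\<lambda>i. - y (\<omega> i)))" using opp[of "\<lambda>i. - y i"] by (simp add: y)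
      moreover have "dg (\<lambda>i. - y (\<omega> i)) \<in> cham \<psi>"
        using dec_rv[of "\<lambda>a. - y (\<omega> (\<psi> a))"] y(1,2) sum_perm[OF \<omega>(1), of y] by (simp add: cham_dg sum_negf)
      ultimately show "X \<in> opp_inv B \<tau> bsp (range line) bpc ` cham \<psi>" by blast
    qed
    then show ?thesis
      unfolding opp_inv_flag_def chamber_of_pflag[OF \<psi>]
      using flag_of_cham[of "\<omega> \<circ> \<psi> \<circ> rv"] \<omega>(1) \<psi> bij_rv by (simp add: bij_comp)
  qed
  then show ?thesis using \<omega>(1-3) that by blast
qed

end

section \<open>Projections\<close>

lemma mult_vec_bounded:
  fixes T :: "'k::scalar_rc^'n^'n"
  obtains c where "c > 0" "\<And>v. norm (T *v v) \<le> c * norm v"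
proof -
  have "linear (\<lambda>v. T *v v)"
    by (rule linearI) (simp_all add: matrix_vector_right_distrib scaleR_mult_vec)
  then have "bounded_linear (\<lambda>v. T *v v)" by (simp add: linear_conv_bounded_linear)
  then obtain c where "c > 0" "\<And>v. norm (T *v v) \<le> norm v * c" using bounded_linear.pos_bounded by blast
  then show ?thesis using that[of c] by (simp add: mult.commute)
qed

text \<open>Fewer equations than unknowns. The equations indexed by \<open>I\<close> are moved by an
  injection to rows in \<open>J\<close>; some row \<open>j0\<close> in \<open>J\<close> stays empty,
  so the square matrix is singular.\<close>

lemma exists_kernel_supported:
  fixes C :: "'k::scalar_rc^'n^'n"
  assumes "card I < card J"
  obtains u where "u \<noteq> 0" "\<And>j. j \<notin> J \<Longrightarrow> u $ j = 0" "\<And>i. i \<in> I \<Longrightarrow> (C *v u) $ i = 0"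
proof -
  obtain \<phi> where \<phi>: "inj_on \<phi> I" "\<phi> ` I \<subseteq> J"
    using card_le_inj[of I J] assms by (metis finite_code less_imp_le)
  have "card (\<phi> ` I) < card J" using \<phi>(1) assms by (simp add: card_image)
  then obtain j0 where j0: "j0 \<in> J" "j0 \<notin> \<phi> ` I" using \<phi>(2) by (metis less_irrefl subsetI subset_antisym)
  define D where "D = (\<chi> j. if j \<notin> J then axis j 1 else if j \<in> \<phi> ` I then C $ the_inv_into I \<phi> j else 0)"
  have "row j0 D = 0" using j0 by (simp add: row_def D_def vec_eq_iff)
  then have "det D = 0" by (rule det_zero_row)
  then obtain u where u: "u \<noteq> 0" "D *v u = 0" unfolding det_eq_0_kernel by blast
  have "(D *v u) $ j = u $ j" if "j \<notin> J" for j
    using that by (simp add: D_def matrix_vector_mult_def axis_def if_distrib[of "\<lambda>z. z * _"] cong: if_cong)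
  moreover have "(D *v u) $ (\<phi> i) = (C *v u) $ i" if "i \<in> I" for i
  proof -
    have "\<phi> i \<in> J" "\<phi> i \<in> \<phi> ` I" "the_inv_into I \<phi> (\<phi> i) = i"
      using that \<phi> by (auto simp: the_inv_into_f_f)
    then show ?thesis by (simp add: D_def matrix_vector_mult_def)
  qed
  ultimately have "u $ j = 0" if "j \<notin> J" for j using u(2) that by (metis zero_index)
  moreover have "(C *v u) $ i = 0" if "i \<in> I" for i
    using \<open>\<And>i. i \<in> I \<Longrightarrow> (D *v u) $ (\<phi> i) = (C *v u) $ i\<close>[OF that] u(2) by simp
  ultimately show ?thesis using that[of u] u(1) by simp
qed

lemma sdot_rdiag: "sdot (rdiag f *v u) u = of_real (\<Sum>i\<in>UNIV. f i * (norm (u $ i))\<^sup>2)"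
  by (simp add: sdot_def rdiag_def diagm_mult_vec_nth mult.assoc mult_scnj')

text \<open>Sylvester's law of inertia, for the positive part with \<open>\<sigma> = 1\<close> and
  for the negative part with \<open>\<sigma> = -1\<close>. A nonzero vector supported on the indices
  counted for \<open>s\<close>, whose image has no component on those counted for \<open>e\<close>,
  would give a form value both positive and not positive.\<close>

lemma signature_le:
  fixes F :: "'k::scalar_rc^'n^'n" and \<sigma> :: real
  assumes F: "mstar F ** rdiag e ** F = rdiag s"
  shows "card {a. \<sigma> * s a > 0} \<le> card {i. \<sigma> * e i > 0}"
proof (rule ccontr)
  assume "\<not> ?thesis"
  then have "card {i. \<sigma> * e i > 0} < card {a. \<sigma> * s a > 0}" by simp
  then obtain u where u: "u \<noteq> 0" "\<And>j. j \<notin> {a. \<sigma> * s a > 0} \<Longrightarrow> u $ j = 0"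
    "\<And>i. i \<in> {i. \<sigma> * e i > 0} \<Longrightarrow> (F *v u) $ i = 0"
    using exists_kernel_supported[of _ _ F] by metis
  have "sdot (rdiag s *v u) u = sdot (rdiag e *v (F *v u)) (F *v u)"
    unfolding F[symmetric] by (simp add: matrix_vector_mul_assoc[symmetric] sdot_mult_left[of "mstar F"])
  then have eq: "(\<Sum>a\<in>UNIV. s a * (norm (u $ a))\<^sup>2) = (\<Sum>i\<in>UNIV. e i * (norm ((F *v u) $ i))\<^sup>2)"
    unfolding sdot_rdiag of_real_eq_iff .
  have "0 < (\<Sum>a\<in>UNIV. \<sigma> * (s a * (norm (u $ a))\<^sup>2))"
  proof -
    have nn: "0 \<le> \<sigma> * (s a * (norm (u $ a))\<^sup>2)" for a
    proof (cases "u $ a = 0")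
      case False
      then have "0 < \<sigma> * s a" using u(2)[of a] by auto
      then show ?thesis by (simp add: mult.assoc[symmetric])
    qed simp
    obtain a where a: "u $ a \<noteq> 0" using u(1) by (auto simp: vec_eq_iff)
    then have "0 < \<sigma> * s a" using u(2)[of a] by auto
    then have "0 < \<sigma> * (s a * (norm (u $ a))\<^sup>2)" using a by (simp add: mult.assoc[symmetric])
    then show ?thesis using nn by (intro sum_pos2[of UNIV a]) auto
  qed
  moreover have "(\<Sum>i\<in>UNIV. \<sigma> * (e i * (norm ((F *v u) $ i))\<^sup>2)) \<le> 0"
  proof (rule sum_nonpos)
    fix i show "\<sigma> * (e i * (norm ((F *v u) $ i))\<^sup>2) \<le> 0"
      using u(3)[of i] by (cases "0 < \<sigma> * e i") (auto simp: mult.assoc[symmetric] mult_nonpos_nonneg not_less)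
  qed
  ultimately show False using eq by (simp add: sum_distrib_left[symmetric])
qed

text \<open>The inequalities of inertia for the two signs are equalities because the totals agree;
  the permutation is glued from bijections between the sign classes.\<close>

lemma signature_perm:
  fixes F :: "'k::scalar_rc^'n^'n"
  assumes F: "mstar F ** rdiag e ** F = rdiag s" and s: "\<And>a. s a \<noteq> 0" and e: "\<And>i. \<bar>e i\<bar> = 1"
  obtains m where "bij m" "\<And>a. e (m a) = sgn (s a)"
proof -
  have e': "e i = 1 \<or> e i = -1" for i using e[of i] by auto
  let ?P = "{a. s a > 0}" and ?Q = "{i. e i > 0}"
  have P: "{a. s a < 0} = - ?P" "{i. e i < 0} = - ?Q" using s e' by (auto simp: not_less less_le) (metis zero_neq_one zero_neq_neg_one)
  have "card ?P \<le> card ?Q" using signature_le[OF F, of 1] by simp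
  moreover have "card (- ?P) \<le> card (- ?Q)" using signature_le[OF F, of "-1"] P by simp
  moreover have "card (- ?P) = CARD('n) - card ?P" "card (- ?Q) = CARD('n) - card ?Q" by (simp_all add: Compl_eq_Diff_UNIV card_Diff_subset)
  moreover have "card ?Q \<le> CARD('n)" by (rule card_mono) simp_all
  ultimately have c: "card ?P = card ?Q" "card (- ?P) = card (- ?Q)" by linarith+
  obtain f where f: "bij_betw f ?P ?Q" using c(1) finite_same_card_bij[of ?P ?Q] by auto
  obtain f' where f': "bij_betw f' (- ?P) (- ?Q)" using c(2) finite_same_card_bij[of "- ?P" "- ?Q"] by auto
  define m where "m a = (if a \<in> ?P then f a else f' a)" for a
  have "bij_betw m ?P ?Q" using f by (rule bij_betw_cong[THEN iffD1, rotated]) (simp add: m_def)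
  moreover have "bij_betw m (- ?P) (- ?Q)" using f' by (rule bij_betw_cong[THEN iffD1, rotated]) (simp add: m_def)
  ultimately have "bij_betw m (?P \<union> - ?P) (?Q \<union> - ?Q)" by (rule bij_betw_combine) simp
  then have bij: "bij m" by simp
  have "e (m a) = sgn (s a)" for a
  proof (cases "a \<in> ?P")
    case True
    then have "m a \<in> ?Q" using \<open>bij_betw m ?P ?Q\<close> by (rule bij_betw_apply[rotated])
    then show ?thesis using True e'[of "m a"] by auto
  next
    case False
    then have "m a \<in> - ?Q" using bij_betw_apply[OF \<open>bij_betw m (- ?P) (- ?Q)\<close>, of a] by simp
    moreover have "s a < 0" using False s[of a] by simp
    ultimately show ?thesis using e'[of "m a"] by auto
  qed
  with bij show ?thesis by (rule that)
qed

lemma monomat_with_det: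
  fixes \<delta> :: "'k::scalar_rc" and \<pi> :: "'n::finite \<Rightarrow> 'n"
  assumes "bij \<pi>" "norm \<delta> = 1"
  obtains c :: "'n \<Rightarrow> 'k" where "\<And>i. norm (c i) = 1" "det (monomat \<pi> c) = \<delta>"
proof -
  obtain c0 where c0: "monomial_unit \<pi> (c0 :: 'n \<Rightarrow> 'k)" using monomial_unit_exists[OF assms(1)] by blast
  fix a :: 'n
  define c where "c i = c0 i * (if i = a then \<delta> else 1)" for i
  have "monomat \<pi> c = monomat \<pi> c0 ** diagm (\<lambda>i. if i = a then \<delta> else 1)"
    by (simp add: vec_eq_iff diagm_mult_right_nth monomat_nth c_def)
  then have "det (monomat \<pi> c) = \<delta>" using c0 by (simp add: det_mul det_diagm monomial_unit_def)
  moreover have "norm (c i) = 1" for i using c0 assms(2) by (simp add: c_def monomial_unit_def norm_mult)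
  ultimately show ?thesis using that by blast
qed

lemma monomat_mult: "monomat \<pi> c ** monomat \<psi> d = monomat (\<lambda>j. \<pi> (\<psi> j)) (\<lambda>j. c (\<psi> j) * d j)"
  by (auto simp: vec_eq_iff monomat_mult_nth monomat_nth)

lemma monomat_id: "monomat id (\<lambda>_. 1) = mat 1"
  by (simp add: vec_eq_iff monomat_nth mat_def)

lemma mstar_monomat_rdiag:
  assumes "bij \<pi>" "\<And>i. norm (c i) = 1"
  shows "mstar (monomat \<pi> c) ** rdiag e ** monomat \<pi> c = rdiag (\<lambda>i. e (\<pi> i))"
proof -
  have "mstar (monomat \<pi> c) ** rdiag e ** monomat \<pi> c = mstar (monomat \<pi> c) ** (monomat \<pi> c ** rdiag (\<lambda>i. e (\<pi> i)))"
    unfolding monomat_mult_rdiag[OF assms(1)] by (simp add: matrix_mul_assoc)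
  also have "\<dots> = rdiag (\<lambda>i. e (\<pi> i))"
    using unitary_monomat[OF assms] by (simp add: matrix_mul_assoc unitary_def)
  finally show ?thesis .
qed

lemma unitary_entry_le:
  assumes "unitary K" shows "norm (K $ i $ j) \<le> 1"
proof -
  have "(norm (K *v axis j 1))\<^sup>2 = 1"
  proof -
    have "of_real ((norm (K *v axis j 1))\<^sup>2) = (mstar K ** mat 1 ** K) $ j $ j"
      unfolding conj_entry by (simp add: sdot_self)
    also have "\<dots> = 1" using assms by (simp add: unitary_def) (simp add: mat_def)
    finally show ?thesis using of_real_eq_1_iff by blast
  qed
  then have "norm (K *v axis j 1) = 1" using norm_ge_zero by (simp add: power2_eq_1_iff) (metis neg_0_le_iff_le not_one_le_zero norm_ge_zero)
  moreover have "norm ((K *v axis j 1) $ i) \<le> norm (K *v axis j 1)"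
    by (rule Finite_Cartesian_Product.norm_nth_le)
  ultimately show ?thesis by (simp add: mult_axis_nth)
qed

text \<open>The entries of a unitary matrix have modulus at most \<open>1\<close>. This bounds the
  Gram matrices of the form in all unitary frames at once.\<close>

lemma unitary_conj_entry_le:
  fixes K :: "'k::scalar_rc^'n^'n"
  assumes "unitary K" "\<And>i. \<bar>e i\<bar> = 1"
  shows "norm ((mstar K ** rdiag e ** K) $ i $ j) \<le> CARD('n)"
proof -
  have "(mstar K ** rdiag e ** K) $ i $ j = (\<Sum>k\<in>UNIV. scnj (K $ k $ i) * of_real (e k) * K $ k $ j)"
    unfolding matrix_matrix_mult_def[of "mstar K ** rdiag e"] by (simp add: rdiag_def diagm_mult_right_nth)
  also have "norm \<dots> \<le> (\<Sum>k\<in>(UNIV::'n set). 1)"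
  proof (rule sum_norm_le)
    fix k
    have "norm (K $ k $ i) * norm (K $ k $ j) \<le> 1 * 1"
      using unitary_entry_le[OF assms(1)] by (intro mult_mono) auto
    then show "norm (scnj (K $ k $ i) * of_real (e k) * K $ k $ j) \<le> 1" using assms(2)[of k] by (simp add: norm_mult)
  qed
  finally show ?thesis by simp
qed

context ocoords
begin

section \<open>Cartan projection, attracting and repelling flags, Jordan projection\<close>

lemma cham_id: "cham id = {dg x |x. sum x UNIV = 0 \<and> decr ord x}" by (simp add: cham_def)

lemma pflag_id: "pflag id = frame_flag ord P" by (simp add: pflag_def monomat_id)

lemma KAK_mult:
  assumes "det K = 1" "det L = 1" "sum x UNIV = 0"
  shows "cl (em K) \<otimes>\<^bsub>PSL\<^esub> PSL_exp (dg x) \<otimes>\<^bsub>PSL\<^esub> cl (em L) = cl (em (K ** rdiag (\<lambda>i. exp (x i)) ** L))"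
  using assms by (simp add: PSL_exp_dg cl_mult det_exp det_mul em_mult)

lemma cl_em_eqD:
  assumes "cl (em A) = cl (em A')"
  obtains c where "norm c = 1" "c ^ CARD('n) = 1" "A' = mat c ** A"
proof -
  obtain c where c: "c ^ CARD('n) = 1" "em A' = mat c ** em A" using cl_eqD[OF assms] .
  then have "em A' = em (mat c ** A)" by (simp add: em_mult[symmetric] em_mat)
  then show ?thesis using c that[of c] norm_root_of_unity[OF c(1)] by (simp add: em_inject)
qed

lemma unitary_mat: "norm c = 1 \<Longrightarrow> unitary (mat c :: 'k^'n^'n)"
  by (simp add: mat_eq_diagm unitary_diagm)

text \<open>Representatives of one class differ by a scalar of modulus one, which is absorbed in
  \<open>K\<close>; the rest is uniqueness of singular values.\<close>

lemma cartan_proj_eq: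
  assumes U: "unitary K" "unitary L" "det K = 1" "det L = 1" and x: "decr ord x" "sum x UNIV = 0"
  shows "cartan_proj \<tau> (cham id) (cl (em (K ** rdiag (\<lambda>i. exp (x i)) ** L))) = dg x"
  unfolding cartan_proj_def
proof (rule the_equality)
  have "cl (em K) \<in> K_group \<tau>" "cl (em L) \<in> K_group \<tau>" using U unfolding K_group_eq by blast+
  then show "dg x \<in> cham id \<and> (\<exists>k\<in>K_group \<tau>. \<exists>l\<in>K_group \<tau>.
      cl (em (K ** rdiag (\<lambda>i. exp (x i)) ** L)) = k \<otimes>\<^bsub>PSL\<^esub> PSL_exp (dg x) \<otimes>\<^bsub>PSL\<^esub> l)"
    using x KAK_mult[OF U(3,4) x(2)] by (auto simp: cham_dg)
  fix X assume "X \<in> cham id \<and> (\<exists>k\<in>K_group \<tau>. \<exists>l\<in>K_group \<tau>.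
      cl (em (K ** rdiag (\<lambda>i. exp (x i)) ** L)) = k \<otimes>\<^bsub>PSL\<^esub> PSL_exp X \<otimes>\<^bsub>PSL\<^esub> l)"
  then obtain x' K' L' where x': "X = dg x'" "sum x' UNIV = 0" "decr ord x'"
    and U': "unitary K'" "det K' = 1" "unitary L'" "det L' = 1"
    and eq: "cl (em (K ** rdiag (\<lambda>i. exp (x i)) ** L)) = cl (em K') \<otimes>\<^bsub>PSL\<^esub> PSL_exp X \<otimes>\<^bsub>PSL\<^esub> cl (em L')"
    unfolding cham_id K_group_eq by blast
  have "cl (em (K ** rdiag (\<lambda>i. exp (x i)) ** L)) = cl (em (K' ** rdiag (\<lambda>i. exp (x' i)) ** L'))"
    unfolding eq x'(1) by (rule KAK_mult[OF U'(2,4) x'(2)])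
  then obtain c where c: "norm c = 1" "K' ** rdiag (\<lambda>i. exp (x' i)) ** L' = mat c ** (K ** rdiag (\<lambda>i. exp (x i)) ** L)"
    by (rule cl_em_eqD)
  have "x' = x"
  proof (rule singular_values_unique[OF inj_ord])
    show "unitary (mat c ** K)" using unitary_mat[OF c(1)] U(1) by (rule unitary_mult)
    show "K' ** rdiag (\<lambda>i. exp (x' i)) ** L' = mat c ** K ** rdiag (\<lambda>i. exp (x i)) ** L"
      unfolding c(2) by (simp add: matrix_mul_assoc)
  qed (use U U' x x' in auto)
  then show "X = dg x" by (simp add: x')
qed

lemma frame_flag_mult_diag:
  assumes "invertible D" "\<And>i j. i \<noteq> j \<Longrightarrow> D $ i $ j = 0"
  shows "frame_flag ord (Q ** D) = frame_flag ord (Q :: 'k^'n^'n)"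
proof -
  have "frame_flag ord D = coord_flag ord" using assms by (rule frame_flag_diag)
  then have "frame_flag ord (Q ** D) = (\<lambda>j. (*v) Q ` coord_flag ord j)"
    by (simp only: frame_flag_mult)
  then show ?thesis by (simp only: frame_flag_def)
qed

text \<open>Distinct eigenvalues force two frames \<open>K\<close> and \<open>K'\<close> of one
  element to differ by a diagonal matrix, which does not change the flag. This gives the definite
  description its value.\<close>

lemma U_flag_eq:
  assumes U: "unitary K" "unitary L" "det K = 1" "det L = 1" and x: "decr ord x" "sum x UNIV = 0" "inj x"
  shows "U_flag \<tau> bsp (range line) (cham id) (cl (em (K ** rdiag (\<lambda>i. exp (x i)) ** L))) = frame_flag ord (P ** K)"
  unfolding U_flag_def cartan_proj_eq[OF U x(1,2)] flag_of_cham[OF bij_id] pflag_id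
proof (rule the_equality)
  have act: "flag_act (cl (em K)) (frame_flag ord P) = frame_flag ord (P ** K)" for K
    by (simp add: flag_act_frame em_P)
  have "cl (em K) \<in> K_group \<tau>" "cl (em L) \<in> K_group \<tau>" using U unfolding K_group_eq by blast+
  then show "\<exists>k\<in>K_group \<tau>. \<exists>l\<in>K_group \<tau>. cl (em (K ** rdiag (\<lambda>i. exp (x i)) ** L)) = k \<otimes>\<^bsub>PSL\<^esub> PSL_exp (dg x) \<otimes>\<^bsub>PSL\<^esub> l \<and>
      frame_flag ord (P ** K) = flag_act k (frame_flag ord P)"
    using KAK_mult[OF U(3,4) x(2)] act[of K] by metis
  fix \<xi> assume "\<exists>k\<in>K_group \<tau>. \<exists>l\<in>K_group \<tau>. cl (em (K ** rdiag (\<lambda>i. exp (x i)) ** L)) = k \<otimes>\<^bsub>PSL\<^esub> PSL_exp (dg x) \<otimes>\<^bsub>PSL\<^esub> l \<and>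
      \<xi> = flag_act k (frame_flag ord P)"
  then obtain K' L' where U': "unitary K'" "det K' = 1" "unitary L'" "det L' = 1"
    and eq: "cl (em (K ** rdiag (\<lambda>i. exp (x i)) ** L)) = cl (em K') \<otimes>\<^bsub>PSL\<^esub> PSL_exp (dg x) \<otimes>\<^bsub>PSL\<^esub> cl (em L')"
    and \<xi>: "\<xi> = flag_act (cl (em K')) (frame_flag ord P)"
    unfolding K_group_eq by blast
  have "cl (em (K ** rdiag (\<lambda>i. exp (x i)) ** L)) = cl (em (K' ** rdiag (\<lambda>i. exp (x i)) ** L'))"
    unfolding eq by (rule KAK_mult[OF U'(2,4) x(2)])
  then obtain c where c: "norm c = 1" "K' ** rdiag (\<lambda>i. exp (x i)) ** L' = mat c ** (K ** rdiag (\<lambda>i. exp (x i)) ** L)"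
    by (rule cl_em_eqD)
  have Uc: "unitary (mat c ** K)" using unitary_mat[OF c(1)] U(1) by (rule unitary_mult)
  define D where "D = mstar K' ** (mat c ** K)"
  have diag: "D $ i $ j = 0" if "i \<noteq> j" for i j
    unfolding D_def
  proof (rule singular_frames_unique[OF Uc U(2) U'(1,3) x(3) _ that])
    show "K' ** rdiag (\<lambda>i. exp (x i)) ** L' = mat c ** K ** rdiag (\<lambda>i. exp (x i)) ** L"
      unfolding c(2) by (simp add: matrix_mul_assoc)
  qed
  have "unitary D" unfolding D_def using unitary_mstar[OF U'(1)] Uc by (rule unitary_mult)
  then have iD: "invertible D" using unitary_det by (force simp: invertible_det_nz)
  have KD: "K' ** D = K ** mat c" unfolding D_def by (subst matrix_mul_assoc) (simp add: unitary_right[OF U'(1)] mat_commute)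
  have "invertible (mat c :: 'k^'n^'n)" using unitary_det[OF unitary_mat[OF c(1)]] by (force simp: invertible_det_nz)
  then have "frame_flag ord (P ** K) = frame_flag ord (P ** K ** mat c)"
    by (intro frame_flag_mult_diag[symmetric]) (simp_all add: mat_def)
  also have "\<dots> = frame_flag ord (P ** K' ** D)" by (simp add: matrix_mul_assoc[symmetric] KD)
  also have "\<dots> = frame_flag ord (P ** K')" using iD diag by (rule frame_flag_mult_diag)
  also have "\<dots> = \<xi>" by (simp add: \<xi> act)
  finally show "\<xi> = frame_flag ord (P ** K)" ..
qed

text \<open>Inversion exchanges the two frames and negates \<open>x\<close>, which must be put back
  in decreasing order; the monomial matrix of \<open>rv\<close> does this.\<close>

lemma S_flag_eq:
  assumes U: "unitary K" "unitary L" "det K = 1" "det L = 1" and x: "decr ord x" "sum x UNIV = 0" "inj x"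
    and c: "monomial_unit rv c"
  shows "S_flag \<tau> bsp (range line) (cham id) (cl (em (K ** rdiag (\<lambda>i. exp (x i)) ** L))) =
    frame_flag ord (P ** (mstar L ** monomat rv c))"
proof -
  note m = monomial_unitD[OF c]
  define N where "N = monomat rv c"
  define A where "A = K ** rdiag (\<lambda>i. exp (x i)) ** L"
  define z where "z a = - x (rv a)" for a
  have detA: "det A = 1" using U x by (simp add: A_def det_mul det_exp)
  have N: "unitary N" "det N = 1" using m by (simp_all add: N_def)
  have "N ** rdiag (\<lambda>i. exp (z i)) ** mstar N = rdiag (\<lambda>i. exp (- x i)) ** (N ** mstar N)"
    using monomat_mult_rdiag[OF bij_rv, of c "\<lambda>i. exp (- x i)"] by (simp add: N_def z_def matrix_mul_assoc)
  then have Nz: "N ** rdiag (\<lambda>i. exp (z i)) ** mstar N = rdiag (\<lambda>i. exp (- x i))"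
    by (simp add: unitary_right[OF N(1)])
  have "A ** (mstar L ** rdiag (\<lambda>i. exp (- x i)) ** mstar K) = K ** rdiag (\<lambda>i. exp (x i)) ** (L ** mstar L) ** rdiag (\<lambda>i. exp (- x i)) ** mstar K"
    by (simp add: A_def matrix_mul_assoc)
  also have "\<dots> = K ** (rdiag (\<lambda>i. exp (x i)) ** rdiag (\<lambda>i. exp (- x i))) ** mstar K"
    by (simp add: unitary_right[OF U(2)] matrix_mul_assoc)
  also have "\<dots> = mat 1" unfolding rdiag_mult by (simp add: exp_minus unitary_right[OF U(1)])
  finally have "matrix_inv A = mstar L ** rdiag (\<lambda>i. exp (- x i)) ** mstar K" by (rule matrix_inv_unique)
  also have "\<dots> = (mstar L ** N) ** rdiag (\<lambda>i. exp (z i)) ** (mstar N ** mstar K)"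
    by (simp add: Nz[symmetric] matrix_mul_assoc)
  finally have iA: "matrix_inv A = (mstar L ** N) ** rdiag (\<lambda>i. exp (z i)) ** (mstar N ** mstar K)" .
  have "decr ord z" unfolding decr_def
  proof (intro allI impI)
    fix i j assume "ord i < ord j"
    then have "ord (rv j) < ord (rv i)" by (simp only: ord_rv_less)
    then show "z j \<le> z i" using x(1) by (simp add: z_def decr_def)
  qed
  moreover have "sum z UNIV = 0" using sum_perm[OF bij_rv, of x] x(2) by (simp add: z_def sum_negf)
  moreover have "inj z" using x(3) bij_is_inj[OF bij_rv] by (auto simp: inj_def z_def)
  ultimately have "U_flag \<tau> bsp (range line) (cham id) (cl (em (matrix_inv A))) = frame_flag ord (P ** (mstar L ** N))"
    unfolding iA using U N by (intro U_flag_eq) (simp_all add: unitary_mult unitary_mstar det_mul det_mstar)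
  then show ?thesis using detA by (simp add: S_flag_def A_def[symmetric] N_def cl_inv inv_em)
qed

lemma roots_sl: "roots sl bsp = {root i j |i j. i \<noteq> j}"
  using roots_eq[OF sl_eq] by simp

text \<open>All differences of eigenvalues in the order of \<open>ord\<close> are positive roots, so
  a bound on the minimum is a gap between any two ranks.\<close>

lemma pos_roots_gap:
  assumes m: "(MIN \<alpha>\<in>pos_roots bsp (cham id). \<alpha> (dg x)) > L" and x: "sum x UNIV = 0" and ij: "ord i < ord j"
  shows "x j + L < x i"
proof -
  have "pos_roots bsp (cham id) \<subseteq> (\<lambda>(i, j). root i j) ` UNIV" unfolding pos_roots_def roots_sl by auto
  then have "finite (pos_roots bsp (cham id))" by (rule finite_subset) simp
  moreover have "root i j \<in> pos_roots bsp (cham id)"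
    using ij unfolding pos_roots_def roots_sl by (auto simp: cham_id root_dg decr_def)
  ultimately have "(MIN \<alpha>\<in>pos_roots bsp (cham id). \<alpha> (dg x)) \<le> root i j (dg x)" by (intro Min_le) auto
  then show ?thesis using m x by (simp add: root_dg)
qed

text \<open>The powers of \<open>M\<close> are conjugate by the fixed matrix \<open>T\<close> to
  those of \<open>rdiag \<mu>\<close>. The logarithms of their singular values therefore stay within
  a constant of \<open>n * ln \<bar>\<mu> i\<bar>\<close>, and the constant disappears after
  division by \<open>n\<close>.\<close>

lemma jordan_proj_eq:
  fixes M T :: "'k^'n^'n"
  assumes M: "det M = 1" and T: "invertible T" and MT: "M ** T = T ** rdiag \<mu>" and \<mu>: "\<And>i. \<mu> i \<noteq> 0"
    and dec: "\<And>a b. ord a < ord b \<Longrightarrow> \<bar>\<mu> b\<bar> \<le> \<bar>\<mu> a\<bar>"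
  shows "jordan_proj \<tau> (cham id) (cl (em M)) = dg (\<lambda>i. ln \<bar>\<mu> i\<bar>)" "(\<Sum>i\<in>UNIV. ln \<bar>\<mu> i\<bar>) = 0"
proof -
  let ?Ti = "matrix_inv T"
  note TT = matrix_inv_mult[OF T]
  have pow: "mpow M n ** T = T ** rdiag (\<lambda>i. \<mu> i ^ n)" for n
  proof (induction n)
    case (Suc n)
    have "mpow M (Suc n) ** T = mpow M n ** T ** rdiag \<mu>" by (simp add: matrix_mul_assoc[symmetric] MT)
    then show ?case by (simp add: Suc matrix_mul_assoc[symmetric] rdiag_mult mult.commute)
  qed simp
  have "det M * det T = det T * of_real (\<Prod>i\<in>UNIV. \<mu> i)" using arg_cong[OF MT, of det] by (simp only: det_mul det_rdiag)
  then have "of_real (\<Prod>i\<in>UNIV. \<mu> i) = (1::'k)" using M T by (simp add: invertible_det_nz del: of_real_prod)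
  then have "(\<Prod>i\<in>UNIV. \<mu> i) = 1" using of_real_eq_1_iff by blast
  then have "(\<Prod>i\<in>UNIV. \<bar>\<mu> i\<bar>) = 1" by (metis abs_1 abs_prod)
  then show s0: "(\<Sum>i\<in>UNIV. ln \<bar>\<mu> i\<bar>) = 0" using ln_prod[of UNIV "\<lambda>i. \<bar>\<mu> i\<bar>"] \<mu> by simp
  have "\<exists>K L x. unitary K \<and> unitary L \<and> det K = 1 \<and> det L = 1 \<and> decr ord x \<and> sum x UNIV = 0 \<and>
      mpow M n = K ** rdiag (\<lambda>i. exp (x i)) ** L" for n
    using singular_value_decomposition[OF det_mpow[OF M] ord, of n] by metis
  then obtain K L x where svd: "\<And>n. unitary (K n :: 'k^'n^'n)" "\<And>n. unitary (L n :: 'k^'n^'n)" "\<And>n. det (K n) = 1" "\<And>n. det (L n) = 1"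
    "\<And>n. decr ord (x n)" "\<And>n. sum (x n) UNIV = 0" "\<And>n. mpow M n = K n ** rdiag (\<lambda>i. exp (x n i)) ** L n" by metis
  have cartan: "cartan_proj \<tau> (cham id) (cl (em M) [^]\<^bsub>PSL\<^esub> n) = dg (x n)" for n
  proof -
    have mp: "em (mpow M n) = mpow (em M) n" by (induction n) (simp_all add: em_mult[symmetric])
    have "cl (em M) [^]\<^bsub>PSL\<^esub> n = cl (em (mpow M n))" using cl_pow[of "em M" n] M by (simp add: mp)
    then show ?thesis unfolding svd(7) using cartan_proj_eq[OF svd(1-6)] by simp
  qed
  obtain c1 where c1: "c1 > 0" "\<And>v. norm (T *v v) \<le> c1 * norm v" using mult_vec_bounded by blast
  obtain c2 where c2: "c2 > 0" "\<And>v. norm (?Ti *v v) \<le> c2 * norm v" using mult_vec_bounded by blast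
  define y where "y n i = real n * ln \<bar>\<mu> i\<bar>" for n i
  \<comment> \<open>The signs of the powers of \<open>\<mu>\<close> are split off as a unitary
    factor, so that \<open>singular_values_le\<close> applies to the diagonal matrix.\<close>
  define sg where "sg n = (rdiag (\<lambda>i. sgn (\<mu> i ^ n)) :: 'k^'n^'n)" for n
  have sg: "unitary (sg n)" for n using \<mu> by (simp add: sg_def rdiag_def unitary_diagm sgn_if)
  have ey: "exp (y n i) = \<bar>\<mu> i\<bar> ^ n" for n i using \<mu>[of i] by (simp add: y_def exp_of_nat_mult)
  have mupow: "rdiag (\<lambda>i. \<mu> i ^ n) = sg n ** rdiag (\<lambda>i. exp (y n i)) ** mat 1" for n
  proof -
    have "sgn (\<mu> i ^ n) * \<bar>\<mu> i\<bar> ^ n = \<mu> i ^ n" for i by (metis power_abs sgn_mult_abs)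
    then show ?thesis by (simp only: sg_def ey matrix_mul_rid rdiag_mult)
  qed
  have decy: "decr ord (y n)" for n
    using dec \<mu> by (auto simp: decr_def y_def intro!: mult_left_mono)
  have eq1: "K n ** rdiag (\<lambda>i. exp (x n i)) ** L n = T ** (sg n ** rdiag (\<lambda>i. exp (y n i)) ** mat 1) ** ?Ti" for n
  proof -
    have "mpow M n = mpow M n ** T ** ?Ti" by (simp add: matrix_mul_assoc[symmetric] TT)
    then show ?thesis unfolding svd(7)[symmetric] mupow[symmetric] pow .
  qed
  have eq2: "sg n ** rdiag (\<lambda>i. exp (y n i)) ** mat 1 = ?Ti ** (K n ** rdiag (\<lambda>i. exp (x n i)) ** L n) ** T" for n
  proof -
    have "?Ti ** mpow M n ** T = rdiag (\<lambda>i. \<mu> i ^ n)" by (simp add: matrix_mul_assoc[symmetric] pow) (simp add: matrix_mul_assoc TT)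
    then show ?thesis unfolding svd(7)[symmetric] mupow[symmetric] ..
  qed
  have "\<bar>x n i - y n i\<bar> \<le> \<bar>ln (c1 * c2)\<bar>" for n i
  proof -
    have "x n i \<le> y n i + ln (c1 * c2)"
      using singular_values_le[OF inj_ord sg unitary_1 svd(1,2) decy svd(5) eq1 c1(2) c2(2) c1(1) c2(1)] .
    moreover have "y n i \<le> x n i + ln (c2 * c1)"
      using singular_values_le[OF inj_ord svd(1,2) sg unitary_1 svd(5) decy eq2 c2(2) c1(2) c2(1) c1(1)] .
    ultimately show ?thesis by (simp add: mult.commute)
  qed
  note bd = this
  have "(\<lambda>n. x n i / real n) \<longlonglongrightarrow> ln \<bar>\<mu> i\<bar>" for i
  proof -
    have "(\<lambda>n. x n i / real n - ln \<bar>\<mu> i\<bar>) \<longlonglongrightarrow> 0"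
    proof (rule Lim_null_comparison[OF _ lim_const_over_n[of "\<bar>ln (c1 * c2)\<bar>"]])
      show "eventually (\<lambda>n. norm (x n i / real n - ln \<bar>\<mu> i\<bar>) \<le> \<bar>ln (c1 * c2)\<bar> / real n) sequentially"
        using eventually_gt_at_top[of 0]
      proof eventually_elim
        case (elim n)
        then have "x n i / real n - ln \<bar>\<mu> i\<bar> = (x n i - y n i) / real n" by (simp add: y_def field_simps)
        then show ?case using bd[of n i] by (simp add: divide_right_mono)
      qed
    qed
    then show ?thesis by (simp add: LIM_zero_iff)
  qed
  then have "(\<lambda>n. dg (\<lambda>i. x n i / real n)) \<longlonglongrightarrow> dg (\<lambda>i. ln \<bar>\<mu> i\<bar>)" by (rule tendsto_dg)
  moreover have "dg (\<lambda>i. x n i / real n) = dg (x n) /\<^sub>R real n" for n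
    using dg_scaleR[of "inverse (real n)" "x n"] by (simp add: divide_inverse mult.commute)
  ultimately have "(\<lambda>n. dg (x n) /\<^sub>R real n) \<longlonglongrightarrow> dg (\<lambda>i. ln \<bar>\<mu> i\<bar>)" by simp
  then show "jordan_proj \<tau> (cham id) (cl (em M)) = dg (\<lambda>i. ln \<bar>\<mu> i\<bar>)"
    unfolding jordan_proj_def cartan by (rule limI)
qed

section \<open>Orthogonal bases and the projection to the chamber\<close>

lemma isometry_inverse:
  assumes "mstar X ** rdiag \<epsilon> ** X = rdiag \<epsilon>" "det (X :: 'k^'n^'n) = 1"
  obtains Y where "X ** Y = mat 1" "Y ** X = mat 1" "mstar Y ** rdiag \<epsilon> ** Y = rdiag \<epsilon>" "det Y = 1"
proof -
  have iX: "invertible X" using assms(2) by (simp add: invertible_det_nz)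
  define Y where "Y = matrix_inv X"
  have XY: "X ** Y = mat 1" "Y ** X = mat 1" using matrix_inv_mult[OF iX] by (simp_all add: Y_def)
  have "mstar Y ** rdiag \<epsilon> ** Y = mstar Y ** (mstar X ** rdiag \<epsilon> ** X) ** Y" by (simp add: assms(1))
  also have "\<dots> = mstar (X ** Y) ** rdiag \<epsilon> ** (X ** Y)" by (simp only: mstar_mult matrix_mul_assoc)
  also have "\<dots> = rdiag \<epsilon>" by (simp add: XY)
  finally show ?thesis using that[OF XY] assms(2) by (simp add: Y_def det_matrix_inv)
qed

text \<open>Dividing the columns by \<open>sqrt \<bar>s a\<bar>\<close> turns the Gram matrix into a
  permutation of the signs \<open>\<epsilon>\<close>, and a monomial matrix brings it back to
  \<open>rdiag \<epsilon>\<close>.\<close>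

lemma normal_frame:
  fixes F :: "'k^'n^'n"
  assumes F: "mstar F ** rdiag \<epsilon> ** F = rdiag s" and s: "\<And>a. s a \<noteq> 0"
    and m: "bij m" "\<And>a. \<epsilon> (m a) = sgn (s a)"
  obtains X c where "mstar X ** rdiag \<epsilon> ** X = rdiag \<epsilon>" "det X = 1" "\<And>i. norm (c i) = 1"
    "F = X ** monomat m c ** rdiag (\<lambda>a. sqrt \<bar>s a\<bar>)"
proof -
  define D where "D = (rdiag (\<lambda>a. 1 / sqrt \<bar>s a\<bar>) :: 'k^'n^'n)"
  define Q where "Q = F ** D"
  have QQ: "mstar Q ** rdiag \<epsilon> ** Q = rdiag (\<lambda>a. \<epsilon> (m a))"
  proof -
    have "mstar Q ** rdiag \<epsilon> ** Q = D ** (mstar F ** rdiag \<epsilon> ** F) ** D"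
      by (simp add: Q_def D_def mstar_mult matrix_mul_assoc)
    also have "\<dots> = rdiag (\<lambda>a. 1 / sqrt \<bar>s a\<bar> * s a * (1 / sqrt \<bar>s a\<bar>))"
      unfolding F D_def rdiag_mult ..
    also have "\<dots> = rdiag (\<lambda>a. \<epsilon> (m a))"
    proof -
      have "1 / sqrt \<bar>s a\<bar> * s a * (1 / sqrt \<bar>s a\<bar>) = sgn (s a)" for a
      proof -
        define q where "q = sqrt \<bar>s a\<bar>"
        have "q \<noteq> 0" "q * q = \<bar>s a\<bar>" using s by (simp_all add: q_def)
        then have "s a = sgn (s a) * (q * q)" by (simp add: sgn_mult_abs)
        then have "1 / q * s a * (1 / q) = 1 / q * (sgn (s a) * (q * q)) * (1 / q)" by simp
        then show ?thesis using \<open>q \<noteq> 0\<close> by (simp add: q_def[symmetric])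
      qed
      then show ?thesis by (simp add: m(2))
    qed
    finally show ?thesis .
  qed
  have de: "det (rdiag \<epsilon> :: 'k^'n^'n) \<noteq> 0" using det_eps_sq by auto
  \<comment> \<open>Permuting the signs does not change their product, so \<open>det Q\<close> has
    modulus one and the phases of the monomial matrix can match it.\<close>
  have "det (rdiag (\<lambda>a. \<epsilon> (m a)) :: 'k^'n^'n) = det (rdiag \<epsilon> :: 'k^'n^'n)"
    unfolding det_rdiag using prod.reindex_bij_betw[of m UNIV UNIV \<epsilon>] m(1) by simp
  then have "of_real ((norm (det Q))\<^sup>2) * det (rdiag \<epsilon> :: 'k^'n^'n) = det (rdiag \<epsilon> :: 'k^'n^'n)"
    using arg_cong[OF QQ, of det] by (simp only: det_conj)
  then have "of_real ((norm (det Q))\<^sup>2) = (1::'k)" using de by simp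
  then have "(norm (det Q))\<^sup>2 = 1" using of_real_eq_1_iff by blast
  then have nQ: "norm (det Q) = 1" using norm_ge_zero[of "det Q"] by (simp add: power2_eq_1_iff)
  obtain c :: "'n \<Rightarrow> 'k" where c: "\<And>i. norm (c i) = 1" "det (monomat m c) = det Q" using monomat_with_det[OF m(1) nQ] by blast
  let ?N = "monomat m c"
  have uN: "unitary ?N" using m(1) c(1) by (rule unitary_monomat)
  define X where "X = Q ** mstar ?N"
  have "mstar X ** rdiag \<epsilon> ** X = ?N ** (mstar Q ** rdiag \<epsilon> ** Q) ** mstar ?N"
    by (simp add: X_def mstar_mult matrix_mul_assoc)
  also have "\<dots> = rdiag \<epsilon> ** (?N ** mstar ?N)"
    unfolding QQ monomat_mult_rdiag[OF m(1)] by (simp add: matrix_mul_assoc)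
  finally have "mstar X ** rdiag \<epsilon> ** X = rdiag \<epsilon>" by (simp add: unitary_right[OF uN])
  moreover have "det X = 1" using nQ by (simp add: X_def det_mul det_mstar c(2) mult_scnj')
  moreover have "F = X ** ?N ** rdiag (\<lambda>a. sqrt \<bar>s a\<bar>)"
  proof -
    have "X ** ?N ** rdiag (\<lambda>a. sqrt \<bar>s a\<bar>) = F ** (D ** (mstar ?N ** ?N) ** rdiag (\<lambda>a. sqrt \<bar>s a\<bar>))"
      by (simp add: X_def Q_def matrix_mul_assoc)
    also have "D ** (mstar ?N ** ?N) ** rdiag (\<lambda>a. sqrt \<bar>s a\<bar>) = mat 1"
      using uN s by (simp add: unitary_def D_def rdiag_mult)
    finally show ?thesis by simp
  qed
  ultimately show ?thesis using that c(1) by blast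
qed

lemma orth_basis_frame:
  fixes F :: "'k^'n^'n"
  assumes F: "mstar F ** rdiag \<epsilon> ** F = rdiag s" and inv: "invertible F"
  shows "orth_basis_of_lines B (range (\<lambda>i. vec.span {(P ** F) *v axis i 1}))"
proof -
  let ?v = "\<lambda>i. (P ** F) *v axis i 1"
  let ?E = "range (\<lambda>i. vec.span {?v i})"
  have iPF: "invertible (P ** F)" using P inv by (rule invertible_mult)
  have Bv: "B (a *s ?v i) (b *s ?v j) = 0" if "i \<noteq> j" for a b i j
  proof -
    have "B (a *s ?v i) (b *s ?v j) = a * (scnj b * (mstar F ** rdiag \<epsilon> ** F) $ j $ i)"
      unfolding conj_entry using B[of "a *s (F *v axis i 1)" "b *s (F *v axis j 1)"]
      by (simp add: matrix_vector_mul_assoc[symmetric] vector_scalar_commute sdot_smult_left sdot_smult_right)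
    moreover have "(mstar F ** rdiag \<epsilon> ** F) $ j $ i = 0"
      unfolding F using that by (simp add: rdiag_def diagm_nth)
    ultimately show ?thesis by simp
  qed
  have inj: "i = j" if "vec.span {?v i} = vec.span {?v j}" for i j
  proof -
    have "?v i \<in> vec.span {?v j}" unfolding that[symmetric] by (rule vec.span_base) simp
    then obtain k where "(P ** F) *v axis i 1 = (P ** F) *v (k *s axis j 1)"
      by (auto simp: vec.span_singleton vector_scalar_commute)
    then have "axis i 1 = k *s axis j (1::'k)" by (rule injD[OF inj_mult_vec[OF iPF]])
    then have "axis i (1::'k) $ i = (k *s axis j 1) $ i" by simp
    then show "i = j" by (auto simp: axis_def split: if_splits)
  qed
  have "card ?E = CARD('n)" by (rule card_image) (simp add: inj_def inj)
  moreover have "is_line (vec.span {?v i})" for i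
  proof -
    have "?v i \<noteq> 0"
    proof
      assume "?v i = 0"
      then have "?v i = (P ** F) *v 0" by simp
      then have "axis i (1::'k) = 0" by (rule injD[OF inj_mult_vec[OF iPF]])
      then show False by (simp add: axis_eq_0_iff)
    qed
    then have "vec.independent {?v i}" by simp
    then have "vec.dim {?v i} = card {?v i}" by (rule vec.dim_eq_card_independent)
    then show ?thesis by (simp add: is_line_def)
  qed
  moreover have "vec.span (\<Union>?E) = UNIV"
  proof -
    have "y \<in> vec.span (\<Union>?E)" for y
    proof -
      define u where "u = matrix_inv (P ** F) *v y"
      have "y = (P ** F) *v u" by (simp add: u_def matrix_vector_mul_assoc matrix_inv_mult[OF iPF])
      also have "u = (\<Sum>i\<in>UNIV. u $ i *s axis i 1)" by (simp add: basis_expansion)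
      finally have y: "y = (\<Sum>i\<in>UNIV. u $ i *s ?v i)"
        by (simp only: mult_vec_sum vector_scalar_commute)
      have "?v i \<in> \<Union>?E" for i using vec.span_base[of "?v i" "{?v i}"] by blast
      then show ?thesis unfolding y by (intro vec.span_sum vec.span_scale vec.span_base)
    qed
    then show ?thesis by auto
  qed
  moreover have "pairwise (\<lambda>l l'. \<forall>u\<in>l. \<forall>v\<in>l'. B u v = 0) ?E"
    unfolding pairwise_def
  proof (intro ballI impI)
    fix l l' u v assume "l \<in> ?E" "l' \<in> ?E" "l \<noteq> l'" "u \<in> l" "v \<in> l'"
    then obtain i j where ij: "l = vec.span {?v i}" "l' = vec.span {?v j}" by blast
    then have "i \<noteq> j" using \<open>l \<noteq> l'\<close> by blast
    moreover obtain a where "u = a *s ?v i" using \<open>u \<in> l\<close> unfolding ij vec.span_singleton by (rule rangeE)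
    moreover obtain b where "v = b *s ?v j" using \<open>v \<in> l'\<close> unfolding ij vec.span_singleton by (rule rangeE)
    ultimately show "B u v = 0" using Bv by simp
  qed
  ultimately show ?thesis by (auto simp: orth_basis_of_lines_def basis_of_lines_def)
qed

lemma B_set_frame:
  fixes F A :: "'k^'n^'n"
  assumes A: "det A = 1" and inv: "invertible F"
    and F: "mstar F ** rdiag \<epsilon> ** F = rdiag s" "mstar (A ** F) ** rdiag \<epsilon> ** (A ** F) = rdiag s'"
  shows "cl (em A) \<in> B_set B"
proof -
  let ?E = "\<lambda>F. range (\<lambda>i. vec.span {(P ** F) *v axis i 1})"
  have iA: "invertible A" using A by (simp add: invertible_det_nz)
  have "sub_act (cl (em A)) (vec.span {(P ** F) *v axis i 1}) = vec.span {(P ** (A ** F)) *v axis i 1}" for i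
  proof -
    have "sub_act (cl (em A)) (vec.span {(P ** F) *v axis i 1}) = (*v) (em A) ` vec.span {(P ** F) *v axis i 1}"
      by (rule sub_act_cl) simp
    also have "\<dots> = range (\<lambda>k. k *s (em A *v ((P ** F) *v axis i 1)))"
      unfolding vec.span_singleton by (simp add: image_image vector_scalar_commute)
    also have "em A *v ((P ** F) *v axis i 1) = (P ** (A ** F)) *v axis i 1"
      by (simp add: matrix_vector_mul_assoc[symmetric] em_vec)
    finally show ?thesis unfolding vec.span_singleton .
  qed
  then have "sub_act (cl (em A)) ` ?E F = ?E (A ** F)" by (simp add: image_image)
  then have "orth_basis_of_lines B (?E F)" "orth_basis_of_lines B (sub_act (cl (em A)) ` ?E F)"
    using orth_basis_frame[OF F(1) inv] orth_basis_frame[OF F(2) invertible_mult[OF iA inv]] by simp_all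
  then show ?thesis using A by (auto simp: B_set_def cl_carrier)
qed

end

lemma matrix_left_cancel:
  fixes G X Y :: "'k::scalar_rc^'n^'n"
  assumes "invertible G" "G ** X = G ** Y" shows "X = Y"
proof -
  have "matrix_inv G ** (G ** X) = matrix_inv G ** (G ** Y)" using assms(2) by simp
  then show ?thesis by (simp add: matrix_mul_assoc matrix_inv_mult[OF assms(1)])
qed

context ocoords
begin

text \<open>Existence: isometries normalize the orthogonal frames \<open>F\<close> and
  \<open>A ** F\<close>, and the ratios of the lengths of their columns are given by
  \<open>exp y\<close>. Uniqueness: another decomposition yields a second simultaneous
  diagonalization of the form and of its pullback by \<open>A\<close>; the moduli of the
  \<open>\<mu> a\<close> being distinct, the two differ by a permutation, which preserves signs and
  order.\<close>

lemma b_proj_eq: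
  fixes A F :: "'k^'n^'n"
  assumes A: "det A = 1" and iF: "invertible F"
    and F: "mstar F ** rdiag \<epsilon> ** F = rdiag t" "mstar (A ** F) ** rdiag \<epsilon> ** (A ** F) = rdiag (\<lambda>a. \<mu> a * t a)"
    and MF: "(bstar A ** A) ** F = F ** rdiag \<mu>"
    and nz: "\<And>a. t a \<noteq> 0" "\<And>a. \<mu> a \<noteq> 0" and inj: "\<And>a b. \<bar>\<mu> a\<bar> = \<bar>\<mu> b\<bar> \<Longrightarrow> a = b"
    and m: "bij m" "\<And>a. \<epsilon> (m a) = sgn (t a)" and y: "\<And>a. y (m a) = ln \<bar>\<mu> a\<bar> / 2" "dg y \<in> bpc"
  shows "b_proj B \<tau> bsp bpc (cl (em A)) = dg y"
  unfolding b_proj_def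
proof (rule the_equality)
  have sy: "sum y UNIV = 0" using y(2) by (simp add: bpc_dg)
  define Ey where "Ey = (rdiag (\<lambda>i. exp (y i)) :: 'k^'n^'n)"
  have dEy: "det Ey = 1" unfolding Ey_def by (rule det_exp[OF sy])
  have nz': "\<mu> a * t a \<noteq> 0" for a using nz by simp
  obtain m' where m': "bij m'" "\<And>a. \<epsilon> (m' a) = sgn (\<mu> a * t a)"
    using signature_perm[OF F(2) nz' eps] by blast
  obtain X1 c1 where X1: "mstar X1 ** rdiag \<epsilon> ** X1 = rdiag \<epsilon>" "det X1 = 1" "\<And>i. norm (c1 i :: 'k) = 1"
    "F = X1 ** monomat m c1 ** rdiag (\<lambda>a. sqrt \<bar>t a\<bar>)"
    using normal_frame[OF F(1) nz(1) m] by blast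
  obtain X2 c2 where X2: "mstar X2 ** rdiag \<epsilon> ** X2 = rdiag \<epsilon>" "det X2 = 1" "\<And>i. norm (c2 i :: 'k) = 1"
    "A ** F = X2 ** monomat m' c2 ** rdiag (\<lambda>a. sqrt \<bar>\<mu> a * t a\<bar>)"
    using normal_frame[OF F(2) nz' m'] by blast
  obtain T1 where T1: "X1 ** T1 = mat 1" "T1 ** X1 = mat 1" "mstar T1 ** rdiag \<epsilon> ** T1 = rdiag \<epsilon>" "det T1 = 1"
    using isometry_inverse[OF X1(1,2)] by blast
  \<comment> \<open>\<open>\<theta>\<close> is the inverse of \<open>m\<close>, so that
    \<open>\<pi>\<close> leads from the lines assigned to the columns of \<open>F\<close> to those
    assigned to the columns of \<open>A ** F\<close>.\<close>
  obtain \<theta> where \<theta>: "\<And>a. a = m (\<theta> a)" using bij_factor[OF m(1), of id] by (metis id_apply)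
  have m\<theta>: "\<theta> (m a) = a" for a using \<theta>[of "m a"] bij_is_inj[OF m(1)] by (simp add: inj_eq)
  define \<pi> where "\<pi> i = m' (\<theta> i)" for i
  define c where "c i = c2 (\<theta> i) / c1 (\<theta> i)" for i
  have nc1: "c1 i \<noteq> 0" for i using X1(3)[of i] by auto
  have "inj \<pi>"
  proof (rule injI)
    fix i j assume "\<pi> i = \<pi> j"
    then have "\<theta> i = \<theta> j" unfolding \<pi>_def by (rule injD[OF bij_is_inj[OF m'(1)]])
    then show "i = j" using \<theta>[of i] \<theta>[of j] by simp
  qed
  then have bij\<pi>: "bij \<pi>" by (simp add: bij_def finite_UNIV_inj_surj)
  have Nm: "monomat \<pi> c ** monomat m c1 = monomat m' c2"
    using nc1 by (simp add: monomat_mult \<pi>_def c_def m\<theta>)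
  \<comment> \<open>Past the permutation \<open>m\<close>, \<open>exp y\<close> becomes
    \<open>sqrt \<bar>\<mu> a\<bar>\<close>, the ratio of the lengths of the columns of
    \<open>A ** F\<close> and \<open>F\<close>.\<close>
  have Eym: "Ey ** monomat m c1 = monomat m c1 ** rdiag (\<lambda>a. sqrt \<bar>\<mu> a\<bar>)"
  proof -
    have "exp (y (m a)) = sqrt \<bar>\<mu> a\<bar>" for a
    proof (rule real_sqrt_unique[symmetric])
      have "(exp (y (m a)))\<^sup>2 = exp (ln \<bar>\<mu> a\<bar>)" by (simp add: y(1) power2_eq_square flip: exp_add)
      then show "(exp (y (m a)))\<^sup>2 = \<bar>\<mu> a\<bar>" using nz(2) by simp
    qed simp
    then show ?thesis unfolding Ey_def using monomat_mult_rdiag[OF m(1), of c1 "\<lambda>i. exp (y i)"] by simp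
  qed
  have AX: "A = X2 ** monomat \<pi> c ** Ey ** T1"
  proof -
    have "X2 ** monomat \<pi> c ** Ey ** T1 ** F =
        X2 ** monomat \<pi> c ** Ey ** (T1 ** X1) ** monomat m c1 ** rdiag (\<lambda>a. sqrt \<bar>t a\<bar>)"
      unfolding X1(4) by (simp only: matrix_mul_assoc)
    also have "\<dots> = X2 ** monomat \<pi> c ** (Ey ** monomat m c1) ** rdiag (\<lambda>a. sqrt \<bar>t a\<bar>)"
      by (simp only: T1(2) matrix_mul_rid matrix_mul_assoc)
    also have "\<dots> = X2 ** (monomat \<pi> c ** monomat m c1) ** (rdiag (\<lambda>a. sqrt \<bar>\<mu> a\<bar>) ** rdiag (\<lambda>a. sqrt \<bar>t a\<bar>))"
      unfolding Eym by (simp only: matrix_mul_assoc)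
    also have "\<dots> = A ** F" unfolding Nm rdiag_mult X2(4) by (simp add: abs_mult real_sqrt_mult)
    finally have "X2 ** monomat \<pi> c ** Ey ** T1 ** F ** matrix_inv F = A ** F ** matrix_inv F" by simp
    then show ?thesis by (simp add: matrix_mul_assoc[symmetric] matrix_inv_mult[OF iF])
  qed
  have "monomial_unit \<pi> c"
  proof -
    have "norm (c i) = 1" for i using X1(3) X2(3) by (simp add: c_def norm_divide)
    moreover have "det (monomat \<pi> c) = 1" using arg_cong[OF AX, of det] A X2(2) T1(4) dEy by (simp add: det_mul)
    ultimately show ?thesis using bij\<pi> by (simp add: monomial_unit_def)
  qed
  note mu = monomial_unitD[OF this]
  have W: "cl (em (monomat \<pi> c)) \<in> W_hat \<tau> bsp" unfolding W_hat_eq using \<open>monomial_unit \<pi> c\<close> by blast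
  have h: "cl (em X2) \<in> isometry_group B" "cl (em T1) \<in> isometry_group B"
    unfolding isometry_group_eq using X2 T1 by blast+
  have decomp: "cl (em X) \<otimes>\<^bsub>PSL\<^esub> cl (em N) \<otimes>\<^bsub>PSL\<^esub> PSL_exp (dg z) \<otimes>\<^bsub>PSL\<^esub> cl (em T) =
      cl (em (X ** N ** rdiag (\<lambda>i. exp (z i)) ** T))"
    if "det X = 1" "det N = 1" "sum z UNIV = 0" "det T = 1" for X N T z
    using that by (simp add: PSL_exp_dg cl_mult det_exp det_mul em_mult)
  have "cl (em A) = cl (em X2) \<otimes>\<^bsub>PSL\<^esub> cl (em (monomat \<pi> c)) \<otimes>\<^bsub>PSL\<^esub> PSL_exp (dg y) \<otimes>\<^bsub>PSL\<^esub> cl (em T1)"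
    unfolding decomp[OF X2(2) mu(3) sy T1(4)] by (simp only: AX Ey_def)
  then show "dg y \<in> bpc \<and> (\<exists>h\<in>isometry_group B. \<exists>n\<in>W_hat \<tau> bsp. \<exists>h'\<in>isometry_group B.
      cl (em A) = h \<otimes>\<^bsub>PSL\<^esub> n \<otimes>\<^bsub>PSL\<^esub> PSL_exp (dg y) \<otimes>\<^bsub>PSL\<^esub> h')"
    using y(2) W h by blast
  fix Y assume "Y \<in> bpc \<and> (\<exists>h\<in>isometry_group B. \<exists>n\<in>W_hat \<tau> bsp. \<exists>h'\<in>isometry_group B.
      cl (em A) = h \<otimes>\<^bsub>PSL\<^esub> n \<otimes>\<^bsub>PSL\<^esub> PSL_exp Y \<otimes>\<^bsub>PSL\<^esub> h')"
  then obtain h n h' where Y: "Y \<in> bpc" and hn: "h \<in> isometry_group B" "n \<in> W_hat \<tau> bsp" "h' \<in> isometry_group B"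
    "cl (em A) = h \<otimes>\<^bsub>PSL\<^esub> n \<otimes>\<^bsub>PSL\<^esub> PSL_exp Y \<otimes>\<^bsub>PSL\<^esub> h'" by blast
  obtain z where z: "Y = dg z" using Y by (auto simp: bpc_def cone_def)
  obtain X where X: "h = cl (em X)" "det X = 1" "mstar X ** rdiag \<epsilon> ** X = rdiag \<epsilon>"
    using hn(1) unfolding isometry_group_eq by blast
  obtain T where T: "h' = cl (em T)" "det T = 1" "mstar T ** rdiag \<epsilon> ** T = rdiag \<epsilon>"
    using hn(3) unfolding isometry_group_eq by blast
  obtain \<phi> d where n: "n = cl (em (monomat \<phi> d))" "monomial_unit \<phi> d" using hn(2) unfolding W_hat_eq by blast
  note mn = monomial_unitD[OF n(2)]
  have bpz: "dg z \<in> bpc" using Y z by simp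
  then have sz: "sum z UNIV = 0" by (simp add: bpc_dg)
  let ?N = "monomat \<phi> d" and ?E = "rdiag (\<lambda>i. exp (z i)) :: 'k^'n^'n"
  have "cl (em A) = cl (em (X ** ?N ** ?E ** T))"
    unfolding hn(4) X(1) n(1) z T(1) by (rule decomp[OF X(2) mn(3) sz T(2)])
  then obtain k where k: "norm k = 1" "X ** ?N ** ?E ** T = mat k ** A" by (rule cl_em_eqD)
  \<comment> \<open>The eigenvalues of \<open>bstar A ** A\<close> as the second decomposition shows
    them: the permutation \<open>\<phi>\<close> contributes the signs and \<open>dg z\<close> the
    moduli.\<close>
  define w where "w i = \<epsilon> i * \<epsilon> (\<phi> i) * exp (2 * z i)" for i
  obtain Ti where Ti: "T ** Ti = mat 1" "Ti ** T = mat 1" "mstar Ti ** rdiag \<epsilon> ** Ti = rdiag \<epsilon>" "det Ti = 1"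
    using isometry_inverse[OF T(3,2)] by blast
  have AFT: "mstar (mat k ** A) ** rdiag \<epsilon> ** (mat k ** A) = mstar A ** rdiag \<epsilon> ** A"
  proof -
    have "mstar (mat k ** A) ** rdiag \<epsilon> ** (mat k ** A) = mstar A ** (mat (scnj k) ** rdiag \<epsilon> ** mat k) ** A"
      by (simp only: mstar_mult mstar_mat matrix_mul_assoc)
    moreover have "mat (scnj k) ** rdiag \<epsilon> ** mat k = (rdiag \<epsilon> :: 'k^'n^'n)"
    proof -
      have "k * scnj k = 1" using mult_scnj'[of k] k(1) by simp
      then have "k * (scnj k * r) = r" for r by (simp only: mult.assoc[symmetric] mult_1_left)
      then show ?thesis by (simp only: vec_eq_iff mat_mult_nth simp_thms)
    qed
    ultimately show ?thesis by simp
  qed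
  have "mstar A ** rdiag \<epsilon> ** A = mstar T ** (?E ** (mstar ?N ** (mstar X ** rdiag \<epsilon> ** X) ** ?N) ** ?E) ** T"
    unfolding AFT[symmetric] k(2)[symmetric] by (simp only: mstar_mult mstar_rdiag matrix_mul_assoc)
  also have "?E ** (mstar ?N ** (mstar X ** rdiag \<epsilon> ** X) ** ?N) ** ?E = rdiag (\<lambda>i. exp (z i) * \<epsilon> (\<phi> i) * exp (z i))"
    unfolding X(3) mstar_monomat_rdiag[OF mn(1,2)] rdiag_mult ..
  also have "(\<lambda>i. exp (z i) * \<epsilon> (\<phi> i) * exp (z i)) = (\<lambda>i. \<epsilon> i * w i)"
  proof
    fix i have "exp (z i) * exp (z i) = exp (2 * z i)" by (simp flip: exp_add)
    then show "exp (z i) * \<epsilon> (\<phi> i) * exp (z i) = \<epsilon> i * w i"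
      using eps_sq[of i] by (simp add: w_def mult_ac)
  qed
  finally have AA: "mstar A ** rdiag \<epsilon> ** A = mstar T ** rdiag (\<lambda>i. \<epsilon> i * w i) ** T" .
  \<comment> \<open>The change of basis between the two diagonalizing frames, \<open>F\<close> and
    the inverse \<open>Ti\<close> of the isometry \<open>T\<close>.\<close>
  define Z where "Z = matrix_inv F ** Ti"
  have FZ: "F ** Z = Ti" by (simp add: Z_def matrix_mul_assoc matrix_inv_mult[OF iF])
  have Zt: "mstar Z ** rdiag t ** Z = rdiag \<epsilon>"
  proof -
    have "mstar Z ** rdiag t ** Z = mstar (F ** Z) ** rdiag \<epsilon> ** (F ** Z)"
      unfolding F(1)[symmetric] by (simp only: mstar_mult matrix_mul_assoc)
    then show ?thesis by (simp add: FZ Ti)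
  qed
  have Zw: "mstar Z ** rdiag (\<lambda>a. \<mu> a * t a) ** Z = rdiag (\<lambda>i. \<epsilon> i * w i)"
  proof -
    have "mstar Z ** rdiag (\<lambda>a. \<mu> a * t a) ** Z = mstar (F ** Z) ** (mstar A ** rdiag \<epsilon> ** A) ** (F ** Z)"
      unfolding F(2)[symmetric] by (simp only: mstar_mult matrix_mul_assoc)
    also have "\<dots> = mstar (T ** Ti) ** rdiag (\<lambda>i. \<epsilon> i * w i) ** (T ** Ti)"
      unfolding FZ AA by (simp only: mstar_mult matrix_mul_assoc)
    finally show ?thesis by (simp add: Ti)
  qed
  have "det Z \<noteq> 0" using arg_cong[OF FZ, of det] Ti(4) by (auto simp: det_mul)
  \<comment> \<open>Both diagonal matrices represent \<open>bstar A ** A\<close>, so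
    \<open>Z\<close> intertwines them and has nonzero entries only where
    \<open>\<mu> a = w i\<close>.\<close>
  have ZZ: "rdiag \<mu> ** Z = Z ** rdiag w"
  proof -
    have iG: "invertible (mstar Z ** rdiag t)"
      using \<open>det Z \<noteq> 0\<close> nz(1) by (simp add: invertible_det_nz det_mul det_mstar det_rdiag del: of_real_prod)
    have "(mstar Z ** rdiag t) ** (rdiag \<mu> ** Z) = mstar Z ** (rdiag t ** rdiag \<mu>) ** Z" by (simp only: matrix_mul_assoc)
    also have "\<dots> = rdiag \<epsilon> ** rdiag w" unfolding rdiag_mult using Zw by (simp add: mult.commute)
    also have "\<dots> = (mstar Z ** rdiag t) ** (Z ** rdiag w)" unfolding Zt[symmetric] by (simp only: matrix_mul_assoc)
    finally show ?thesis by (rule matrix_left_cancel[OF iG])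
  qed
  have Zeq: "\<mu> a = w i" if "Z $ a $ i \<noteq> 0" for a i
  proof -
    have "of_real (\<mu> a) * Z $ a $ i = Z $ a $ i * of_real (w i)"
      using arg_cong[OF ZZ, of "\<lambda>M. M $ a $ i"] by (simp add: rdiag_def diagm_mult_left_nth diagm_mult_right_nth)
    then show ?thesis using that by (simp add: mult.commute)
  qed
  have "\<exists>a. Z $ a $ i \<noteq> 0" for i
  proof (rule ccontr)
    assume "\<not> ?thesis"
    then have "(mstar Z ** rdiag t ** Z) $ i $ i = 0" by (simp add: matrix_matrix_mult_def)
    then show False unfolding Zt using eps[of i] by (simp add: rdiag_def diagm_nth)
  qed
  \<comment> \<open>Distinct moduli of the \<open>\<mu> a\<close> leave exactly one nonzero entry in
    each column of \<open>Z\<close>, in row \<open>\<rho> i\<close>.\<close>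
  then obtain \<rho> where \<rho>: "\<And>i. Z $ \<rho> i $ i \<noteq> 0" by metis
  have Z0: "Z $ a $ i = 0" if "a \<noteq> \<rho> i" for a i
  proof (rule ccontr)
    assume "Z $ a $ i \<noteq> 0"
    then have "\<mu> a = \<mu> (\<rho> i)" using Zeq Zeq[OF \<rho>] by metis
    then have "a = \<rho> i" by (intro inj) simp
    then show False using that by simp
  qed
  have Zij: "(mstar Z ** rdiag t ** Z) $ i $ j = scnj (Z $ \<rho> i $ i) * of_real (t (\<rho> i)) * Z $ \<rho> i $ j" for i j
  proof -
    have "(mstar Z ** rdiag t) $ i $ a * Z $ a $ j =
        (if a = \<rho> i then scnj (Z $ \<rho> i $ i) * of_real (t (\<rho> i)) * Z $ \<rho> i $ j else 0)" for a
      using Z0[of a i] by (auto simp: rdiag_def diagm_mult_right_nth)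
    then show ?thesis by (simp add: matrix_matrix_mult_def[of "mstar Z ** rdiag t"])
  qed
  have \<rho>inj: "i = j" if "\<rho> i = \<rho> j" for i j
  proof (rule ccontr)
    assume "i \<noteq> j"
    then have "(mstar Z ** rdiag t ** Z) $ i $ j = 0" unfolding Zt by (simp add: rdiag_def diagm_nth)
    then show False unfolding Zij using \<rho>[of i] \<rho>[of j] nz(1) that by simp
  qed
  \<comment> \<open>A diagonal entry of the congruence \<open>Zt\<close> is a positive multiple of
    \<open>t (\<rho> i)\<close>.\<close>
  have sgn\<rho>: "sgn (t (\<rho> i)) = \<epsilon> i" for i
  proof -
    have "of_real (\<epsilon> i) = (mstar Z ** rdiag t ** Z) $ i $ i" unfolding Zt by (simp add: rdiag_def diagm_nth)
    also have "\<dots> = of_real ((norm (Z $ \<rho> i $ i))\<^sup>2 * t (\<rho> i))"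
      unfolding Zij by (simp only: of_real_mult mult_scnj'[symmetric] mult_ac)
    finally have e: "\<epsilon> i = (norm (Z $ \<rho> i $ i))\<^sup>2 * t (\<rho> i)" unfolding of_real_eq_iff .
    have "0 < (norm (Z $ \<rho> i $ i))\<^sup>2" using \<rho>[of i] by simp
    then have "sgn (\<epsilon> i) = sgn (t (\<rho> i))" unfolding e by (simp add: sgn_mult)
    then show ?thesis using eps_cases[of i] by auto
  qed
  have zy: "z i = y (m (\<rho> i))" for i
  proof -
    have "\<bar>\<mu> (\<rho> i)\<bar> = \<bar>w i\<bar>" using Zeq[OF \<rho>[of i]] by simp
    also have "\<dots> = exp (2 * z i)" by (simp add: w_def abs_mult eps)
    finally have "ln \<bar>\<mu> (\<rho> i)\<bar> = 2 * z i" by simp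
    then show ?thesis by (simp add: y(1))
  qed
  \<comment> \<open>The permutation relating \<open>z\<close> to \<open>y\<close>. It preserves
    \<open>\<epsilon>\<close> by \<open>sgn\<rho>\<close>, and the order within each sign class
    because both elements lie in \<open>bpc\<close>.\<close>
  define \<kappa> where "\<kappa> i = m (\<rho> i)" for i
  have "inj \<kappa>"
  proof (rule injI)
    fix i j assume "\<kappa> i = \<kappa> j"
    then have "\<rho> i = \<rho> j" unfolding \<kappa>_def by (rule injD[OF bij_is_inj[OF m(1)]])
    then show "i = j" by (rule \<rho>inj)
  qed
  then have b\<kappa>: "bij \<kappa>" by (simp add: bij_def finite_UNIV_inj_surj)
  have e\<kappa>: "\<epsilon> (\<kappa> i) = \<epsilon> i" for i by (simp add: \<kappa>_def m(2) sgn\<rho>)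
  have yinj: "i = j" if "y i = y j" for i j
  proof -
    obtain a b where ab: "i = m a" "j = m b" using \<theta> by blast
    then have "\<bar>\<mu> a\<bar> = \<bar>\<mu> b\<bar>" using that nz(2) by (simp add: y(1))
    then show ?thesis using inj ab by blast
  qed
  have "\<kappa> = id"
  proof (rule sign_mono_perm_id[OF b\<kappa> e\<kappa>])
    fix i j assume ij: "\<epsilon> i = \<epsilon> j" "ord i < ord j"
    then have "z j \<le> z i" using bpz by (simp add: bpc_dg)
    then have le: "y (\<kappa> j) \<le> y (\<kappa> i)" by (simp add: zy \<kappa>_def)
    show "ord (\<kappa> i) \<le> ord (\<kappa> j)"
    proof (rule ccontr)
      assume n: "\<not> ord (\<kappa> i) \<le> ord (\<kappa> j)"
      then have "y (\<kappa> i) \<le> y (\<kappa> j)" using y(2) e\<kappa> ij(1) by (simp add: bpc_dg)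
      with le have "y (\<kappa> i) = y (\<kappa> j)" by simp
      then have "\<kappa> i = \<kappa> j" by (rule yinj)
      then show False using n by simp
    qed
  qed
  then have "z = y" by (auto simp: fun_eq_iff zy \<kappa>_def)
  then show "Y = dg y" by (simp add: z)
qed

section \<open>Minors of the form along flags\<close>

lemma gram_conj:
  "mstar (P ** Q) ** (mstar (matrix_inv P) ** rdiag \<epsilon> ** matrix_inv P) ** (P ** Q) = mstar Q ** rdiag \<epsilon> ** Q"
proof -
  have "mstar (P ** Q) ** (mstar (matrix_inv P) ** rdiag \<epsilon> ** matrix_inv P) ** (P ** Q) =
      mstar Q ** mstar (matrix_inv P ** P) ** rdiag \<epsilon> ** (matrix_inv P ** P) ** Q"
    by (simp only: mstar_mult matrix_mul_assoc)
  then show ?thesis by (simp add: PP)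
qed

lemma hermitian_eps: "hermitian (rdiag \<epsilon> :: 'k^'n^'n)" by (simp add: hermitian_def)

text \<open>A vanishing initial minor would give a nonzero vector in a term of the flag that is
  orthogonal to this whole term.\<close>

lemma nondeg_minor:
  assumes \<xi>: "\<xi> \<in> nondeg_flags B"
  obtains Q where "invertible (P ** Q)" "frame_flag ord (P ** Q) = \<xi>"
    "\<And>k. pminor {a. ord a < k} (mstar Q ** rdiag \<epsilon> ** Q) \<noteq> 0"
proof -
  have full: "\<xi> \<in> full_flags" and nd: "\<And>j u. u \<in> \<xi> j \<Longrightarrow> (\<And>v. v \<in> \<xi> j \<Longrightarrow> B u v = 0) \<Longrightarrow> u = 0"
    using \<xi> by (auto simp: nondeg_flags_def)
  obtain Q0 where Q0: "invertible Q0" "frame_flag ord Q0 = \<xi>" using full_flag_frame[OF ord full] .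
  define Q where "Q = matrix_inv P ** Q0"
  have PQ: "P ** Q = Q0" by (simp add: Q_def matrix_mul_assoc PP)
  have "pminor {a. ord a < k} (mstar Q ** rdiag \<epsilon> ** Q) \<noteq> 0" for k
  proof
    assume z: "pminor {a. ord a < k} (mstar Q ** rdiag \<epsilon> ** Q) = 0"
    obtain u where u: "u \<noteq> 0" "\<And>i. i \<notin> {a. ord a < k} \<Longrightarrow> u $ i = 0"
      "\<And>i. i \<in> {a. ord a < k} \<Longrightarrow> ((mstar Q ** rdiag \<epsilon> ** Q) *v u) $ i = 0"
      using pminor_eq_0_kernel[OF hermitian_conj[OF hermitian_eps] z] by blast
    have mem: "Q0 *v v \<in> \<xi> k" if "v \<in> coord_flag ord k" for v
      using that unfolding Q0(2)[symmetric] frame_flag_def by blast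
    have "Q0 *v u = 0"
    proof (rule nd[of _ k])
      show "Q0 *v u \<in> \<xi> k" using u(2) by (intro mem) (simp add: coord_flag_def)
      fix v assume "v \<in> \<xi> k"
      then obtain v' where v': "v = Q0 *v v'" "v' \<in> coord_flag ord k"
        unfolding Q0(2)[symmetric] frame_flag_def by blast
      have "B (Q0 *v u) v = sdot ((mstar Q ** rdiag \<epsilon> ** Q) *v u) v'"
        unfolding v'(1) PQ[symmetric] using B[of "Q *v u" "Q *v v'"]
        by (simp add: matrix_vector_mul_assoc[symmetric] sdot_mult_left[of "mstar Q"])
      also have "\<dots> = 0"
        unfolding sdot_def
      proof (rule sum.neutral, rule ballI)
        fix i show "((mstar Q ** rdiag \<epsilon> ** Q) *v u) $ i * scnj (v' $ i) = 0"
          using u(3)[of i] v'(2) by (cases "ord i < k") (simp_all add: coord_flag_def)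
      qed
      finally show "B (Q0 *v u) v = 0" .
    qed
    then show False using u(1) Q0(1) det_eq_0_kernel[of Q0] by (auto simp: invertible_det_nz)
  qed
  then show ?thesis using that[of Q] Q0 by (simp add: PQ)
qed

lemma orbit_frame:
  assumes "\<xi> \<in> H_orbit B (pflag \<psi>)"
  obtains T where "det T = 1" "mstar T ** rdiag \<epsilon> ** T = rdiag \<epsilon>"
    "\<xi> = frame_flag ord (P ** (T ** monomat \<psi> (\<lambda>_. 1)))"
proof -
  obtain h where h: "h \<in> isometry_group B" "\<xi> = flag_act h (pflag \<psi>)" using assms by (auto simp: H_orbit_def)
  obtain T where T: "h = cl (em T)" "det T = 1" "mstar T ** rdiag \<epsilon> ** T = rdiag \<epsilon>"
    using h(1) unfolding isometry_group_eq by blast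
  have "\<xi> = frame_flag ord (P ** (T ** monomat \<psi> (\<lambda>_. 1)))"
    unfolding h(2) T(1) pflag_def flag_act_frame by (simp add: matrix_mul_assoc em_P)
  then show ?thesis using that T by blast
qed

text \<open>An isometry does not change Gram matrices, so this is the diagonal one of the coordinate
  lines in the order \<open>\<psi>\<close>. The minors are thus signs that are constant on the
  orbit.\<close>

lemma pminor_orbit_frame:
  assumes "bij \<psi>" "mstar T ** rdiag \<epsilon> ** T = rdiag \<epsilon>"
  shows "pminor I (mstar (T ** monomat \<psi> (\<lambda>_. 1)) ** rdiag \<epsilon> ** (T ** monomat \<psi> (\<lambda>_. 1 :: 'k))) = (\<Prod>a\<in>I. \<epsilon> (\<psi> a))"
proof -
  have "mstar (T ** monomat \<psi> (\<lambda>_. 1)) ** rdiag \<epsilon> ** (T ** monomat \<psi> (\<lambda>_. 1)) =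
      mstar (monomat \<psi> (\<lambda>_. 1)) ** (mstar T ** rdiag \<epsilon> ** T) ** monomat \<psi> (\<lambda>_. 1 :: 'k)"
    by (simp only: mstar_mult matrix_mul_assoc)
  also have "\<dots> = rdiag (\<lambda>a. \<epsilon> (\<psi> a))" unfolding assms(2) using assms(1) by (intro mstar_monomat_rdiag) simp_all
  finally show ?thesis by (simp add: pminor_rdiag)
qed

lemma abs_prod_eps: "\<bar>\<Prod>a\<in>I. \<epsilon> (\<psi> a)\<bar> = 1"
  by (simp add: abs_prod eps)

lemma rv_image: "k \<le> CARD('n) \<Longrightarrow> rv ` {a. ord a < k} = {j. CARD('n) - k \<le> ord j}"
proof (intro equalityI subsetI)
  fix j assume k: "k \<le> CARD('n)" and "j \<in> {j. CARD('n) - k \<le> ord j}"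
  then have "ord (rv j) < k" using ord_less[of j] by simp
  then show "j \<in> rv ` {a. ord a < k}" by (intro image_eqI[of _ _ "rv j"]) simp_all
qed (use ord_less in auto)

theorem orthogonal_decomposition:
  fixes C Cs :: "(nat \<Rightarrow> ('k^'n) set) set"
  assumes \<psi>: "bij \<psi>" "\<And>a b. \<epsilon> (\<psi> a) = \<epsilon> (\<psi> b) \<Longrightarrow> ord a < ord b \<Longrightarrow> ord (\<psi> a) < ord (\<psi> b)"
    and Cs: "compactin flag_topology Cs" "Cs \<subseteq> H_orbit B (pflag \<psi>)"
    and C: "compactin flag_topology C" "C \<subseteq> nondeg_flags B"
  shows "\<exists>L>0. \<forall>g\<in>carrier PSL.
    (MIN \<alpha>\<in>pos_roots bsp (cham id). \<alpha> (cartan_proj \<tau> (cham id) g)) > L \<and>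
    S_flag \<tau> bsp (range line) (cham id) g \<in> Cs \<and> U_flag \<tau> bsp (range line) (cham id) g \<in> C \<longrightarrow>
      g \<in> B_set B \<and>
      b_proj B \<tau> bsp bpc g =
        (1/2) *\<^sub>R W_act (w_flags \<tau> bsp (opp_inv_flag B \<tau> bsp (range line) bpc (pflag \<psi>)) (flag_of_chamber bsp (range line) (cham id)))
                   (jordan_proj \<tau> (cham id) (sigma_o B (inv\<^bsub>PSL\<^esub> g) \<otimes>\<^bsub>PSL\<^esub> g)) \<and>
      (opp_inv_flag B \<tau> bsp (range line) bpc (pflag \<psi>) = flag_of_chamber bsp (range line) (cham id) \<longrightarrow>
        b_proj B \<tau> bsp bpc g =
          (1/2) *\<^sub>R jordan_proj \<tau> (cham id) (sigma_o B (inv\<^bsub>PSL\<^esub> g) \<otimes>\<^bsub>PSL\<^esub> g))"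
proof -
  let ?d = "CARD('n)"
  let ?Pi = "matrix_inv P"
  \<comment> \<open>The Gram matrix of the form in the standard basis, as needed for
    \<open>compact_flags_minor_bound\<close>.\<close>
  let ?B0 = "mstar ?Pi ** rdiag \<epsilon> ** ?Pi"
  have iPi: "invertible ?Pi" using PP unfolding invertible_def by blast
  have SQ: "?Pi ** (P ** Q) = Q" for Q by (simp add: matrix_mul_assoc PP)
  have unit_minor: "pminor I (mat 1 :: 'k^'n^'n) = 1" for I using pminor_rdiag[of I "\<lambda>_. 1"] by simp
  \<comment> \<open>In a frame \<open>P ** U\<close> with \<open>U\<close> unitary the minors of the
    inner product are \<open>1\<close>, so the lower bound for the ratio is one for the minors of
    the form.\<close>
  have bound: "\<exists>c>0. \<forall>U k. unitary U \<longrightarrow> frame_flag ord (P ** U) \<in> D \<longrightarrow> k \<le> ?d \<longrightarrow>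
      c \<le> \<bar>pminor {a. ord a < k} (mstar U ** rdiag \<epsilon> ** U)\<bar>"
    if D: "compactin flag_topology D" and nz: "\<And>\<xi>. \<xi> \<in> D \<Longrightarrow> \<exists>Q. invertible (P ** Q) \<and> frame_flag ord (P ** Q) = \<xi> \<and>
      (\<forall>k. pminor {a. ord a < k} (mstar Q ** rdiag \<epsilon> ** Q) \<noteq> 0)" for D
  proof -
    have nz': "\<exists>Q. invertible Q \<and> frame_flag ord Q = \<xi> \<and> (\<forall>k\<le>?d. pminor {a. ord a < k} (mstar Q ** ?B0 ** Q) \<noteq> 0)"
      if \<xi>: "\<xi> \<in> D" for \<xi>
    proof -
      obtain Q where "invertible (P ** Q)" "frame_flag ord (P ** Q) = \<xi>"
        "\<forall>k. pminor {a. ord a < k} (mstar Q ** rdiag \<epsilon> ** Q) \<noteq> 0" using nz[OF \<xi>] by blast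
      then show ?thesis by (intro exI[of _ "P ** Q"]) (simp only: gram_conj simp_thms)
    qed
    obtain c where c: "c > 0" and cb: "\<And>Q k. invertible Q \<Longrightarrow> frame_flag ord Q \<in> D \<Longrightarrow> k \<le> ?d \<Longrightarrow>
      c * \<bar>pminor {a. ord a < k} (mstar (?Pi ** Q) ** (?Pi ** Q))\<bar> \<le> \<bar>pminor {a. ord a < k} (mstar Q ** ?B0 ** Q)\<bar>"
      using compact_flags_minor_bound[OF ord D nz' iPi] by blast
    have "c \<le> \<bar>pminor {a. ord a < k} (mstar U ** rdiag \<epsilon> ** U)\<bar>"
      if U: "unitary U" "frame_flag ord (P ** U) \<in> D" "k \<le> ?d" for U k
    proof -
      have "det U \<noteq> 0" using unitary_det[OF U(1)] by auto
      then have "invertible (P ** U)" using P by (simp add: invertible_det_nz det_mul)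
      from cb[OF this U(2,3)] show ?thesis
        unfolding gram_conj SQ using U(1) by (simp add: unitary_def unit_minor)
    qed
    then show ?thesis using c by blast
  qed
  have "\<exists>Q. invertible (P ** Q) \<and> frame_flag ord (P ** Q) = \<xi> \<and>
      (\<forall>k. pminor {a. ord a < k} (mstar Q ** rdiag \<epsilon> ** Q) \<noteq> 0)" if "\<xi> \<in> C" for \<xi>
  proof -
    have "\<xi> \<in> nondeg_flags B" using that C(2) by blast
    then show ?thesis by (rule nondeg_minor) blast
  qed
  from bound[OF C(1) this] obtain c1 where c1: "c1 > 0" "\<And>U k. unitary U \<Longrightarrow> frame_flag ord (P ** U) \<in> C \<Longrightarrow> k \<le> ?d \<Longrightarrow>
      c1 \<le> \<bar>pminor {a. ord a < k} (mstar U ** rdiag \<epsilon> ** U)\<bar>" by blast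
  have "\<exists>Q. invertible (P ** Q) \<and> frame_flag ord (P ** Q) = \<xi> \<and>
      (\<forall>k. pminor {a. ord a < k} (mstar Q ** rdiag \<epsilon> ** Q) \<noteq> 0)" if "\<xi> \<in> Cs" for \<xi>
  proof -
    have "\<xi> \<in> H_orbit B (pflag \<psi>)" using that Cs(2) by blast
    then obtain T where T: "det T = 1" "mstar T ** rdiag \<epsilon> ** T = rdiag \<epsilon>"
      "\<xi> = frame_flag ord (P ** (T ** monomat \<psi> (\<lambda>_. 1)))" by (rule orbit_frame)
    have "norm (det (monomat \<psi> (\<lambda>_. 1) :: 'k^'n^'n)) = 1"
      using \<psi>(1) by (intro unitary_det unitary_monomat) simp_all
    then have "invertible (P ** (T ** monomat \<psi> (\<lambda>_. 1)))"
      using P T(1) by (auto simp: invertible_det_nz det_mul)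
    moreover have "pminor I (mstar (T ** monomat \<psi> (\<lambda>_. 1)) ** rdiag \<epsilon> ** (T ** monomat \<psi> (\<lambda>_. 1))) \<noteq> 0" for I
      unfolding pminor_orbit_frame[OF \<psi>(1) T(2)] using abs_prod_eps[of \<psi> I] by (metis abs_0 zero_neq_one)
    ultimately show ?thesis unfolding T(3) by blast
  qed
  from bound[OF Cs(1) this] obtain c2 where c2: "c2 > 0" "\<And>U k. unitary U \<Longrightarrow> frame_flag ord (P ** U) \<in> Cs \<Longrightarrow> k \<le> ?d \<Longrightarrow>
      c2 \<le> \<bar>pminor {a. ord a < k} (mstar U ** rdiag \<epsilon> ** U)\<bar>" by blast
  define c0 where "c0 = min c1 c2"
  have c0: "c0 > 0" using c1 c2 by (simp add: c0_def)
  show ?thesis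
  proof (rule simultaneous_diagonalization[OF ord c0, of "real ?d", where 'k='k])
    show "0 \<le> real ?d" by simp
    fix L :: real assume L: "L > 0" and key: "\<And>(GU :: 'k^'n^'n) GS x.
      hermitian GU \<Longrightarrow> hermitian GS \<Longrightarrow> (\<And>i j. norm (GU $ i $ j) \<le> ?d) \<Longrightarrow> (\<And>i j. norm (GS $ i $ j) \<le> ?d) \<Longrightarrow>
      (\<And>i. i \<le> ?d \<Longrightarrow> c0 \<le> \<bar>pminor {j. ord j < i} GU\<bar>) \<Longrightarrow>
      (\<And>i. i \<le> ?d \<Longrightarrow> c0 \<le> \<bar>pminor {j. i \<le> ord j} GS\<bar>) \<Longrightarrow>
      (\<And>i j. ord i < ord j \<Longrightarrow> x j + L < x i) \<Longrightarrow>
      \<exists>V \<mu> t. det V \<noteq> 0 \<and> mstar V ** GS ** V = rdiag t \<and>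
        mstar V ** scaled x GU ** V = rdiag (\<lambda>a. \<mu> a * t a) \<and>
        (\<forall>a b. ord a < ord b \<longrightarrow> \<bar>\<mu> b\<bar> < \<bar>\<mu> a\<bar>) \<and>
        (\<forall>a. \<mu> a \<noteq> 0 \<and> t a \<noteq> 0 \<and>
          sgn (t a) = sgn (pminor {j. ord a \<le> ord j} GS) * sgn (pminor {j. ord a < ord j} GS))"
    obtain nc where nc: "monomial_unit rv (nc :: 'n \<Rightarrow> 'k)" using monomial_unit_exists[OF bij_rv] by blast
    note mnc = monomial_unitD[OF nc]
    obtain \<omega> where \<omega>: "bij \<omega>" "\<And>i. \<epsilon> (\<omega> i) = \<epsilon> i"
      "\<And>i j. \<epsilon> i = \<epsilon> j \<Longrightarrow> ord i < ord j \<Longrightarrow> ord (\<omega> j) < ord (\<omega> i)"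
      "opp_inv_flag B \<tau> bsp (range line) bpc (pflag \<psi>) = pflag (\<omega> \<circ> \<psi> \<circ> rv)"
      using opp_inv_flag_eq \<psi>(1) by metis
    \<comment> \<open>The permutation of the opposite flag of \<open>pflag \<psi>\<close>. The form
      has on the eigenvector of index \<open>a\<close> the sign of \<open>line (m a)\<close>, so
      \<open>m\<close> tells on which line each eigenvalue is to be placed.\<close>
    define m where "m = \<omega> \<circ> \<psi> \<circ> rv"
    have bm: "bij m" unfolding m_def using \<omega>(1) \<psi>(1) bij_rv by (intro bij_comp)
    have em': "\<epsilon> (m a) = \<epsilon> (\<psi> (rv a))" for a by (simp add: m_def \<omega>(2))
    have m_ord: "ord (m a) < ord (m b)" if "\<epsilon> (m a) = \<epsilon> (m b)" "ord a < ord b" for a b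
    proof -
      have e: "\<epsilon> (\<psi> (rv b)) = \<epsilon> (\<psi> (rv a))" using that(1) by (simp add: em')
      have "ord (rv b) < ord (rv a)" using that(2) by (simp only: ord_rv_less)
      from \<omega>(3)[OF e \<psi>(2)[OF e this]] show ?thesis by (simp add: m_def)
    qed
    have main: "cl (em A) \<in> B_set B \<and> (\<exists>\<mu> y. b_proj B \<tau> bsp bpc (cl (em A)) = dg y \<and>
        jordan_proj \<tau> (cham id) (cl (em (bstar A ** A))) = dg (\<lambda>i. ln \<bar>\<mu> i\<bar>) \<and> (\<forall>a. y (m a) = ln \<bar>\<mu> a\<bar> / 2))"
      if A: "det A = 1"
        and mn: "(MIN \<alpha>\<in>pos_roots bsp (cham id). \<alpha> (cartan_proj \<tau> (cham id) (cl (em A)))) > L"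
        and Sf: "S_flag \<tau> bsp (range line) (cham id) (cl (em A)) \<in> Cs"
        and Uf: "U_flag \<tau> bsp (range line) (cham id) (cl (em A)) \<in> C" for A
    proof -
      obtain K Lm x where svd: "unitary K" "unitary Lm" "det K = 1" "det Lm = 1" "decr ord x" "sum x UNIV = 0"
        and AK: "A = K ** rdiag (\<lambda>i. exp (x i)) ** Lm" using singular_value_decomposition[OF A ord] .
      have gap: "x j + L < x i" if "ord i < ord j" for i j
        using mn unfolding AK cartan_proj_eq[OF svd] by (rule pos_roots_gap[OF _ svd(6) that])
      have injx: "inj x"
      proof (rule injI)
        fix i j assume "x i = x j"
        then show "i = j" using gap[of i j] gap[of j i] L
          by (cases "ord i" "ord j" rule: linorder_cases) (auto simp: ord_eq_iff)
      qed
      define GU where "GU = mstar K ** rdiag \<epsilon> ** K"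
      define GS where "GS = mstar (mstar Lm) ** rdiag \<epsilon> ** mstar Lm"
      have HU: "hermitian GU" "hermitian GS" unfolding GU_def GS_def by (intro hermitian_conj hermitian_eps)+
      have bd: "norm (GU $ i $ j) \<le> ?d" "norm (GS $ i $ j) \<le> ?d" for i j
        unfolding GU_def GS_def using unitary_conj_entry_le[OF svd(1) eps] unitary_conj_entry_le[OF unitary_mstar[OF svd(2)] eps] by auto
      have UC: "frame_flag ord (P ** K) \<in> C" using Uf unfolding AK U_flag_eq[OF svd injx] .
      have SC: "frame_flag ord (P ** (mstar Lm ** monomat rv nc)) \<in> Cs" using Sf unfolding AK S_flag_eq[OF svd injx nc] .
      have uLN: "unitary (mstar Lm ** monomat rv nc)" using unitary_mstar[OF svd(2)] mnc(4) by (rule unitary_mult)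
      \<comment> \<open>The repelling flag is given by the reversed frame, whose initial segments
        are final segments for \<open>GS\<close>.\<close>
      have GSm: "pminor {a. ord a < k} (mstar (mstar Lm ** monomat rv nc) ** rdiag \<epsilon> ** (mstar Lm ** monomat rv nc)) =
          pminor {j. ?d - k \<le> ord j} GS" if "k \<le> ?d" for k
      proof -
        have "mstar (mstar Lm ** monomat rv nc) ** rdiag \<epsilon> ** (mstar Lm ** monomat rv nc) =
            mstar (monomat rv nc) ** GS ** monomat rv nc"
          unfolding GS_def by (simp only: mstar_mult matrix_mul_assoc)
        then show ?thesis using pminor_monomat[OF bij_rv mnc(2), where I="{a. ord a < k}" and G=GS] rv_image[OF that] by simp
      qed
      have cU: "c0 \<le> \<bar>pminor {j. ord j < i} GU\<bar>" if "i \<le> ?d" for i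
        using c1(2)[OF svd(1) UC that] by (simp add: GU_def c0_def)
      have cS: "c0 \<le> \<bar>pminor {j. i \<le> ord j} GS\<bar>" if "i \<le> ?d" for i
        using c2(2)[OF uLN SC, of "?d - i"] GSm[of "?d - i"] that by (simp add: c0_def)
      have "\<exists>V \<mu> t. det V \<noteq> 0 \<and> mstar V ** GS ** V = rdiag t \<and>
        mstar V ** scaled x GU ** V = rdiag (\<lambda>a. \<mu> a * t a) \<and>
        (\<forall>a b. ord a < ord b \<longrightarrow> \<bar>\<mu> b\<bar> < \<bar>\<mu> a\<bar>) \<and>
        (\<forall>a. \<mu> a \<noteq> 0 \<and> t a \<noteq> 0 \<and>
          sgn (t a) = sgn (pminor {j. ord a \<le> ord j} GS) * sgn (pminor {j. ord a < ord j} GS))"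
        by (rule key[OF HU]) (rule bd cU cS gap | assumption)+
      then obtain V \<mu> t where V0: "det V \<noteq> 0" "mstar V ** GS ** V = rdiag t"
        "mstar V ** scaled x GU ** V = rdiag (\<lambda>a. \<mu> a * t a)" "\<forall>a b. ord a < ord b \<longrightarrow> \<bar>\<mu> b\<bar> < \<bar>\<mu> a\<bar>"
        "\<forall>a. \<mu> a \<noteq> 0 \<and> t a \<noteq> 0 \<and>
          sgn (t a) = sgn (pminor {j. ord a \<le> ord j} GS) * sgn (pminor {j. ord a < ord j} GS)"
        by (elim exE conjE)
      note V = V0(1-3) V0(4)[rule_format] V0(5)[rule_format, THEN conjunct1]
        V0(5)[rule_format, THEN conjunct2, THEN conjunct1] V0(5)[rule_format, THEN conjunct2, THEN conjunct2]
      define F where "F = mstar Lm ** V"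
      have F1: "mstar F ** rdiag \<epsilon> ** F = rdiag t"
        unfolding V(2)[symmetric] F_def GS_def by (simp only: mstar_mult matrix_mul_assoc)
      have AF: "A ** F = K ** rdiag (\<lambda>i. exp (x i)) ** V"
      proof -
        have "A ** F = K ** rdiag (\<lambda>i. exp (x i)) ** (Lm ** mstar Lm) ** V"
          unfolding AK F_def by (simp only: matrix_mul_assoc)
        then show ?thesis by (simp add: unitary_right[OF svd(2)])
      qed
      have F2: "mstar (A ** F) ** rdiag \<epsilon> ** (A ** F) = rdiag (\<lambda>a. \<mu> a * t a)"
        unfolding AF V(3)[symmetric] scaled_def GU_def by (simp only: mstar_mult mstar_rdiag matrix_mul_assoc)
      have "det F \<noteq> 0" using V(1) svd(4) by (simp add: F_def det_mul det_mstar)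
      then have iF: "invertible F" by (simp add: invertible_det_nz)
      \<comment> \<open>After multiplication by the invertible matrix
        \<open>mstar F ** rdiag \<epsilon>\<close> both sides are the Gram matrix of
        \<open>A ** F\<close>.\<close>
      have MF: "(bstar A ** A) ** F = F ** rdiag \<mu>"
      proof -
        let ?G = "mstar F ** rdiag \<epsilon>"
        have de: "det (rdiag \<epsilon> :: 'k^'n^'n) \<noteq> 0" using det_eps_sq by auto
        have iG: "invertible ?G" using \<open>det F \<noteq> 0\<close> de by (simp add: invertible_det_nz det_mul det_mstar)
        have "?G ** ((bstar A ** A) ** F) = mstar F ** (rdiag \<epsilon> ** rdiag \<epsilon>) ** mstar A ** rdiag \<epsilon> ** A ** F"
          unfolding bstar_def by (simp only: matrix_mul_assoc)
        also have "\<dots> = mstar (A ** F) ** rdiag \<epsilon> ** (A ** F)"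
          by (simp only: rdiag_eps_sq matrix_mul_rid mstar_mult matrix_mul_assoc)
        also have "\<dots> = rdiag t ** rdiag \<mu>" unfolding F2 rdiag_mult by (simp add: mult.commute)
        also have "\<dots> = ?G ** (F ** rdiag \<mu>)" unfolding F1[symmetric] by (simp only: matrix_mul_assoc)
        finally show ?thesis by (rule matrix_left_cancel[OF iG])
      qed
      have dM: "det (bstar A ** A) = 1" using A by (simp add: det_mul det_bstar)
      have jordan: "jordan_proj \<tau> (cham id) (cl (em (bstar A ** A))) = dg (\<lambda>i. ln \<bar>\<mu> i\<bar>)"
        and slog: "(\<Sum>i\<in>UNIV. ln \<bar>\<mu> i\<bar>) = 0"
        using jordan_proj_eq[OF dM iF MF V(5) less_imp_le[OF V(4)]] by auto
      \<comment> \<open>The repelling frame and the frame of an orbit point define the same flag, so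
        their minors have the same signs, and the latter are products of \<open>\<epsilon>\<close>
        along \<open>\<psi>\<close>. The sign of \<open>t a\<close> compares two consecutive
        products, which leaves a single factor.\<close>
      have sgn_t: "\<epsilon> (m a) = sgn (t a)" for a
      proof -
        have "frame_flag ord (P ** (mstar Lm ** monomat rv nc)) \<in> H_orbit B (pflag \<psi>)" using SC Cs(2) by blast
        then obtain T where T: "det T = 1" "mstar T ** rdiag \<epsilon> ** T = rdiag \<epsilon>"
          "frame_flag ord (P ** (mstar Lm ** monomat rv nc)) = frame_flag ord (P ** (T ** monomat \<psi> (\<lambda>_. 1)))"
          by (rule orbit_frame)
        have "norm (det (monomat \<psi> (\<lambda>_. 1) :: 'k^'n^'n)) = 1"
          using \<psi>(1) by (intro unitary_det unitary_monomat) simp_all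
        then have "invertible (P ** (T ** monomat \<psi> (\<lambda>_. 1)))"
          using P T(1) by (auto simp: invertible_det_nz det_mul)
        from pminor_frame[OF this T(3)] obtain N where N: "\<And>k G. pminor {a. ord a < k} (mstar (P ** (mstar Lm ** monomat rv nc)) ** G ** (P ** (mstar Lm ** monomat rv nc))) =
            N k * pminor {a. ord a < k} (mstar (P ** (T ** monomat \<psi> (\<lambda>_. 1))) ** G ** (P ** (T ** monomat \<psi> (\<lambda>_. 1))))"
            "\<And>k. N k \<ge> (0::real)" by blast
        define pr where "pr k = (\<Prod>a | ord a < k. \<epsilon> (\<psi> a))" for k
        have sg: "sgn (pminor {j. ?d - k \<le> ord j} GS) = pr k" if "k \<le> ?d" for k
        proof -
          have e: "pminor {j. ?d - k \<le> ord j} GS = N k * pr k"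
            using N(1)[of k ?B0] unfolding gram_conj GSm[OF that] pminor_orbit_frame[OF \<psi>(1) T(2)] pr_def .
          have "pminor {j. ?d - k \<le> ord j} GS \<noteq> 0" using cS[of "?d - k"] c0 by auto
          then have "N k > 0" using N(2)[of k] unfolding e by (auto simp: less_le)
          then have "sgn (pminor {j. ?d - k \<le> ord j} GS) = sgn (pr k)" unfolding e by (simp add: sgn_mult)
          moreover have "\<bar>pr k\<bar> = 1" unfolding pr_def by (rule abs_prod_eps)
          ultimately show ?thesis by (auto simp: abs_if sgn_if split: if_splits)
        qed
        \<comment> \<open>Ranks counted from the end: the final segment from \<open>ord a\<close> on
          has \<open>Suc k\<close> elements, the one strictly after it has \<open>k\<close>.\<close>
        define k where "k = ord (rv a)"
        have k: "Suc k \<le> ?d" using ord_less[of "rv a"] unfolding k_def by (simp only: Suc_le_eq)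
        have "?d - Suc k = ord a" using ord_less[of a] by (simp add: k_def)
        moreover have "?d - k \<le> ord j \<longleftrightarrow> ord a < ord j" for j using ord_less[of a] by (auto simp: k_def)
        ultimately have "sgn (t a) = pr (Suc k) * pr k"
          using sg[of k] sg[of "Suc k"] k V(7)[of a] by simp
        moreover have "pr (Suc k) = \<epsilon> (\<psi> (rv a)) * pr k"
        proof -
          have "{a'. ord a' < Suc k} = insert (rv a) {a'. ord a' < k}"
            by (auto simp: k_def less_Suc_eq ord_eq_iff simp del: ord_rv)
          then show ?thesis unfolding pr_def by (simp add: k_def del: ord_rv)
        qed
        moreover have "pr k * pr k = 1" using abs_prod_eps[of \<psi> "{a. ord a < k}"] unfolding pr_def[symmetric]
          by (auto simp: abs_if split: if_splits)
        ultimately show ?thesis by (simp add: em' mult.assoc)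
      qed
      \<comment> \<open>Half the logarithm of the eigenvalue of index \<open>a\<close> is put on
        \<open>line (m a)\<close>. Since \<open>m\<close> is increasing on the indices of each sign,
        the result lies in \<open>bpc\<close>.\<close>
      obtain y where y: "\<And>a. y (m a) = ln \<bar>\<mu> a\<bar> / 2" "sum y UNIV = (\<Sum>a\<in>UNIV. ln \<bar>\<mu> a\<bar> / 2)"
        using perm_shift[OF bm, of "\<lambda>a. ln \<bar>\<mu> a\<bar> / 2"] by blast
      have "dg y \<in> bpc"
        unfolding bpc_dg
      proof (intro conjI allI impI)
        show "sum y UNIV = 0" using y(2) slog by (simp add: sum_divide_distrib[symmetric])
        fix i j assume ij: "\<epsilon> i = \<epsilon> j" "ord i < ord j"
        obtain a where a: "i = m a" using bm by (rule bij_pointE)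
        obtain b where b: "j = m b" using bm by (rule bij_pointE)
        have "ord a < ord b"
          using ij m_ord[of b a] unfolding a b by (cases "ord a" "ord b" rule: linorder_cases) (auto simp: ord_eq_iff)
        then have "\<bar>\<mu> b\<bar> < \<bar>\<mu> a\<bar>" by (rule V(4))
        then show "y j \<le> y i" using V(5) by (simp add: a b y(1))
      qed
      moreover have "a = b" if "\<bar>\<mu> a\<bar> = \<bar>\<mu> b\<bar>" for a b
        using V(4)[of a b] V(4)[of b a] that by (cases "ord a" "ord b" rule: linorder_cases) (auto simp: ord_eq_iff)
      ultimately have "b_proj B \<tau> bsp bpc (cl (em A)) = dg y"
        using b_proj_eq[OF A iF F1 F2 MF V(6) V(5) _ bm sgn_t y(1)] by blast
      then show ?thesis using B_set_frame[OF A iF F1 F2] jordan y(1) by blast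
    qed
    show ?thesis
    proof (intro exI[of _ L] conjI ballI impI)
      show "L > 0" by fact
      fix g :: "('k^'n^'n) set" assume g: "g \<in> carrier PSL"
      assume H: "(MIN \<alpha>\<in>pos_roots bsp (cham id). \<alpha> (cartan_proj \<tau> (cham id) g)) > L \<and>
        S_flag \<tau> bsp (range line) (cham id) g \<in> Cs \<and> U_flag \<tau> bsp (range line) (cham id) g \<in> C"
      obtain A0 where A0: "g = cl A0" "det A0 = 1" using g by (auto simp: carrier_PSL)
      define A where "A = co A0"
      have A: "g = cl (em A)" "det A = 1" using A0 det_em[of A] by (simp_all add: A_def)
      have sig: "sigma_o B (inv\<^bsub>PSL\<^esub> g) \<otimes>\<^bsub>PSL\<^esub> g = cl (em (bstar A ** A))"
        unfolding A(1) by (rule sigma_inv_mult[OF A(2)])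
      obtain \<mu> y where my: "g \<in> B_set B" "b_proj B \<tau> bsp bpc g = dg y"
        "jordan_proj \<tau> (cham id) (cl (em (bstar A ** A))) = dg (\<lambda>i. ln \<bar>\<mu> i\<bar>)" "\<forall>a. y (m a) = ln \<bar>\<mu> a\<bar> / 2"
        using main[OF A(2)] H unfolding A(1) by blast
      then show "g \<in> B_set B" by simp
      have fl: "flag_of_chamber bsp (range line) (cham id) = pflag id" by (rule flag_of_cham[OF bij_id])
      have wf: "w_flags \<tau> bsp (opp_inv_flag B \<tau> bsp (range line) bpc (pflag \<psi>)) (flag_of_chamber bsp (range line) (cham id)) = wcl m"
        unfolding fl \<omega>(4) m_def[symmetric] by (rule w_flags_eq[OF bm])
      \<comment> \<open>The Jordan projection written as a pullback by \<open>m\<close>, the shape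
        that the action of \<open>wcl m\<close> undoes.\<close>
      have ln2: "(\<lambda>i. ln \<bar>\<mu> i\<bar>) = (\<lambda>i. 2 * y (m i))" using my(4) by (simp add: fun_eq_iff mult.commute)
      have half: "(1/2) *\<^sub>R dg (\<lambda>i. 2 * y i) = dg y" unfolding dg_scaleR by simp
      show "b_proj B \<tau> bsp bpc g = (1/2) *\<^sub>R W_act (w_flags \<tau> bsp (opp_inv_flag B \<tau> bsp (range line) bpc (pflag \<psi>))
          (flag_of_chamber bsp (range line) (cham id))) (jordan_proj \<tau> (cham id) (sigma_o B (inv\<^bsub>PSL\<^esub> g) \<otimes>\<^bsub>PSL\<^esub> g))"
        unfolding wf sig my(2,3) ln2 W_act_dg[OF bm, of "\<lambda>i. 2 * y i"] half ..
      assume "opp_inv_flag B \<tau> bsp (range line) bpc (pflag \<psi>) = flag_of_chamber bsp (range line) (cham id)"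
      then have "pflag m = pflag id" unfolding fl \<omega>(4) m_def .
      then have "m = id" by (rule pflag_inject[OF bm bij_id])
      then show "b_proj B \<tau> bsp bpc g = (1/2) *\<^sub>R jordan_proj \<tau> (cham id) (sigma_o B (inv\<^bsub>PSL\<^esub> g) \<otimes>\<^bsub>PSL\<^esub> g)"
        unfolding sig my(2,3) ln2 using half by simp
    qed
  qed
qed

end

section \<open>Adapted coordinates\<close>

lemma hermitian_formD:
  assumes "hermitian_form B"
  shows "B (u + v) w = B u w + B v w" "B (c *s u) v = c * B u v" "B v u = scnj (B u v)"
  using assms unfolding hermitian_form_def by blast+

lemma hermitian_form_right:
  assumes "hermitian_form B"
  shows "B u (c *s v) = scnj c * B u v" "B 0 u = 0" "B u 0 = 0"
proof -
  show "B u (c *s v) = scnj c * B u v"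
    using hermitian_formD(2,3)[OF assms] by (metis scnj_mult)
  have z: "B 0 v = 0" for v using hermitian_formD(2)[OF assms, of 0 0 v] by simp
  then show "B 0 u = 0" .
  show "B u 0 = 0" using z[of u] hermitian_formD(3)[OF assms, of 0 u] by simp
qed

lemma hermitian_form_sum:
  assumes "hermitian_form B" "finite S"
  shows "B (\<Sum>a\<in>S. f a *s v a) w = (\<Sum>a\<in>S. f a * B (v a) w)"
    and "B w (\<Sum>a\<in>S. f a *s v a) = (\<Sum>a\<in>S. scnj (f a) * B w (v a))"
proof -
  show *: "B (\<Sum>a\<in>S. f a *s v a) w = (\<Sum>a\<in>S. f a * B (v a) w)" for w
    using assms(2) by (induction S rule: finite_induct)
      (simp_all add: hermitian_form_right[OF assms(1)] hermitian_formD(1,2)[OF assms(1)])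
  have "B w (\<Sum>a\<in>S. f a *s v a) = scnj (\<Sum>a\<in>S. f a * B (v a) w)"
    unfolding *[symmetric] by (rule hermitian_formD(3)[OF assms(1)])
  also have "\<dots> = (\<Sum>a\<in>S. scnj (f a) * scnj (B (v a) w))" by (simp add: scnj_sum scnj_mult)
  also have "\<dots> = (\<Sum>a\<in>S. scnj (f a) * B w (v a))"
    by (simp only: hermitian_formD(3)[OF assms(1), of w, symmetric])
  finally show "B w (\<Sum>a\<in>S. f a *s v a) = (\<Sum>a\<in>S. scnj (f a) * B w (v a))" .
qed

lemma diagonal_form:
  fixes P :: "'k::scalar_rc^'n^'n"
  assumes B: "hermitian_form B"
    and d: "\<And>i j. B (P *v axis i 1) (P *v axis j 1) = (if i = j then of_real (\<beta> i) else 0)"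
  shows "B (P *v u) (P *v v) = sdot (rdiag \<beta> *v u) v"
proof -
  have sum: "P *v w = (\<Sum>i\<in>UNIV. w $ i *s (P *v axis i 1))" for w
  proof -
    have "column i P = P *v axis i 1" for i by (simp add: vec_eq_iff column_def mult_axis_nth)
    then show ?thesis using matrix_mult_sum[of P w] by simp
  qed
  have "B (P *v u) (P *v v) = (\<Sum>i\<in>UNIV. u $ i * B (P *v axis i 1) (P *v v))"
    unfolding sum[of u] by (rule hermitian_form_sum(1)[OF B finite])
  also have "\<dots> = (\<Sum>i\<in>UNIV. u $ i * (\<Sum>j\<in>UNIV. scnj (v $ j) * B (P *v axis i 1) (P *v axis j 1)))"
    unfolding sum[of v] hermitian_form_sum(2)[OF B finite] ..
  also have "\<dots> = (\<Sum>i\<in>UNIV. of_real (\<beta> i) * u $ i * scnj (v $ i))"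
    unfolding d by (simp add: if_distrib[of "\<lambda>z. _ * z"] mult_ac cong: if_cong)
  finally show ?thesis by (simp add: sdot_def rdiag_def diagm_mult_vec_nth)
qed

text \<open>Expanding \<open>v\<close> in the orthogonal basis of the definition and pairing with
  one basis vector isolates the corresponding coefficient.\<close>

lemma form_radical:
  fixes B :: "'k::scalar_rc^'n \<Rightarrow> 'k^'n \<Rightarrow> 'k"
  assumes "form_of_signature p q B" "p \<ge> 1" "q \<ge> 1" and rad: "\<And>w. B v w = 0"
  shows "v = 0"
proof -
  obtain P N where PN: "card P = p" "card N = q" "vec.span (P \<union> N) = UNIV"
    "pairwise (\<lambda>u v. B u v = 0) (P \<union> N)" "\<forall>v\<in>P. pos_scalar (B v v)" "\<forall>v\<in>N. neg_scalar (B v v)"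
    and B: "hermitian_form B"
    using assms(1) unfolding form_of_signature_def by blast
  \<comment> \<open>\<open>card\<close> is \<open>0\<close> on infinite sets, so positive
    cardinalities give finiteness.\<close>
  have fin: "finite (P \<union> N)" using PN(1,2) assms(2,3) by (metis card_ge_0_finite finite_Un less_le_trans zero_less_one)
  have "v \<in> vec.span (P \<union> N)" using PN(3) by simp
  then obtain r where r: "v = (\<Sum>a\<in>P \<union> N. r a *s a)" unfolding vec.span_finite[OF fin] by blast
  have "r b = 0" if b: "b \<in> P \<union> N" for b
  proof -
    have "0 = B v b" using rad by simp
    also have "\<dots> = (\<Sum>a\<in>P \<union> N. r a * B a b)" unfolding r by (rule hermitian_form_sum[OF B fin])
    also have "\<dots> = (\<Sum>a\<in>P \<union> N. if a = b then r b * B b b else 0)"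
      using PN(4) b by (intro sum.cong) (auto simp: pairwise_def)
    also have "\<dots> = r b * B b b" using fin b by simp
    finally have "r b * B b b = 0" ..
    moreover have "B b b \<noteq> 0" using PN(5,6) b by (auto simp: pos_scalar_def neg_scalar_def)
    ultimately show ?thesis by simp
  qed
  then show ?thesis by (simp add: r)
qed

lemma line_span:
  fixes l :: "('k::scalar_rc^'n) set"
  assumes "is_line l" obtains x where "x \<noteq> 0" "l = vec.span {x}"
proof -
  obtain S where S: "S \<subseteq> l" "vec.independent S" "l \<subseteq> vec.span S" "card S = vec.dim l" by (rule vec.basis_exists)
  then obtain x where x: "S = {x}" using assms by (auto simp: is_line_def card_1_singleton_iff)
  have "l = vec.span {x}" using S assms x by (metis is_line_def subset_antisym vec.span_minimal)
  moreover have "x \<noteq> 0" using S(2) x by (auto simp: vec.dependent_single)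
  ultimately show ?thesis by (rule that[rotated])
qed

lemma span_scale:
  fixes x :: "'k::scalar_rc^'n"
  assumes "c \<noteq> 0" shows "vec.span {c *s x} = vec.span {x}"
proof -
  have "range (\<lambda>k. k *s (c *s x)) = range (\<lambda>k. k *s x)"
  proof (intro equalityI subsetI)
    fix y assume "y \<in> range (\<lambda>k. k *s x)"
    then obtain k where "y = k *s x" by blast
    then have "y = (k / c) *s (c *s x)" using assms by simp
    then show "y \<in> range (\<lambda>k. k *s (c *s x))" by blast
  qed auto
  then show ?thesis unfolding vec.span_singleton .
qed

lemma unit_vector:
  fixes l :: "('k::scalar_rc^'n) set"
  assumes "is_line l" "inner_form h" obtains e where "l = vec.span {e}" "h e e = 1"
proof -
  have h: "hermitian_form h" using assms(2) by (simp add: inner_form_def)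
  obtain x where x: "x \<noteq> 0" "l = vec.span {x}" using assms(1) by (rule line_span)
  obtain r where r: "r > 0" "h x x = of_real r" using assms(2) x(1) by (auto simp: inner_form_def pos_scalar_def)
  define c :: 'k where "c = of_real (1 / sqrt r)"
  have c: "c \<noteq> 0" using r(1) by (simp add: c_def)
  have "h (c *s x) (c *s x) = of_real (1 / sqrt r * (1 / sqrt r) * r)"
    unfolding hermitian_formD(2)[OF h] hermitian_form_right(1)[OF h] r(2) c_def scnj_of_real
    by (simp only: of_real_mult mult.assoc)
  also have "1 / sqrt r * (1 / sqrt r) * r = 1" using r(1) by simp
  finally have "h (c *s x) (c *s x) = 1" by simp
  moreover have "vec.span {c *s x} = l" unfolding x(2) using c by (rule span_scale)
  ultimately show ?thesis using that by blast
qed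

lemma orthonormal_frame:
  fixes h :: "'k::scalar_rc^'n \<Rightarrow> 'k^'n \<Rightarrow> 'k"
  assumes h: "inner_form h" and E: "orth_basis_of_lines h E"
  shows "\<exists>(P :: 'k^'n^'n) f. invertible P \<and> bij_betw f UNIV E \<and>
    (\<forall>i. f i = vec.span {P *v axis i 1}) \<and> (\<forall>u v. h (P *v u) (P *v v) = sdot u v)"
proof -
  have hf: "hermitian_form h" using h by (simp add: inner_form_def)
  have E': "card E = CARD('n)" "\<And>l. l \<in> E \<Longrightarrow> is_line l"
    "\<And>l l' u v. l \<in> E \<Longrightarrow> l' \<in> E \<Longrightarrow> l \<noteq> l' \<Longrightarrow> u \<in> l \<Longrightarrow> v \<in> l' \<Longrightarrow> h u v = 0"
    using E unfolding orth_basis_of_lines_def basis_of_lines_def pairwise_def by blast+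
  have "finite E" using E'(1) by (metis card_ge_0_finite zero_less_card_finite)
  then obtain f :: "'n \<Rightarrow> _" where f: "bij_betw f UNIV E"
    using finite_same_card_bij[of "UNIV :: 'n set" E] E'(1) by auto
  have fE: "f i \<in> E" for i using f by (auto simp: bij_betw_def)
  have "\<exists>e. f i = vec.span {e} \<and> h e e = 1" for i
    using unit_vector[OF E'(2)[OF fE] h] by metis
  then obtain e where e: "\<And>i. f i = vec.span {e i}" "\<And>i. h (e i) (e i) = 1" by metis
  define P :: "'k^'n^'n" where "P = (\<chi> a i. e i $ a)"
  have Pe: "P *v axis i 1 = e i" for i by (simp add: vec_eq_iff P_def mult_axis_nth)
  have dP: "h (P *v axis i 1) (P *v axis j 1) = (if i = j then of_real 1 else 0)" for i j
  proof (cases "i = j")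
    case False
    then have "f i \<noteq> f j" using f by (auto simp: bij_betw_def inj_eq)
    moreover have "e i \<in> f i" "e j \<in> f j" unfolding e(1) by (auto intro: vec.span_base)
    ultimately show ?thesis using E'(3)[OF fE fE] False unfolding Pe by simp
  qed (simp add: Pe e)
  have hP: "h (P *v u) (P *v v) = sdot u v" for u v
    using diagonal_form[OF hf, where P=P and \<beta>="\<lambda>_. 1", OF dP] by simp
  have "u = 0" if "P *v u = 0" for u
    using hP[of u u] that by (simp add: hermitian_form_right[OF hf])
  then have "invertible P" unfolding invertible_det_nz using det_eq_0_kernel by blast
  moreover have "f i = vec.span {P *v axis i 1}" for i by (simp only: Pe e(1))
  ultimately show ?thesis using f hP by blast
qed

lemma mult_rdiag_axis: "(P ** rdiag s) *v axis i 1 = of_real (s i) *s (P *v axis i (1::'k::scalar_rc))"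
  by (simp add: vec_eq_iff mult_axis_nth rdiag_def diagm_mult_right_nth mult.commute)

text \<open>Rescaling an orthonormal frame makes the values of the form on it equal to \<open>1\<close> or \<open>-1\<close>; since
  \<open>\<tau>\<close> commutes with \<open>dsigma B\<close>, all the scaling factors are equal, so that the frame remains
  orthonormal up to one common factor.\<close>

lemma adapted_coordinates:
  fixes B :: "'k::scalar_rc^'n \<Rightarrow> 'k^'n \<Rightarrow> 'k"
  assumes B: "hermitian_form B" "\<And>v. (\<And>w. B v w = 0) \<Longrightarrow> v = 0"
    and h: "cartan_inner_form \<tau> h" "orth_basis_of_lines h E" and E: "orth_basis_of_lines B E"
    and comm: "\<And>X. X \<in> sl \<Longrightarrow> \<tau> (dsigma B X) = dsigma B (\<tau> X)" and card: "CARD('n) \<ge> 2"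
  obtains P \<epsilon> where "coords P B \<tau> \<epsilon>" "E = range (\<lambda>i. vec.span {P *v axis i 1})"
proof -
  have hi: "inner_form h" and \<tau>: "\<And>X. X \<in> sl \<Longrightarrow> \<tau> X = - adj h X" using h(1) by (auto simp: cartan_inner_form_def)
  obtain P0 :: "'k^'n^'n" and f where P0: "invertible P0" "bij_betw f UNIV E"
    "\<And>i. f i = vec.span {P0 *v axis i 1}" "\<And>u v. h (P0 *v u) (P0 *v v) = sdot u v"
    using orthonormal_frame[OF hi h(2)] by blast
  have fE: "f i \<in> E" for i using P0(2) by (auto simp: bij_betw_def)
  let ?e = "\<lambda>i. P0 *v axis i 1"
  define \<beta> where "\<beta> i = rp (B (?e i) (?e i))" for i
  have BP: "B (?e i) (?e j) = (if i = j then of_real (\<beta> i) else 0)" for i j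
  proof (cases "i = j")
    case True
    have "scnj (B (?e i) (?e i)) = B (?e i) (?e i)" by (rule hermitian_formD(3)[OF B(1), symmetric])
    from scnj_fixed_real[OF this] show ?thesis using True by (simp add: \<beta>_def)
  next
    case False
    then have "f i \<noteq> f j" using P0(2) by (auto simp: bij_betw_def inj_eq)
    moreover have "?e i \<in> f i" "?e j \<in> f j" unfolding P0(3) by (auto intro: vec.span_base)
    ultimately show ?thesis using E fE False unfolding orth_basis_of_lines_def pairwise_def by (metis (no_types, lifting))
  qed
  note BP' = diagonal_form[OF B(1) BP]
  have \<beta>: "\<beta> i \<noteq> 0" for i
  proof
    assume z: "\<beta> i = 0"
    have "B (?e i) w = 0" for w
    proof -
      have "w = P0 *v (matrix_inv P0 *v w)" by (simp add: matrix_vector_mul_assoc matrix_inv_mult[OF P0(1)])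
      moreover have "rdiag \<beta> *v axis i (1::'k) = 0"
        using z by (auto simp: vec_eq_iff rdiag_def diagm_mult_vec_nth axis_def)
      ultimately show ?thesis using BP'[of "axis i 1" "matrix_inv P0 *v w"] by simp
    qed
    then have "?e i = 0" by (rule B(2))
    then have "sdot (axis i (1::'k)) (axis i 1) = 0"
      using P0(4)[of "axis i 1" "axis i 1"] hi by (simp add: hermitian_form_right inner_form_def)
    then show False by (simp add: axis_eq_0_iff)
  qed
  define s where "s i = 1 / sqrt \<bar>\<beta> i\<bar>" for i
  have s: "s i > 0" for i using \<beta>[of i] by (simp add: s_def)
  define \<epsilon> where "\<epsilon> i = sgn (\<beta> i)" for i
  define P where "P = P0 ** rdiag s"
  let ?D = "rdiag s :: 'k^'n^'n" and ?Di = "rdiag (\<lambda>i. 1 / s i) :: 'k^'n^'n"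
  have DD: "?D ** ?Di = mat 1" "?Di ** ?D = mat 1"
    using s by (simp_all add: rdiag_mult less_imp_neq[THEN not_sym])
  have iD: "invertible ?D" using DD unfolding invertible_def by blast
  have iP: "invertible P" unfolding P_def using P0(1) iD by (rule invertible_mult)
  have sb: "s i * \<beta> i * s i = \<epsilon> i" for i
  proof -
    have "s i * s i = 1 / \<bar>\<beta> i\<bar>" by (simp add: s_def real_sqrt_mult[symmetric] del: real_sqrt_mult)
    then have "s i * \<beta> i * s i = \<beta> i / \<bar>\<beta> i\<bar>" by (metis mult.commute mult.left_commute times_divide_eq_right mult_1_right)
    then show ?thesis by (simp add: \<epsilon>_def sgn_if abs_if \<beta>)
  qed
  have Bc: "B (P *v u) (P *v v) = sdot (rdiag \<epsilon> *v u) v" for u v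
  proof -
    have "B (P *v u) (P *v v) = sdot (rdiag \<beta> *v (?D *v u)) (?D *v v)"
      unfolding P_def matrix_vector_mul_assoc[symmetric] BP' ..
    also have "\<dots> = sdot ((?D ** rdiag \<beta> ** ?D) *v u) v"
      using sdot_mult_left[of ?D] by (simp add: matrix_vector_mul_assoc[symmetric])
    finally show ?thesis by (simp add: rdiag_mult sb)
  qed
  interpret c: form_coords P B \<epsilon> by standard (use iP Bc \<beta> in \<open>simp_all add: \<epsilon>_def abs_sgn_eq\<close>)
  interpret c0: form_coords P0 h "\<lambda>_. 1" by standard (use P0 in simp_all)
  have PiP: "matrix_inv P0 ** P = ?D" "matrix_inv P ** P0 = ?Di"
  proof -
    show "matrix_inv P0 ** P = ?D" by (simp add: P_def matrix_mul_assoc c0.PP)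
    have "P ** ?Di = P0" by (simp add: P_def matrix_mul_assoc[symmetric] DD)
    then show "matrix_inv P ** P0 = ?Di" by (metis c.PP(1) matrix_mul_assoc matrix_mul_lid)
  qed
  \<comment> \<open>In the rescaled frame the inner product has the diagonal matrix
    \<open>?D ** ?D\<close>, by which the conjugate transpose is twisted as long as \<open>s\<close>
    is not known to be constant.\<close>
  have tau: "\<tau> (c.em Y) = - c.em ((?Di ** ?Di) ** mstar Y ** (?D ** ?D))" if "trace Y = 0" for Y
  proof -
    have "c.em Y \<in> sl" using that by (simp add: c.em_sl)
    then have "\<tau> (c.em Y) = - c0.em (mstar (c0.co (c.em Y)))" by (simp add: \<tau> c0.adj_co c0.bstar_def)
    also have "c0.co (c.em Y) = (matrix_inv P0 ** P) ** Y ** (matrix_inv P ** P0)"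
      unfolding c0.co_def c.em_def by (simp only: matrix_mul_assoc)
    also have "mstar \<dots> = ?Di ** mstar Y ** ?D"
      unfolding PiP by (simp only: mstar_mult mstar_rdiag matrix_mul_assoc)
    also have "c0.em \<dots> = c.em ((?Di ** ?Di) ** mstar Y ** (?D ** ?D))"
    proof -
      have P0P: "P0 = P ** ?Di" "matrix_inv P0 = ?D ** matrix_inv P"
        using PiP by (metis c.PP(2) matrix_mul_assoc matrix_mul_lid matrix_mul_rid)+
      have "c0.em Z = (P ** ?Di) ** Z ** (?D ** matrix_inv P)" for Z
        unfolding c0.em_def by (simp only: P0P[symmetric])
      then show ?thesis unfolding c.em_def by (simp only: matrix_mul_assoc)
    qed
    finally show ?thesis .
  qed
  \<comment> \<open>Evaluating the commutation on the elementary matrix of position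
    \<open>(i, j)\<close> gives equality of the fourth powers of \<open>s i\<close> and
    \<open>s j\<close>.\<close>
  have s_eq: "s i = s j" for i j
  proof (cases "i = j")
    case False
    let ?Y = "munit i j :: 'k^'n^'n"
    have tY: "trace ?Y = 0" using munit_sl[OF False] by (simp add: sl_def)
    have tb: "trace (- c.bstar ?Y) = 0"
      using False by (auto simp: trace_def c.bstar_def rdiag_def diagm_mult_left_nth diagm_mult_right_nth munit_def intro!: sum.neutral)
    have ds: "dsigma B (c.em Z) = c.em (- c.bstar Z)" for Z by (simp add: c.dsigma_eq c.em_uminus)
    have "\<tau> (dsigma B (c.em ?Y)) = dsigma B (\<tau> (c.em ?Y))" by (rule comm) (simp add: c.em_sl tY)
    then have "- ((?Di ** ?Di) ** mstar (- c.bstar ?Y) ** (?D ** ?D)) =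
        - c.bstar (- ((?Di ** ?Di) ** mstar ?Y ** (?D ** ?D)))"
      unfolding ds tau[OF tb] tau[OF tY] c.em_uminus[symmetric] c.em_inject .
    then have "(- ((?Di ** ?Di) ** mstar (- c.bstar ?Y) ** (?D ** ?D))) $ i $ j =
        (- c.bstar (- ((?Di ** ?Di) ** mstar ?Y ** (?D ** ?D)))) $ i $ j" by simp
    moreover define g k where "g = (\<lambda>i. 1 / s i * (1 / s i))" and "k = (\<lambda>i. s i * s i)"
    have D2: "?Di ** ?Di = rdiag g" "?D ** ?D = rdiag k" by (simp_all only: rdiag_mult g_def k_def)
    ultimately have "of_real (g i * (\<epsilon> i * \<epsilon> j) * k j) = (of_real (\<epsilon> i * \<epsilon> j * k i * g j) :: 'k)"
      unfolding D2 c.bstar_def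
      by (simp add: rdiag_def diagm_mult_left_nth diagm_mult_right_nth munit_def scnj_mult mult_ac)
    then have "g i * (\<epsilon> i * \<epsilon> j) * k j = \<epsilon> i * \<epsilon> j * k i * g j" unfolding of_real_eq_iff .
    then have "1 / s i * (1 / s i) * (\<epsilon> i * \<epsilon> j) * (s j * s j) = \<epsilon> i * \<epsilon> j * (s i * s i) * (1 / s j * (1 / s j))"
      by (simp only: g_def k_def)
    moreover have "\<epsilon> i * \<epsilon> j \<noteq> 0" using \<beta>[of i] \<beta>[of j] by (simp add: \<epsilon>_def sgn_eq_0_iff)
    ultimately have "(s j) ^ 4 = (s i) ^ 4" using s[of i] s[of j] by (simp add: field_simps power4_eq_xxxx)
    then show ?thesis using s[of i] s[of j] power_eq_imp_eq_base[of "s i" 4 "s j"] by simp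
  qed simp
  have "coords P B \<tau> \<epsilon>"
  proof
    fix X assume X: "X \<in> (sl :: ('k^'n^'n) set)"
    have "trace (c.co X) = 0" using X c.em_sl[of "c.co X"] by simp
    from tau[OF this] have "\<tau> X = - c.em ((?Di ** ?Di) ** mstar (c.co X) ** (?D ** ?D))" by simp
    also have "(?Di ** ?Di) ** mstar (c.co X) ** (?D ** ?D) = mstar (c.co X)"
    proof -
      have "of_real (1 / s a * (1 / s a)) * (x * of_real (s b * s b)) = (x :: 'k)" for a b x
      proof -
        have "of_real (1 / s a * (1 / s a)) * (x * of_real (s b * s b)) = x * of_real (1 / s a * (1 / s a) * (s a * s a))"
          unfolding s_eq[of b a] by (simp only: of_real_mult mult_ac)
        also have "1 / s a * (1 / s a) * (s a * s a) = 1" using s[of a] by simp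
        finally show ?thesis by simp
      qed
      then show ?thesis
        unfolding rdiag_mult
        by (simp only: vec_eq_iff rdiag_def diagm_mult_left_nth diagm_mult_right_nth mult.assoc simp_thms)
    qed
    finally show "\<tau> X = - (P ** mstar (matrix_inv P ** X ** P) ** matrix_inv P)"
      by (simp only: c.em_def c.co_def)
  qed (rule card)
  moreover have "E = range (\<lambda>i. vec.span {P *v axis i 1})"
  proof -
    have "vec.span {P *v axis i 1} = f i" for i
      unfolding P0(3) P_def mult_rdiag_axis using s[of i] by (intro span_scale) simp
    then show ?thesis using P0(2) by (simp add: bij_betw_def)
  qed
  ultimately show ?thesis by (rule that)
qed

section \<open>Chambers and compatible flags in the coordinates\<close>

lemma decreasing_rank:
  fixes x :: "'n::finite \<Rightarrow> real"
  assumes inj: "\<And>i j. i \<noteq> j \<Longrightarrow> x i \<noteq> x j"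
  obtains ord where "bij_betw ord UNIV {..<CARD('n)}" "\<And>i j. ord i < ord j \<longleftrightarrow> x j < x i"
proof -
  define ord where "ord i = card {k. x i < x k}" for i
  have lt: "ord i < ord j" if "x j < x i" for i j
    unfolding ord_def by (rule psubset_card_mono) (use that in auto)
  have iff: "ord i < ord j \<longleftrightarrow> x j < x i" for i j
  proof
    assume o: "ord i < ord j"
    then have "i \<noteq> j" by auto
    then have "x i < x j \<or> x j < x i" using inj[of i j] by linarith
    then show "x j < x i"
    proof
      assume "x i < x j"
      then have "ord j < ord i" by (rule lt)
      then show ?thesis using o by simp
    qed
  qed (rule lt)
  have "inj ord"
  proof (rule injI)
    fix i j assume "ord i = ord j"
    then have "\<not> x i < x j" "\<not> x j < x i" using iff[of i j] iff[of j i] by simp_all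
    then show "i = j" using inj[of i j] by linarith
  qed
  moreover have "ord i < CARD('n)" for i
    unfolding ord_def by (rule psubset_card_mono) auto
  then have "range ord \<subseteq> {..<CARD('n)}" by auto
  ultimately have "bij_betw ord UNIV {..<CARD('n)}"
    unfolding bij_betw_def by (intro conjI card_subset_eq) (simp_all add: card_image)
  then show ?thesis using iff by (rule that)
qed

lemma (in coords) chamber_ord:
  assumes "weyl_chamber (roots sl bsp) bsp ap"
  obtains ord where "bij_betw ord UNIV {..<CARD('n)}" "ap = {dg x |x. sum x UNIV = 0 \<and> decr ord x}"
proof -
  have "weyl_chamber {root i j |i j. i \<noteq> j \<and> True} bsp ap" using assms unfolding roots_eq[OF sl_eq] .
  then obtain x0 :: "'n \<Rightarrow> real" where x0: "\<And>i j. i \<noteq> j \<Longrightarrow> x0 i \<noteq> x0 j" "ap = cone (\<lambda>i j. True \<and> x0 j < x0 i)"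
    by (rule weyl_chamber_cone) auto
  obtain ord where ord: "bij_betw ord UNIV {..<CARD('n)}" "\<And>i j. ord i < ord j \<longleftrightarrow> x0 j < x0 i"
    using decreasing_rank[of x0] x0(1) by blast
  show ?thesis by (rule that[OF ord(1)]) (simp add: x0(2) cone_def decr_def ord(2))
qed

context ocoords
begin

text \<open>Both cones prescribe an order on each sign class; the regular element
  \<open>ramp\<close> lies in both, so the orders agree.\<close>

lemma chamber_eq_bpc:
  assumes bp: "weyl_chamber (roots (fixed_subalgebra \<tau> B) bsp) bsp bp" and sub: "cham id \<subseteq> bp"
  shows "bp = bpc"
proof -
  have "weyl_chamber {root i j |i j. i \<noteq> j \<and> \<epsilon> i = \<epsilon> j} bsp bp" using bp unfolding roots_eq[OF fixed_subalgebra_eq] .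
  then obtain x1 :: "'n \<Rightarrow> real" where x1: "\<And>i j. i \<noteq> j \<Longrightarrow> \<epsilon> i = \<epsilon> j \<Longrightarrow> x1 i \<noteq> x1 j"
    "bp = cone (\<lambda>i j. \<epsilon> i = \<epsilon> j \<and> x1 j < x1 i)"
    by (rule weyl_chamber_cone) auto
  have "dg ramp \<in> bp" using sub sum_ramp by (auto simp: cham_dg decr_def ramp_def)
  then have ramp: "ord i < ord j" if "\<epsilon> i = \<epsilon> j" "x1 j < x1 i" for i j
  proof -
    have "ramp j \<le> ramp i" using \<open>dg ramp \<in> bp\<close> that unfolding x1(2) by (auto simp: cone_def dg_inject)
    moreover have "i \<noteq> j" using that(2) by auto
    ultimately show ?thesis using ord_eq_iff[of i j] by (simp add: ramp_def)
  qed
  have "(\<epsilon> i = \<epsilon> j \<and> x1 j < x1 i) = (\<epsilon> i = \<epsilon> j \<and> ord i < ord j)" for i j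
  proof (cases "\<epsilon> i = \<epsilon> j \<and> ord i < ord j")
    case True
    then have "x1 i \<noteq> x1 j" by (intro x1(1)) auto
    moreover have "\<not> x1 i < x1 j" using ramp[of j i] True by auto
    ultimately show ?thesis using True by simp
  qed (use ramp in blast)
  then show ?thesis unfolding x1(2) bpc_def by simp
qed

text \<open>Tested on one regular element of \<open>cham \<psi>\<close>, compatibility says that
  \<open>\<psi>\<close> is increasing on the indices of each sign.\<close>

lemma compatible_flag_pflag:
  assumes "compatible_flag bsp (range line) bpc \<xi>"
  shows "\<exists>\<psi>. bij \<psi> \<and> \<xi> = pflag \<psi> \<and>
    (\<forall>a b. \<epsilon> (\<psi> a) = \<epsilon> (\<psi> b) \<longrightarrow> ord a < ord b \<longrightarrow> ord (\<psi> a) < ord (\<psi> b))"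
proof -
  obtain \<psi> where \<psi>: "bij \<psi>" "\<xi> = pflag \<psi>"
    using assms flags_spanned unfolding compatible_flag_def by blast
  have sub: "cham \<psi> \<subseteq> bpc" using assms unfolding compatible_flag_def \<psi>(2) chamber_of_pflag[OF \<psi>(1)] by blast
  obtain x where x: "\<And>a. x (\<psi> a) = ramp a" "sum x UNIV = sum ramp UNIV" using perm_shift[OF \<psi>(1)] by metis
  have "dg x \<in> cham \<psi>" using x sum_ramp by (simp add: cham_dg decr_def ramp_def)
  then have dx: "dg x \<in> bpc" using sub by blast
  have "ord (\<psi> a) < ord (\<psi> b)" if "\<epsilon> (\<psi> a) = \<epsilon> (\<psi> b)" "ord a < ord b" for a b
  proof (rule ccontr)
    assume n: "\<not> ord (\<psi> a) < ord (\<psi> b)"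
    have "\<psi> a \<noteq> \<psi> b" using that(2) bij_is_inj[OF \<psi>(1)] by (auto simp: inj_eq)
    then have "ord (\<psi> b) < ord (\<psi> a)" using n ord_eq_iff[of "\<psi> a" "\<psi> b"] by linarith
    then have "x (\<psi> a) \<le> x (\<psi> b)" using dx that(1) by (simp add: bpc_dg)
    then show False using that(2) by (simp add: x(1) ramp_def)
  qed
  then show ?thesis using \<psi> by blast
qed

end

theorem proposition5p8:
  fixes p q :: nat
    and form_o :: "('k::scalar_rc ^ 'n \<Rightarrow> 'k ^ 'n \<Rightarrow> 'k) set"
    and B :: "'k ^ 'n \<Rightarrow> 'k ^ 'n \<Rightarrow> 'k"
    and \<tau> :: "'k ^ 'n ^ 'n \<Rightarrow> 'k ^ 'n ^ 'n"
    and b bp ap :: "('k ^ 'n ^ 'n) set"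
    and E :: "('k ^ 'n) set set"
    and \<xi>s :: "nat \<Rightarrow> ('k ^ 'n) set"
    and Cs C :: "(nat \<Rightarrow> ('k ^ 'n) set) set"
  assumes "p \<ge> 1" and "q \<ge> 1" and "CARD('n) = p + q" and "p + q \<ge> 3"
    and "form_o \<in> Q_forms p q" and "B \<in> form_o"
    and "cartan_involution \<tau>"
    and "\<forall>X\<in>sl. \<tau> (dsigma B X) = dsigma B (\<tau> X)"
    and "maximal_subalgebra_in (p_space \<tau> \<inter> q_space B) b"
    and "orth_basis_of_lines B E"
    and "\<exists>h. cartan_inner_form \<tau> h \<and> orth_basis_of_lines h E"
    and "b = real_diagonal E"
    and "weyl_chamber (roots (fixed_subalgebra \<tau> B) b) b bp"
    and "weyl_chamber (roots sl b) b ap" and "ap \<subseteq> bp"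
    and "compatible_flag b E bp \<xi>s"
    and "compactin flag_topology Cs" and "Cs \<subseteq> H_orbit B \<xi>s"
    and "compactin flag_topology C" and "C \<subseteq> nondeg_flags B"
  shows "\<exists>L>0. \<forall>g\<in>carrier PSL.
    (MIN \<alpha>\<in>pos_roots b ap. \<alpha> (cartan_proj \<tau> ap g)) > L \<and>
    S_flag \<tau> b E ap g \<in> Cs \<and> U_flag \<tau> b E ap g \<in> C \<longrightarrow>
      g \<in> B_set B \<and>
      b_proj B \<tau> b bp g =
        (1/2) *\<^sub>R W_act (w_flags \<tau> b (opp_inv_flag B \<tau> b E bp \<xi>s) (flag_of_chamber b E ap))
                   (jordan_proj \<tau> ap (sigma_o B (inv\<^bsub>PSL\<^esub> g) \<otimes>\<^bsub>PSL\<^esub> g)) \<and>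
      (opp_inv_flag B \<tau> b E bp \<xi>s = flag_of_chamber b E ap \<longrightarrow>
        b_proj B \<tau> b bp g =
          (1/2) *\<^sub>R jordan_proj \<tau> ap (sigma_o B (inv\<^bsub>PSL\<^esub> g) \<otimes>\<^bsub>PSL\<^esub> g))"
proof -
  have Bf: "hermitian_form B" and rad: "\<And>v. (\<And>w. B v w = 0) \<Longrightarrow> v = 0"
  proof -
    obtain B0 c where B0: "form_of_signature p q B0" and c: "c > 0" "B = (\<lambda>u v. of_real c * B0 u v)"
      using assms(5,6) by (auto simp: Q_forms_def form_class_def)
    have h0: "hermitian_form B0" using B0 by (simp add: form_of_signature_def)
    show "hermitian_form B"
      unfolding hermitian_form_def c(2)
    proof (intro conjI allI)
      show "of_real c * B0 (u + v) w = of_real c * B0 u w + of_real c * B0 v w" for u v w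
        by (simp add: hermitian_formD(1)[OF h0] distrib_left)
      show "of_real c * B0 (a *s u) v = a * (of_real c * B0 u v)" for a u v
        by (simp add: hermitian_formD(2)[OF h0])
      show "of_real c * B0 v u = scnj (of_real c * B0 u v)" for u v
        using hermitian_formD(3)[OF h0, of v u] by (simp add: scnj_mult)
    qed
    show "v = 0" if "\<And>w. B v w = 0" for v
      using form_radical[OF B0 assms(1,2), of v] that c by simp
  qed
  obtain h where h: "cartan_inner_form \<tau> h" "orth_basis_of_lines h E" using assms(11) by blast
  have "CARD('n) \<ge> 2" using assms(3,4) by simp
  then obtain P \<epsilon> where P: "coords P B \<tau> \<epsilon>" and E0: "E = range (\<lambda>i. vec.span {P *v axis i 1})"
    using adapted_coordinates[OF Bf rad h assms(10)] assms(8) by blast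
  interpret c: coords P B \<tau> \<epsilon> by fact
  have E: "E = range c.line" unfolding E0 c.line_def ..
  have b: "b = c.bsp" unfolding assms(12) E by (rule c.real_diagonal_lines)
  \<comment> \<open>The ranking is read off from \<open>ap\<close>, which thereby becomes
    \<open>cham id\<close>; \<open>bp\<close> is then determined because it contains
    \<open>ap\<close>.\<close>
  obtain ord where ord: "bij_betw ord UNIV {..<CARD('n)}" and ap0: "ap = {c.dg x |x. sum x UNIV = 0 \<and> decr ord x}"
    using assms(14) unfolding b by (rule c.chamber_ord)
  interpret c: ocoords P B \<tau> \<epsilon> ord by standard (rule ord)
  have ap: "ap = c.cham id" unfolding ap0 c.cham_id ..
  have bp: "bp = c.bpc" using assms(13,15) unfolding b ap by (rule c.chamber_eq_bpc)
  have "\<exists>\<psi>. bij \<psi> \<and> \<xi>s = c.pflag \<psi> \<and>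
      (\<forall>a b. \<epsilon> (\<psi> a) = \<epsilon> (\<psi> b) \<longrightarrow> ord a < ord b \<longrightarrow> ord (\<psi> a) < ord (\<psi> b))"
    using assms(16) unfolding b E bp by (rule c.compatible_flag_pflag)
  then obtain \<psi> where \<psi>: "bij \<psi>" "\<xi>s = c.pflag \<psi>"
    and less: "\<forall>a b. \<epsilon> (\<psi> a) = \<epsilon> (\<psi> b) \<longrightarrow> ord a < ord b \<longrightarrow> ord (\<psi> a) < ord (\<psi> b)" by blast
  show ?thesis
    unfolding b E bp ap \<psi>(2)
    using assms(17-20) unfolding b E bp ap \<psi>(2)
    by (intro c.orthogonal_decomposition[OF \<psi>(1) less[rule_format]])
qed

end
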